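(* Let $m\in\mathbb{N}$, let $U,V$ be $m\times m$ matrix $A_{p,q}$ weights on $\mathbb{R}^d$, and let $B$ be a locally integrable $m\times m$ matrix-valued function on $\mathbb{R}^d$. (i) Let $T$ be any linear operator acting on scalar-valued functions such that for all $n\in\mathbb{N}$ and all $n\times n$ matrix $A_{p,q}$ weights $W$ its canonical $\mathbb{C}^n$-valued extension is bounded from $L^p(W^{p/q})$ to $L^q(W)$, with a bound depending only on $T,n,d,p$ and $\|W\|_{A_{p,q}}$. Then $$\|[M_B,T]\|_{L^p(U^{p/q})\to L^q(V)}\le C\,\|B\|_{\mathrm{BMO}^{p,q}_{V,U}},$$ where $C$ depends only on $T,m,d,p,\|U\|_{A_{p,q}}$ and $\|V\|_{A_{p,q}}$. (ii) If $T$ is any fractional lower bound operator, then $$\|B\|_{\mathrm{BMO}^{p,q}_{V,U}}\le C\,\|[M_B,T]\|_{L^p(U^{p/q})\to L^q(V)},$$ where $C$ depends only on $T,m,d,p,\|U\|_{A_{p,q}}$ and $\|V\|_{A_{p,q}}$.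
   Context: Throughout $0<\alpha<d$ is fixed, $p,q>1$ and $\frac{\alpha}{d}+\frac1q=\frac1p$; $p'$ is the conjugate exponent of $p$. $\fint_Q$ and $m_Q$ denote the unweighted average over $Q$ (taken entrywise for matrix functions); cubes $Q\subseteq\mathbb{R}^d$; $\|\cdot\|$ applied to a matrix is the operator norm. An $n\times n$ matrix weight is a function $W$ on $\mathbb{R}^d$ with values in the $n\times n$ complex matrices that is positive definite a.e. For $r>1$, $L^r(W)$ is the space of $\mathbb{C}^n$-valued $\vec f$ with $\|\vec f\|_{L^r(W)}=\left(\int_{\mathbb{R}^d}|W^{1/r}(x)\vec f(x)|^r\,dx\right)^{1/r}<\infty$. $W$ is a matrix $A_{p,q}$ weight if $$\|W\|_{A_{p,q}}=\sup_Q\fint_Q\left(\fint_Q\|W^{1/q}(x)W^{-1/q}(y)\|^{p'}\,dy\right)^{q/p'}dx<\infty .$$ A linear operator $T$ on scalar functions is canonically extended to $\mathbb{C}^n$-valued functions by applying $T$ to each coordinate in an orthonormal basis (this is independent of the basis); the extension is again denoted $T$. $M_B$ is (pointwise) multiplication by $B$ and $[M_B,T]=M_BT-TM_B$. The weighted BMO quantity is $$\|B\|_{\mathrm{BMO}^{p,q}_{V,U}}=\sup_Q\fint_Q\left\|(m_QV^{1/q})(B(x)-m_QB)(m_QU^{1/q})^{-1}\right\|dx .$$ A linear operator $T$ acting on scalar functions is a fractional lower bound operator if for every $n\in\mathbb{N}$: (a) there is a constant $c$, independent of $W$ (but possibly depending on $n$), such that $\|W\|_{A_{p,q}}^{1/q}\le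 c\,\|T\|_{L^p(W^{p/q})\to L^q(W)}$ for every $n\times n$ matrix weight $W$; and (b) $\|T\|_{L^p(W^{p/q})\to L^q(W)}<\infty$ whenever $W$ is an $n\times n$ matrix $A_{p,q}$ weight. *)

theory Defs
  imports
    "HOL-Analysis.Analysis"
    "Jordan_Normal_Form.Schur_Decomposition"
    "Jordan_Normal_Form.Gauss_Jordan_Elimination"
begin

(* The statement quantifies over the size n of the matrices, so vectors and matrices over the
   complex numbers are those of Jordan_Normal_Form, whose dimensions are terms.  The domain R^d of
   all functions is the type real^'d, with d = CARD('d).  The index syntax $ below is that of
   Jordan_Normal_Form. *)

unbundle no vec_syntax

type_synonym cvec = "complex Matrix.vec"
type_synonym cmat = "complex Matrix.mat"


section \<open>Vectors, matrices and real powers of positive definite matrices\<close>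

definition vec_norm2 :: "cvec \<Rightarrow> real" where
  "vec_norm2 v = L2_set (\<lambda>i. cmod (v $ i)) {..<dim_vec v}"

definition mat_opnorm :: "cmat \<Rightarrow> real" where
  "mat_opnorm A = (SUP v\<in>{v \<in> carrier_vec (dim_col A). vec_norm2 v \<le> 1}. vec_norm2 (A *\<^sub>v v))"

definition positive_definite :: "nat \<Rightarrow> cmat \<Rightarrow> bool" where
  "positive_definite n A \<longleftrightarrow> A \<in> carrier_mat n n \<and> mat_adjoint A = A \<and>
     (\<forall>v\<in>carrier_vec n. v \<noteq> 0\<^sub>v n \<longrightarrow> 0 < Re ((A *\<^sub>v v) \<bullet>c v))"

definition unitary_mat :: "nat \<Rightarrow> cmat \<Rightarrow> bool" where
  "unitary_mat n S \<longleftrightarrow> S \<in> carrier_mat n n \<and>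
     S * mat_adjoint S = 1\<^sub>m n \<and> mat_adjoint S * S = 1\<^sub>m n"

(* Functional calculus.  The description determines a unique matrix exactly when A is positive
   definite; for any other A the value is unspecified. *)
definition mat_powr :: "cmat \<Rightarrow> real \<Rightarrow> cmat" where
  "mat_powr A s = (THE P. \<exists>S (e :: nat \<Rightarrow> real).
      unitary_mat (dim_row A) S \<and> (\<forall>i<dim_row A. 0 < e i) \<and>
      A = S * mat_diag (dim_row A) (\<lambda>i. complex_of_real (e i)) * mat_adjoint S \<and>
      P = S * mat_diag (dim_row A) (\<lambda>i. complex_of_real (e i powr s)) * mat_adjoint S)"


section \<open>Cubes and averages\<close>

definition cubes :: "(real^'d) set set" where
  "cubes = {cbox a (a + l *\<^sub>R One) | a l. 0 < l}"

(* used for r > 0 only *)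
definition ennreal_powr :: "ennreal \<Rightarrow> real \<Rightarrow> ennreal" where
  "ennreal_powr x r = (if x = \<infinity> then \<infinity> else ennreal (enn2real x powr r))"

definition avg :: "(real^'d) set \<Rightarrow> (real^'d \<Rightarrow> ennreal) \<Rightarrow> ennreal" where
  "avg Q g = (\<integral>\<^sup>+x\<in>Q. g x \<partial>lebesgue) / emeasure lebesgue Q"

definition mat_avg :: "nat \<Rightarrow> (real^'d) set \<Rightarrow> (real^'d \<Rightarrow> cmat) \<Rightarrow> cmat" where
  "mat_avg n Q A =
     Matrix.mat n n (\<lambda>ij. (LINT x:Q|lebesgue. A x $$ ij) /\<^sub>R measure lebesgue Q)"

definition locally_integrable_mat :: "nat \<Rightarrow> (real^'d \<Rightarrow> cmat) \<Rightarrow> bool" where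
  "locally_integrable_mat n B \<longleftrightarrow> (\<forall>x. B x \<in> carrier_mat n n) \<and>
     (\<forall>i<n. \<forall>j<n. (\<lambda>x. B x $$ (i, j)) \<in> borel_measurable lebesgue \<and>
        (\<forall>K. compact K \<longrightarrow> (\<lambda>x. B x $$ (i, j)) absolutely_integrable_on K))"


section \<open>Matrix weights and weighted spaces\<close>

definition matrix_weight :: "nat \<Rightarrow> (real^'d \<Rightarrow> cmat) \<Rightarrow> bool" where
  "matrix_weight n W \<longleftrightarrow> (\<forall>x. W x \<in> carrier_mat n n) \<and>
     (\<forall>i<n. \<forall>j<n. (\<lambda>x. W x $$ (i, j)) \<in> borel_measurable lebesgue) \<and>
     (AE x in lebesgue. positive_definite n (W x))"

definition weight_powr :: "(real^'d \<Rightarrow> cmat) \<Rightarrow> real \<Rightarrow> real^'d \<Rightarrow> cmat" where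
  "weight_powr W s x = mat_powr (W x) s"

definition conj_exp :: "real \<Rightarrow> real" where
  "conj_exp p = p / (p - 1)"

definition Apq :: "real \<Rightarrow> real \<Rightarrow> (real^'d \<Rightarrow> cmat) \<Rightarrow> ennreal" where
  "Apq p q W = (SUP Q\<in>cubes. avg Q (\<lambda>x.
     ennreal_powr
       (avg Q (\<lambda>y. ennreal
          (mat_opnorm (weight_powr W (1/q) x * weight_powr W (- (1/q)) y) powr conj_exp p)))
       (q / conj_exp p)))"

definition Apq_weight :: "nat \<Rightarrow> real \<Rightarrow> real \<Rightarrow> (real^'d \<Rightarrow> cmat) \<Rightarrow> bool" where
  "Apq_weight n p q W \<longleftrightarrow> matrix_weight n W \<and> Apq p q W < \<infinity>"

definition wnorm :: "real \<Rightarrow> (real^'d \<Rightarrow> cmat) \<Rightarrow> (real^'d \<Rightarrow> cvec) \<Rightarrow> ennreal" where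
  "wnorm r W f = ennreal_powr
     (\<integral>\<^sup>+x. ennreal (vec_norm2 (weight_powr W (1/r) x *\<^sub>v f x) powr r) \<partial>lebesgue) (1/r)"

definition wspace :: "nat \<Rightarrow> real \<Rightarrow> (real^'d \<Rightarrow> cmat) \<Rightarrow> (real^'d \<Rightarrow> cvec) set" where
  "wspace n r W = {f. (\<forall>x. f x \<in> carrier_vec n) \<and>
     (\<forall>i<n. (\<lambda>x. f x $ i) \<in> borel_measurable lebesgue) \<and> wnorm r W f < \<infinity>}"

definition bmo :: "nat \<Rightarrow> real \<Rightarrow> (real^'d \<Rightarrow> cmat) \<Rightarrow> (real^'d \<Rightarrow> cmat) \<Rightarrow>
    (real^'d \<Rightarrow> cmat) \<Rightarrow> ennreal" where
  "bmo n q V U B = (SUP Q\<in>cubes. avg Q (\<lambda>x. ennreal (mat_opnorm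
     (mat_avg n Q (weight_powr V (1/q)) * (B x - mat_avg n Q B) *
      the (mat_inverse (mat_avg n Q (weight_powr U (1/q))))))))"


section \<open>Operators\<close>

(* An operator on scalar functions is a map T together with its domain D, a linear space of
   measurable functions (integral operators, for instance, are not defined on all functions).
   Functions are representatives of their almost-everywhere classes, hence linearity almost
   everywhere. *)
definition linear_operator ::
    "(real^'d \<Rightarrow> complex) set \<Rightarrow> ((real^'d \<Rightarrow> complex) \<Rightarrow> real^'d \<Rightarrow> complex) \<Rightarrow> bool" where
  "linear_operator D T \<longleftrightarrow>
     D \<subseteq> borel_measurable lebesgue \<and> T ` D \<subseteq> borel_measurable lebesgue \<and>
     (\<lambda>x. 0) \<in> D \<and>
     (\<forall>f\<in>D. \<forall>g\<in>D. (\<lambda>x. f x + g x) \<in> D \<and>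
        (AE x in lebesgue. T (\<lambda>x. f x + g x) x = T f x + T g x)) \<and>
     (\<forall>c. \<forall>f\<in>D. (\<lambda>x. c * f x) \<in> D \<and>
        (AE x in lebesgue. T (\<lambda>x. c * f x) x = c * T f x))"

definition ext_dom :: "nat \<Rightarrow> (real^'d \<Rightarrow> complex) set \<Rightarrow> (real^'d \<Rightarrow> cvec) set" where
  "ext_dom n D = {f. (\<forall>x. f x \<in> carrier_vec n) \<and> (\<forall>i<n. (\<lambda>x. f x $ i) \<in> D)}"

definition ext_op :: "nat \<Rightarrow> ((real^'d \<Rightarrow> complex) \<Rightarrow> real^'d \<Rightarrow> complex) \<Rightarrow>
    (real^'d \<Rightarrow> cvec) \<Rightarrow> real^'d \<Rightarrow> cvec" where
  "ext_op n T f x = Matrix.vec n (\<lambda>i. T (\<lambda>y. f y $ i) x)"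

definition mult_op :: "(real^'d \<Rightarrow> cmat) \<Rightarrow> (real^'d \<Rightarrow> cvec) \<Rightarrow> real^'d \<Rightarrow> cvec" where
  "mult_op B f x = B x *\<^sub>v f x"

definition comm_dom :: "nat \<Rightarrow> (real^'d \<Rightarrow> cmat) \<Rightarrow> (real^'d \<Rightarrow> complex) set \<Rightarrow>
    (real^'d \<Rightarrow> cvec) set" where
  "comm_dom n B D = {f \<in> ext_dom n D. mult_op B f \<in> ext_dom n D}"

definition comm_op :: "nat \<Rightarrow> (real^'d \<Rightarrow> cmat) \<Rightarrow>
    ((real^'d \<Rightarrow> complex) \<Rightarrow> real^'d \<Rightarrow> complex) \<Rightarrow> (real^'d \<Rightarrow> cvec) \<Rightarrow> real^'d \<Rightarrow> cvec" where
  "comm_op n B T f x = mult_op B (ext_op n T f) x - ext_op n T (mult_op B f) x"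

(* Norm of the operator S with domain E as a map from L^r(X) to L^s(Y).  A bound requires S to be
   defined on all of L^r(X); if there is no bound, the infimum of the empty set makes the norm
   infinite. *)
definition op_norm :: "nat \<Rightarrow> real \<Rightarrow> (real^'d \<Rightarrow> cmat) \<Rightarrow> real \<Rightarrow> (real^'d \<Rightarrow> cmat) \<Rightarrow>
    (real^'d \<Rightarrow> cvec) set \<Rightarrow> ((real^'d \<Rightarrow> cvec) \<Rightarrow> real^'d \<Rightarrow> cvec) \<Rightarrow> ennreal" where
  "op_norm n r X s Y E S = (INF c\<in>{c :: real. 0 \<le> c \<and>
       (\<forall>f\<in>wspace n r X. f \<in> E \<and> S f \<in> wspace n s Y \<and>
          wnorm s Y (S f) \<le> ennreal c * wnorm r X f)}. ennreal c)"

definition T_norm :: "nat \<Rightarrow> real \<Rightarrow> real \<Rightarrow> (real^'d \<Rightarrow> cmat) \<Rightarrow>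
    (real^'d \<Rightarrow> complex) set \<Rightarrow> ((real^'d \<Rightarrow> complex) \<Rightarrow> real^'d \<Rightarrow> complex) \<Rightarrow> ennreal" where
  "T_norm n p q W D T = op_norm n p (weight_powr W (p/q)) q W (ext_dom n D) (ext_op n T)"

definition comm_norm :: "nat \<Rightarrow> real \<Rightarrow> real \<Rightarrow> (real^'d \<Rightarrow> cmat) \<Rightarrow> (real^'d \<Rightarrow> cmat) \<Rightarrow>
    (real^'d \<Rightarrow> cmat) \<Rightarrow> (real^'d \<Rightarrow> complex) set \<Rightarrow>
    ((real^'d \<Rightarrow> complex) \<Rightarrow> real^'d \<Rightarrow> complex) \<Rightarrow> ennreal" where
  "comm_norm n p q U V B D T =
     op_norm n p (weight_powr U (p/q)) q V (comm_dom n B D) (comm_op n B T)"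

definition fractional_lower_bound_operator :: "real \<Rightarrow> real \<Rightarrow>
    (real^'d \<Rightarrow> complex) set \<Rightarrow> ((real^'d \<Rightarrow> complex) \<Rightarrow> real^'d \<Rightarrow> complex) \<Rightarrow> bool" where
  "fractional_lower_bound_operator p q D T \<longleftrightarrow> linear_operator D T \<and>
     (\<forall>n>0.
        (\<exists>c>0. \<forall>W. matrix_weight n W \<longrightarrow>
           ennreal_powr (Apq p q W) (1/q) \<le> ennreal c * T_norm n p q W D T) \<and>
        (\<forall>W. Apq_weight n p q W \<longrightarrow> T_norm n p q W D T < \<infinity>))"

end

theory Submission
  imports Defs "HOL-Probability.Probability_Measure"
begin

unbundle no vec_syntax

text \<open>
  Write \<open>v = V\<^bsup>1/q\<^esup>\<close> and \<open>u = U\<^bsup>1/q\<^esup>\<close>. For \<open>\<tau> > 0\<close> the block matrix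
  \<open>\<Phi> = [[v, \<tau> v B], [0, u]]\<close> defines a \<open>2m \<times> 2m\<close> weight \<open>W\<close> with \<open>\<bar>W\<^bsup>1/q\<^esup> z\<bar> = \<bar>\<Phi> z\<bar>\<close>, and
  \<open>\<Phi>(x) \<Phi>(y)\<^sup>-\<^sup>1\<close> has the off-diagonal block \<open>\<tau> v(x) (B(x) - B(y)) u(y)\<^sup>-\<^sup>1\<close>. So the \<open>A\<^sub>p\<^sub>,\<^sub>q\<close> constant of
  \<open>W\<close> is controlled by those of \<open>U\<close> and \<open>V\<close> and by \<open>\<tau>\<^sup>q\<close> times a mixed oscillation of \<open>B\<close>, while the norm
  of \<open>T\<close> on the spaces of \<open>W\<close> is comparable to \<open>\<parallel>T\<parallel>\<^sub>U + \<parallel>T\<parallel>\<^sub>V + \<tau> \<parallel>[M\<^sub>B, T]\<parallel>\<close>. For (i) one takes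
  \<open>\<tau>\<close> to be the reciprocal of the BMO norm, for (ii) one lets \<open>\<tau>\<close> tend to infinity.

  The mixed oscillation is equivalent to the BMO quantity by a John-Nirenberg iteration over
  Calderon-Zygmund cubes, where the reducing matrices of \<open>U\<close> and \<open>V\<close> are the averages of \<open>u\<close> and \<open>v\<close>.
  The bound for \<open>T\<close> in (i) need not be monotone in the \<open>A\<^sub>p\<^sub>,\<^sub>q\<close> constant; therefore every weight is first
  padded by a scalar two-valued weight, whose ratio is chosen so that the constant takes a prescribed
  value.
\<close>

section \<open>Norms of vectors and matrices\<close>

text \<open>Instead of a reverse Hoelder inequality, the proof uses that the functions h in question
  satisfy h x \<le> K x y * h y with K x y = |w x * w y^-1|, w = W^(1/q). One y at which K x y and h
  y are both moderate controls h x; Markov's inequality supplies such points, so averages over half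
  a cube control those over the whole cube. The averages of w and of w^-1 are almost inverse to each
  other: their product is bounded, its determinant is at least 1 by Cauchy-Schwarz, and Cramer's
  rule then bounds its inverse. This is why plain averages can serve as reducing matrices. The mixed
  oscillation splits at the mean of B into two parts of dual type. Hence the iteration runs twice:
  for v, u, B with exponent q, and for u^-1, v^-1 and the adjoint of B with the conjugate exponent
  of p. The way back from the mixed oscillation uses p \<le> q, which follows from \<alpha> > 0. The
  matrix \<Phi> is diag(v, u) times the shear (a, b) -> (a + \<tau> B b, b); conjugating T with a
  shear produces the commutator.\<close>

lemma mat_adjoint_index [simp]:
  "i < dim_col A \<Longrightarrow> j < dim_row A \<Longrightarrow> mat_adjoint A $$ (i, j) = cnj (A $$ (j, i))"
  for A :: cmat
  by (simp add: mat_adjoint_def mat_of_rows_index)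

lemma mat_adjoint_dim [simp]:
  "dim_row (mat_adjoint A) = dim_col A" "dim_col (mat_adjoint A) = dim_row A" for A :: cmat
  by (simp_all add: mat_adjoint_def)

lemma mat_adjoint_carrier [simp, intro]:
  "A \<in> carrier_mat n m \<Longrightarrow> mat_adjoint A \<in> carrier_mat m n" for A :: cmat
  by (auto intro!: carrier_matI)

lemma mat_adjoint_adjoint [simp]: "mat_adjoint (mat_adjoint A) = A" for A :: cmat
  by (rule eq_matI) auto

lemma mat_adjoint_one [simp]: "mat_adjoint (1\<^sub>m n :: cmat) = 1\<^sub>m n"
  by (rule eq_matI) auto

lemma index_mult_mat_sum:
  "i < n \<Longrightarrow> j < k \<Longrightarrow> A \<in> carrier_mat n m \<Longrightarrow> B \<in> carrier_mat m k \<Longrightarrow>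
   (A * B) $$ (i, j) = (\<Sum>l<m. A $$ (i, l) * B $$ (l, j))"
  by (auto simp: scalar_prod_def atLeast0LessThan intro!: sum.cong)

lemma index_mult_mat_vec_sum:
  "i < n \<Longrightarrow> A \<in> carrier_mat n m \<Longrightarrow> v \<in> carrier_vec m \<Longrightarrow>
   (A *\<^sub>v v) $ i = (\<Sum>l<m. A $$ (i, l) * v $ l)"
  by (auto simp: scalar_prod_def atLeast0LessThan intro!: sum.cong)

lemma mat_adjoint_mult:
  "A \<in> carrier_mat n m \<Longrightarrow> B \<in> carrier_mat m k \<Longrightarrow>
   mat_adjoint (A * B) = mat_adjoint B * mat_adjoint A" for A B :: cmat
  by (rule eq_matI) (auto simp: scalar_prod_def cnj_sum mult.commute intro!: sum.cong)

lemma mat_adjoint_minus: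
  "A \<in> carrier_mat n m \<Longrightarrow> B \<in> carrier_mat n m \<Longrightarrow>
   mat_adjoint (A - B) = mat_adjoint A - mat_adjoint B" for A B :: cmat
  by (rule eq_matI) auto

lemma mat_adjoint_diag:
  "mat_adjoint (mat_diag n (\<lambda>i. complex_of_real (e i))) = mat_diag n (\<lambda>i. complex_of_real (e i))"
  by (rule eq_matI) (auto simp: mat_diag_def)

lemma cscalar_prod_sum:
  "v \<in> carrier_vec n \<Longrightarrow> w \<in> carrier_vec n \<Longrightarrow> v \<bullet>c w = (\<Sum>i<n. v $ i * cnj (w $ i))" for v w :: cvec
  by (auto simp: scalar_prod_def atLeast0LessThan intro!: sum.cong)

lemma cscalar_prod_adjoint:
  fixes A :: cmat
  assumes "A \<in> carrier_mat n m" "v \<in> carrier_vec m" "w \<in> carrier_vec n"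
  shows "(A *\<^sub>v v) \<bullet>c w = v \<bullet>c (mat_adjoint A *\<^sub>v w)"
proof -
  have "(A *\<^sub>v v) \<bullet>c w = (\<Sum>i<n. \<Sum>l<m. A $$ (i, l) * v $ l * cnj (w $ i))"
    using assms by (subst cscalar_prod_sum[of _ n])
      (auto simp: index_mult_mat_vec_sum[of _ n _ m] sum_distrib_right simp del: index_mult_mat_vec intro!: sum.cong)
  also have "\<dots> = (\<Sum>l<m. \<Sum>i<n. A $$ (i, l) * v $ l * cnj (w $ i))" by (rule sum.swap)
  also have "\<dots> = v \<bullet>c (mat_adjoint A *\<^sub>v w)"
    using assms mult_mat_vec_carrier[OF mat_adjoint_carrier[OF assms(1)] assms(3)] by (subst cscalar_prod_sum[of _ m])
      (auto simp: index_mult_mat_vec_sum[of _ m _ n] sum_distrib_left ac_simps simp del: index_mult_mat_vec intro!: sum.cong)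
  finally show ?thesis .
qed

section \<open>Euclidean norm of complex vectors\<close>

lemma vec_norm2_sum: "v \<in> carrier_vec n \<Longrightarrow> vec_norm2 v = L2_set (\<lambda>i. cmod (v $ i)) {..<n}"
  by (simp add: vec_norm2_def)

lemma vec_norm2_nonneg [simp]: "0 \<le> vec_norm2 v"
  by (simp add: vec_norm2_def L2_set_nonneg)

lemma vec_norm2_sq: "v \<in> carrier_vec n \<Longrightarrow> (vec_norm2 v)\<^sup>2 = (\<Sum>i<n. (cmod (v $ i))\<^sup>2)"
  by (simp add: vec_norm2_def L2_set_def sum_nonneg)

lemma cscalar_prod_self: "v \<in> carrier_vec n \<Longrightarrow> v \<bullet>c v = complex_of_real ((vec_norm2 v)\<^sup>2)" for v :: cvec
  by (simp add: cscalar_prod_sum[of _ n] vec_norm2_sq complex_norm_square[symmetric] of_real_sum)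

lemma vec_norm2_eq_0_iff: "v \<in> carrier_vec n \<Longrightarrow> vec_norm2 v = 0 \<longleftrightarrow> v = 0\<^sub>v n" for v :: cvec
  by (auto simp: vec_norm2_def L2_set_eq_0_iff intro!: eq_vecI)

lemma vec_norm2_triangle:
  "v \<in> carrier_vec n \<Longrightarrow> w \<in> carrier_vec n \<Longrightarrow> vec_norm2 (v + w) \<le> vec_norm2 v + vec_norm2 w"
proof -
  assume a: "v \<in> carrier_vec n" "w \<in> carrier_vec n"
  have "vec_norm2 (v + w) \<le> L2_set (\<lambda>i. cmod (v $ i) + cmod (w $ i)) {..<n}"
    using a by (auto simp: vec_norm2_def intro!: L2_set_mono norm_triangle_ineq)
  also have "\<dots> \<le> vec_norm2 v + vec_norm2 w"
    using a by (auto simp: vec_norm2_def intro!: L2_set_triangle_ineq)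
  finally show ?thesis .
qed

lemma vec_norm2_smult: "vec_norm2 (c \<cdot>\<^sub>v v) = cmod c * vec_norm2 v"
  by (auto simp: vec_norm2_def norm_mult L2_set_right_distrib intro!: L2_set_cong)

lemma vec_norm2_zero [simp]: "vec_norm2 (0\<^sub>v n) = 0"
  by (simp add: vec_norm2_def L2_set_def)

lemma cauchy_schwarz_cvec:
  assumes "v \<in> carrier_vec n" "w \<in> carrier_vec n"
  shows "cmod (v \<bullet>c w) \<le> vec_norm2 v * vec_norm2 w"
proof -
  have "cmod (v \<bullet>c w) \<le> (\<Sum>i<n. cmod (v $ i) * cmod (w $ i))"
    using assms by (simp add: cscalar_prod_sum[of _ n] norm_mult sum_norm_le)
  also have "\<dots> \<le> (\<Sum>i<n. \<bar>cmod (v $ i)\<bar> * \<bar>cmod (w $ i)\<bar>)" by simp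
  also have "\<dots> \<le> vec_norm2 v * vec_norm2 w"
    using assms L2_set_mult_ineq[of "\<lambda>i. cmod (v $ i)" "\<lambda>i. cmod (w $ i)" "{..<n}"] by (simp add: vec_norm2_sum[of _ n])
  finally show ?thesis .
qed

text \<open>The Frobenius norm. Most estimates are made in it: it is a finite expression in the
  entries, so measurability, invariance under the adjoint and integral inequalities come easily. The
  passage to and from the operator norm costs only a factor given by the dimension.\<close>

definition fro :: "cmat \<Rightarrow> real" where
  "fro A = L2_set (\<lambda>i. L2_set (\<lambda>j. cmod (A $$ (i, j))) {..<dim_col A}) {..<dim_row A}"

lemma fro_nonneg [simp]: "0 \<le> fro A"
  by (simp add: fro_def L2_set_nonneg)

lemma fro_sq: "A \<in> carrier_mat n m \<Longrightarrow> (fro A)\<^sup>2 = (\<Sum>i<n. \<Sum>j<m. (cmod (A $$ (i, j)))\<^sup>2)"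
  by (auto simp: fro_def L2_set_def sum_nonneg)

lemma fro_eq_sqrt: "A \<in> carrier_mat n m \<Longrightarrow> fro A = sqrt (\<Sum>i<n. \<Sum>j<m. (cmod (A $$ (i, j)))\<^sup>2)"
  by (metis fro_sq fro_nonneg real_sqrt_unique)

lemma fro_eqI: "A \<in> carrier_mat n m \<Longrightarrow> B \<in> carrier_mat n' m' \<Longrightarrow>
   (\<Sum>i<n. \<Sum>j<m. (cmod (A $$ (i, j)))\<^sup>2) = (\<Sum>i<n'. \<Sum>j<m'. (cmod (B $$ (i, j)))\<^sup>2) \<Longrightarrow> fro A = fro B"
  by (simp add: fro_eq_sqrt)

lemma fro_adjoint [simp]: "fro (mat_adjoint A) = fro A"
proof (rule fro_eqI)
  show "A \<in> carrier_mat (dim_row A) (dim_col A)" "mat_adjoint A \<in> carrier_mat (dim_col A) (dim_row A)" by auto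
  show "(\<Sum>i<dim_col A. \<Sum>j<dim_row A. (cmod (mat_adjoint A $$ (i, j)))\<^sup>2) =
    (\<Sum>i<dim_row A. \<Sum>j<dim_col A. (cmod (A $$ (i, j)))\<^sup>2)"
    by (subst sum.swap) (auto intro!: sum.cong)
qed

lemma fro_triangle:
  assumes "A \<in> carrier_mat n m" "B \<in> carrier_mat n m"
  shows "fro (A + B) \<le> fro A + fro B"
proof -
  have "fro (A + B) \<le> L2_set (\<lambda>i. L2_set (\<lambda>j. cmod (A $$ (i, j))) {..<m} + L2_set (\<lambda>j. cmod (B $$ (i, j))) {..<m}) {..<n}"
    unfolding fro_def using assms
    by (auto intro!: L2_set_mono order_trans[OF _ L2_set_triangle_ineq] norm_triangle_ineq simp: L2_set_nonneg)
  also have "\<dots> \<le> fro A + fro B"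
    using assms by (auto simp: fro_def intro!: L2_set_triangle_ineq)
  finally show ?thesis .
qed

lemma fro_smult: "fro (c \<cdot>\<^sub>m A) = cmod c * fro A"
  by (auto simp: fro_def norm_mult L2_set_right_distrib intro!: L2_set_cong)

lemma fro_minus:
  assumes "A \<in> carrier_mat n m" "B \<in> carrier_mat n m"
  shows "fro (A - B) \<le> fro A + fro B"
proof -
  have "A - B = A + (-1) \<cdot>\<^sub>m B" using assms by (intro eq_matI) auto
  then show ?thesis using fro_triangle[of A n m "(-1) \<cdot>\<^sub>m B"] assms fro_smult[of "-1" B] by simp
qed

lemma vec_norm2_mult_fro:
  assumes "A \<in> carrier_mat n m" "v \<in> carrier_vec m"
  shows "vec_norm2 (A *\<^sub>v v) \<le> fro A * vec_norm2 v"
proof -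
  have "cmod ((A *\<^sub>v v) $ i) \<le> L2_set (\<lambda>j. cmod (A $$ (i, j))) {..<m} * vec_norm2 v" if "i < n" for i
  proof -
    have "cmod ((A *\<^sub>v v) $ i) \<le> (\<Sum>l<m. cmod (A $$ (i, l)) * cmod (v $ l))"
      using assms that by (simp add: index_mult_mat_vec_sum[of _ n _ m] norm_mult sum_norm_le del: index_mult_mat_vec)
    also have "\<dots> \<le> (\<Sum>l<m. \<bar>cmod (A $$ (i, l))\<bar> * \<bar>cmod (v $ l)\<bar>)" by simp
    also have "\<dots> \<le> L2_set (\<lambda>j. cmod (A $$ (i, j))) {..<m} * vec_norm2 v"
      unfolding vec_norm2_sum[OF assms(2)] by (rule L2_set_mult_ineq)
    finally show ?thesis .
  qed
  then have "vec_norm2 (A *\<^sub>v v) \<le> L2_set (\<lambda>i. L2_set (\<lambda>j. cmod (A $$ (i, j))) {..<m} * vec_norm2 v) {..<n}"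
    using assms by (auto simp: vec_norm2_def intro!: L2_set_mono)
  then show ?thesis using assms by (simp add: fro_def L2_set_left_distrib)
qed

lemma fro_mult:
  assumes "A \<in> carrier_mat n m" "B \<in> carrier_mat m k"
  shows "fro (A * B) \<le> fro A * fro B"
proof -
  have "cmod ((A * B) $$ (i, j)) \<le> L2_set (\<lambda>l. cmod (A $$ (i, l))) {..<m} * L2_set (\<lambda>l. cmod (B $$ (l, j))) {..<m}"
    if "i < n" "j < k" for i j
  proof -
    have "cmod ((A * B) $$ (i, j)) \<le> (\<Sum>l<m. cmod (A $$ (i, l)) * cmod (B $$ (l, j)))"
      using assms that by (simp add: index_mult_mat_sum[of _ n _ k _ m] norm_mult sum_norm_le del: index_mult_mat)
    also have "\<dots> \<le> (\<Sum>l<m. \<bar>cmod (A $$ (i, l))\<bar> * \<bar>cmod (B $$ (l, j))\<bar>)" by simp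
    also have "\<dots> \<le> L2_set (\<lambda>l. cmod (A $$ (i, l))) {..<m} * L2_set (\<lambda>l. cmod (B $$ (l, j))) {..<m}"
      by (rule L2_set_mult_ineq)
    finally show ?thesis .
  qed
  then have "(fro (A * B))\<^sup>2 \<le> (\<Sum>i<n. \<Sum>j<k. (L2_set (\<lambda>l. cmod (A $$ (i, l))) {..<m} * L2_set (\<lambda>l. cmod (B $$ (l, j))) {..<m})\<^sup>2)"
    using assms by (subst fro_sq[of _ n k]) (auto intro!: sum_mono power_mono)
  also have "\<dots> = (\<Sum>i<n. (L2_set (\<lambda>l. cmod (A $$ (i, l))) {..<m})\<^sup>2) * (\<Sum>j<k. (L2_set (\<lambda>l. cmod (B $$ (l, j))) {..<m})\<^sup>2)"
    by (simp add: power_mult_distrib sum_product)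
  also have "(\<Sum>i<n. (L2_set (\<lambda>l. cmod (A $$ (i, l))) {..<m})\<^sup>2) = (fro A)\<^sup>2"
    using assms by (simp add: fro_sq L2_set_def sum_nonneg)
  also have "(\<Sum>j<k. (L2_set (\<lambda>l. cmod (B $$ (l, j))) {..<m})\<^sup>2) = (fro B)\<^sup>2"
    using assms by (simp add: fro_sq L2_set_def sum_nonneg) (rule sum.swap)
  finally have "(fro (A * B))\<^sup>2 \<le> (fro A * fro B)\<^sup>2" by (simp add: power_mult_distrib)
  then show ?thesis by (rule power2_le_imp_le) simp
qed

lemma cmod_le_fro: "A \<in> carrier_mat n m \<Longrightarrow> i < n \<Longrightarrow> j < m \<Longrightarrow> cmod (A $$ (i, j)) \<le> fro A"
  unfolding fro_def
  by (rule order_trans[OF member_le_L2_set[of "{..<m}" j "\<lambda>j. cmod (A $$ (i, j))"]])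
     (auto intro!: order_trans[OF _ member_le_L2_set[of _ i]] simp: L2_set_nonneg)

lemma fro_le_sum: "A \<in> carrier_mat n m \<Longrightarrow> fro A \<le> (\<Sum>i<n. \<Sum>j<m. cmod (A $$ (i, j)))"
  unfolding fro_def
  by (auto intro!: order_trans[OF L2_set_le_sum] sum_mono L2_set_le_sum simp: L2_set_nonneg)

lemma fro_zero_mat [simp]: "fro (0\<^sub>m n k) = 0"
  by (simp add: fro_def L2_set_def)

section \<open>Operator norm and its comparison with the Frobenius norm\<close>

lemma bdd_above_opnorm:
  "bdd_above ((\<lambda>v. vec_norm2 (A *\<^sub>v v)) ` {v \<in> carrier_vec (dim_col A). vec_norm2 v \<le> 1})"
proof (rule bdd_aboveI2)
  fix v assume "v \<in> {v \<in> carrier_vec (dim_col A). vec_norm2 v \<le> 1}"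
  then have "vec_norm2 (A *\<^sub>v v) \<le> fro A * vec_norm2 v" "fro A * vec_norm2 v \<le> fro A * 1"
    by (blast intro!: vec_norm2_mult_fro mult_left_mono fro_nonneg carrier_matI)+
  then show "vec_norm2 (A *\<^sub>v v) \<le> fro A" by simp
qed

lemma opnorm_nonneg [simp]: "0 \<le> mat_opnorm A"
  unfolding mat_opnorm_def
  by (rule order_trans[OF _ cSUP_upper[OF _ bdd_above_opnorm, of "0\<^sub>v (dim_col A)"]]) auto

lemma opnorm_leI:
  assumes "A \<in> carrier_mat n m" "0 \<le> c" "\<And>v. v \<in> carrier_vec m \<Longrightarrow> vec_norm2 (A *\<^sub>v v) \<le> c * vec_norm2 v"
  shows "mat_opnorm A \<le> c"
  unfolding mat_opnorm_def
proof (rule cSUP_least)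
  show "{v \<in> carrier_vec (dim_col A). vec_norm2 v \<le> 1} \<noteq> {}"
    by (auto intro!: exI[of _ "0\<^sub>v (dim_col A)"])
  fix v assume "v \<in> {v \<in> carrier_vec (dim_col A). vec_norm2 v \<le> 1}"
  then have "vec_norm2 (A *\<^sub>v v) \<le> c * vec_norm2 v" "c * vec_norm2 v \<le> c * 1"
    using assms by (auto intro: mult_left_le)
  then show "vec_norm2 (A *\<^sub>v v) \<le> c" by simp
qed

lemma vec_norm2_mult_opnorm:
  assumes "A \<in> carrier_mat n m" "v \<in> carrier_vec m"
  shows "vec_norm2 (A *\<^sub>v v) \<le> mat_opnorm A * vec_norm2 v"
proof (cases "vec_norm2 v = 0")
  case True
  then have "v = 0\<^sub>v m" using assms vec_norm2_eq_0_iff by blast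
  then have "A *\<^sub>v v = 0\<^sub>v n" using assms by auto
  then show ?thesis by simp
next
  case False
  define w where "w = complex_of_real (inverse (vec_norm2 v)) \<cdot>\<^sub>v v"
  have w: "w \<in> carrier_vec m" "vec_norm2 w = 1" using False assms by (auto simp: w_def vec_norm2_smult norm_inverse)
  have "A *\<^sub>v w = complex_of_real (inverse (vec_norm2 v)) \<cdot>\<^sub>v (A *\<^sub>v v)"
    unfolding w_def by (rule mult_mat_vec[OF assms])
  then have "vec_norm2 (A *\<^sub>v w) = inverse (vec_norm2 v) * vec_norm2 (A *\<^sub>v v)"
    by (simp add: vec_norm2_smult norm_inverse)
  moreover have "vec_norm2 (A *\<^sub>v w) \<le> mat_opnorm A"
    unfolding mat_opnorm_def by (rule cSUP_upper[OF _ bdd_above_opnorm]) (use w assms in auto)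
  ultimately have "inverse (vec_norm2 v) * vec_norm2 (A *\<^sub>v v) \<le> mat_opnorm A" by simp
  moreover have "0 < vec_norm2 v" using False vec_norm2_nonneg[of v] by linarith
  ultimately show ?thesis by (simp add: field_simps)
qed

lemma opnorm_le_fro: "mat_opnorm A \<le> fro A"
  by (rule opnorm_leI[of _ "dim_row A" "dim_col A"]) (auto intro!: vec_norm2_mult_fro)

text \<open>The columns of A are, up to conjugation, the rows of its adjoint, and an l2 norm is at
  most the l1 norm. This is how estimates for single vectors become estimates for matrices.\<close>

lemma fro_le_cols:
  assumes "A \<in> carrier_mat n m"
  shows "fro A \<le> (\<Sum>j<m. vec_norm2 (A *\<^sub>v unit_vec m j))"
proof -
  have e: "vec_norm2 (A *\<^sub>v unit_vec m j) = L2_set (\<lambda>i. cmod (A $$ (i, j))) {..<n}" if "j < m" for j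
    using assms that unfolding vec_norm2_def by (intro L2_set_cong) auto
  have "fro A = fro (mat_adjoint A)" by simp
  also have "\<dots> = L2_set (\<lambda>j. vec_norm2 (A *\<^sub>v unit_vec m j)) {..<m}"
    unfolding fro_def using assms by (auto intro!: L2_set_cong simp: e)
  also have "\<dots> \<le> (\<Sum>j<m. vec_norm2 (A *\<^sub>v unit_vec m j))" by (intro L2_set_le_sum) auto
  finally show ?thesis .
qed

lemma vec_norm2_unit_vec [simp]: "j < m \<Longrightarrow> vec_norm2 (unit_vec m j) = 1"
proof -
  assume j: "j < m"
  have "(vec_norm2 (unit_vec m j))\<^sup>2 = (\<Sum>i<m. (if i = j then 1 else 0))"
    using j unfolding vec_norm2_sq[OF unit_vec_carrier] by (intro sum.cong) auto
  also have "\<dots> = 1" using j by simp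
  finally have "(vec_norm2 (unit_vec m j))\<^sup>2 = 1\<^sup>2" by simp
  then show ?thesis by (rule power2_eq_imp_eq) auto
qed

lemma fro_le_opnorm:
  assumes "A \<in> carrier_mat n m"
  shows "fro A \<le> real m * mat_opnorm A"
proof -
  have "fro A \<le> (\<Sum>j<m. vec_norm2 (A *\<^sub>v unit_vec m j))" by (rule fro_le_cols[OF assms])
  also have "\<dots> \<le> (\<Sum>j<m. mat_opnorm A)"
  proof (intro sum_mono)
    fix j assume "j \<in> {..<m}"
    then show "vec_norm2 (A *\<^sub>v unit_vec m j) \<le> mat_opnorm A"
      using vec_norm2_mult_opnorm[OF assms, of "unit_vec m j"] by simp
  qed
  finally show ?thesis by simp
qed

section \<open>Spectral theorem and powers of positive definite matrices\<close>

lemma sq_mult_carrier [simp]: "A \<in> carrier_mat n n \<Longrightarrow> B \<in> carrier_mat n n \<Longrightarrow> A * B \<in> carrier_mat n n"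
  by (rule mult_carrier_mat)

lemma sq_mult_one [simp]:
  "A \<in> carrier_mat n n \<Longrightarrow> A * 1\<^sub>m n = A" "A \<in> carrier_mat n n \<Longrightarrow> 1\<^sub>m n * A = A"
  for A :: "'a::semiring_1 mat"
  by simp_all

lemmas sq_assoc = assoc_mult_mat[of _ n n _ n _ n for n]

lemma unitary_matD:
  assumes "unitary_mat n S"
  shows "S \<in> carrier_mat n n" "mat_adjoint S \<in> carrier_mat n n"
    "S * mat_adjoint S = 1\<^sub>m n" "mat_adjoint S * S = 1\<^sub>m n"
  using assms by (auto simp: unitary_mat_def)

lemma sq_cancel:
  fixes A B C :: cmat
  assumes "A * B = 1\<^sub>m n" "A \<in> carrier_mat n n" "B \<in> carrier_mat n n" "C \<in> carrier_mat n k"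
  shows "A * (B * C) = C"
  using assoc_mult_mat[OF assms(2-4)] assms(1) left_mult_one_mat[OF assms(4)] by simp

lemma unitary_mult:
  assumes S: "unitary_mat n S" and T: "unitary_mat n T"
  shows "unitary_mat n (S * T)"
proof -
  note s = unitary_matD[OF S] note t = unitary_matD[OF T]
  have a: "mat_adjoint (S * T) = mat_adjoint T * mat_adjoint S"
    using s t by (auto intro: mat_adjoint_mult)
  have "S * T * (mat_adjoint T * mat_adjoint S) = S * (T * (mat_adjoint T * mat_adjoint S))"
    using s t by (simp add: sq_assoc[where n=n])
  also have "\<dots> = 1\<^sub>m n" using s t by (simp add: sq_cancel[OF t(3), where k=n])
  finally have 1: "S * T * (mat_adjoint T * mat_adjoint S) = 1\<^sub>m n" .
  have "mat_adjoint T * mat_adjoint S * (S * T) = mat_adjoint T * (mat_adjoint S * (S * T))"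
    using s t by (simp add: sq_assoc[where n=n])
  also have "\<dots> = 1\<^sub>m n" using s t by (simp add: sq_cancel[OF s(4), where k=n])
  finally show ?thesis using 1 s t by (simp add: unitary_mat_def a)
qed

text \<open>The reflection along w = e_0 - v exchanges e_0 and v. A real entry \<open>v $ 0\<close>
  = r is what makes this work over the complex numbers: then |w|^2 = 2 - 2r, and c = 1 / (1 - r) is
  both the reflection coefficient 2 / |w|^2 and the inverse of the first entry of w.\<close>

lemma householder:
  assumes v: "v \<in> carrier_vec n" "vec_norm2 v = 1" and n: "0 < n" and r: "v $ 0 = complex_of_real r"
  shows "\<exists>H. unitary_mat n H \<and> H *\<^sub>v unit_vec n 0 = v"
proof (cases "v = unit_vec n 0")
  case True
  then show ?thesis using v by (intro exI[of _ "1\<^sub>m n"]) (auto simp: unitary_mat_def)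
next
  case False
  define w where "w = (\<lambda>i. unit_vec n 0 $ i - v $ i)"
  have v2: "(\<Sum>i<n. (cmod (v $ i))\<^sup>2) = 1" using vec_norm2_sq[OF v(1)] v(2) by simp
  have "(cmod (v $ 0))\<^sup>2 + (\<Sum>i\<in>{..<n} - {0}. (cmod (v $ i))\<^sup>2) = 1"
    using v2 n by (subst (asm) sum.remove[of _ 0]) auto
  moreover have "(\<Sum>i<n. (cmod (w i))\<^sup>2) = (cmod (w 0))\<^sup>2 + (\<Sum>i\<in>{..<n} - {0}. (cmod (v $ i))\<^sup>2)"
    using n by (subst sum.remove[of _ 0]) (auto simp: w_def)
  moreover have "(cmod (v $ 0))\<^sup>2 = r\<^sup>2" unfolding r norm_of_real by simp
  moreover have w0: "w 0 = complex_of_real (1 - r)" using n by (simp add: w_def r)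
  have "(cmod (w 0))\<^sup>2 = (1 - r)\<^sup>2" unfolding w0 norm_of_real by simp
  ultimately have w2: "(\<Sum>i<n. (cmod (w i))\<^sup>2) = 2 - 2 * r"
    by (simp add: power2_diff)
  have r1: "r \<noteq> 1"
  proof
    assume "r = 1"
    then have "(\<Sum>i<n. (cmod (w i))\<^sup>2) = 0" using w2 by simp
    then have "\<forall>i<n. w i = 0" by (subst (asm) sum_nonneg_eq_0_iff) auto
    then have "v = unit_vec n 0" using v by (intro eq_vecI) (auto simp: w_def)
    with False show False by simp
  qed
  define c where "c = complex_of_real (1 / (1 - r))"
  define H where "H = Matrix.mat n n (\<lambda>(i,j). (if i = j then 1 else 0) - c * w i * cnj (w j))"
  have Hc: "H \<in> carrier_mat n n" by (simp add: H_def)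
  have Ha: "mat_adjoint H = H"
    using Hc by (intro eq_matI) (auto simp: H_def c_def)
  have cw: "c * (\<Sum>l<n. w l * cnj (w l)) = 2"
  proof -
    have "(\<Sum>l<n. w l * cnj (w l)) = complex_of_real (2 - 2 * r)"
      unfolding w2[symmetric] by (simp add: complex_norm_square[symmetric])
    then have "c * (\<Sum>l<n. w l * cnj (w l)) = complex_of_real (1 / (1 - r) * (2 - 2 * r))"
      unfolding c_def by (simp only: of_real_mult)
    also have "1 / (1 - r) * (2 - 2 * r) = 2" using r1 by (simp add: field_simps)
    finally show ?thesis by simp
  qed
  have HH: "H * H = 1\<^sub>m n"
  proof (rule eq_matI)
    fix i j assume ij: "i < dim_row (1\<^sub>m n :: cmat)" "j < dim_col (1\<^sub>m n :: cmat)"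
    have "(H * H) $$ (i, j) = (\<Sum>l<n. ((if i = l then 1 else 0) - c * w i * cnj (w l)) *
        ((if l = j then 1 else 0) - c * w l * cnj (w j)))"
      using ij Hc by (subst index_mult_mat_sum[of _ n _ n _ n]) (auto simp: H_def)
    also have "\<dots> = (\<Sum>l<n. (if l = i then (if i = j then 1 else 0) else 0)
       - (if l = j then c * w i * cnj (w j) else 0) - (if l = i then c * w i * cnj (w j) else 0)
       + (c * c * w i * cnj (w j)) * (w l * cnj (w l)))"
      by (intro sum.cong) (auto simp: algebra_simps)
    also have "\<dots> = (if i = j then 1 else 0) - 2 * (c * w i * cnj (w j)) + (c * w i * cnj (w j)) * (c * (\<Sum>l<n. w l * cnj (w l)))"
      using ij by (simp add: sum.distrib sum_subtractf sum_distrib_left ac_simps)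
    also have "\<dots> = (1\<^sub>m n) $$ (i, j)" using ij by (simp add: cw)
    finally show "(H * H) $$ (i, j) = (1\<^sub>m n) $$ (i, j)" .
  qed (use Hc in auto)
  have "H *\<^sub>v unit_vec n 0 = v"
  proof (rule eq_vecI)
    fix i assume i: "i < dim_vec v"
    have "(H *\<^sub>v unit_vec n 0) $ i = H $$ (i, 0)"
      using i v n Hc by auto
    also have "\<dots> = unit_vec n 0 $ i - w i * (c * cnj (w 0))"
      using i v n by (simp add: H_def)
    also have "c * cnj (w 0) = 1"
    proof -
      have "c * cnj (w 0) = complex_of_real (1 / (1 - r) * (1 - r))" unfolding w0 c_def by simp
      then show ?thesis using r1 by simp
    qed
    finally show "(H *\<^sub>v unit_vec n 0) $ i = v $ i" by (simp add: w_def)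
  qed (use v Hc in auto)
  then show ?thesis using Hc Ha HH by (auto simp: unitary_mat_def)
qed

lemma unit_eigenvector:
  assumes A: "A \<in> carrier_mat n n" "mat_adjoint A = A" and n: "0 < n"
  shows "\<exists>v r l. v \<in> carrier_vec n \<and> vec_norm2 v = 1 \<and> v $ 0 = complex_of_real r \<and>
     A *\<^sub>v v = complex_of_real l \<cdot>\<^sub>v v"
proof -
  have "degree (char_poly A) = n" using degree_monic_char_poly[OF A(1)] by simp
  then have "\<not> constant (poly (char_poly A))" using n by (simp add: constant_degree)
  then obtain z where "poly (char_poly A) z = 0" using fundamental_theorem_of_algebra by blast
  then have "eigenvalue A z" using eigenvalue_root_char_poly[OF A(1)] by simp
  then obtain x where x: "x \<in> carrier_vec n" "x \<noteq> 0\<^sub>v n" "A *\<^sub>v x = z \<cdot>\<^sub>v x"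
    using A by (auto simp: eigenvalue_def eigenvector_def)
  have nx: "vec_norm2 x \<noteq> 0" using x vec_norm2_eq_0_iff by blast
  have "z * complex_of_real ((vec_norm2 x)\<^sup>2) = (A *\<^sub>v x) \<bullet>c x"
    using x cscalar_prod_self[OF x(1)] by simp
  also have "\<dots> = x \<bullet>c (A *\<^sub>v x)" using cscalar_prod_adjoint[OF A(1) x(1) x(1)] A(2) by simp
  also have "\<dots> = cnj z * (x \<bullet>c x)" using x by (simp add: conjugate_smult_vec)
  also have "x \<bullet>c x = complex_of_real ((vec_norm2 x)\<^sup>2)" using x by (simp add: cscalar_prod_self)
  finally have "z = cnj z" using nx by simp
  then have z: "z = complex_of_real (Re z)" by (simp add: complex_eq_iff)
  \<comment> \<open>Normalises the length and turns the first entry into a nonnegative real number,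
    as \<open>householder\<close> requires.\<close>
  define c where "c = (if x $ 0 = 0 then 1 else cnj (x $ 0) / cmod (x $ 0)) / vec_norm2 x"
  have c: "cmod c = 1 / vec_norm2 x" by (auto simp: c_def norm_divide)
  have "(c \<cdot>\<^sub>v x) $ 0 = complex_of_real (cmod (x $ 0) / vec_norm2 x)"
  proof (cases "x $ 0 = 0")
    case False
    have "(c \<cdot>\<^sub>v x) $ 0 = (x $ 0 * cnj (x $ 0)) / cmod (x $ 0) / vec_norm2 x"
      using x n False by (simp add: c_def)
    then show ?thesis using False unfolding complex_norm_square[symmetric] by (simp add: power2_eq_square)
  qed (use x n in simp)
  moreover have "A *\<^sub>v (c \<cdot>\<^sub>v x) = complex_of_real (Re z) \<cdot>\<^sub>v (c \<cdot>\<^sub>v x)"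
    using mult_mat_vec[OF A(1) x(1), of c] x z by (simp add: smult_smult_assoc mult.commute)
  moreover have "c \<cdot>\<^sub>v x \<in> carrier_vec n" "vec_norm2 (c \<cdot>\<^sub>v x) = 1"
    using x nx c by (auto simp: vec_norm2_smult)
  ultimately show ?thesis by blast
qed

lemma four_block_adjoint:
  fixes A :: cmat
  assumes "A \<in> carrier_mat n1 n1" "D \<in> carrier_mat n2 n2"
  shows "mat_adjoint (four_block_mat A (0\<^sub>m n1 n2) (0\<^sub>m n2 n1) D) =
    four_block_mat (mat_adjoint A) (0\<^sub>m n1 n2) (0\<^sub>m n2 n1) (mat_adjoint D)"
  using assms by (intro eq_matI) auto

lemma four_block_diag_mult:
  fixes A :: cmat
  assumes "A \<in> carrier_mat n1 n1" "D \<in> carrier_mat n2 n2" "A' \<in> carrier_mat n1 n1" "D' \<in> carrier_mat n2 n2"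
  shows "four_block_mat A (0\<^sub>m n1 n2) (0\<^sub>m n2 n1) D * four_block_mat A' (0\<^sub>m n1 n2) (0\<^sub>m n2 n1) D' =
    four_block_mat (A * A') (0\<^sub>m n1 n2) (0\<^sub>m n2 n1) (D * D')"
  using assms by (subst mult_four_block_mat[of _ n1 n1 _ n2 _ n2 _ _ n1 _ n2]) auto

text \<open>Deflation: conjugation with a Householder reflection that sends e_0 to a unit
  eigenvector clears the first column, hence by symmetry the first row, and the induction hypothesis
  diagonalises the remaining block.\<close>

theorem hermitian_spectral:
  assumes "A \<in> carrier_mat n n" "mat_adjoint A = A"
  shows "\<exists>S e. unitary_mat n S \<and> A = S * mat_diag n (\<lambda>i. complex_of_real (e i)) * mat_adjoint S"
  using assms
proof (induction n arbitrary: A)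
  case 0
  then show ?case
    by (intro exI[of _ "1\<^sub>m 0"] exI[of _ "\<lambda>_. 0"] conjI eq_matI) (auto simp: unitary_mat_def mat_diag_def)
next
  case (Suc k)
  let ?n = "Suc k"
  obtain v r l where v: "v \<in> carrier_vec ?n" "vec_norm2 v = 1" "v $ 0 = complex_of_real r"
    "A *\<^sub>v v = complex_of_real l \<cdot>\<^sub>v v"
    using unit_eigenvector[OF Suc.prems] by auto
  obtain H where H: "unitary_mat ?n H" "H *\<^sub>v unit_vec ?n 0 = v"
    using householder[OF v(1,2) _ v(3)] by auto
  note h = unitary_matD[OF H(1)]
  define A' where "A' = mat_adjoint H * (A * H)"
  have A'c: "A' \<in> carrier_mat ?n ?n" using h Suc.prems by (simp add: A'_def)
  have A'a: "mat_adjoint A' = A'"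
  proof -
    have "mat_adjoint A' = mat_adjoint (A * H) * H"
      unfolding A'_def using h Suc.prems(1) by (subst mat_adjoint_mult[of _ ?n ?n _ ?n]) auto
    also have "mat_adjoint (A * H) = mat_adjoint H * A"
      using mat_adjoint_mult[OF Suc.prems(1) h(1)] Suc.prems(2) by simp
    finally show ?thesis unfolding A'_def using h(1,2) Suc.prems(1) by (simp only: sq_assoc[where n="?n"])
  qed
  have "A' *\<^sub>v unit_vec ?n 0 = mat_adjoint H *\<^sub>v (A *\<^sub>v v)"
    using h Suc.prems H(2) by (simp add: A'_def assoc_mult_mat_vec[of _ ?n ?n _ ?n])
  also have "\<dots> = complex_of_real l \<cdot>\<^sub>v (mat_adjoint H *\<^sub>v (H *\<^sub>v unit_vec ?n 0))"
    using h v H(2) by (simp add: mult_mat_vec[of _ ?n ?n])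
  also have "mat_adjoint H *\<^sub>v (H *\<^sub>v unit_vec ?n 0) = unit_vec ?n 0"
    using h by (simp add: assoc_mult_mat_vec[of _ ?n ?n _ ?n, symmetric])
  finally have e: "A' *\<^sub>v unit_vec ?n 0 = complex_of_real l \<cdot>\<^sub>v unit_vec ?n 0" .
  have col0: "A' $$ (i, 0) = (if i = 0 then complex_of_real l else 0)" if "i < ?n" for i
    using arg_cong[OF e, of "\<lambda>x. x $ i"] that A'c by auto
  have row0: "A' $$ (0, i) = (if i = 0 then complex_of_real l else 0)" if "i < ?n" for i
    using arg_cong[OF A'a, of "\<lambda>x. x $$ (0, i)"] that A'c col0[OF that] by auto
  define C where "C = Matrix.mat k k (\<lambda>(i, j). A' $$ (Suc i, Suc j))"
  have Cc: "C \<in> carrier_mat k k" by (simp add: C_def)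
  have "mat_adjoint C = C"
  proof (rule eq_matI)
    fix i j assume "i < dim_row C" "j < dim_col C"
    then show "mat_adjoint C $$ (i, j) = C $$ (i, j)"
      using arg_cong[OF A'a, of "\<lambda>x. x $$ (Suc i, Suc j)"] A'c by (auto simp: C_def)
  qed (use Cc in auto)
  from Suc.IH[OF Cc this] obtain S' e' where S': "unitary_mat k S'"
    and C: "C = S' * mat_diag k (\<lambda>i. complex_of_real (e' i)) * mat_adjoint S'" by blast
  note s = unitary_matD[OF S']
  let ?fb = "\<lambda>X Y. four_block_mat X (0\<^sub>m 1 k) (0\<^sub>m k 1) Y"
  define e2 where "e2 = (\<lambda>i. case i of 0 \<Rightarrow> l | Suc i \<Rightarrow> e' i)"
  define L where "L = Matrix.mat 1 1 (\<lambda>_. complex_of_real l)"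
  have Lc: "L \<in> carrier_mat 1 1" by (simp add: L_def)
  define S2 where "S2 = ?fb (1\<^sub>m 1) S'"
  have S2c: "S2 \<in> carrier_mat ?n ?n" using s by (auto simp: S2_def)
  have S2a: "mat_adjoint S2 = ?fb (1\<^sub>m 1) (mat_adjoint S')"
    unfolding S2_def using s by (subst four_block_adjoint) auto
  have "S2 * mat_adjoint S2 = 1\<^sub>m ?n" "mat_adjoint S2 * S2 = 1\<^sub>m ?n"
    unfolding S2a unfolding S2_def using s four_block_one_mat[of 1 k]
    by (simp_all add: four_block_diag_mult)
  then have S2u: "unitary_mat ?n S2" using S2c by (auto simp: unitary_mat_def)
  have dg: "mat_diag ?n (\<lambda>i. complex_of_real (e2 i)) = ?fb L (mat_diag k (\<lambda>i. complex_of_real (e' i)))"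
    by (intro eq_matI) (auto simp: mat_diag_def L_def e2_def split: nat.splits)
  have "A' = ?fb L C"
    using A'c by (intro eq_matI) (auto simp: L_def C_def row0 col0)
  also have "\<dots> = S2 * mat_diag ?n (\<lambda>i. complex_of_real (e2 i)) * mat_adjoint S2"
    unfolding dg S2a unfolding S2_def C using s Lc by (simp add: four_block_diag_mult)
  finally have A'2: "A' = S2 * mat_diag ?n (\<lambda>i. complex_of_real (e2 i)) * mat_adjoint S2" .
  have "H * A' = A * H"
    unfolding A'_def by (rule sq_cancel[OF h(3,1,2), where k="?n"]) (use h Suc.prems in simp)
  then have "H * A' * mat_adjoint H = A * (H * mat_adjoint H)"
    using assoc_mult_mat[OF Suc.prems(1) h(1,2)] by simp
  then have "A = H * A' * mat_adjoint H" unfolding h(3) using Suc.prems(1) by simp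
  also have "\<dots> = (H * S2) * mat_diag ?n (\<lambda>i. complex_of_real (e2 i)) * mat_adjoint (H * S2)"
  proof -
    let ?E = "mat_diag ?n (\<lambda>i. complex_of_real (e2 i))"
    have c: "?E \<in> carrier_mat ?n ?n" "mat_adjoint S2 \<in> carrier_mat ?n ?n" using S2c by auto
    show ?thesis unfolding A'2 mat_adjoint_mult[OF h(1) S2c]
      using h(1,2) S2c c by (simp only: sq_assoc[where n="?n"] sq_mult_carrier)
  qed
  finally show ?case using unitary_mult[OF H(1) S2u] by blast
qed

text \<open>Entrywise the hypothesis says that \<open>U $$ (i, j)\<close> can be nonzero only where
  e' i = e j, and there f takes equal values. No eigenspaces are needed.\<close>

lemma diag_intertwine:
  fixes U :: cmat
  assumes U: "U \<in> carrier_mat n n"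
    and eq: "mat_diag n (\<lambda>i. complex_of_real (e' i)) * U = U * mat_diag n (\<lambda>i. complex_of_real (e i))"
  shows "mat_diag n (\<lambda>i. complex_of_real (f (e' i))) * U = U * mat_diag n (\<lambda>i. complex_of_real (f (e i)))"
proof (rule eq_matI)
  fix i j assume "i < dim_row (U * mat_diag n (\<lambda>i. complex_of_real (f (e i))))"
    "j < dim_col (U * mat_diag n (\<lambda>i. complex_of_real (f (e i))))"
  then have ij: "i < n" "j < n" using U by (auto simp: mat_diag_def)
  have "complex_of_real (e' i) * U $$ (i, j) = U $$ (i, j) * complex_of_real (e j)"
    using arg_cong[OF eq, of "\<lambda>x. x $$ (i, j)"] ij
    by (simp add: mat_diag_mult_left[OF U] mat_diag_mult_right[OF U])
  then have "e' i = e j \<or> U $$ (i, j) = 0" by auto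
  then show "(mat_diag n (\<lambda>i. complex_of_real (f (e' i))) * U) $$ (i, j) =
      (U * mat_diag n (\<lambda>i. complex_of_real (f (e i)))) $$ (i, j)"
    using ij by (auto simp: mat_diag_mult_left[OF U] mat_diag_mult_right[OF U])
qed (use U in \<open>auto simp: mat_diag_def\<close>)

text \<open>The unitary U = adjoint of S' times S intertwines the two diagonal matrices, so
  \<open>diag_intertwine\<close> applies to it. This is the uniqueness on which the definite
  description in \<open>mat_powr\<close> rests.\<close>

lemma functional_calculus_unique:
  assumes S: "unitary_mat n S" and S': "unitary_mat n S'"
    and eq: "S * mat_diag n (\<lambda>i. complex_of_real (e i)) * mat_adjoint S =
      S' * mat_diag n (\<lambda>i. complex_of_real (e' i)) * mat_adjoint S'"
  shows "S * mat_diag n (\<lambda>i. complex_of_real (f (e i))) * mat_adjoint S =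
      S' * mat_diag n (\<lambda>i. complex_of_real (f (e' i))) * mat_adjoint S'"
proof -
  note s = unitary_matD[OF S] note s' = unitary_matD[OF S']
  let ?D = "\<lambda>e. mat_diag n (\<lambda>i. complex_of_real (e i))"
  have D: "?D e \<in> carrier_mat n n" for e by simp
  define U where "U = mat_adjoint S' * S"
  have U: "U \<in> carrier_mat n n" using s s' by (simp add: U_def)
  have r: "X * 1\<^sub>m n = X" if "X \<in> carrier_mat n n" for X :: cmat using that by simp
  have "?D e' * U = mat_adjoint S' * (S' * ?D e' * mat_adjoint S') * S"
    unfolding U_def using s s' sq_cancel[OF s'(4), of "?D e' * (mat_adjoint S' * S)" n]
    by (simp add: sq_assoc[where n=n])
  also have "\<dots> = U * ?D e"
    unfolding eq[symmetric] U_def using s s' r[OF D] by (simp add: sq_assoc[where n=n])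
  finally have "?D (\<lambda>i. f (e' i)) * U = U * ?D (\<lambda>i. f (e i))" by (rule diag_intertwine[OF U])
  then have "S' * (?D (\<lambda>i. f (e' i)) * U) * mat_adjoint S = S' * (U * ?D (\<lambda>i. f (e i))) * mat_adjoint S" by simp
  moreover have "S' * (?D (\<lambda>i. f (e' i)) * U) * mat_adjoint S = S' * ?D (\<lambda>i. f (e' i)) * mat_adjoint S'"
    unfolding U_def using s s' r[OF s'(2)] by (simp add: sq_assoc[where n=n])
  moreover have "S' * (U * ?D (\<lambda>i. f (e i))) * mat_adjoint S = S * ?D (\<lambda>i. f (e i)) * mat_adjoint S"
    unfolding U_def using s s' sq_cancel[OF s'(3), of "S * (?D (\<lambda>i. f (e i)) * mat_adjoint S)" n]
    by (simp add: sq_assoc[where n=n])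
  ultimately show ?thesis by simp
qed

section \<open>Real powers of positive definite matrices\<close>

lemma mat_powr_eq:
  assumes S: "unitary_mat n S" and e: "\<forall>i<n. 0 < e i"
    and A: "A = S * mat_diag n (\<lambda>i. complex_of_real (e i)) * mat_adjoint S"
  shows "mat_powr A s = S * mat_diag n (\<lambda>i. complex_of_real (e i powr s)) * mat_adjoint S"
proof -
  have d: "dim_row A = n" using unitary_matD[OF S] by (simp add: A)
  show ?thesis unfolding mat_powr_def d
  proof (rule the_equality)
    show "\<exists>Sa ea. unitary_mat n Sa \<and> (\<forall>i<n. 0 < ea i) \<and>
       A = Sa * mat_diag n (\<lambda>i. complex_of_real (ea i)) * mat_adjoint Sa \<and>
       S * mat_diag n (\<lambda>i. complex_of_real (e i powr s)) * mat_adjoint S =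
       Sa * mat_diag n (\<lambda>i. complex_of_real (ea i powr s)) * mat_adjoint Sa"
      using S e A by blast
  next
    fix P assume "\<exists>Sa ea. unitary_mat n Sa \<and> (\<forall>i<n. 0 < ea i) \<and>
       A = Sa * mat_diag n (\<lambda>i. complex_of_real (ea i)) * mat_adjoint Sa \<and>
       P = Sa * mat_diag n (\<lambda>i. complex_of_real (ea i powr s)) * mat_adjoint Sa"
    then obtain Sa ea where Sa: "unitary_mat n Sa"
       "A = Sa * mat_diag n (\<lambda>i. complex_of_real (ea i)) * mat_adjoint Sa"
       "P = Sa * mat_diag n (\<lambda>i. complex_of_real (ea i powr s)) * mat_adjoint Sa" by blast
    show "P = S * mat_diag n (\<lambda>i. complex_of_real (e i powr s)) * mat_adjoint S"
      unfolding Sa(3)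
      by (rule functional_calculus_unique[OF Sa(1) S, where f="\<lambda>x. x powr s"]) (use Sa(2) A in simp)
  qed
qed

lemma positive_definiteD:
  assumes "positive_definite n A"
  shows "A \<in> carrier_mat n n" "mat_adjoint A = A"
    "\<And>v. v \<in> carrier_vec n \<Longrightarrow> v \<noteq> 0\<^sub>v n \<Longrightarrow> 0 < Re ((A *\<^sub>v v) \<bullet>c v)"
  using assms by (auto simp: positive_definite_def)

lemma diag_mult_vec:
  "v \<in> carrier_vec n \<Longrightarrow> mat_diag n f *\<^sub>v v = Matrix.vec n (\<lambda>i. f i * v $ i)" for v :: cvec
proof (rule eq_vecI)
  fix i assume v: "v \<in> carrier_vec n" and "i < dim_vec (Matrix.vec n (\<lambda>i. f i * v $ i))"
  then have i: "i < n" by simp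
  have "(mat_diag n f *\<^sub>v v) $ i = (\<Sum>l<n. (if l = i then f i * v $ i else 0))"
  proof -
    have "(mat_diag n f *\<^sub>v v) $ i = (\<Sum>l<n. mat_diag n f $$ (i, l) * v $ l)"
      by (rule index_mult_mat_vec_sum[OF i _ v]) simp
    also have "\<dots> = (\<Sum>l<n. (if l = i then f i * v $ i else 0))"
      using i by (intro sum.cong) (auto simp: mat_diag_def)
    finally show ?thesis .
  qed
  then show "(mat_diag n f *\<^sub>v v) $ i = Matrix.vec n (\<lambda>i. f i * v $ i) $ i" using i by simp
qed (simp add: mat_diag_def)

lemma spectral_form:
  assumes S: "unitary_mat n S" and v: "v \<in> carrier_vec n"
  shows "((S * mat_diag n (\<lambda>i. complex_of_real (e i)) * mat_adjoint S) *\<^sub>v v) \<bullet>c v =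
    complex_of_real (\<Sum>i<n. e i * (cmod ((mat_adjoint S *\<^sub>v v) $ i))\<^sup>2)"
proof -
  note s = unitary_matD[OF S]
  let ?D = "mat_diag n (\<lambda>i. complex_of_real (e i))" let ?w = "mat_adjoint S *\<^sub>v v"
  have D: "?D \<in> carrier_mat n n" by simp
  have w: "?w \<in> carrier_vec n" using s v by (intro mult_mat_vec_carrier)
  have "(S * ?D * mat_adjoint S) *\<^sub>v v = S *\<^sub>v (?D *\<^sub>v ?w)"
    using s v D w by (simp add: assoc_mult_mat_vec[of _ n n _ n])
  then have "((S * ?D * mat_adjoint S) *\<^sub>v v) \<bullet>c v = (?D *\<^sub>v ?w) \<bullet>c ?w"
    using cscalar_prod_adjoint[OF s(1) mult_mat_vec_carrier[OF D w] v] by simp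
  also have "\<dots> = (\<Sum>i<n. complex_of_real (e i) * ?w $ i * cnj (?w $ i))"
    unfolding diag_mult_vec[OF w] using w by (subst cscalar_prod_sum[of _ n]) auto
  also have "\<dots> = complex_of_real (\<Sum>i<n. e i * (cmod (?w $ i))\<^sup>2)"
    by (simp only: complex_norm_square mult.assoc of_real_sum of_real_mult of_real_power[symmetric])
  finally show ?thesis .
qed

lemma adjoint_conj_diag:
  assumes "unitary_mat n S"
  shows "mat_adjoint (S * mat_diag n (\<lambda>i. complex_of_real (e i)) * mat_adjoint S) =
    S * mat_diag n (\<lambda>i. complex_of_real (e i)) * mat_adjoint S"
proof -
  note s = unitary_matD[OF assms]
  let ?D = "mat_diag n (\<lambda>i. complex_of_real (e i))"
  have D: "?D \<in> carrier_mat n n" by simp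
  have "mat_adjoint (S * ?D * mat_adjoint S) = S * (mat_adjoint (S * ?D))"
    using s D by (subst mat_adjoint_mult[of _ n n _ n]) auto
  also have "mat_adjoint (S * ?D) = ?D * mat_adjoint S"
    using s D by (subst mat_adjoint_mult[of _ n n _ n]) (auto simp: mat_adjoint_diag)
  finally show ?thesis using s D by (simp add: sq_assoc[where n=n])
qed

lemma positive_definite_spectralI:
  assumes S: "unitary_mat n S" and e: "\<forall>i<n. 0 < e i"
  shows "positive_definite n (S * mat_diag n (\<lambda>i. complex_of_real (e i)) * mat_adjoint S)"
  unfolding positive_definite_def
proof (intro conjI ballI impI)
  note s = unitary_matD[OF S]
  show "S * mat_diag n (\<lambda>i. complex_of_real (e i)) * mat_adjoint S \<in> carrier_mat n n" using s by simp
  show "mat_adjoint (S * mat_diag n (\<lambda>i. complex_of_real (e i)) * mat_adjoint S) =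
    S * mat_diag n (\<lambda>i. complex_of_real (e i)) * mat_adjoint S" by (rule adjoint_conj_diag[OF S])
  fix v :: cvec assume v: "v \<in> carrier_vec n" "v \<noteq> 0\<^sub>v n"
  let ?w = "mat_adjoint S *\<^sub>v v"
  have w: "?w \<in> carrier_vec n" using s v by (intro mult_mat_vec_carrier)
  have "\<exists>i<n. ?w $ i \<noteq> 0"
  proof (rule ccontr)
    assume "\<not> ?thesis"
    then have "?w = 0\<^sub>v n" using w by (intro eq_vecI) (auto simp del: index_mult_mat_vec dim_mult_mat_vec)
    then have "S *\<^sub>v ?w = 0\<^sub>v n" using s by auto
    moreover have "S *\<^sub>v ?w = v" using s v by (simp add: assoc_mult_mat_vec[of _ n n _ n, symmetric])
    ultimately show False using v by simp
  qed
  then obtain i where i: "i < n" "?w $ i \<noteq> 0" by blast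
  have "0 < (\<Sum>i<n. e i * (cmod (?w $ i))\<^sup>2)"
    using i e by (intro sum_pos2[of _ i]) (auto intro!: mult_nonneg_nonneg simp: less_imp_le)
  then show "0 < Re (((S * mat_diag n (\<lambda>i. complex_of_real (e i)) * mat_adjoint S) *\<^sub>v v) \<bullet>c v)"
    unfolding spectral_form[OF S v(1)] by simp
qed

lemma positive_definite_spectral:
  assumes "positive_definite n A"
  obtains S e where "unitary_mat n S" "\<forall>i<n. 0 < e i"
    "A = S * mat_diag n (\<lambda>i. complex_of_real (e i)) * mat_adjoint S"
proof -
  note a = positive_definiteD[OF assms]
  obtain S e where S: "unitary_mat n S" and A: "A = S * mat_diag n (\<lambda>i. complex_of_real (e i)) * mat_adjoint S"
    using hermitian_spectral[OF a(1,2)] by blast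
  note s = unitary_matD[OF S]
  have "0 < e i" if i: "i < n" for i
  proof -
    define v where "v = S *\<^sub>v unit_vec n i"
    have v: "v \<in> carrier_vec n" using s by (auto simp: v_def)
    have w: "mat_adjoint S *\<^sub>v v = unit_vec n i"
      unfolding v_def using s by (simp add: assoc_mult_mat_vec[of _ n n _ n, symmetric])
    have "v \<noteq> 0\<^sub>v n"
    proof
      assume "v = 0\<^sub>v n"
      then have "mat_adjoint S *\<^sub>v v = 0\<^sub>v n" using s by auto
      then have "unit_vec n i $ i = (0\<^sub>v n :: cvec) $ i" using w by simp
      then show False using i by simp
    qed
    from a(3)[OF v this] have "0 < (\<Sum>j<n. e j * (cmod ((mat_adjoint S *\<^sub>v v) $ j))\<^sup>2)"
      unfolding A spectral_form[OF S v] by simp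
    also have "\<dots> = (\<Sum>j<n. if j = i then e i else 0)" unfolding w using i by (intro sum.cong) auto
    finally show ?thesis using i by simp
  qed
  with S A that show ?thesis by blast
qed

lemma conj_diag_mult:
  assumes "unitary_mat n S"
  shows "(S * mat_diag n (\<lambda>i. complex_of_real (e i)) * mat_adjoint S) *
    (S * mat_diag n (\<lambda>i. complex_of_real (e' i)) * mat_adjoint S) =
    S * mat_diag n (\<lambda>i. complex_of_real (e i * e' i)) * mat_adjoint S"
proof -
  note s = unitary_matD[OF assms]
  let ?D = "\<lambda>e. mat_diag n (\<lambda>i. complex_of_real (e i))"
  have "(S * ?D e * mat_adjoint S) * (S * ?D e' * mat_adjoint S) =
    S * (?D e * (mat_adjoint S * (S * (?D e' * mat_adjoint S))))"
    using s by (simp add: sq_assoc[where n=n])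
  also have "mat_adjoint S * (S * (?D e' * mat_adjoint S)) = ?D e' * mat_adjoint S"
    using s by (intro sq_cancel[OF s(4), where k=n]) auto
  also have "?D e * (?D e' * mat_adjoint S) = (?D e * ?D e') * mat_adjoint S"
    using s by (subst assoc_mult_mat[of _ n n _ n _ n]) auto
  also have "S * (?D e * ?D e' * mat_adjoint S) = S * (?D e * ?D e') * mat_adjoint S"
    using s by (subst assoc_mult_mat[of _ n n _ n _ n]) auto
  finally show ?thesis by (simp add: mat_diag_diag)
qed

lemma mat_diag_cong: "(\<And>i. i < n \<Longrightarrow> f i = g i) \<Longrightarrow> mat_diag n f = mat_diag n g"
  by (intro eq_matI) (auto simp: mat_diag_def)

lemma pd_mat_powr: "positive_definite n A \<Longrightarrow> positive_definite n (mat_powr A s)"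
proof -
  assume "positive_definite n A"
  then obtain S e where S: "unitary_mat n S" and e: "\<forall>i<n. 0 < e i"
    and A: "A = S * mat_diag n (\<lambda>i. complex_of_real (e i)) * mat_adjoint S"
    using positive_definite_spectral by blast
  show ?thesis unfolding mat_powr_eq[OF S e A] using e by (intro positive_definite_spectralI S) (auto dest: less_imp_neq)
qed

lemma mat_powr_carrier: "positive_definite n A \<Longrightarrow> mat_powr A s \<in> carrier_mat n n"
  using pd_mat_powr positive_definiteD(1) by blast

lemma mat_powr_powr:
  assumes "positive_definite n A" shows "mat_powr (mat_powr A s) t = mat_powr A (s * t)"
proof -
  obtain S e where S: "unitary_mat n S" and e: "\<forall>i<n. 0 < e i"
    and A: "A = S * mat_diag n (\<lambda>i. complex_of_real (e i)) * mat_adjoint S"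
    using positive_definite_spectral[OF assms] by blast
  show ?thesis
    unfolding mat_powr_eq[OF S e A]
    by (subst mat_powr_eq[OF S _ refl]) (use e in \<open>auto simp: powr_powr less_imp_neq[symmetric] intro!: mat_diag_cong arg_cong2[where f=times]\<close>)
qed

lemma mat_powr_add:
  assumes "positive_definite n A" shows "mat_powr A s * mat_powr A t = mat_powr A (s + t)"
proof -
  obtain S e where S: "unitary_mat n S" and e: "\<forall>i<n. 0 < e i"
    and A: "A = S * mat_diag n (\<lambda>i. complex_of_real (e i)) * mat_adjoint S"
    using positive_definite_spectral[OF assms] by blast
  show ?thesis
    unfolding mat_powr_eq[OF S e A] conj_diag_mult[OF S] by (simp add: powr_add)
qed

lemma mat_powr_one:
  assumes "positive_definite n A" shows "mat_powr A 1 = A"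
proof -
  obtain S e where S: "unitary_mat n S" and e: "\<forall>i<n. 0 < e i"
    and A: "A = S * mat_diag n (\<lambda>i. complex_of_real (e i)) * mat_adjoint S"
    using positive_definite_spectral[OF assms] by blast
  have "mat_diag n (\<lambda>i. complex_of_real (e i powr 1)) = mat_diag n (\<lambda>i. complex_of_real (e i))"
    using e by (intro mat_diag_cong) (simp add: less_imp_le)
  then show ?thesis using mat_powr_eq[OF S e A, of 1] A by simp
qed

lemma mat_powr_zero:
  assumes "positive_definite n A" shows "mat_powr A 0 = 1\<^sub>m n"
proof -
  obtain S e where S: "unitary_mat n S" and e: "\<forall>i<n. 0 < e i"
    and A: "A = S * mat_diag n (\<lambda>i. complex_of_real (e i)) * mat_adjoint S"
    using positive_definite_spectral[OF assms] by blast
  have "mat_diag n (\<lambda>i. complex_of_real (e i powr 0)) = mat_diag n (\<lambda>i. 1)"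
    using e by (intro mat_diag_cong) (auto dest: less_imp_neq)
  then show ?thesis using mat_powr_eq[OF S e A, of 0] unitary_matD[OF S] by simp
qed

lemma mat_powr_inverse:
  assumes "positive_definite n A"
  shows "mat_powr A s * mat_powr A (- s) = 1\<^sub>m n" "mat_powr A (- s) * mat_powr A s = 1\<^sub>m n"
  using mat_powr_add[OF assms, of s "- s"] mat_powr_add[OF assms, of "- s" s] mat_powr_zero[OF assms] by simp_all

lemma pd_one: "positive_definite n (1\<^sub>m n)"
proof -
  have "unitary_mat n (1\<^sub>m n)" by (simp add: unitary_mat_def)
  then show ?thesis
    using positive_definite_spectralI[of n "1\<^sub>m n" "\<lambda>_. 1"] by simp
qed

lemma pd_sum_form:
  assumes "positive_definite n A" "v \<in> carrier_vec n"
  shows "Im ((A *\<^sub>v v) \<bullet>c v) = 0" "0 \<le> Re ((A *\<^sub>v v) \<bullet>c v)"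
proof -
  obtain S e where S: "unitary_mat n S" and e: "\<forall>i<n. 0 < e i"
    and A: "A = S * mat_diag n (\<lambda>i. complex_of_real (e i)) * mat_adjoint S"
    using positive_definite_spectral[OF assms(1)] by blast
  show "Im ((A *\<^sub>v v) \<bullet>c v) = 0" "0 \<le> Re ((A *\<^sub>v v) \<bullet>c v)"
    unfolding A spectral_form[OF S assms(2)] using e by (auto intro!: sum_nonneg mult_nonneg_nonneg simp: less_imp_le)
qed

section \<open>Determinants and bounds for inverse matrices\<close>

lemma cmod_det_le:
  fixes A :: cmat
  assumes A: "A \<in> carrier_mat n n" and K: "\<And>i j. i < n \<Longrightarrow> j < n \<Longrightarrow> cmod (A $$ (i, j)) \<le> K"
  shows "cmod (Determinant.det A) \<le> fact n * K ^ n"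
proof -
  have "cmod (Determinant.det A) \<le> (\<Sum>p | p permutes {0..<n}. cmod (signof p * (\<Prod>i = 0..<n. A $$ (i, p i))))"
    unfolding det_def'[OF A] by (rule norm_sum)
  also have "\<dots> \<le> (\<Sum>p | p permutes {0..<n}. K ^ n)"
  proof (rule sum_mono)
    fix p assume "p \<in> {p. p permutes {0..<n}}"
    then have p: "p permutes {0..<n}" by simp
    have "cmod (signof p * (\<Prod>i = 0..<n. A $$ (i, p i))) = (\<Prod>i = 0..<n. cmod (A $$ (i, p i)))"
      by (simp add: norm_mult prod_norm[symmetric] sign_def)
    also have "\<dots> \<le> (\<Prod>i = 0..<n. K)"
    proof (intro prod_mono conjI)
      fix i assume i: "i \<in> {0..<n}"
      then have "p i < n" using permutes_in_image[OF p] by (metis atLeastLessThan_iff)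
      then show "cmod (A $$ (i, p i)) \<le> K" using i K by simp
    qed simp
    finally show "cmod (signof p * (\<Prod>i = 0..<n. A $$ (i, p i))) \<le> K ^ n" by simp
  qed
  also have "\<dots> = fact n * K ^ n"
    using card_permutations[of "{0..<n}" n] by simp
  finally show ?thesis .
qed

text \<open>Cramer's rule: the adjugate is det X times Y, its entries are minors of X and so bounded
  by powers of K, and dividing by a determinant of modulus at least 1 does no harm.\<close>

lemma fro_inverse_le:
  fixes X Y :: cmat
  assumes X: "X \<in> carrier_mat n n" and Y: "Y \<in> carrier_mat n n" and YX: "Y * X = 1\<^sub>m n"
    and det: "1 \<le> cmod (Determinant.det X)" and K: "fro X \<le> K" "1 \<le> K"
  shows "fro Y \<le> real n * real n * fact n * K ^ n"
proof -
  have aX: "adj_mat X \<in> carrier_mat n n" using adj_mat[OF X] by simp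
  have "adj_mat X = Y * X * adj_mat X" using aX YX by simp
  also have "\<dots> = Y * (Determinant.det X \<cdot>\<^sub>m 1\<^sub>m n)"
    using X Y aX adj_mat[OF X] by (simp add: assoc_mult_mat[of _ n n _ n _ n])
  finally have eq: "adj_mat X = Determinant.det X \<cdot>\<^sub>m Y"
    using Y by (simp add: mult_smult_distrib[of _ n n _ n])
  have "cmod (Y $$ (i, j)) \<le> fact n * K ^ n" if ij: "i < n" "j < n" for i j
  proof -
    have md: "mat_delete X j i \<in> carrier_mat (n - 1) (n - 1)" using X by (rule mat_delete_carrier)
    have "cmod (Y $$ (i, j)) \<le> cmod (Determinant.det X) * cmod (Y $$ (i, j))"
      using det mult_right_mono[OF det, of "cmod (Y $$ (i, j))"] by simp
    also have "\<dots> = cmod (adj_mat X $$ (i, j))" unfolding eq using ij Y by (simp add: norm_mult)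
    also have "\<dots> = cmod (Determinant.det (mat_delete X j i))"
      using ij X by (simp add: adj_mat_def cofactor_def norm_mult norm_power)
    also have "\<dots> \<le> fact (n - 1) * K ^ (n - 1)"
    proof (rule cmod_det_le[OF md])
      fix a b assume ab: "a < n - 1" "b < n - 1"
      have "cmod (mat_delete X j i $$ (a, b)) \<le> fro X"
        using ab X ij by (auto simp: mat_delete_def intro!: cmod_le_fro[OF X])
      then show "cmod (mat_delete X j i $$ (a, b)) \<le> K" using K by simp
    qed
    also have "\<dots> \<le> fact n * K ^ n"
      using K by (intro mult_mono fact_mono power_increasing) auto
    finally show ?thesis .
  qed
  then have "(\<Sum>i<n. \<Sum>j<n. cmod (Y $$ (i, j))) \<le> (\<Sum>i<n. \<Sum>j<n. fact n * K ^ n)"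
    by (intro sum_mono) auto
  then show ?thesis using fro_le_sum[OF Y] by simp
qed

text \<open>Schur triangularisation makes the determinant the product of the eigenvalues.\<close>

lemma det_ge_one_of_eigenvalues:
  fixes X :: cmat
  assumes X: "X \<in> carrier_mat n n"
    and ev: "\<And>z v. v \<in> carrier_vec n \<Longrightarrow> v \<noteq> 0\<^sub>v n \<Longrightarrow> X *\<^sub>v v = z \<cdot>\<^sub>v v \<Longrightarrow> 1 \<le> cmod z"
  shows "1 \<le> cmod (Determinant.det X)"
proof -
  obtain es where es: "char_poly X = (\<Prod>a\<leftarrow>es. [:- a, 1:])" using char_poly_factorized[OF X] by blast
  obtain B P Q where B: "schur_decomposition X es = (B, P, Q)" by (cases "schur_decomposition X es") auto
  have sd: "similar_mat_wit X B P Q" "upper_triangular B" "diag_mat B = es"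
    using schur_decomposition[OF X es B] by auto
  then have "Determinant.det X = Determinant.det B" by (intro det_similar) (auto simp: similar_mat_def)
  also have "\<dots> = prod_list es"
    using sd similar_mat_witD2[OF X sd(1)] det_upper_triangular[of B n] by simp
  finally have d: "Determinant.det X = prod_list es" .
  have "1 \<le> cmod e" if "e \<in> set es" for e
  proof -
    have "poly (char_poly X) e = 0" unfolding es using that by (simp add: poly_prod_list o_def prod_list_zero_iff)
    then have "eigenvalue X e" using eigenvalue_root_char_poly[OF X] by simp
    then show ?thesis using X ev by (auto simp: eigenvalue_def eigenvector_def)
  qed
  then have "1 \<le> cmod (prod_list es)"
  proof (induction es)
    case (Cons a es)
    then show ?case using mult_mono[of 1 "cmod a" 1 "cmod (prod_list es)"] by (auto simp: norm_mult)
  qed simp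
  then show ?thesis unfolding d .
qed

lemma pd_inverse:
  assumes "positive_definite n A"
  obtains B where "B \<in> carrier_mat n n" "A * B = 1\<^sub>m n" "B * A = 1\<^sub>m n" "mat_adjoint B = B"
proof -
  have "positive_definite n (mat_powr A (- 1))" by (rule pd_mat_powr[OF assms])
  note b = positive_definiteD[OF this]
  have "A * mat_powr A (- 1) = 1\<^sub>m n" "mat_powr A (- 1) * A = 1\<^sub>m n"
    using mat_powr_inverse[OF assms, of 1] mat_powr_one[OF assms] by simp_all
  with b that show ?thesis by blast
qed

text \<open>The hypothesis \<open>cs\<close> expresses that M dominates the inverse of N; it is
  applied to means of a weight and of its inverse. For an eigenvector f of N M put g = N^-1 f: both
  f . g and g . f equal \<beta> = (N g) . g > 0, while (M f) . f = z \<beta>, so \<open>cs\<close>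
  gives \<beta>^2 \<le> Re z * \<beta>^2. Every eigenvalue therefore has real part at least
  1.\<close>

lemma det_mult_ge_one:
  assumes N: "positive_definite n N" and M: "positive_definite n M"
    and cs: "\<And>f g. f \<in> carrier_vec n \<Longrightarrow> g \<in> carrier_vec n \<Longrightarrow>
      (cmod (f \<bullet>c g))\<^sup>2 \<le> Re ((M *\<^sub>v f) \<bullet>c f) * Re ((N *\<^sub>v g) \<bullet>c g)"
  shows "1 \<le> cmod (Determinant.det (N * M))"
proof (rule det_ge_one_of_eigenvalues)
  note n = positive_definiteD[OF N] note m = positive_definiteD[OF M]
  show "N * M \<in> carrier_mat n n" using n m by simp
  fix z and f :: cvec assume f: "f \<in> carrier_vec n" "f \<noteq> 0\<^sub>v n" "(N * M) *\<^sub>v f = z \<cdot>\<^sub>v f"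
  obtain B where B: "B \<in> carrier_mat n n" "N * B = 1\<^sub>m n" "B * N = 1\<^sub>m n" "mat_adjoint B = B"
    using pd_inverse[OF N] by blast
  define g where "g = B *\<^sub>v f"
  have g: "g \<in> carrier_vec n" using B f by (auto simp: g_def)
  have Ng: "N *\<^sub>v g = f" unfolding g_def using assoc_mult_mat_vec[OF n(1) B(1) f(1)] B(2) f(1) by simp
  have Mf: "M *\<^sub>v f = z \<cdot>\<^sub>v g"
  proof -
    have "B *\<^sub>v ((N * M) *\<^sub>v f) = M *\<^sub>v f"
    proof -
      have Mf: "M *\<^sub>v f \<in> carrier_vec n" using m(1) f(1) by auto
      have "(N * M) *\<^sub>v f = N *\<^sub>v (M *\<^sub>v f)" by (rule assoc_mult_mat_vec[OF n(1) m(1) f(1)])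
      then have "B *\<^sub>v ((N * M) *\<^sub>v f) = (B * N) *\<^sub>v (M *\<^sub>v f)"
        using assoc_mult_mat_vec[OF B(1) n(1) Mf] by simp
      then show ?thesis using B(3) Mf by simp
    qed
    then show ?thesis unfolding f(3) g_def using mult_mat_vec[OF B(1) f(1)] by simp
  qed
  define \<beta> where "\<beta> = Re ((N *\<^sub>v g) \<bullet>c g)"
  have gz: "g \<noteq> 0\<^sub>v n" using Ng n f by auto
  have \<beta>: "0 < \<beta>" unfolding \<beta>_def using n(3)[OF g gz] .
  have fg: "f \<bullet>c g = complex_of_real \<beta>"
    using pd_sum_form(1)[OF N g] Ng by (simp add: \<beta>_def complex_eq_iff)
  have gf: "g \<bullet>c f = complex_of_real \<beta>"
  proof -
    have "g \<bullet>c f = cnj (f \<bullet>c g)"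
      unfolding cscalar_prod_sum[OF f(1) g] cscalar_prod_sum[OF g f(1)] by (simp add: mult.commute)
    then show ?thesis using fg by simp
  qed
  have "(M *\<^sub>v f) \<bullet>c f = z * \<beta>" unfolding Mf using f(1) g gf by simp
  then have "\<beta>\<^sup>2 \<le> Re (z * \<beta>) * \<beta>"
    using cs[OF f(1) g] unfolding fg \<beta>_def[symmetric] by simp
  then have "1 \<le> Re z" using \<beta> by (simp add: power2_eq_square)
  then show "1 \<le> cmod z" using complex_Re_le_cmod[of z] by linarith
qed


section \<open>Gram matrices and polar parts\<close>

lemma pd_gram:
  assumes X: "X \<in> carrier_mat n n" "Y \<in> carrier_mat n n" and YX: "Y * X = 1\<^sub>m n"
  shows "positive_definite n (mat_adjoint X * X)"
  unfolding positive_definite_def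
proof (intro conjI ballI impI)
  show "mat_adjoint X * X \<in> carrier_mat n n" using X by simp
  show "mat_adjoint (mat_adjoint X * X) = mat_adjoint X * X"
    using X by (subst mat_adjoint_mult[of _ n n _ n]) auto
  fix v :: cvec assume v: "v \<in> carrier_vec n" "v \<noteq> 0\<^sub>v n"
  have Xv: "X *\<^sub>v v \<in> carrier_vec n" using X v by auto
  have "Y *\<^sub>v (X *\<^sub>v v) = v" using X v YX by (simp add: assoc_mult_mat_vec[of _ n n _ n, symmetric])
  moreover have "Y *\<^sub>v (0\<^sub>v n) = 0\<^sub>v n" using X by auto
  ultimately have "X *\<^sub>v v \<noteq> 0\<^sub>v n" using v by auto
  then have nz: "vec_norm2 (X *\<^sub>v v) \<noteq> 0" using vec_norm2_eq_0_iff[OF Xv] by simp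
  have "((mat_adjoint X * X) *\<^sub>v v) \<bullet>c v = (mat_adjoint X *\<^sub>v (X *\<^sub>v v)) \<bullet>c v"
    using X v by (simp add: assoc_mult_mat_vec[of _ n n _ n])
  also have "\<dots> = (X *\<^sub>v v) \<bullet>c (X *\<^sub>v v)"
    using cscalar_prod_adjoint[of "mat_adjoint X" n n "X *\<^sub>v v" v] X v Xv by simp
  also have "\<dots> = complex_of_real ((vec_norm2 (X *\<^sub>v v))\<^sup>2)" by (rule cscalar_prod_self[OF Xv])
  finally show "0 < Re (((mat_adjoint X * X) *\<^sub>v v) \<bullet>c v)" using nz by simp
qed

lemma vec_norm2_polar:
  assumes X: "X \<in> carrier_mat n n" "Y \<in> carrier_mat n n" and YX: "Y * X = 1\<^sub>m n" and v: "v \<in> carrier_vec n"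
  shows "vec_norm2 (mat_powr (mat_adjoint X * X) (1/2) *\<^sub>v v) = vec_norm2 (X *\<^sub>v v)"
proof -
  let ?A = "mat_adjoint X * X"
  note pd = pd_gram[OF assms(1-3)]
  define P where "P = mat_powr ?A (1/2)"
  note P = positive_definiteD[OF pd_mat_powr[OF pd, of "1/2"], folded P_def]
  have PP: "P * P = ?A" unfolding P_def unfolding mat_powr_add[OF pd] using mat_powr_one[OF pd] by simp
  have Pv: "P *\<^sub>v v \<in> carrier_vec n" and Xv: "X *\<^sub>v v \<in> carrier_vec n"
    using mult_mat_vec_carrier[OF P(1) v] mult_mat_vec_carrier[OF X(1) v] .
  have "complex_of_real ((vec_norm2 (P *\<^sub>v v))\<^sup>2) = (P *\<^sub>v v) \<bullet>c (P *\<^sub>v v)" by (rule cscalar_prod_self[OF Pv, symmetric])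
  also have "\<dots> = (P *\<^sub>v (P *\<^sub>v v)) \<bullet>c v"
    unfolding cscalar_prod_adjoint[OF P(1) Pv v] P(2) ..
  also have "P *\<^sub>v (P *\<^sub>v v) = mat_adjoint X *\<^sub>v (X *\<^sub>v v)"
    unfolding assoc_mult_mat_vec[OF P(1) P(1) v, symmetric] PP
    by (rule assoc_mult_mat_vec[OF mat_adjoint_carrier[OF X(1)] X(1) v])
  also have "(mat_adjoint X *\<^sub>v (X *\<^sub>v v)) \<bullet>c v = (X *\<^sub>v v) \<bullet>c (X *\<^sub>v v)"
    unfolding cscalar_prod_adjoint[OF mat_adjoint_carrier[OF X(1)] Xv v] mat_adjoint_adjoint ..
  also have "\<dots> = complex_of_real ((vec_norm2 (X *\<^sub>v v))\<^sup>2)" by (rule cscalar_prod_self[OF Xv])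
  finally have "(vec_norm2 (P *\<^sub>v v))\<^sup>2 = (vec_norm2 (X *\<^sub>v v))\<^sup>2" by (simp only: of_real_eq_iff)
  then show ?thesis unfolding P_def by (rule power2_eq_imp_eq) auto
qed

text \<open>The operator norm of X times the inverse of X' is the best c in |X z| \<le> c |X' z|,
  and by \<open>vec_norm2_polar\<close> both sides are unchanged when X and X' are replaced by their
  positive polar parts. The unitary factors never have to be named.\<close>

lemma opnorm_polar:
  assumes X: "X \<in> carrier_mat n n" "Y \<in> carrier_mat n n" and YX: "Y * X = 1\<^sub>m n"
    and X': "X' \<in> carrier_mat n n" "Y' \<in> carrier_mat n n" and YX': "Y' * X' = 1\<^sub>m n" "X' * Y' = 1\<^sub>m n"
  shows "mat_opnorm (mat_powr (mat_adjoint X * X) (1/2) * mat_powr (mat_adjoint X' * X') (- (1/2))) = mat_opnorm (X * Y')"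
proof -
  define P where "P = mat_powr (mat_adjoint X * X) (1/2)"
  define P' where "P' = mat_powr (mat_adjoint X' * X') (1/2)"
  define Q' where "Q' = mat_powr (mat_adjoint X' * X') (- (1/2))"
  note pd = pd_gram[OF X YX] pd_gram[OF X' YX'(1)]
  have c: "P \<in> carrier_mat n n" "P' \<in> carrier_mat n n" "Q' \<in> carrier_mat n n"
    unfolding P_def P'_def Q'_def by (rule mat_powr_carrier, rule pd)+
  have PQ: "P' * Q' = 1\<^sub>m n" "Q' * P' = 1\<^sub>m n" unfolding P'_def Q'_def by (rule mat_powr_inverse[OF pd(2)])+
  have nP: "vec_norm2 (P *\<^sub>v v) = vec_norm2 (X *\<^sub>v v)" if "v \<in> carrier_vec n" for v
    unfolding P_def by (rule vec_norm2_polar[OF X YX that])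
  have nP': "vec_norm2 (P' *\<^sub>v v) = vec_norm2 (X' *\<^sub>v v)" if "v \<in> carrier_vec n" for v
    unfolding P'_def by (rule vec_norm2_polar[OF X' YX'(1) that])
  show ?thesis unfolding P_def[symmetric] Q'_def[symmetric]
  proof (rule antisym)
    show "mat_opnorm (P * Q') \<le> mat_opnorm (X * Y')"
    proof (rule opnorm_leI)
      fix v :: cvec assume v: "v \<in> carrier_vec n"
      define z where "z = Q' *\<^sub>v v"
      have z: "z \<in> carrier_vec n" using c v by (auto simp: z_def)
      have P'z: "P' *\<^sub>v z = v" unfolding z_def using c v PQ by (simp add: assoc_mult_mat_vec[of _ n n _ n, symmetric])
      have X'z: "X' *\<^sub>v z \<in> carrier_vec n" using X' z by auto
      have "Y' *\<^sub>v (X' *\<^sub>v z) = z" using X' z YX' by (simp add: assoc_mult_mat_vec[of _ n n _ n, symmetric])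
      then have "(X * Y') *\<^sub>v (X' *\<^sub>v z) = X *\<^sub>v z" using X X' X'z by (simp add: assoc_mult_mat_vec[of _ n n _ n])
      moreover have "(P * Q') *\<^sub>v v = P *\<^sub>v z" unfolding z_def using c v by (simp add: assoc_mult_mat_vec[of _ n n _ n])
      ultimately show "vec_norm2 ((P * Q') *\<^sub>v v) \<le> mat_opnorm (X * Y') * vec_norm2 v"
        using vec_norm2_mult_opnorm[of "X * Y'" n n "X' *\<^sub>v z"] X X' X'z nP[OF z] nP'[OF z] P'z by simp
    qed (use c in auto)
    show "mat_opnorm (X * Y') \<le> mat_opnorm (P * Q')"
    proof (rule opnorm_leI)
      fix v :: cvec assume v: "v \<in> carrier_vec n"
      define z where "z = Y' *\<^sub>v v"
      have z: "z \<in> carrier_vec n" using X' v by (auto simp: z_def)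
      have X'z: "X' *\<^sub>v z = v" unfolding z_def using X' v YX' by (simp add: assoc_mult_mat_vec[of _ n n _ n, symmetric])
      have P'z: "P' *\<^sub>v z \<in> carrier_vec n" using c z by auto
      have "Q' *\<^sub>v (P' *\<^sub>v z) = z" using c z PQ by (simp add: assoc_mult_mat_vec[of _ n n _ n, symmetric])
      then have "(P * Q') *\<^sub>v (P' *\<^sub>v z) = P *\<^sub>v z" using c P'z by (simp add: assoc_mult_mat_vec[of _ n n _ n])
      moreover have "(X * Y') *\<^sub>v v = X *\<^sub>v z" unfolding z_def using X X' v by (simp add: assoc_mult_mat_vec[of _ n n _ n])
      ultimately show "vec_norm2 ((X * Y') *\<^sub>v v) \<le> mat_opnorm (P * Q') * vec_norm2 v"
        using vec_norm2_mult_opnorm[of "P * Q'" n n "P' *\<^sub>v z"] c P'z nP[OF z] nP'[OF z] X'z by simp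
    qed (use X X' in auto)
  qed
qed

section \<open>Measurable matrix functions\<close>

definition mat_measurable :: "'x measure \<Rightarrow> nat \<Rightarrow> ('x \<Rightarrow> cmat) \<Rightarrow> bool" where
  "mat_measurable M n A \<longleftrightarrow> (\<forall>x. A x \<in> carrier_mat n n) \<and>
     (\<forall>i<n. \<forall>j<n. (\<lambda>x. A x $$ (i, j)) \<in> borel_measurable M)"

lemma mat_measurableD:
  assumes "mat_measurable M n A"
  shows "A x \<in> carrier_mat n n"
    "i < n \<Longrightarrow> j < n \<Longrightarrow> (\<lambda>x. A x $$ (i, j)) \<in> borel_measurable M"
  using assms by (auto simp: mat_measurable_def)

lemma mat_measurableI:
  assumes "\<And>x. A x \<in> carrier_mat n n"
    "\<And>i j. i < n \<Longrightarrow> j < n \<Longrightarrow> (\<lambda>x. A x $$ (i, j)) \<in> borel_measurable M"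
  shows "mat_measurable M n A"
  using assms by (auto simp: mat_measurable_def)

lemma mat_measurable_const: "C \<in> carrier_mat n n \<Longrightarrow> mat_measurable M n (\<lambda>_. C)"
  by (rule mat_measurableI) auto

lemma mat_measurable_mult:
  assumes A: "mat_measurable M n A" and B: "mat_measurable M n B"
  shows "mat_measurable M n (\<lambda>x. A x * B x)"
proof (rule mat_measurableI)
  fix i j assume ij: "i < n" "j < n"
  have "(A x * B x) $$ (i, j) = (\<Sum>l<n. A x $$ (i, l) * B x $$ (l, j))" for x
    by (rule index_mult_mat_sum[OF ij]) (rule mat_measurableD[OF A] mat_measurableD[OF B])+
  moreover have "(\<lambda>x. \<Sum>l<n. A x $$ (i, l) * B x $$ (l, j)) \<in> borel_measurable M"
    using ij mat_measurableD(2)[OF A] mat_measurableD(2)[OF B]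
    by (intro borel_measurable_sum borel_measurable_times) auto
  ultimately show "(\<lambda>x. (A x * B x) $$ (i, j)) \<in> borel_measurable M" by simp
qed (use mat_measurableD(1)[OF A] mat_measurableD(1)[OF B] in simp)

lemma mat_measurable_minus:
  assumes A: "mat_measurable M n A" and B: "mat_measurable M n B"
  shows "mat_measurable M n (\<lambda>x. A x - B x)"
proof (rule mat_measurableI)
  fix i j assume ij: "i < n" "j < n"
  have "(A x - B x) $$ (i, j) = A x $$ (i, j) - B x $$ (i, j)" for x
    using ij mat_measurableD(1)[OF A, of x] mat_measurableD(1)[OF B, of x] by simp
  then show "(\<lambda>x. (A x - B x) $$ (i, j)) \<in> borel_measurable M"
    using mat_measurableD(2)[OF A ij] mat_measurableD(2)[OF B ij] by simp
qed (use mat_measurableD(1)[OF A] mat_measurableD(1)[OF B] in \<open>auto intro!: minus_carrier_mat\<close>)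

lemma mat_measurable_adjoint:
  assumes A: "mat_measurable M n A"
  shows "mat_measurable M n (\<lambda>x. mat_adjoint (A x))"
proof (rule mat_measurableI)
  fix i j assume ij: "i < n" "j < n"
  have "mat_adjoint (A x) $$ (i, j) = cnj (A x $$ (j, i))" for x
    using ij mat_measurableD(1)[OF A, of x] by simp
  then show "(\<lambda>x. mat_adjoint (A x) $$ (i, j)) \<in> borel_measurable M"
    using mat_measurableD(2)[OF A ij(2,1)] by (simp add: bounded_linear_cnj borel_measurable_continuous_on[OF continuous_on_cnj[OF continuous_on_id]])
qed (use mat_measurableD(1)[OF A] in auto)

lemma mat_measurable_compose:
  assumes "f \<in> M \<rightarrow>\<^sub>M N" "mat_measurable N n A"
  shows "mat_measurable M n (\<lambda>x. A (f x))"
  using assms by (auto simp: mat_measurable_def intro: measurable_compose)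

lemma borel_measurable_fro:
  assumes A: "mat_measurable M n A"
  shows "(\<lambda>x. fro (A x)) \<in> borel_measurable M"
proof -
  have "fro (A x) = sqrt (\<Sum>i<n. \<Sum>j<n. (cmod (A x $$ (i, j)))\<^sup>2)" for x
    by (rule fro_eq_sqrt[OF mat_measurableD(1)[OF A]])
  moreover have "(\<lambda>x. sqrt (\<Sum>i<n. \<Sum>j<n. (cmod (A x $$ (i, j)))\<^sup>2)) \<in> borel_measurable M"
    using mat_measurableD(2)[OF A]
    by (intro measurable_compose[OF _ borel_measurable_sqrt] borel_measurable_sum borel_measurable_power borel_measurable_norm) auto
  ultimately show ?thesis by simp
qed

lemma borel_measurable_mult_vec:
  assumes A: "mat_measurable M n A" and f: "\<And>x. f x \<in> carrier_vec n"
    "\<And>i. i < n \<Longrightarrow> (\<lambda>x. f x $ i) \<in> borel_measurable M" and i: "i < n"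
  shows "(\<lambda>x. (A x *\<^sub>v f x) $ i) \<in> borel_measurable M"
proof -
  have "(A x *\<^sub>v f x) $ i = (\<Sum>l<n. A x $$ (i, l) * f x $ l)" for x
    by (rule index_mult_mat_vec_sum[OF i mat_measurableD(1)[OF A] f(1)])
  moreover have "(\<lambda>x. \<Sum>l<n. A x $$ (i, l) * f x $ l) \<in> borel_measurable M"
    using i mat_measurableD(2)[OF A] f(2)
    by (intro borel_measurable_sum borel_measurable_times) auto
  ultimately show ?thesis by simp
qed

lemma borel_measurable_vec_norm2:
  assumes f: "\<And>x. f x \<in> carrier_vec n" "\<And>i. i < n \<Longrightarrow> (\<lambda>x. f x $ i) \<in> borel_measurable M"
  shows "(\<lambda>x. vec_norm2 (f x)) \<in> borel_measurable M"
proof -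
  have "vec_norm2 (f x) = sqrt (\<Sum>i<n. (cmod (f x $ i))\<^sup>2)" for x
    using vec_norm2_sum[OF f(1)[of x]] by (simp add: L2_set_def)
  moreover have "(\<lambda>x. sqrt (\<Sum>i<n. (cmod (f x $ i))\<^sup>2)) \<in> borel_measurable M"
    using f(2) by (intro measurable_compose[OF _ borel_measurable_sqrt] borel_measurable_sum borel_measurable_power borel_measurable_norm) auto
  ultimately show ?thesis by simp
qed

lemma borel_measurable_mat_vec_norm2:
  assumes A: "mat_measurable M n A" and v: "v \<in> carrier_vec n"
  shows "(\<lambda>x. vec_norm2 (A x *\<^sub>v v)) \<in> borel_measurable M"
  using mat_measurableD(1)[OF A] v
  by (intro borel_measurable_vec_norm2[of _ n] borel_measurable_mult_vec[OF A]) (auto intro: mult_mat_vec_carrier)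

text \<open>Stone-Weierstrass on intervals that exhaust the positive half line, with errors tending
  to 0, so that a single sequence of polynomials converges to the power at every positive
  point.\<close>

lemma powr_approx_polynomial:
  fixes s :: real
  shows "\<exists>a d. \<forall>x\<in>{1 / real (Suc k)..real (Suc k)}. \<bar>x powr s - (\<Sum>i\<le>d. a i * x ^ i)\<bar> < 1 / real (Suc k)"
proof -
  have "continuous_on {1 / real (Suc k)..real (Suc k)} (\<lambda>x. x powr s)"
    by (intro continuous_on_powr continuous_on_id continuous_on_const) (auto dest!: order_trans[rotated])
  then obtain g where "real_polynomial_function g"
    "\<And>x. x \<in> {1 / real (Suc k)..real (Suc k)} \<Longrightarrow> \<bar>x powr s - g x\<bar> < 1 / real (Suc k)"
    using Stone_Weierstrass_real_polynomial_function[OF compact_Icc, of "1 / real (Suc k)" "real (Suc k)" "\<lambda>x. x powr s" "1 / real (Suc k)"]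
    by (metis of_nat_0_less_iff zero_less_Suc zero_less_divide_1_iff)
  then show ?thesis unfolding real_polynomial_function_iff_sum by blast
qed

lemma conj_diag_index:
  assumes "unitary_mat n S" "i < n" "j < n"
  shows "(S * mat_diag n (\<lambda>i. complex_of_real (e i)) * mat_adjoint S) $$ (i, j) =
    (\<Sum>l<n. S $$ (i, l) * complex_of_real (e l) * cnj (S $$ (j, l)))"
proof -
  note s = unitary_matD[OF assms(1)]
  have "S * mat_diag n (\<lambda>i. complex_of_real (e i)) \<in> carrier_mat n n" using s by simp
  then have "(S * mat_diag n (\<lambda>i. complex_of_real (e i)) * mat_adjoint S) $$ (i, j) =
    (\<Sum>l<n. (S * mat_diag n (\<lambda>i. complex_of_real (e i))) $$ (i, l) * mat_adjoint S $$ (l, j))"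
    using s(2) assms(2,3) by (intro index_mult_mat_sum)
  also have "\<dots> = (\<Sum>l<n. S $$ (i, l) * complex_of_real (e l) * cnj (S $$ (j, l)))"
    using s(1) assms(2,3) by (intro sum.cong refl arg_cong2[where f=times]) (simp_all add: mat_diag_mult_right[OF s(1)])
  finally show ?thesis .
qed

lemma pow_mat_conj_diag:
  assumes "unitary_mat n S"
  shows "(S * mat_diag n (\<lambda>i. complex_of_real (e i)) * mat_adjoint S) ^\<^sub>m k =
     S * mat_diag n (\<lambda>i. complex_of_real (e i ^ k)) * mat_adjoint S"
proof (induction k)
  case 0
  then show ?case using unitary_matD[OF assms] by simp
next
  case (Suc k)
  show ?case
    unfolding pow_mat.simps Suc conj_diag_mult[OF assms] by (simp add: mult.commute)
qed

text \<open>The diagonalising unitary matrices depend on x in no controlled way. Polynomials in A x,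
  however, are measurable, and by the spectral theorem at each fixed x the polynomials of
  \<open>powr_approx_polynomial\<close> converge to the power entry by entry.\<close>

lemma mat_measurable_powr:
  assumes A: "mat_measurable M n A" and pd: "\<And>x. positive_definite n (A x)"
  shows "mat_measurable M n (\<lambda>x. mat_powr (A x) s)"
proof (rule mat_measurableI)
  show "mat_powr (A x) s \<in> carrier_mat n n" for x by (rule mat_powr_carrier[OF pd])
  fix i j assume ij: "i < n" "j < n"
  obtain a d where ad: "\<And>k x. x \<in> {1 / real (Suc k)..real (Suc k)} \<Longrightarrow>
      \<bar>x powr s - (\<Sum>i\<le>d k. a k i * x ^ i)\<bar> < 1 / real (Suc k)"
    using powr_approx_polynomial[of _ s] by metis
  have pow: "mat_measurable M n (\<lambda>x. A x ^\<^sub>m r)" for r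
  proof (induction r)
    case 0
    have "A x ^\<^sub>m 0 = 1\<^sub>m n" for x using mat_measurableD(1)[OF A, of x] by simp
    then show ?case by (simp add: mat_measurable_const)
  next
    case (Suc r)
    then show ?case using mat_measurable_mult[OF Suc A] by simp
  qed
  define f where "f = (\<lambda>k x. \<Sum>r\<le>d k. complex_of_real (a k r) * (A x ^\<^sub>m r) $$ (i, j))"
  show "(\<lambda>x. mat_powr (A x) s $$ (i, j)) \<in> borel_measurable M"
  proof (rule borel_measurable_LIMSEQ_metric)
    show "f k \<in> borel_measurable M" for k
      unfolding f_def using mat_measurableD(2)[OF pow ij]
      by (intro borel_measurable_sum borel_measurable_times) auto
  next
    fix x assume "x \<in> space M"
    obtain S e where S: "unitary_mat n S" and e: "\<forall>i<n. 0 < e i"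
      and Ax: "A x = S * mat_diag n (\<lambda>i. complex_of_real (e i)) * mat_adjoint S"
      using positive_definite_spectral[OF pd] by blast
    define p where "p = (\<lambda>k t. \<Sum>r\<le>d k. a k r * t ^ r :: real)"
    have fk: "f k x = (\<Sum>l<n. S $$ (i, l) * complex_of_real (p k (e l)) * cnj (S $$ (j, l)))" for k
    proof -
      have "f k x = (\<Sum>r\<le>d k. \<Sum>l<n. complex_of_real (a k r) * (S $$ (i, l) * complex_of_real (e l ^ r) * cnj (S $$ (j, l))))"
        unfolding f_def Ax pow_mat_conj_diag[OF S] conj_diag_index[OF S ij] sum_distrib_left ..
      also have "\<dots> = (\<Sum>l<n. \<Sum>r\<le>d k. complex_of_real (a k r) * (S $$ (i, l) * complex_of_real (e l ^ r) * cnj (S $$ (j, l))))"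
        by (rule sum.swap)
      also have "\<dots> = (\<Sum>l<n. S $$ (i, l) * complex_of_real (p k (e l)) * cnj (S $$ (j, l)))"
        by (intro sum.cong) (auto simp: p_def sum_distrib_left sum_distrib_right of_real_sum ac_simps)
      finally show ?thesis .
    qed
    have lim: "(\<lambda>k. p k t) \<longlonglongrightarrow> t powr s" if t: "0 < t" for t
    proof (rule LIMSEQ_I)
      fix r :: real assume r: "0 < r"
      \<comment> \<open>From K on, t lies inside the interval of approximation and the error there
        is below r.\<close>
      obtain K :: nat where K: "max (max t (1 / t)) (1 / r) < real K" using reals_Archimedean2 by blast
      show "\<exists>no. \<forall>k\<ge>no. norm (p k t - t powr s) < r"
      proof (intro exI[of _ K] allI impI)
        fix k assume k: "K \<le> k"
        then have kk: "t < real (Suc k)" "1 / t < real (Suc k)" "1 / r < real (Suc k)" using K by auto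
        then have "1 / real (Suc k) < t" "1 / real (Suc k) < r" using t r by (auto simp: field_simps)
        then have "\<bar>t powr s - p k t\<bar> < 1 / real (Suc k)" unfolding p_def using kk by (intro ad) auto
        then show "norm (p k t - t powr s) < r" using \<open>1 / real (Suc k) < r\<close> by simp
      qed
    qed
    have "(\<lambda>k. f k x) \<longlonglongrightarrow> (\<Sum>l<n. S $$ (i, l) * complex_of_real (e l powr s) * cnj (S $$ (j, l)))"
      unfolding fk using e by (intro tendsto_sum tendsto_mult tendsto_const tendsto_of_real lim) auto
    then show "(\<lambda>k. f k x) \<longlonglongrightarrow> mat_powr (A x) s $$ (i, j)"
      unfolding mat_powr_eq[OF S e Ax] conj_diag_index[OF S ij] .
  qed
qed

text \<open>The exceptional set is contained in a null set, and Lebesgue measure is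
  complete.\<close>

lemma AE_lebesgue_sets:
  fixes P :: "'a::euclidean_space \<Rightarrow> bool"
  assumes "AE x in lebesgue. P x"
  shows "{x. P x} \<in> sets lebesgue"
proof -
  have "{x \<in> space lebesgue. \<not> P x} \<in> null_sets (lebesgue :: 'a measure)"
    using assms completion.AE_iff_null_sets by blast
  then have "{x \<in> space lebesgue. \<not> P x} \<in> sets (lebesgue :: 'a measure)" by (rule null_setsD2)
  then have "space lebesgue - {x \<in> space lebesgue. \<not> P x} \<in> sets (lebesgue :: 'a measure)" by (rule sets.compl_sets)
  also have "space lebesgue - {x \<in> space (lebesgue :: 'a measure). \<not> P x} = {x. P x}" by auto
  finally show ?thesis .
qed

text \<open>A weight is positive definite only almost everywhere, and \<open>mat_powr\<close> is
  unspecified elsewhere. Changing the weight on that null set makes powers and inverses available at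
  every point.\<close>

definition regularized :: "nat \<Rightarrow> ('x \<Rightarrow> cmat) \<Rightarrow> 'x \<Rightarrow> cmat" where
  "regularized n W x = (if positive_definite n (W x) then W x else 1\<^sub>m n)"

lemma regularized_pd: "positive_definite n (regularized n W x)"
  by (simp add: regularized_def pd_one)

lemma regularized_measurable:
  fixes W :: "real^'d \<Rightarrow> cmat"
  assumes "matrix_weight n W"
  shows "mat_measurable lebesgue n (regularized n W)"
proof (rule mat_measurableI)
  show "regularized n W x \<in> carrier_mat n n" for x by (rule positive_definiteD(1)[OF regularized_pd])
  fix i j assume ij: "i < n" "j < n"
  have "(\<lambda>x. if positive_definite n (W x) then W x $$ (i, j) else 1\<^sub>m n $$ (i, j)) \<in> borel_measurable lebesgue"
    using assms ij AE_lebesgue_sets[of "\<lambda>x. positive_definite n (W x)"]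
    by (intro measurable_If_set measurable_If) (auto simp: matrix_weight_def)
  then show "(\<lambda>x. regularized n W x $$ (i, j)) \<in> borel_measurable lebesgue"
    unfolding regularized_def by (simp add: if_distrib[of "\<lambda>A. A $$ (i, j)"])
qed

lemma regularized_AE: "matrix_weight n W \<Longrightarrow> AE x in lebesgue. regularized n W x = W x"
  by (auto simp: matrix_weight_def regularized_def)

section \<open>Matrix weights on a probability space\<close>

lemma ennreal_powr_ennreal [simp]: "0 \<le> x \<Longrightarrow> ennreal_powr (ennreal x) r = ennreal (x powr r)"
  by (simp add: ennreal_powr_def)

lemma ennreal_powr_top [simp]: "ennreal_powr \<infinity> r = \<infinity>"
  by (simp add: ennreal_powr_def)

lemma ennreal_powr_mono: "x \<le> y \<Longrightarrow> 0 \<le> r \<Longrightarrow> ennreal_powr x r \<le> ennreal_powr y r"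
  by (cases x; cases y) (auto simp: top_unique powr_mono2 ennreal_powr_def)

lemma ennreal_powr_measurable [measurable]: "(\<lambda>x. ennreal_powr x r) \<in> borel_measurable borel"
  unfolding ennreal_powr_def by measurable

lemma ennreal_powr_less_top_iff: "ennreal_powr x r < \<infinity> \<longleftrightarrow> x < \<infinity>"
  by (cases x) (auto simp: ennreal_powr_def)

lemma ennreal_powr_le_imp:
  assumes "ennreal_powr x r \<le> ennreal c" "0 < r" "0 \<le> c"
  shows "x \<le> ennreal (c powr (1 / r))"
proof (cases x)
  case (real t)
  then have "t powr r \<le> c" using assms by simp
  then have "(t powr r) powr (1 / r) \<le> c powr (1 / r)" using assms by (intro powr_mono2) auto
  then show ?thesis using real assms by (simp add: powr_powr ennreal_leI)
qed (use assms in \<open>auto simp: ennreal_powr_def top_unique\<close>)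

lemma powr_add_le: "0 \<le> x \<Longrightarrow> 0 \<le> y \<Longrightarrow> 0 \<le> r \<Longrightarrow> (x + y) powr r \<le> 2 powr r * (x powr r + y powr r)" for x y r :: real
proof -
  assume a: "0 \<le> x" "0 \<le> y" "0 \<le> r"
  have "(x + y) powr r \<le> (2 * max x y) powr r" using a by (intro powr_mono2) auto
  also have "\<dots> = 2 powr r * (max x y) powr r" using a by (simp add: powr_mult)
  also have "(max x y) powr r \<le> x powr r + y powr r" by (auto simp: max_def)
  finally show ?thesis by simp
qed

lemma powr_le_one_add: "0 \<le> x \<Longrightarrow> 1 \<le> r \<Longrightarrow> x \<le> 1 + x powr r" for x r :: real
proof (cases "x \<le> 1")
  case False
  assume "0 \<le> x" "1 \<le> r"
  with False have "x powr 1 \<le> x powr r" by (intro powr_mono) auto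
  with False show ?thesis by simp
qed (simp add: add_increasing2)

text \<open>A substitute for Hoelder's inequality: after integration both terms are linear, and the
  free scale t is chosen to balance them. It is \<open>powr_le_one_add\<close> for x / t.\<close>

lemma le_scaled_add_powr: "0 \<le> x \<Longrightarrow> 1 \<le> r \<Longrightarrow> 0 < t \<Longrightarrow> x \<le> t + t powr (1 - r) * x powr r" for x r t :: real
proof -
  assume a: "0 \<le> x" "1 \<le> r" "0 < t"
  have "x / t \<le> 1 + (x / t) powr r" using a by (intro powr_le_one_add) auto
  then have "x \<le> t * (1 + (x / t) powr r)" using a by (simp add: field_simps)
  also have "\<dots> = t + t powr (1 - r) * x powr r"
    using a by (simp add: powr_divide powr_diff field_simps)
  finally show ?thesis .
qed

text \<open>R is the inverse of P, and f . g is the product of P^(-1/2) f with P^(1/2) g, to which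
  the ordinary Cauchy-Schwarz inequality applies.\<close>

lemma pd_cauchy_schwarz:
  assumes P: "positive_definite n P" and R: "R \<in> carrier_mat n n" "R * P = 1\<^sub>m n"
    and f: "f \<in> carrier_vec n" and g: "g \<in> carrier_vec n"
  shows "(cmod (f \<bullet>c g))\<^sup>2 \<le> Re ((R *\<^sub>v f) \<bullet>c f) * Re ((P *\<^sub>v g) \<bullet>c g)"
proof -
  define S where "S = mat_powr P (1/2)"
  define S' where "S' = mat_powr P (- (1/2))"
  note s = positive_definiteD(1,2)[OF pd_mat_powr[OF P, of "1/2"], folded S_def]
  note s' = positive_definiteD(1,2)[OF pd_mat_powr[OF P, of "- (1/2)"], folded S'_def]
  have SS': "S * S' = 1\<^sub>m n" unfolding S_def S'_def by (rule mat_powr_inverse[OF P])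
  have SS: "S * S = P" unfolding S_def mat_powr_add[OF P] using mat_powr_one[OF P] by simp
  have Pm: "P * mat_powr P (- 1) = 1\<^sub>m n" using mat_powr_inverse[OF P, of 1] mat_powr_one[OF P] by simp
  have "R = R * (P * mat_powr P (- 1))" unfolding Pm using R by simp
  also have "\<dots> = mat_powr P (- 1)"
    using assoc_mult_mat[OF R(1) positive_definiteD(1)[OF P] mat_powr_carrier[OF P, of "- 1"]] R(2)
      left_mult_one_mat[OF mat_powr_carrier[OF P, of "- 1"]] by simp
  finally have R': "R = S' * S'" unfolding S'_def mat_powr_add[OF P] by simp
  have sf: "S' *\<^sub>v f \<in> carrier_vec n" "S *\<^sub>v g \<in> carrier_vec n"
    using mult_mat_vec_carrier[OF s'(1) f] mult_mat_vec_carrier[OF s(1) g] .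
  have q: "vec_norm2 (X *\<^sub>v h) ^ 2 = Re (((X * X) *\<^sub>v h) \<bullet>c h)"
    if X: "X \<in> carrier_mat n n" "mat_adjoint X = X" and h: "h \<in> carrier_vec n" for X h
  proof -
    have Xh: "X *\<^sub>v h \<in> carrier_vec n" by (rule mult_mat_vec_carrier[OF X(1) h])
    have "((X * X) *\<^sub>v h) \<bullet>c h = (X *\<^sub>v (X *\<^sub>v h)) \<bullet>c h" unfolding assoc_mult_mat_vec[OF X(1) X(1) h] ..
    also have "\<dots> = (X *\<^sub>v h) \<bullet>c (X *\<^sub>v h)" unfolding cscalar_prod_adjoint[OF X(1) Xh h] X(2) ..
    also have "\<dots> = complex_of_real ((vec_norm2 (X *\<^sub>v h))\<^sup>2)" by (rule cscalar_prod_self[OF Xh])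
    finally show ?thesis by simp
  qed
  have "f = S *\<^sub>v (S' *\<^sub>v f)" unfolding assoc_mult_mat_vec[OF s(1) s'(1) f, symmetric] SS' using f by simp
  then have "f \<bullet>c g = (S *\<^sub>v (S' *\<^sub>v f)) \<bullet>c g" by simp
  also have "\<dots> = (S' *\<^sub>v f) \<bullet>c (S *\<^sub>v g)" unfolding cscalar_prod_adjoint[OF s(1) sf(1) g] s(2) ..
  finally have "cmod (f \<bullet>c g) \<le> vec_norm2 (S' *\<^sub>v f) * vec_norm2 (S *\<^sub>v g)"
    using cauchy_schwarz_cvec[OF sf] by simp
  then have "(cmod (f \<bullet>c g))\<^sup>2 \<le> (vec_norm2 (S' *\<^sub>v f) * vec_norm2 (S *\<^sub>v g))\<^sup>2"
    by (intro power_mono) auto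
  then show ?thesis unfolding power_mult_distrib q[OF s' f] q[OF s g] R' SS .
qed

section \<open>Entrywise means of matrix functions\<close>

definition mat_mean :: "'x measure \<Rightarrow> nat \<Rightarrow> ('x \<Rightarrow> cmat) \<Rightarrow> cmat" where
  "mat_mean M n A = Matrix.mat n n (\<lambda>ij. LINT x|M. A x $$ ij)"

definition mat_integrable :: "'x measure \<Rightarrow> nat \<Rightarrow> ('x \<Rightarrow> cmat) \<Rightarrow> bool" where
  "mat_integrable M n A \<longleftrightarrow> (\<forall>x. A x \<in> carrier_mat n n) \<and>
     (\<forall>i<n. \<forall>j<n. integrable M (\<lambda>x. A x $$ (i, j)))"

lemma mat_mean_carrier [simp]: "mat_mean M n A \<in> carrier_mat n n"
  by (simp add: mat_mean_def)

lemma mat_mean_index [simp]: "i < n \<Longrightarrow> j < n \<Longrightarrow> mat_mean M n A $$ (i, j) = (LINT x|M. A x $$ (i, j))"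
  by (simp add: mat_mean_def)

lemma mat_mean_dim [simp]: "dim_row (mat_mean M n A) = n" "dim_col (mat_mean M n A) = n"
  by (simp_all add: mat_mean_def)

lemma mat_integrableD:
  assumes "mat_integrable M n A"
  shows "A x \<in> carrier_mat n n" "i < n \<Longrightarrow> j < n \<Longrightarrow> integrable M (\<lambda>x. A x $$ (i, j))"
  using assms by (auto simp: mat_integrable_def)

lemma mat_integrable_measurable: "mat_integrable M n A \<Longrightarrow> mat_measurable M n A"
  by (auto simp: mat_integrable_def mat_measurable_def intro: borel_measurable_integrable)

lemma integral_double_sum:
  fixes f :: "nat \<Rightarrow> nat \<Rightarrow> 'x \<Rightarrow> 'b::{banach, second_countable_topology}"
  assumes "\<And>i j. i < n \<Longrightarrow> j < n \<Longrightarrow> integrable M (f i j)"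
  shows "integrable M (\<lambda>x. \<Sum>i<n. \<Sum>j<n. f i j x)"
    "(LINT x|M. (\<Sum>i<n. \<Sum>j<n. f i j x)) = (\<Sum>i<n. \<Sum>j<n. LINT x|M. f i j x)"
proof -
  have s: "integrable M (\<lambda>x. \<Sum>j<n. f i j x)" if "i < n" for i
    using assms that by (auto intro!: Bochner_Integration.integrable_sum)
  then show "integrable M (\<lambda>x. \<Sum>i<n. \<Sum>j<n. f i j x)"
    by (rule Bochner_Integration.integrable_sum) simp
  have "(LINT x|M. (\<Sum>i<n. \<Sum>j<n. f i j x)) = (\<Sum>i<n. LINT x|M. (\<Sum>j<n. f i j x))"
    using s by (intro Bochner_Integration.integral_sum) auto
  also have "\<dots> = (\<Sum>i<n. \<Sum>j<n. LINT x|M. f i j x)"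
    using assms by (intro sum.cong refl Bochner_Integration.integral_sum) auto
  finally show "(LINT x|M. (\<Sum>i<n. \<Sum>j<n. f i j x)) = (\<Sum>i<n. \<Sum>j<n. LINT x|M. f i j x)" .
qed

lemma mat_integrableI:
  assumes A: "mat_measurable M n A" and fin: "(\<integral>\<^sup>+x. ennreal (fro (A x)) \<partial>M) < \<infinity>"
  shows "mat_integrable M n A"
  unfolding mat_integrable_def
proof (intro conjI allI impI)
  fix i j assume ij: "i < n" "j < n"
  show "integrable M (\<lambda>x. A x $$ (i, j))"
  proof (rule integrableI_bounded)
    have "(\<integral>\<^sup>+x. ennreal (norm (A x $$ (i, j))) \<partial>M) \<le> (\<integral>\<^sup>+x. ennreal (fro (A x)) \<partial>M)"
      using cmod_le_fro[OF mat_measurableD(1)[OF A] ij] by (intro nn_integral_mono ennreal_leI)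
    then show "(\<integral>\<^sup>+x. ennreal (norm (A x $$ (i, j))) \<partial>M) < \<infinity>" using fin by (rule le_less_trans)
  qed (use mat_measurableD[OF A] ij in auto)
qed (use mat_measurableD[OF A] in auto)

lemma fro_integrable:
  assumes "mat_integrable M n A" shows "integrable M (\<lambda>x. fro (A x))"
proof (rule Bochner_Integration.integrable_bound)
  show "integrable M (\<lambda>x. \<Sum>i<n. \<Sum>j<n. cmod (A x $$ (i, j)))"
    by (rule integral_double_sum(1)) (rule integrable_norm[OF mat_integrableD(2)[OF assms]])
  show "AE x in M. norm (fro (A x)) \<le> norm (\<Sum>i<n. \<Sum>j<n. cmod (A x $$ (i, j)))"
    using fro_le_sum[OF mat_integrableD(1)[OF assms]] by (auto simp: sum_nonneg)
qed (use borel_measurable_fro[OF mat_integrable_measurable[OF assms]] in auto)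

text \<open>Pairing the mean with itself in the Frobenius inner product moves the integral outside;
  Cauchy-Schwarz under the integral and one division give constant 1, whereas an entrywise estimate
  would cost a dimensional factor.\<close>

lemma fro_mat_mean_le:
  assumes A: "mat_integrable M n A"
  shows "fro (mat_mean M n A) \<le> (LINT x|M. fro (A x))"
proof (cases "fro (mat_mean M n A) = 0")
  case True
  then show ?thesis by (simp add: Bochner_Integration.integral_nonneg)
next
  case False
  let ?X = "mat_mean M n A"
  have int: "integrable M (\<lambda>x. A x $$ (i, j) * cnj (?X $$ (i, j)))" if "i < n" "j < n" for i j
    using mat_integrableD(2)[OF A that] by simp
  have "complex_of_real ((fro ?X)\<^sup>2) = (\<Sum>i<n. \<Sum>j<n. ?X $$ (i, j) * cnj (?X $$ (i, j)))"
    unfolding fro_sq[OF mat_mean_carrier] by (simp only: complex_norm_square of_real_sum of_real_power[symmetric])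
  also have "\<dots> = (\<Sum>i<n. \<Sum>j<n. LINT x|M. A x $$ (i, j) * cnj (?X $$ (i, j)))"
    by (intro sum.cong refl) (simp add: mat_integrableD(2)[OF A])
  also have "\<dots> = (LINT x|M. (\<Sum>i<n. \<Sum>j<n. A x $$ (i, j) * cnj (?X $$ (i, j))))"
    by (rule integral_double_sum(2)[OF int, symmetric])
  finally have "(fro ?X)\<^sup>2 = cmod (LINT x|M. (\<Sum>i<n. \<Sum>j<n. A x $$ (i, j) * cnj (?X $$ (i, j))))"
    by (metis norm_of_real abs_of_nonneg zero_le_power2)
  also have "\<dots> \<le> (LINT x|M. cmod (\<Sum>i<n. \<Sum>j<n. A x $$ (i, j) * cnj (?X $$ (i, j))))"
    by (rule integral_norm_bound)
  also have "\<dots> \<le> (LINT x|M. fro (A x) * fro ?X)"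
  proof (rule integral_mono)
    show "integrable M (\<lambda>x. cmod (\<Sum>i<n. \<Sum>j<n. A x $$ (i, j) * cnj (?X $$ (i, j))))"
      by (rule integrable_norm[OF integral_double_sum(1)[OF int]])
    show "integrable M (\<lambda>x. fro (A x) * fro ?X)" using fro_integrable[OF A] by simp
    fix x
    let ?a = "\<lambda>i. L2_set (\<lambda>j. cmod (A x $$ (i, j))) {..<n}" and ?x = "\<lambda>i. L2_set (\<lambda>j. cmod (?X $$ (i, j))) {..<n}"
    have "cmod (\<Sum>i<n. \<Sum>j<n. A x $$ (i, j) * cnj (?X $$ (i, j))) \<le> (\<Sum>i<n. \<Sum>j<n. \<bar>cmod (A x $$ (i, j))\<bar> * \<bar>cmod (?X $$ (i, j))\<bar>)"
      by (intro order_trans[OF norm_sum] sum_mono) (auto simp: norm_mult intro!: order_trans[OF norm_sum] sum_mono)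
    also have "\<dots> \<le> (\<Sum>i<n. \<bar>?a i\<bar> * \<bar>?x i\<bar>)"
      unfolding abs_of_nonneg[OF L2_set_nonneg] by (intro sum_mono L2_set_mult_ineq)
    also have "\<dots> \<le> L2_set ?a {..<n} * L2_set ?x {..<n}" by (rule L2_set_mult_ineq)
    also have "\<dots> = fro (A x) * fro ?X"
      using mat_integrableD(1)[OF A, of x] by (simp add: fro_def)
    finally show "cmod (\<Sum>i<n. \<Sum>j<n. A x $$ (i, j) * cnj (?X $$ (i, j))) \<le> fro (A x) * fro ?X" .
  qed
  finally have "fro ?X * fro ?X \<le> (LINT x|M. fro (A x)) * fro ?X" by (simp add: power2_eq_square)
  moreover have "0 < fro ?X" using False fro_nonneg[of ?X] by linarith
  ultimately show ?thesis by simp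
qed

lemma mat_integrable_mult_left:
  assumes A: "mat_integrable M n A" and C: "C \<in> carrier_mat n n"
  shows "mat_integrable M n (\<lambda>x. C * A x)" "mat_mean M n (\<lambda>x. C * A x) = C * mat_mean M n A"
proof -
  have e: "(C * A x) $$ (i, j) = (\<Sum>l<n. C $$ (i, l) * A x $$ (l, j))" if "i < n" "j < n" for i j x
    by (rule index_mult_mat_sum[OF that C mat_integrableD(1)[OF A]])
  show "mat_integrable M n (\<lambda>x. C * A x)"
    unfolding mat_integrable_def using mat_integrableD[OF A] C by (auto simp: e simp del: index_mult_mat(1))
  show "mat_mean M n (\<lambda>x. C * A x) = C * mat_mean M n A"
  proof (rule eq_matI)
    fix i j assume "i < dim_row (C * mat_mean M n A)" "j < dim_col (C * mat_mean M n A)"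
    then have ij: "i < n" "j < n" using C by auto
    show "mat_mean M n (\<lambda>x. C * A x) $$ (i, j) = (C * mat_mean M n A) $$ (i, j)"
      using ij mat_integrableD(2)[OF A] unfolding index_mult_mat_sum[OF ij C mat_mean_carrier]
      by (simp add: e Bochner_Integration.integral_sum del: index_mult_mat(1))
  qed (use C in auto)
qed

lemma mat_integrable_mult_right:
  assumes A: "mat_integrable M n A" and C: "C \<in> carrier_mat n n"
  shows "mat_integrable M n (\<lambda>x. A x * C)" "mat_mean M n (\<lambda>x. A x * C) = mat_mean M n A * C"
proof -
  have e: "(A x * C) $$ (i, j) = (\<Sum>l<n. A x $$ (i, l) * C $$ (l, j))" if "i < n" "j < n" for i j x
    by (rule index_mult_mat_sum[OF that mat_integrableD(1)[OF A] C])
  show "mat_integrable M n (\<lambda>x. A x * C)"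
    unfolding mat_integrable_def using mat_integrableD[OF A] C by (auto simp: e simp del: index_mult_mat(1))
  show "mat_mean M n (\<lambda>x. A x * C) = mat_mean M n A * C"
  proof (rule eq_matI)
    fix i j assume "i < dim_row (mat_mean M n A * C)" "j < dim_col (mat_mean M n A * C)"
    then have ij: "i < n" "j < n" using C by auto
    show "mat_mean M n (\<lambda>x. A x * C) $$ (i, j) = (mat_mean M n A * C) $$ (i, j)"
      using ij mat_integrableD(2)[OF A] unfolding index_mult_mat_sum[OF ij mat_mean_carrier C]
      by (simp add: e Bochner_Integration.integral_sum del: index_mult_mat(1))
  qed (use C in auto)
qed

lemma mat_integrable_minus:
  assumes A: "mat_integrable M n A" and B: "mat_integrable M n B"
  shows "mat_integrable M n (\<lambda>x. A x - B x)" "mat_mean M n (\<lambda>x. A x - B x) = mat_mean M n A - mat_mean M n B"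
proof -
  have e: "(A x - B x) $$ (i, j) = A x $$ (i, j) - B x $$ (i, j)" if "i < n" "j < n" for i j x
    using that mat_integrableD(1)[OF A, of x] mat_integrableD(1)[OF B, of x] by simp
  show "mat_integrable M n (\<lambda>x. A x - B x)"
    unfolding mat_integrable_def
  proof (intro conjI allI impI)
    show "A x - B x \<in> carrier_mat n n" for x by (rule minus_carrier_mat[OF mat_integrableD(1)[OF B]])
    fix i j assume ij: "i < n" "j < n"
    show "integrable M (\<lambda>x. (A x - B x) $$ (i, j))"
      unfolding e[OF ij] using mat_integrableD(2)[OF A ij] mat_integrableD(2)[OF B ij] by simp
  qed
  show "mat_mean M n (\<lambda>x. A x - B x) = mat_mean M n A - mat_mean M n B"
  proof (rule eq_matI)
    fix i j assume "i < dim_row (mat_mean M n A - mat_mean M n B)" "j < dim_col (mat_mean M n A - mat_mean M n B)"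
    then have ij: "i < n" "j < n" by auto
    have "mat_mean M n (\<lambda>x. A x - B x) $$ (i, j) = (LINT x|M. A x $$ (i, j) - B x $$ (i, j))"
      using ij by (simp only: mat_mean_index e)
    also have "\<dots> = (mat_mean M n A - mat_mean M n B) $$ (i, j)"
      using ij mat_integrableD(2)[OF A ij] mat_integrableD(2)[OF B ij] by simp
    finally show "mat_mean M n (\<lambda>x. A x - B x) $$ (i, j) = (mat_mean M n A - mat_mean M n B) $$ (i, j)" .
  qed simp_all
qed

lemma (in prob_space) mat_integrable_const:
  "C \<in> carrier_mat n n \<Longrightarrow> mat_integrable M n (\<lambda>_. C)"
  "C \<in> carrier_mat n n \<Longrightarrow> mat_mean M n (\<lambda>_. C) = C"
  by (auto simp: mat_integrable_def prob_space intro!: eq_matI)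

lemma mat_integrable_adjoint:
  assumes A: "mat_integrable M n A"
  shows "mat_integrable M n (\<lambda>x. mat_adjoint (A x))" "mat_mean M n (\<lambda>x. mat_adjoint (A x)) = mat_adjoint (mat_mean M n A)"
proof -
  have e: "mat_adjoint (A x) $$ (i, j) = cnj (A x $$ (j, i))" if "i < n" "j < n" for i j x
    using that mat_integrableD(1)[OF A, of x] by simp
  show "mat_integrable M n (\<lambda>x. mat_adjoint (A x))"
    unfolding mat_integrable_def using mat_integrableD[OF A] by (auto simp: e)
  show "mat_mean M n (\<lambda>x. mat_adjoint (A x)) = mat_adjoint (mat_mean M n A)"
    by (intro eq_matI) (auto simp: e integral_cnj)
qed

lemma form_mat_mean:
  assumes A: "mat_integrable M n A" and f: "f \<in> carrier_vec n" and g: "g \<in> carrier_vec n"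
  shows "integrable M (\<lambda>x. (A x *\<^sub>v f) \<bullet>c g)" "(mat_mean M n A *\<^sub>v f) \<bullet>c g = (LINT x|M. (A x *\<^sub>v f) \<bullet>c g)"
proof -
  have e: "(X *\<^sub>v f) \<bullet>c g = (\<Sum>i<n. \<Sum>j<n. X $$ (i, j) * f $ j * cnj (g $ i))" if "X \<in> carrier_mat n n" for X
    unfolding cscalar_prod_sum[OF mult_mat_vec_carrier[OF that f] g]
    by (intro sum.cong refl) (simp add: index_mult_mat_vec_sum[OF _ that f] sum_distrib_right del: index_mult_mat_vec)
  have i: "integrable M (\<lambda>x. A x $$ (i, j) * f $ j * cnj (g $ i))" if "i < n" "j < n" for i j
    using mat_integrableD(2)[OF A that] by simp
  show "integrable M (\<lambda>x. (A x *\<^sub>v f) \<bullet>c g)"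
    unfolding e[OF mat_integrableD(1)[OF A]] by (rule integral_double_sum(1)[OF i])
  show "(mat_mean M n A *\<^sub>v f) \<bullet>c g = (LINT x|M. (A x *\<^sub>v f) \<bullet>c g)"
  proof -
    have "(LINT x|M. (A x *\<^sub>v f) \<bullet>c g) = (\<Sum>i<n. \<Sum>j<n. LINT x|M. A x $$ (i, j) * f $ j * cnj (g $ i))"
      unfolding e[OF mat_integrableD(1)[OF A]] by (rule integral_double_sum(2)[OF i])
    also have "\<dots> = (\<Sum>i<n. \<Sum>j<n. mat_mean M n A $$ (i, j) * f $ j * cnj (g $ i))"
      by (intro sum.cong refl) (simp add: mat_integrableD(2)[OF A])
    finally show ?thesis unfolding e[OF mat_mean_carrier] ..
  qed
qed

lemma (in prob_space) pd_mat_mean: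
  assumes A: "mat_integrable M n A" and pd: "\<And>x. positive_definite n (A x)"
  shows "positive_definite n (mat_mean M n A)"
  unfolding positive_definite_def
proof (intro conjI ballI impI)
  have "(\<lambda>x. mat_adjoint (A x)) = A" using positive_definiteD(2)[OF pd] by auto
  then show "mat_adjoint (mat_mean M n A) = mat_mean M n A" using mat_integrable_adjoint(2)[OF A] by simp
  fix v :: cvec assume v: "v \<in> carrier_vec n" "v \<noteq> 0\<^sub>v n"
  have int: "integrable M (\<lambda>x. Re ((A x *\<^sub>v v) \<bullet>c v))"
    using form_mat_mean(1)[OF A v(1) v(1)] by (rule integrable_Re)
  have eq: "Re ((mat_mean M n A *\<^sub>v v) \<bullet>c v) = (LINT x|M. Re ((A x *\<^sub>v v) \<bullet>c v))"
    unfolding form_mat_mean(2)[OF A v(1) v(1)] by (rule integral_Re[OF form_mat_mean(1)[OF A v(1) v(1)], symmetric])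
  have pos: "0 < Re ((A x *\<^sub>v v) \<bullet>c v)" for x by (rule positive_definiteD(3)[OF pd v])
  have "(LINT x|M. Re ((A x *\<^sub>v v) \<bullet>c v)) \<noteq> 0"
  proof
    assume "(LINT x|M. Re ((A x *\<^sub>v v) \<bullet>c v)) = 0"
    then have "AE x in M. Re ((A x *\<^sub>v v) \<bullet>c v) = 0"
      using integral_nonneg_eq_0_iff_AE[OF int] pos by (auto simp: less_imp_le)
    then have "AE x in M. False" using pos by (auto elim!: eventually_mono simp: less_imp_neq[symmetric])
    then show False by simp
  qed
  moreover have "0 \<le> (LINT x|M. Re ((A x *\<^sub>v v) \<bullet>c v))" using pos by (intro Bochner_Integration.integral_nonneg) (auto simp: less_imp_le)
  ultimately show "0 < Re ((mat_mean M n A *\<^sub>v v) \<bullet>c v)" unfolding eq by linarith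
qed simp

text \<open>The pointwise inequality |f . g|^2 \<le> \<alpha> x * \<beta> x is linearised by the
  arithmetic-geometric mean inequality with a constant t, integrated, and t is chosen optimally.
  This is the input of \<open>det_mult_ge_one\<close> for the means of a weight and of its
  inverse.\<close>

lemma (in prob_space) mat_mean_cauchy_schwarz:
  assumes w: "mat_integrable M n w" and wi: "mat_integrable M n wi"
    and pd: "\<And>x. positive_definite n (w x)" "\<And>x. positive_definite n (wi x)"
    and inv: "\<And>x. wi x * w x = 1\<^sub>m n"
    and f: "f \<in> carrier_vec n" and g: "g \<in> carrier_vec n"
  shows "(cmod (f \<bullet>c g))\<^sup>2 \<le> Re ((mat_mean M n wi *\<^sub>v f) \<bullet>c f) * Re ((mat_mean M n w *\<^sub>v g) \<bullet>c g)"
proof (cases "f = 0\<^sub>v n \<or> g = 0\<^sub>v n")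
  case True
  then have "f \<bullet>c g = 0" using f g by (subst cscalar_prod_sum[of _ n]) auto
  then show ?thesis
    using pd_sum_form(2)[OF pd_mat_mean[OF w pd(1)] g] pd_sum_form(2)[OF pd_mat_mean[OF wi pd(2)] f] by simp
next
  case False
  define \<alpha> where "\<alpha> = (\<lambda>x. Re ((wi x *\<^sub>v f) \<bullet>c f))"
  define \<beta> where "\<beta> = (\<lambda>x. Re ((w x *\<^sub>v g) \<bullet>c g))"
  define I where "I = Re ((mat_mean M n wi *\<^sub>v f) \<bullet>c f)"
  define J where "J = Re ((mat_mean M n w *\<^sub>v g) \<bullet>c g)"
  have I: "0 < I" "I = (LINT x|M. \<alpha> x)" and inta: "integrable M \<alpha>"
    using positive_definiteD(3)[OF pd_mat_mean[OF wi pd(2)] f] False form_mat_mean[OF wi f f]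
    by (auto simp: I_def \<alpha>_def integral_Re)
  have J: "0 < J" "J = (LINT x|M. \<beta> x)" and intb: "integrable M \<beta>"
    using positive_definiteD(3)[OF pd_mat_mean[OF w pd(1)] g] False form_mat_mean[OF w g g]
    by (auto simp: J_def \<beta>_def integral_Re)
  \<comment> \<open>This choice makes t * I and J / t equal, so that the linearised bound is the
    geometric mean of I and J.\<close>
  define t where "t = sqrt (J / I)"
  have t: "0 < t" "t * t = J / I" using I J by (auto simp: t_def)
  have J': "J = t * t * I" using t(2) I(1) by simp
  have "cmod (f \<bullet>c g) \<le> (t * \<alpha> x + \<beta> x / t) / 2" for x
  proof -
    have ab: "0 \<le> \<alpha> x" "0 \<le> \<beta> x" using pd_sum_form(2)[OF pd(2) f] pd_sum_form(2)[OF pd(1) g] by (auto simp: \<alpha>_def \<beta>_def)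
    have "(cmod (f \<bullet>c g))\<^sup>2 \<le> \<alpha> x * \<beta> x"
      unfolding \<alpha>_def \<beta>_def by (rule pd_cauchy_schwarz[OF pd(1) positive_definiteD(1)[OF pd(2)] inv f g])
    also have "\<dots> = (t * \<alpha> x) * (\<beta> x / t)" using t(1) by simp
    also have "\<dots> \<le> ((t * \<alpha> x + \<beta> x / t) / 2)\<^sup>2"
    proof -
      have "X * Y \<le> ((X + Y) / 2)\<^sup>2" for X Y :: real
        using zero_le_power2[of "X - Y"] by (simp add: power2_eq_square field_simps)
      then show ?thesis .
    qed
    finally show ?thesis by (rule power2_le_imp_le) (use ab t(1) in simp)
  qed
  then have "(LINT x|M. cmod (f \<bullet>c g)) \<le> (LINT x|M. (t * \<alpha> x + \<beta> x / t) / 2)"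
    using inta intb by (intro integral_mono) auto
  then have "cmod (f \<bullet>c g) \<le> (t * I + J / t) / 2"
    using inta intb by (simp add: I(2) J(2) prob_space)
  also have "\<dots> = t * I"
  proof -
    have "J / t = t * I" using J' t(1) by simp
    then show ?thesis by simp
  qed
  finally have "(cmod (f \<bullet>c g))\<^sup>2 \<le> (t * I)\<^sup>2" by (intro power_mono) auto
  also have "\<dots> = I * J" unfolding J' by (simp add: power2_eq_square)
  finally show ?thesis by (simp add: I_def J_def)
qed

section \<open>Points at which several functions are moderate at once\<close>

lemma (in prob_space) emeasure_gt_le:
  assumes f: "f \<in> borel_measurable M" and F: "F \<in> events"
    and int: "(\<integral>\<^sup>+x\<in>F. f x \<partial>M) \<le> ennreal C" and C: "0 < C"
  shows "emeasure M {x \<in> F. ennreal (8 * C) < f x} \<le> ennreal (1 / 8)"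
proof -
  have Fs: "F \<subseteq> space M" using F by (rule sets.sets_into_space)
  have "{x \<in> F. ennreal (8 * C) < f x} \<subseteq> {x \<in> F. 1 \<le> ennreal (1 / (8 * C)) * f x}"
  proof safe
    fix x assume "ennreal (8 * C) < f x"
    then have "ennreal (1 / (8 * C)) * ennreal (8 * C) \<le> ennreal (1 / (8 * C)) * f x"
      by (intro mult_left_mono) auto
    then show "1 \<le> ennreal (1 / (8 * C)) * f x" using C by (simp add: ennreal_mult[symmetric])
  qed
  moreover have "{x \<in> F. 1 \<le> ennreal (1 / (8 * C)) * f x} \<in> events"
  proof -
    have "{x \<in> F. 1 \<le> ennreal (1 / (8 * C)) * f x} = F \<inter> {x \<in> space M. 1 \<le> ennreal (1 / (8 * C)) * f x}"
      using Fs by auto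
    then show ?thesis using F f by simp
  qed
  ultimately have "emeasure M {x \<in> F. ennreal (8 * C) < f x} \<le> emeasure M {x \<in> F. 1 \<le> ennreal (1 / (8 * C)) * f x}"
    by (rule emeasure_mono)
  also have "\<dots> \<le> ennreal (1 / (8 * C)) * (\<integral>\<^sup>+x\<in>F. f x \<partial>M)"
    using f F by (intro nn_integral_Markov_inequality) auto
  also have "\<dots> \<le> ennreal (1 / (8 * C)) * ennreal C" using int by (rule mult_left_mono) simp
  also have "\<dots> = ennreal (1 / 8)" using C by (simp add: ennreal_mult[symmetric])
  finally show ?thesis .
qed

text \<open>Markov's inequality with factor 8 discards measure at most 1/8 for each of f and g, so
  of a set of measure at least 1/2 something remains even after the null set for P is removed. This
  origin of the factor 8 is behind all later constants with an 8 in them.\<close>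

lemma (in prob_space) exists_good_point:
  assumes f: "f \<in> borel_measurable M" and g: "g \<in> borel_measurable M" and F: "F \<in> events" "1 / 2 \<le> prob F"
    and intf: "(\<integral>\<^sup>+x\<in>F. f x \<partial>M) \<le> ennreal C" "0 < C" and intg: "(\<integral>\<^sup>+x\<in>F. g x \<partial>M) \<le> ennreal D" "0 < D"
    and P: "AE x in M. P x"
  shows "\<exists>x\<in>F. f x \<le> ennreal (8 * C) \<and> g x \<le> ennreal (8 * D) \<and> P x"
proof (rule ccontr)
  assume neg: "\<not> ?thesis"
  from P obtain N where N: "{x \<in> space M. \<not> P x} \<subseteq> N" "emeasure M N = 0" "N \<in> events" by (rule AE_E)
  let ?S = "{x \<in> F. ennreal (8 * C) < f x}" and ?T = "{x \<in> F. ennreal (8 * D) < g x}"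
  have Fs: "F \<subseteq> space M" using F(1) by (rule sets.sets_into_space)
  have "?S = F \<inter> {x \<in> space M. ennreal (8 * C) < f x}" "?T = F \<inter> {x \<in> space M. ennreal (8 * D) < g x}"
    using Fs by auto
  then have ST: "?S \<in> events" "?T \<in> events" using F(1) f g by simp_all
  have "F \<subseteq> (?S \<union> ?T) \<union> N" using neg N(1) Fs by (auto simp: not_le)
  then have "emeasure M F \<le> emeasure M ((?S \<union> ?T) \<union> N)" using ST N by (intro emeasure_mono) auto
  also have "\<dots> \<le> emeasure M (?S \<union> ?T) + emeasure M N" using ST N by (intro emeasure_subadditive) auto
  also have "emeasure M (?S \<union> ?T) \<le> emeasure M ?S + emeasure M ?T" using ST by (intro emeasure_subadditive) auto
  also have "\<dots> \<le> ennreal (1 / 8) + ennreal (1 / 8)"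
    by (intro add_mono emeasure_gt_le[OF f F(1) intf] emeasure_gt_le[OF g F(1) intg])
  finally have "emeasure M F \<le> ennreal (1 / 4)" using N by (simp add: ennreal_plus[symmetric] del: ennreal_plus)
  then have "prob F \<le> 1 / 4" by (simp add: emeasure_eq_measure)
  with F(2) show False by simp
qed

text \<open>The sublevel sets exhaust the space. This turns a merely measurable function into one
  that is bounded on half of the space, which starts the proofs of finiteness below.\<close>

lemma (in prob_space) exists_bound_half:
  fixes h :: "'a \<Rightarrow> real"
  assumes h: "h \<in> borel_measurable M"
  shows "\<exists>m>0. 1 / 2 \<le> prob {x \<in> space M. h x \<le> m}"
proof -
  have "(\<lambda>k. prob {x \<in> space M. h x \<le> real k}) \<longlonglongrightarrow> prob (\<Union>k. {x \<in> space M. h x \<le> real k})"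
    using h by (intro finite_Lim_measure_incseq) (auto simp: incseq_def le_fun_def)
  moreover have "(\<Union>k. {x \<in> space M. h x \<le> real k}) = space M"
    using real_arch_simple by auto
  ultimately have "(\<lambda>k. prob {x \<in> space M. h x \<le> real k}) \<longlonglongrightarrow> 1" by (simp add: prob_space)
  then have "eventually (\<lambda>k. 1 / 2 < prob {x \<in> space M. h x \<le> real k}) sequentially"
    by (rule order_tendstoD) simp
  then have "eventually (\<lambda>k. 1 / 2 < prob {x \<in> space M. h x \<le> real k} \<and> 0 < k) sequentially"
    using eventually_gt_at_top[of 0] by eventually_elim simp
  then obtain k where "1 / 2 < prob {x \<in> space M. h x \<le> real k}" "0 < k"
    using eventually_happens'[OF sequentially_bot] by blast
  then show ?thesis by (intro exI[of _ "real k"]) auto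
qed

text \<open>Jensen's inequality up to a factor 2^r, for functions that need not be integrable, from
  \<open>le_scaled_add_powr\<close> with the balancing scale.\<close>

lemma (in prob_space) mean_powr_le:
  fixes f :: "'a \<Rightarrow> real"
  assumes X: "0 \<le> X" "ennreal X \<le> (\<integral>\<^sup>+x. ennreal (f x) \<partial>M)" and r: "1 \<le> r"
    and f: "f \<in> borel_measurable M" "\<And>x. 0 \<le> f x"
  shows "ennreal (X powr r) \<le> ennreal (2 powr r) * (\<integral>\<^sup>+x. ennreal (f x powr r) \<partial>M)"
proof (cases "\<integral>\<^sup>+x. ennreal (f x powr r) \<partial>M")
  case (real J)
  have *: "X powr r \<le> 2 powr r * (J + e)" if e: "0 < e" for e
  proof -
    \<comment> \<open>Balances the two terms of the scaled inequality; e keeps t positive when J = 0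
      and is removed at the end.\<close>
    define t where "t = (J + e) powr (1 / r)"
    have t: "0 < t" using real e by (simp add: t_def)
    have tr: "t powr r = J + e" using real e r by (simp add: t_def powr_powr)
    have "ennreal X \<le> (\<integral>\<^sup>+x. ennreal t + ennreal (t powr (1 - r)) * ennreal (f x powr r) \<partial>M)"
      using le_scaled_add_powr[OF f(2) r t]
      by (intro order_trans[OF X(2)] nn_integral_mono) (simp add: t less_imp_le ennreal_leI flip: ennreal_mult ennreal_plus)
    also have "\<dots> = ennreal t + ennreal (t powr (1 - r)) * ennreal J"
      using f by (subst nn_integral_add) (auto simp: nn_integral_cmult emeasure_space_1 real)
    also have "\<dots> = ennreal (t + t powr (1 - r) * J)"
      using t real by (simp add: ennreal_mult)
    finally have "X \<le> t + t powr (1 - r) * J" using t real by (subst (asm) ennreal_le_iff) auto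
    also have "\<dots> \<le> t + t powr (1 - r) * t powr r" using e unfolding tr by (intro add_left_mono mult_left_mono) auto
    also have "\<dots> = 2 * t" using t by (simp flip: powr_add)
    finally have "X powr r \<le> (2 * t) powr r" using X r by (intro powr_mono2) auto
    also have "\<dots> = 2 powr r * (J + e)" using t tr by (simp add: powr_mult)
    finally show ?thesis .
  qed
  have "X powr r / 2 powr r \<le> J"
  proof (rule field_le_epsilon)
    fix e :: real assume "0 < e"
    from *[OF this] show "X powr r / 2 powr r \<le> J + e" by (simp add: field_simps)
  qed
  then have "X powr r \<le> 2 powr r * J" by (simp add: field_simps)
  then show ?thesis using real by (simp add: ennreal_mult[symmetric] ennreal_leI)
qed (simp add: ennreal_mult_top)

text \<open>Duality again: the averaged vector g is paired with itself and |g| is cancelled. The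
  right-hand side is an extended real, so no integrability of the norm has to be supplied.\<close>

lemma vec_norm2_mat_mean_le:
  assumes A: "mat_integrable M n A" and e: "e \<in> carrier_vec n"
  shows "ennreal (vec_norm2 (mat_mean M n A *\<^sub>v e)) \<le> (\<integral>\<^sup>+x. ennreal (vec_norm2 (A x *\<^sub>v e)) \<partial>M)"
proof (cases "vec_norm2 (mat_mean M n A *\<^sub>v e) = 0")
  case False
  define g where "g = mat_mean M n A *\<^sub>v e"
  have g: "g \<in> carrier_vec n" unfolding g_def by (rule mult_mat_vec_carrier[OF mat_mean_carrier e])
  have Ae: "A x *\<^sub>v e \<in> carrier_vec n" for x by (rule mult_mat_vec_carrier[OF mat_integrableD(1)[OF A] e])
  have m: "(\<lambda>x. vec_norm2 (A x *\<^sub>v e)) \<in> borel_measurable M"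
    by (rule borel_measurable_mat_vec_norm2[OF mat_integrable_measurable[OF A] e])
  have gp: "0 < vec_norm2 g" using False vec_norm2_nonneg[of g] unfolding g_def by linarith
  have "complex_of_real ((vec_norm2 g)\<^sup>2) = g \<bullet>c g" by (rule cscalar_prod_self[OF g, symmetric])
  also have "\<dots> = (LINT x|M. (A x *\<^sub>v e) \<bullet>c g)" using form_mat_mean(2)[OF A e g] by (simp only: g_def)
  finally have "(vec_norm2 g)\<^sup>2 = cmod (LINT x|M. (A x *\<^sub>v e) \<bullet>c g)"
    by (metis norm_of_real abs_of_nonneg zero_le_power2)
  then have "ennreal (vec_norm2 g * vec_norm2 g) = ennreal (cmod (LINT x|M. (A x *\<^sub>v e) \<bullet>c g))"
    by (simp add: power2_eq_square)
  also have "\<dots> \<le> (\<integral>\<^sup>+x. ennreal (cmod ((A x *\<^sub>v e) \<bullet>c g)) \<partial>M)"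
    by (rule integral_norm_bound_ennreal[OF form_mat_mean(1)[OF A e g]])
  also have "\<dots> \<le> (\<integral>\<^sup>+x. ennreal (vec_norm2 g) * ennreal (vec_norm2 (A x *\<^sub>v e)) \<partial>M)"
    using cauchy_schwarz_cvec[OF Ae g]
    by (intro nn_integral_mono) (simp add: mult.commute ennreal_leI flip: ennreal_mult)
  also have "\<dots> = ennreal (vec_norm2 g) * (\<integral>\<^sup>+x. ennreal (vec_norm2 (A x *\<^sub>v e)) \<partial>M)"
    using m by (intro nn_integral_cmult) simp
  finally have "ennreal (vec_norm2 g) * ennreal (vec_norm2 g) \<le> ennreal (vec_norm2 g) * (\<integral>\<^sup>+x. ennreal (vec_norm2 (A x *\<^sub>v e)) \<partial>M)"
    by (simp add: ennreal_mult)
  then show ?thesis unfolding g_def[symmetric] using gp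
    by (subst (asm) ennreal_mult_le_mult_iff) auto
qed simp

text \<open>A single cube with its normalised measure. In the application w is W^(1/q), wi its
  inverse, a the conjugate exponent of p and b = q. H is a real majorant, at least 1, of the inner
  average in the definition of the weight class, so that its powers can be compared without treating
  0 and \<infinity> separately.\<close>

locale weight_space = prob_space M for M :: "'x measure" +
  fixes n :: nat and w wi :: "'x \<Rightarrow> cmat" and a b A :: real and H :: "'x \<Rightarrow> real"
  assumes w_meas: "mat_measurable M n w" and wi_meas: "mat_measurable M n wi"
    and pdw: "\<And>x. positive_definite n (w x)" and pdwi: "\<And>x. positive_definite n (wi x)"
    and wwi: "\<And>x. w x * wi x = 1\<^sub>m n" and wiw: "\<And>x. wi x * w x = 1\<^sub>m n"
    and a1: "1 < a" and b1: "1 < b" and A1: "1 \<le> A"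
    and H_meas: "H \<in> borel_measurable M" and H1: "\<And>x. 1 \<le> H x"
    and KH: "AE x in M. (\<integral>\<^sup>+y. ennreal (fro (w x * wi y) powr a) \<partial>M) \<le> ennreal (H x)"
    and HA: "(\<integral>\<^sup>+x. ennreal (H x powr (b / a)) \<partial>M) \<le> ennreal A"
begin

abbreviation "K x y \<equiv> fro (w x * wi y)"

lemma w_car [simp]: "w x \<in> carrier_mat n n" by (rule mat_measurableD(1)[OF w_meas])
lemma wi_car [simp]: "wi x \<in> carrier_mat n n" by (rule mat_measurableD(1)[OF wi_meas])

lemma K_meas: "(\<lambda>y. K x y) \<in> borel_measurable M"
  by (intro borel_measurable_fro[of M n] mat_measurable_mult wi_meas mat_measurable_const w_car)

lemma K_meas2: "(\<lambda>z. K (fst z) (snd z)) \<in> borel_measurable (M \<Otimes>\<^sub>M M)"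
  by (intro borel_measurable_fro[of _ n] mat_measurable_mult mat_measurable_compose[OF measurable_fst w_meas]
      mat_measurable_compose[OF measurable_snd wi_meas])

lemma w_split: "w x = (w x * wi y) * w y"
  using wiw[of y] by (simp add: assoc_mult_mat[of _ n n _ n _ n])

lemma wi_split: "wi y = wi x * (w x * wi y)"
  using wiw[of x] by (simp add: assoc_mult_mat[of _ n n _ n _ n, symmetric])

text \<open>\<open>c4\<close> is the loss in \<open>transfer\<close>. \<open>g0\<close> bounds H x
  at the points where Markov's inequality gives H x powr (b / a) \<le> 8 * A.\<close>

definition "c4 = 8 * 8 powr (b / a) * A"
definition "g0 = (8 * A) powr (a / b)"

lemma c4_pos: "0 < c4" using A1 by (simp add: c4_def)
lemma g0_pos: "0 < g0" using A1 by (simp add: g0_def)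

text \<open>For fixed x, \<open>exists_good_point\<close> yields y in F with K x y powr a \<le> 8 *
  H x and h y powr b \<le> 8 * D; hence h x powr b is at most a constant times D * H x powr (b / a),
  and this is integrable in x by \<open>HA\<close>. Half of the cube thus controls the whole cube,
  the property a reverse Hoelder inequality would otherwise provide.\<close>

lemma transfer:
  assumes h: "h \<in> borel_measurable M" "\<And>x. 0 \<le> h x" "\<And>x y. h x \<le> K x y * h y"
    and F: "F \<in> events" "1 / 2 \<le> prob F" and D: "0 < D" "(\<integral>\<^sup>+x\<in>F. ennreal (h x powr b) \<partial>M) \<le> ennreal D"
  shows "(\<integral>\<^sup>+x. ennreal (h x powr b) \<partial>M) \<le> ennreal (c4 * D)"
proof -
  have "AE x in M. ennreal (h x powr b) \<le> ennreal (8 * 8 powr (b / a) * D) * ennreal (H x powr (b / a))"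
    using KH
  proof eventually_elim
    case (elim x)
    have Hx: "0 < H x" using H1[of x] by linarith
    have "(\<integral>\<^sup>+y\<in>F. ennreal (K x y powr a) \<partial>M) \<le> ennreal (H x)"
      by (rule order_trans[OF nn_integral_mono elim]) (auto simp: indicator_def)
    then have "\<exists>y\<in>F. ennreal (K x y powr a) \<le> ennreal (8 * H x) \<and> ennreal (h y powr b) \<le> ennreal (8 * D) \<and> True"
      using K_meas h(1) D Hx by (intro exists_good_point[OF _ _ F]) auto
    then obtain y where y: "K x y powr a \<le> 8 * H x" "h y powr b \<le> 8 * D"
      using D Hx by auto
    have "K x y powr b = (K x y powr a) powr (b / a)" using a1 by (simp add: powr_powr)
    also have "\<dots> \<le> (8 * H x) powr (b / a)" using y a1 b1 by (intro powr_mono2) auto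
    finally have Kb: "K x y powr b \<le> 8 powr (b / a) * H x powr (b / a)" using Hx by (simp add: powr_mult)
    have "h x powr b \<le> (K x y * h y) powr b" using h b1 by (intro powr_mono2) auto
    also have "\<dots> = K x y powr b * h y powr b" using h by (simp add: powr_mult)
    also have "\<dots> \<le> (8 powr (b / a) * H x powr (b / a)) * (8 * D)" using Kb y by (intro mult_mono) auto
    finally show ?case using D by (simp add: ennreal_leI mult_ac flip: ennreal_mult)
  qed
  then have "(\<integral>\<^sup>+x. ennreal (h x powr b) \<partial>M) \<le> (\<integral>\<^sup>+x. ennreal (8 * 8 powr (b / a) * D) * ennreal (H x powr (b / a)) \<partial>M)"
    by (rule nn_integral_mono_AE)
  also have "\<dots> = ennreal (8 * 8 powr (b / a) * D) * (\<integral>\<^sup>+x. ennreal (H x powr (b / a)) \<partial>M)"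
    using H_meas by (intro nn_integral_cmult) auto
  also have "\<dots> \<le> ennreal (8 * 8 powr (b / a) * D) * ennreal A" using HA by (rule mult_left_mono) simp
  also have "\<dots> = ennreal (c4 * D)" using D A1 by (simp add: c4_def mult_ac flip: ennreal_mult)
  finally show ?thesis .
qed

lemma H_good: "H x powr (b / a) \<le> 8 * A \<Longrightarrow> H x \<le> g0"
proof -
  assume "H x powr (b / a) \<le> 8 * A"
  then have "(H x powr (b / a)) powr (a / b) \<le> (8 * A) powr (a / b)" using a1 b1 by (intro powr_mono2) auto
  then show ?thesis using a1 b1 H1[of x] by (simp add: powr_powr g0_def)
qed

lemma HA_on: "(\<integral>\<^sup>+x\<in>F. ennreal (H x powr (b / a)) \<partial>M) \<le> ennreal A"
  by (rule order_trans[OF nn_integral_mono HA]) (auto simp: indicator_def)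

lemma prob_H_good: "{x \<in> space M. H x \<le> g0} \<in> events" "1 / 2 \<le> prob {x \<in> space M. H x \<le> g0}"
proof -
  show ev: "{x \<in> space M. H x \<le> g0} \<in> events" using H_meas by simp
  have "emeasure M {x \<in> space M. ennreal (8 * A) < ennreal (H x powr (b / a))} \<le> ennreal (1 / 8)"
    using HA_on[of "space M"] A1 H_meas by (intro emeasure_gt_le) auto
  moreover have "space M - {x \<in> space M. H x \<le> g0} \<subseteq> {x \<in> space M. ennreal (8 * A) < ennreal (H x powr (b / a))}"
    using H_good A1 by (auto simp: ennreal_less_iff not_le[symmetric])
  moreover have "{x \<in> space M. ennreal (8 * A) < ennreal (H x powr (b / a))} \<in> events" using H_meas by simp
  ultimately have "emeasure M (space M - {x \<in> space M. H x \<le> g0}) \<le> ennreal (1 / 8)"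
    by (meson emeasure_mono order_trans)
  then have "prob (space M - {x \<in> space M. H x \<le> g0}) \<le> 1 / 8" by (simp add: emeasure_eq_measure)
  then show "1 / 2 \<le> prob {x \<in> space M. H x \<le> g0}" using prob_compl[OF ev] by simp
qed

text \<open>The dual version for functions that propagate in the second variable of K: one good x in
  F is fixed, and K x y is integrated in y.\<close>

lemma transfer':
  assumes h: "h \<in> borel_measurable M" "\<And>x. 0 \<le> h x" "\<And>x y. h y \<le> K x y * h x"
    and F: "F \<in> events" "1 / 2 \<le> prob F" and D: "0 < D" "(\<integral>\<^sup>+x\<in>F. ennreal (h x powr a) \<partial>M) \<le> ennreal D"
  shows "(\<integral>\<^sup>+x. ennreal (h x powr a) \<partial>M) \<le> ennreal (8 * g0 * D)"
proof -
  have "\<exists>x\<in>F. ennreal (H x powr (b / a)) \<le> ennreal (8 * A) \<and> ennreal (h x powr a) \<le> ennreal (8 * D) \<and>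
      (\<integral>\<^sup>+y. ennreal (K x y powr a) \<partial>M) \<le> ennreal (H x)"
    using HA_on h(1) H_meas D A1 by (intro exists_good_point[OF _ _ F _ _ _ _ KH]) auto
  then obtain x where x: "H x powr (b / a) \<le> 8 * A" "h x powr a \<le> 8 * D"
    "(\<integral>\<^sup>+y. ennreal (K x y powr a) \<partial>M) \<le> ennreal (H x)" using A1 D by auto
  have "(\<integral>\<^sup>+y. ennreal (h y powr a) \<partial>M) \<le> (\<integral>\<^sup>+y. ennreal (8 * D) * ennreal (K x y powr a) \<partial>M)"
  proof (rule nn_integral_mono)
    fix y
    have "h y powr a \<le> (K x y * h x) powr a" using h a1 by (intro powr_mono2) auto
    also have "\<dots> = K x y powr a * h x powr a" using h by (simp add: powr_mult)
    also have "\<dots> \<le> K x y powr a * (8 * D)" using x by (intro mult_left_mono) auto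
    finally show "ennreal (h y powr a) \<le> ennreal (8 * D) * ennreal (K x y powr a)"
      using D by (simp add: ennreal_leI mult.commute flip: ennreal_mult)
  qed
  also have "\<dots> = ennreal (8 * D) * (\<integral>\<^sup>+y. ennreal (K x y powr a) \<partial>M)"
    using K_meas by (intro nn_integral_cmult) auto
  also have "\<dots> \<le> ennreal (8 * D) * ennreal g0"
    using x(3) H_good[OF x(1)] by (intro mult_left_mono order_trans[OF x(3)] ennreal_leI) auto
  also have "\<dots> = ennreal (8 * g0 * D)" using D g0_pos by (simp add: mult_ac flip: ennreal_mult)
  finally show ?thesis .
qed

text \<open>\<open>transfer\<close> applied to a half of the space on which h is bounded.
  Integrability of w and of its inverse is thereby a consequence of the kernel bound rather than an
  assumption.\<close>

lemma transfer_finite: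
  assumes h: "h \<in> borel_measurable M" "\<And>x. 0 \<le> h x" "\<And>x y. h x \<le> K x y * h y"
  shows "(\<integral>\<^sup>+x. ennreal (h x powr b) \<partial>M) < \<infinity>"
proof -
  obtain m where m: "0 < m" "1 / 2 \<le> prob {x \<in> space M. h x \<le> m}" using exists_bound_half[OF h(1)] by blast
  let ?F = "{x \<in> space M. h x \<le> m}"
  have F: "?F \<in> events" using h(1) by simp
  have "(\<integral>\<^sup>+x\<in>?F. ennreal (h x powr b) \<partial>M) \<le> (\<integral>\<^sup>+x. ennreal (m powr b) \<partial>M)"
    using h(2) b1 by (intro nn_integral_mono) (auto simp: indicator_def intro!: ennreal_leI powr_mono2)
  also have "\<dots> = ennreal (m powr b)" by (simp add: emeasure_space_1)
  finally show ?thesis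
    using le_less_trans[OF transfer[OF h F m(2), of "m powr b"], of \<infinity>] m by simp
qed

lemma transfer_finite':
  assumes h: "h \<in> borel_measurable M" "\<And>x. 0 \<le> h x" "\<And>x y. h y \<le> K x y * h x"
  shows "(\<integral>\<^sup>+x. ennreal (h x powr a) \<partial>M) < \<infinity>"
proof -
  obtain m where m: "0 < m" "1 / 2 \<le> prob {x \<in> space M. h x \<le> m}" using exists_bound_half[OF h(1)] by blast
  let ?F = "{x \<in> space M. h x \<le> m}"
  have F: "?F \<in> events" using h(1) by simp
  have "(\<integral>\<^sup>+x\<in>?F. ennreal (h x powr a) \<partial>M) \<le> (\<integral>\<^sup>+x. ennreal (m powr a) \<partial>M)"
    using h(2) a1 by (intro nn_integral_mono) (auto simp: indicator_def intro!: ennreal_leI powr_mono2)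
  also have "\<dots> = ennreal (m powr a)" by (simp add: emeasure_space_1)
  finally show ?thesis
    using le_less_trans[OF transfer'[OF h F m(2), of "m powr a"], of \<infinity>] m by simp
qed

lemma nn_integral_le_one_add:
  assumes "h \<in> borel_measurable M" "\<And>x. 0 \<le> h x" "1 \<le> r"
  shows "(\<integral>\<^sup>+x. ennreal (h x) \<partial>M) \<le> 1 + (\<integral>\<^sup>+x. ennreal (h x powr r) \<partial>M)"
proof -
  have "(\<integral>\<^sup>+x. ennreal (h x) \<partial>M) \<le> (\<integral>\<^sup>+x. 1 + ennreal (h x powr r) \<partial>M)"
    using powr_le_one_add[OF assms(2,3)]
    by (intro nn_integral_mono) (simp add: ennreal_leI flip: ennreal_1 ennreal_plus)
  also have "\<dots> = 1 + (\<integral>\<^sup>+x. ennreal (h x powr r) \<partial>M)"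
    using assms by (subst nn_integral_add) (auto simp: emeasure_space_1)
  finally show ?thesis .
qed

lemma w_int: "mat_integrable M n w"
proof (rule mat_integrableI[OF w_meas])
  have "fro (w x) \<le> K x y * fro (w y)" for x y
    by (subst w_split[of x y]) (rule fro_mult[of _ n n _ n]; simp)
  then have "(\<integral>\<^sup>+x. ennreal (fro (w x) powr b) \<partial>M) < \<infinity>"
    by (intro transfer_finite borel_measurable_fro[OF w_meas]) auto
  then show "(\<integral>\<^sup>+x. ennreal (fro (w x)) \<partial>M) < \<infinity>"
    using nn_integral_le_one_add[OF borel_measurable_fro[OF w_meas] fro_nonneg, of b] b1
    by (auto simp: less_top[symmetric] top_unique)
qed

lemma wi_int: "mat_integrable M n wi"
proof (rule mat_integrableI[OF wi_meas])
  have "fro (wi y) \<le> K x y * fro (wi x)" for x y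
    by (subst wi_split[of y x], subst mult.commute) (rule fro_mult[of _ n n _ n]; simp)
  then have "(\<integral>\<^sup>+x. ennreal (fro (wi x) powr a) \<partial>M) < \<infinity>"
    by (intro transfer_finite' borel_measurable_fro[OF wi_meas]) auto
  then show "(\<integral>\<^sup>+x. ennreal (fro (wi x)) \<partial>M) < \<infinity>"
    using nn_integral_le_one_add[OF borel_measurable_fro[OF wi_meas] fro_nonneg, of a] a1
    by (auto simp: less_top[symmetric] top_unique)
qed

abbreviation "N \<equiv> mat_mean M n w"
abbreviation "M0 \<equiv> mat_mean M n wi"

lemma N_pd: "positive_definite n N" by (rule pd_mat_mean[OF w_int pdw])
lemma M0_pd: "positive_definite n M0" by (rule pd_mat_mean[OF wi_int pdwi])

text \<open>\<open>c2a\<close> bounds the b-th moment of |w M0|; \<open>ci\<close> is the bound of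
  \<open>fro_inverse_le\<close> for the product N M0, whose norm is at most 1 + c2a.\<close>

definition "c2a = c4 * (1 + g0) powr b"
definition "ci = real n * real n * fact n * (1 + c2a) ^ n"

lemma c2a_pos: "0 < c2a" using c4_pos g0_pos by (simp add: c2a_def)
lemma ci_nonneg: "0 \<le> ci" using c2a_pos by (simp add: ci_def)

text \<open>w x * M0 is the mean of w x * wi y in y, so its norm is at most 1 + H x, which is at
  most 1 + g0 on a set of probability at least 1/2. \<open>transfer\<close> extends this bound to
  the whole cube.\<close>

lemma w_M0: "(\<integral>\<^sup>+x. ennreal (fro (w x * M0) powr b) \<partial>M) \<le> ennreal c2a"
  unfolding c2a_def
proof (rule transfer)
  show m: "(\<lambda>x. fro (w x * M0)) \<in> borel_measurable M"
    by (intro borel_measurable_fro[of M n] mat_measurable_mult w_meas mat_measurable_const mat_mean_carrier)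
  show "fro (w x * M0) \<le> K x y * fro (w y * M0)" for x y
  proof -
    have "w x * M0 = (w x * wi y) * (w y * M0)"
      by (subst w_split[of x y]) (rule assoc_mult_mat[of _ n n _ n _ n]; simp)
    then show ?thesis using fro_mult[of "w x * wi y" n n "w y * M0" n] by simp
  qed
  show "{x \<in> space M. H x \<le> g0} \<in> events" "1 / 2 \<le> prob {x \<in> space M. H x \<le> g0}" by (fact prob_H_good)+
  show "0 < (1 + g0) powr b" using g0_pos by simp
  have "AE x in M. ennreal (fro (w x * M0) powr b) * indicator {x \<in> space M. H x \<le> g0} x \<le> ennreal ((1 + g0) powr b)"
    using KH
  proof eventually_elim
    case (elim x)
    have int: "mat_integrable M n (\<lambda>y. w x * wi y)" and mean: "mat_mean M n (\<lambda>y. w x * wi y) = w x * M0"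
      by (rule mat_integrable_mult_left[OF wi_int w_car])+
    have "ennreal (fro (w x * M0)) \<le> ennreal (LINT y|M. K x y)"
      using fro_mat_mean_le[OF int] unfolding mean by (rule ennreal_leI)
    also have "\<dots> = (\<integral>\<^sup>+y. ennreal (K x y) \<partial>M)"
      using fro_integrable[OF int] by (intro nn_integral_eq_integral[symmetric]) auto
    also have "\<dots> \<le> 1 + (\<integral>\<^sup>+y. ennreal (K x y powr a) \<partial>M)" using a1 by (intro nn_integral_le_one_add K_meas) auto
    also have "\<dots> \<le> 1 + ennreal (H x)" using elim by (rule add_left_mono)
    also have "\<dots> = ennreal (1 + H x)" using H1[of x] by (simp flip: ennreal_1 ennreal_plus)
    finally have "fro (w x * M0) \<le> 1 + H x" using H1[of x] by (subst (asm) ennreal_le_iff) auto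
    then show ?case using b1 by (auto simp: indicator_def intro!: ennreal_leI powr_mono2)
  qed
  then have "(\<integral>\<^sup>+x\<in>{x \<in> space M. H x \<le> g0}. ennreal (fro (w x * M0) powr b) \<partial>M) \<le> (\<integral>\<^sup>+x. ennreal ((1 + g0) powr b) \<partial>M)"
    by (rule nn_integral_mono_AE)
  then show "(\<integral>\<^sup>+x\<in>{x \<in> space M. H x \<le> g0}. ennreal (fro (w x * M0) powr b) \<partial>M) \<le> ennreal ((1 + g0) powr b)"
    by (simp add: emeasure_space_1)
qed simp

lemma N_M0: "fro (N * M0) \<le> 1 + c2a"
proof -
  have int: "mat_integrable M n (\<lambda>x. w x * M0)" and mean: "mat_mean M n (\<lambda>x. w x * M0) = N * M0"
    by (rule mat_integrable_mult_right[OF w_int mat_mean_carrier])+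
  have "ennreal (fro (N * M0)) \<le> ennreal (LINT x|M. fro (w x * M0))"
    using fro_mat_mean_le[OF int] unfolding mean by (rule ennreal_leI)
  also have "\<dots> = (\<integral>\<^sup>+x. ennreal (fro (w x * M0)) \<partial>M)"
    using fro_integrable[OF int] by (intro nn_integral_eq_integral[symmetric]) auto
  also have "\<dots> \<le> 1 + (\<integral>\<^sup>+x. ennreal (fro (w x * M0) powr b) \<partial>M)"
    using b1 by (intro nn_integral_le_one_add borel_measurable_fro[OF mat_integrable_measurable[OF int]]) auto
  also have "\<dots> \<le> 1 + ennreal c2a" using w_M0 by (rule add_left_mono)
  also have "\<dots> = ennreal (1 + c2a)" using c2a_pos by (simp flip: ennreal_1 ennreal_plus)
  finally show ?thesis using c2a_pos by (subst (asm) ennreal_le_iff) auto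
qed

text \<open>N M0 is bounded by \<open>N_M0\<close> and has determinant of modulus at least 1 by
  \<open>det_mult_ge_one\<close>, so Cramer's rule bounds its inverse. Up to bounded factors, M0 is
  thus the inverse of N, the fact that lets the mean of w act as a reducing matrix.\<close>

lemma inverse_product_bound:
  assumes Ni: "Ni \<in> carrier_mat n n" "Ni * N = 1\<^sub>m n" and Mi: "Mi \<in> carrier_mat n n" "Mi * M0 = 1\<^sub>m n"
  shows "fro (Mi * Ni) \<le> ci"
  unfolding ci_def
proof (rule fro_inverse_le)
  show "N * M0 \<in> carrier_mat n n" "Mi * Ni \<in> carrier_mat n n" using Ni Mi by simp_all
  have "(Mi * Ni) * (N * M0) = Mi * ((Ni * N) * M0)"
    using Ni(1) Mi(1) by (simp add: assoc_mult_mat[of _ n n _ n _ n])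
  also have "\<dots> = 1\<^sub>m n" unfolding Ni(2) using Mi by simp
  finally show "(Mi * Ni) * (N * M0) = 1\<^sub>m n" .
  show "1 \<le> cmod (Determinant.det (N * M0))"
    by (rule det_mult_ge_one[OF N_pd M0_pd]) (rule mat_mean_cauchy_schwarz[OF w_int wi_int pdw pdwi wiw])
  show "fro (N * M0) \<le> 1 + c2a" by (rule N_M0)
  show "1 \<le> 1 + c2a" using c2a_pos by simp
qed

lemma w_Ni:
  assumes Ni: "Ni \<in> carrier_mat n n" "Ni * N = 1\<^sub>m n"
  shows "(\<integral>\<^sup>+x. ennreal (fro (w x * Ni) powr b) \<partial>M) \<le> ennreal (ci powr b * c2a)"
proof -
  obtain Mi where Mi: "Mi \<in> carrier_mat n n" "M0 * Mi = 1\<^sub>m n" "Mi * M0 = 1\<^sub>m n"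
    using pd_inverse[OF M0_pd] by blast
  have "(\<integral>\<^sup>+x. ennreal (fro (w x * Ni) powr b) \<partial>M) \<le> (\<integral>\<^sup>+x. ennreal (ci powr b) * ennreal (fro (w x * M0) powr b) \<partial>M)"
  proof (rule nn_integral_mono)
    fix x
    have "(w x * M0) * (Mi * Ni) = w x * ((M0 * Mi) * Ni)"
      using Ni(1) Mi(1) by (simp add: assoc_mult_mat[of _ n n _ n _ n])
    then have "w x * Ni = (w x * M0) * (Mi * Ni)" unfolding Mi(2) using Ni by simp
    then have "fro (w x * Ni) \<le> fro (w x * M0) * fro (Mi * Ni)"
      using fro_mult[of "w x * M0" n n "Mi * Ni" n] Ni Mi by simp
    also have "\<dots> \<le> fro (w x * M0) * ci" using inverse_product_bound[OF Ni Mi(1,3)] by (intro mult_left_mono) auto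
    finally have "fro (w x * Ni) powr b \<le> (fro (w x * M0) * ci) powr b" using b1 by (intro powr_mono2) auto
    then show "ennreal (fro (w x * Ni) powr b) \<le> ennreal (ci powr b) * ennreal (fro (w x * M0) powr b)"
      using ci_nonneg by (simp add: powr_mult mult.commute ennreal_leI flip: ennreal_mult)
  qed
  also have "\<dots> = ennreal (ci powr b) * (\<integral>\<^sup>+x. ennreal (fro (w x * M0) powr b) \<partial>M)"
  proof (rule nn_integral_cmult)
    have [measurable]: "(\<lambda>x. fro (w x * M0)) \<in> borel_measurable M"
      by (intro borel_measurable_fro[of M n] mat_measurable_mult w_meas mat_measurable_const mat_mean_carrier)
    show "(\<lambda>x. ennreal (fro (w x * M0) powr b)) \<in> borel_measurable M" by measurable
  qed
  also have "\<dots> \<le> ennreal (ci powr b) * ennreal c2a" using w_M0 by (rule mult_left_mono) simp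
  finally show ?thesis using c2a_pos by (simp add: ennreal_mult less_imp_le)
qed

text \<open>It suffices to bound N * wi x at one good x, since N * wi y = (N * wi x) * (w x * wi y).
  As N is a mean of w, |N * wi x| is at most L x, the integral of the kernel in its other variable;
  Fubini bounds the integral of L, and Markov's inequality finds an x where both L and H are
  moderate.\<close>

lemma N_wi: "(\<integral>\<^sup>+y. ennreal (fro (N * wi y) powr a) \<partial>M) \<le> ennreal ((16 * A) powr a * g0)"
proof -
  interpret P: pair_prob_space M M ..
  define L where "L = (\<lambda>y. \<integral>\<^sup>+x. ennreal (K x y) \<partial>M)"
  have Km: "(\<lambda>z. ennreal (K (fst z) (snd z))) \<in> borel_measurable (M \<Otimes>\<^sub>M M)" using K_meas2 by simp
  then have Km': "(\<lambda>(x, y). ennreal (K x y)) \<in> borel_measurable (M \<Otimes>\<^sub>M M)" by (simp add: case_prod_beta)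
  have L_meas: "L \<in> borel_measurable M" unfolding L_def
    using borel_measurable_nn_integral_fst[of "\<lambda>z. ennreal (K (snd z) (fst z))" M]
      measurable_compose[OF measurable_pair_swap' Km] by (simp add: case_prod_beta)
  have "(\<integral>\<^sup>+y. L y \<partial>M) = (\<integral>\<^sup>+x. (\<integral>\<^sup>+y. ennreal (K x y) \<partial>M) \<partial>M)"
    unfolding L_def by (rule P.Fubini'[OF Km'])
  also have "\<dots> \<le> (\<integral>\<^sup>+x. ennreal 2 * ennreal (H x powr (b / a)) \<partial>M)"
  proof (rule nn_integral_mono_AE)
    show "AE x in M. (\<integral>\<^sup>+y. ennreal (K x y) \<partial>M) \<le> ennreal 2 * ennreal (H x powr (b / a))"
      using KH
    proof eventually_elim
      case (elim x)
      \<comment> \<open>Balancing scale. The resulting bound 2 * H x powr (1 / a) is enlarged to the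
        power b / a, the one that \<open>HA\<close> controls; this uses H x \<ge> 1 and b >
        1.\<close>
      define t where "t = H x powr (1 / a)"
      have t: "0 < t" "t powr a = H x" using H1[of x] a1 by (auto simp: t_def powr_powr)
      have "(\<integral>\<^sup>+y. ennreal (K x y) \<partial>M) \<le> (\<integral>\<^sup>+y. ennreal t + ennreal (t powr (1 - a)) * ennreal (K x y powr a) \<partial>M)"
        using le_scaled_add_powr[OF fro_nonneg less_imp_le[OF a1] t(1)]
        by (intro nn_integral_mono) (simp add: t less_imp_le ennreal_leI flip: ennreal_mult ennreal_plus)
      also have "\<dots> = ennreal t + ennreal (t powr (1 - a)) * (\<integral>\<^sup>+y. ennreal (K x y powr a) \<partial>M)"
        using K_meas by (subst nn_integral_add) (auto simp: nn_integral_cmult emeasure_space_1)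
      also have "\<dots> \<le> ennreal t + ennreal (t powr (1 - a)) * ennreal (H x)"
        using elim by (intro add_left_mono mult_left_mono) auto
      also have "\<dots> = ennreal (t + t powr (1 - a) * t powr a)"
        unfolding t(2) using t H1[of x] by (simp add: ennreal_mult)
      also have "t + t powr (1 - a) * t powr a = 2 * t" using t(1) by (simp flip: powr_add)
      also have "t \<le> H x powr (b / a)" unfolding t_def using H1[of x] a1 b1 by (intro powr_mono divide_right_mono) auto
      finally show ?case by (simp add: ennreal_mult ennreal_leI mult_left_mono)
    qed
  qed
  also have "\<dots> = ennreal 2 * (\<integral>\<^sup>+x. ennreal (H x powr (b / a)) \<partial>M)" using H_meas by (intro nn_integral_cmult) auto
  also have "\<dots> \<le> ennreal 2 * ennreal A" using HA by (rule mult_left_mono) simp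
  finally have "(\<integral>\<^sup>+y. L y \<partial>M) \<le> ennreal (2 * A)" using A1 by (simp add: ennreal_mult)
  then have L_on: "(\<integral>\<^sup>+y\<in>space M. L y \<partial>M) \<le> ennreal (2 * A)"
    by (rule order_trans[rotated]) (intro nn_integral_mono, auto simp: indicator_def)
  have "\<exists>x\<in>space M. L x \<le> ennreal (8 * (2 * A)) \<and> ennreal (H x powr (b / a)) \<le> ennreal (8 * A) \<and>
      (\<integral>\<^sup>+y. ennreal (K x y powr a) \<partial>M) \<le> ennreal (H x)"
    using HA_on[of "space M"] H_meas L_meas L_on A1 prob_space sets.top[of M]
    by (intro exists_good_point[OF _ _ _ _ _ _ _ _ KH]) (simp_all add: HA)
  then obtain x where x: "L x \<le> ennreal (16 * A)" "H x powr (b / a) \<le> 8 * A"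
    "(\<integral>\<^sup>+y. ennreal (K x y powr a) \<partial>M) \<le> ennreal (H x)" using A1 by auto
  have int: "mat_integrable M n (\<lambda>z. w z * wi x)" and mean: "mat_mean M n (\<lambda>z. w z * wi x) = N * wi x"
    by (rule mat_integrable_mult_right[OF w_int wi_car])+
  have "ennreal (fro (N * wi x)) \<le> ennreal (LINT z|M. K z x)"
    using fro_mat_mean_le[OF int] unfolding mean by (rule ennreal_leI)
  also have "\<dots> = L x" unfolding L_def
    using fro_integrable[OF int] by (intro nn_integral_eq_integral[symmetric]) auto
  also note x(1)
  finally have Nx: "fro (N * wi x) \<le> 16 * A" using A1 by simp
  have "(\<integral>\<^sup>+y. ennreal (fro (N * wi y) powr a) \<partial>M) \<le> (\<integral>\<^sup>+y. ennreal ((16 * A) powr a) * ennreal (K x y powr a) \<partial>M)"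
  proof (rule nn_integral_mono)
    fix y
    have "(N * wi x) * (w x * wi y) = N * (wi x * (w x * wi y))"
      by (simp add: assoc_mult_mat[of _ n n _ n _ n])
    then have "N * wi y = (N * wi x) * (w x * wi y)" using wi_split[of y x] by simp
    then have "fro (N * wi y) \<le> fro (N * wi x) * K x y"
      using fro_mult[of "N * wi x" n n "w x * wi y" n] by simp
    also have "\<dots> \<le> (16 * A) * K x y" using Nx by (intro mult_right_mono) auto
    finally have "fro (N * wi y) powr a \<le> ((16 * A) * K x y) powr a" using a1 by (intro powr_mono2) auto
    then show "ennreal (fro (N * wi y) powr a) \<le> ennreal ((16 * A) powr a) * ennreal (K x y powr a)"
      using A1 by (simp add: powr_mult ennreal_leI flip: ennreal_mult)
  qed
  also have "\<dots> = ennreal ((16 * A) powr a) * (\<integral>\<^sup>+y. ennreal (K x y powr a) \<partial>M)"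
    using K_meas by (intro nn_integral_cmult) auto
  also have "\<dots> \<le> ennreal ((16 * A) powr a) * ennreal g0"
    using H_good[OF x(2)] by (intro mult_left_mono order_trans[OF x(3)] ennreal_leI) auto
  finally show ?thesis using g0_pos by (simp add: ennreal_mult less_imp_le)
qed

lemma N_vec:
  assumes e: "e \<in> carrier_vec n"
  shows "ennreal (vec_norm2 (N *\<^sub>v e) powr b) \<le> ennreal (2 powr b) * (\<integral>\<^sup>+x. ennreal (vec_norm2 (w x *\<^sub>v e) powr b) \<partial>M)"
  using b1 by (intro mean_powr_le vec_norm2_mat_mean_le w_int e borel_measurable_mat_vec_norm2[OF w_meas]) auto

text \<open>Ni = (Ni * Mi) * M0, where the first factor is bounded and M0 e is a mean of the vectors
  wi x e.\<close>

lemma Ni_vec: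
  assumes Ni: "Ni \<in> carrier_mat n n" "N * Ni = 1\<^sub>m n" "Ni * N = 1\<^sub>m n" and e: "e \<in> carrier_vec n"
  shows "ennreal (vec_norm2 (Ni *\<^sub>v e) powr a) \<le>
    ennreal ((2 * ci) powr a) * (\<integral>\<^sup>+x. ennreal (vec_norm2 (wi x *\<^sub>v e) powr a) \<partial>M)"
proof -
  obtain Mi where Mi: "Mi \<in> carrier_mat n n" "M0 * Mi = 1\<^sub>m n" "Mi * M0 = 1\<^sub>m n" "mat_adjoint Mi = Mi"
    using pd_inverse[OF M0_pd] by blast
  obtain B where B: "B \<in> carrier_mat n n" "N * B = 1\<^sub>m n" "mat_adjoint B = B"
    using pd_inverse[OF N_pd] by blast
  \<comment> \<open>\<open>inverse_product_bound\<close> concerns Mi * Ni, the factors in the other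
    order. Both inverses being self-adjoint, the adjoint exchanges the order and preserves the
    Frobenius norm.\<close>
  have "Ni = Ni * (N * B)" unfolding B(2) using Ni by simp
  also have "\<dots> = B" using sq_cancel[OF Ni(3,1) mat_mean_carrier B(1)] by simp
  finally have "mat_adjoint Ni = Ni" using B(3) by simp
  then have "mat_adjoint (Ni * Mi) = Mi * Ni" using mat_adjoint_mult[OF Ni(1) Mi(1)] Mi(4) by simp
  then have ci: "fro (Ni * Mi) \<le> ci" using inverse_product_bound[OF Ni(1,3) Mi(1,3)] fro_adjoint[of "Ni * Mi"] by simp
  have Me: "M0 *\<^sub>v e \<in> carrier_vec n" by (rule mult_mat_vec_carrier[OF mat_mean_carrier e])
  have "(Ni * Mi) *\<^sub>v (M0 *\<^sub>v e) = (Ni * Mi * M0) *\<^sub>v e"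
    by (rule assoc_mult_mat_vec[of _ n n _ n, symmetric]) (use Ni Mi e in simp_all)
  also have "Ni * Mi * M0 = Ni" using assoc_mult_mat[OF Ni(1) Mi(1) mat_mean_carrier[of M n wi]] Mi(3) Ni(1) by simp
  finally have "vec_norm2 (Ni *\<^sub>v e) \<le> fro (Ni * Mi) * vec_norm2 (M0 *\<^sub>v e)"
    using vec_norm2_mult_fro[of "Ni * Mi" n n "M0 *\<^sub>v e"] Ni Mi Me by simp
  also have "\<dots> \<le> ci * vec_norm2 (M0 *\<^sub>v e)" using ci by (intro mult_right_mono) auto
  finally have "vec_norm2 (Ni *\<^sub>v e) powr a \<le> (ci * vec_norm2 (M0 *\<^sub>v e)) powr a" using a1 by (intro powr_mono2) auto
  also have "\<dots> = ci powr a * vec_norm2 (M0 *\<^sub>v e) powr a" using ci_nonneg by (simp add: powr_mult)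
  finally have "ennreal (vec_norm2 (Ni *\<^sub>v e) powr a) \<le> ennreal (ci powr a) * ennreal (vec_norm2 (M0 *\<^sub>v e) powr a)"
    by (simp add: ennreal_leI flip: ennreal_mult)
  also have "\<dots> \<le> ennreal (ci powr a) * (ennreal (2 powr a) * (\<integral>\<^sup>+x. ennreal (vec_norm2 (wi x *\<^sub>v e) powr a) \<partial>M))"
    using a1 by (intro mult_left_mono mean_powr_le vec_norm2_mat_mean_le wi_int e borel_measurable_mat_vec_norm2[OF wi_meas]) auto
  also have "\<dots> = ennreal ((2 * ci) powr a) * (\<integral>\<^sup>+x. ennreal (vec_norm2 (wi x *\<^sub>v e) powr a) \<partial>M)"
    using ci_nonneg by (simp add: powr_mult ennreal_mult mult_ac)
  finally show ?thesis .
qed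

end

section \<open>Calderon-Zygmund decomposition\<close>

text \<open>Half-open cubes, because dyadic ones then partition exactly. They differ from the closed
  cubes of the definitions by null sets, so that averages agree (\<open>avg_hcube\<close>).\<close>

definition hcube :: "real^'d \<Rightarrow> real \<Rightarrow> (real^'d) set" where
  "hcube a l = {y. \<forall>i. vec_nth a i \<le> vec_nth y i \<and> vec_nth y i < vec_nth a i + l}"

lemma vec_nth_One [simp]: "vec_nth (One :: real^'d) i = 1"
proof -
  have "inner (One :: real^'d) (axis i (1 :: real)) = 1"
    using inner_sum_Basis[of "axis i (1 :: real) :: real^'d"] by (simp add: axis_in_Basis_iff del: sum_component)
  then show ?thesis by (simp add: inner_axis del: sum_component)
qed

lemma cube_mem_iff: "y \<in> cbox a (a + l *\<^sub>R One) \<longleftrightarrow> (\<forall>i. vec_nth a i \<le> vec_nth y i \<and> vec_nth y i \<le> vec_nth a i + l)"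
  for a y :: "real^'d"
  by (simp add: mem_box_cart del: sum_component)

lemma open_cube_mem_iff: "y \<in> box a (a + l *\<^sub>R One) \<longleftrightarrow> (\<forall>i. vec_nth a i < vec_nth y i \<and> vec_nth y i < vec_nth a i + l)"
  for a y :: "real^'d"
  by (simp add: mem_box_cart del: sum_component)

lemma hcube_subset: "hcube a l \<subseteq> cbox a (a + l *\<^sub>R One)"
  by (auto simp: hcube_def cube_mem_iff less_imp_le)

lemma hcube_sets [measurable, simp]: "hcube a l \<in> sets lebesgue"
proof -
  have "hcube a l = (\<Inter>i. {y. vec_nth a i \<le> vec_nth y i} \<inter> {y. vec_nth y i < vec_nth a i + l})"
    by (auto simp: hcube_def)
  also have "\<dots> \<in> sets borel"
    by (intro sets.finite_INT sets.Int borel_closed borel_open closed_Collect_le open_Collect_less continuous_intros) auto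
  finally show ?thesis by simp
qed

lemma cube_diff_null: "cbox a (a + l *\<^sub>R One) - box a (a + l *\<^sub>R One) \<in> null_sets lebesgue"
  for a :: "real^'d"
  using negligible_frontier_interval negligible_iff_null_sets by blast

lemma AE_hcube_iff: "AE x in lebesgue. x \<in> hcube a l \<longleftrightarrow> x \<in> cbox a (a + l *\<^sub>R One)"
proof -
  have "AE x in lebesgue. x \<notin> cbox a (a + l *\<^sub>R One) - box a (a + l *\<^sub>R One)"
    using AE_not_in[OF cube_diff_null] .
  then show ?thesis
  proof eventually_elim
    case (elim x)
    show ?case
    proof
      assume "x \<in> cbox a (a + l *\<^sub>R One)"
      with elim have "x \<in> box a (a + l *\<^sub>R One)" by simp
      then show "x \<in> hcube a l" unfolding open_cube_mem_iff by (auto simp: hcube_def less_imp_le)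
    qed (use hcube_subset in blast)
  qed
qed

lemma emeasure_cube:
  fixes a :: "real^'d"
  assumes "0 < l"
  shows "emeasure lebesgue (cbox a (a + l *\<^sub>R One)) = ennreal (l ^ CARD('d))"
proof -
  have "emeasure lebesgue (cbox a (a + l *\<^sub>R One)) = emeasure lborel (cbox a (a + l *\<^sub>R One))" by simp
  also have "\<dots> = ennreal (\<Prod>b\<in>Basis. inner (a + l *\<^sub>R One - a) b)"
    using assms by (intro emeasure_lborel_cbox) (auto simp: inner_add_left)
  also have "(\<Prod>b\<in>Basis. inner (a + l *\<^sub>R One - a) b) = l ^ CARD('d)" by simp
  finally show ?thesis .
qed

lemma emeasure_hcube: "0 < l \<Longrightarrow> emeasure lebesgue (hcube a l) = ennreal (l ^ CARD('d))"
  for a :: "real^'d"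
  using emeasure_cube[of l a] emeasure_eq_AE[OF AE_hcube_iff, of a l] by simp

lemma avg_hcube: "avg (hcube a l) g = avg (cbox a (a + l *\<^sub>R One)) g" if "0 < l"
proof -
  have "(\<integral>\<^sup>+x\<in>hcube a l. g x \<partial>lebesgue) = (\<integral>\<^sup>+x\<in>cbox a (a + l *\<^sub>R One). g x \<partial>lebesgue)"
    by (rule nn_integral_cong_AE) (use AE_hcube_iff in eventually_elim, auto simp: indicator_def)
  then show ?thesis unfolding avg_def emeasure_hcube[OF that] emeasure_cube[OF that] by simp
qed

text \<open>The lattice position of y at generation k. With dyadic cubes defined as fibres of this
  map, the partition property is immediate, and passing to the parent cube is integer division by
  2.\<close>

definition dyadic_index :: "real^'d \<Rightarrow> real \<Rightarrow> nat \<Rightarrow> real^'d \<Rightarrow> 'd \<Rightarrow> int" where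
  "dyadic_index a l k y i = \<lfloor>2 ^ k * ((vec_nth y i - vec_nth a i) / l)\<rfloor>"

definition dyadic_cube :: "real^'d \<Rightarrow> real \<Rightarrow> nat \<Rightarrow> real^'d \<Rightarrow> (real^'d) set" where
  "dyadic_cube a l k x = {y. dyadic_index a l k y = dyadic_index a l k x}"

lemma dyadic_cube_self: "x \<in> dyadic_cube a l k x"
  by (simp add: dyadic_cube_def)

lemma dyadic_cube_cong: "y \<in> dyadic_cube a l k x \<Longrightarrow> dyadic_cube a l k y = dyadic_cube a l k x"
  by (auto simp: dyadic_cube_def)

lemma dyadic_index_Suc: "dyadic_index a l k y i = dyadic_index a l (Suc k) y i div 2"
proof -
  have "\<lfloor>r\<rfloor> = \<lfloor>2 * r\<rfloor> div 2" for r :: real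
  proof -
    have "\<lfloor>(2 * r) / real_of_int 2\<rfloor> = \<lfloor>2 * r\<rfloor> div 2" by (rule floor_divide_real_eq_div) simp
    moreover have "(2 * r) / real_of_int 2 = r" by simp
    ultimately show ?thesis by (simp only:)
  qed
  then show ?thesis unfolding dyadic_index_def power_Suc mult.assoc .
qed

lemma dyadic_cube_Suc: "dyadic_cube a l (Suc k) x \<subseteq> dyadic_cube a l k x"
proof
  fix y assume "y \<in> dyadic_cube a l (Suc k) x"
  then have "dyadic_index a l k y i = dyadic_index a l k x i" for i
    unfolding dyadic_index_Suc[of a l k y] dyadic_index_Suc[of a l k x] by (simp add: dyadic_cube_def)
  then show "y \<in> dyadic_cube a l k x" by (auto simp: dyadic_cube_def)
qed

lemma dyadic_cube_antimono: "j \<le> k \<Longrightarrow> dyadic_cube a l k x \<subseteq> dyadic_cube a l j x"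
  by (rule lift_Suc_antimono_le[of "\<lambda>k. dyadic_cube a l k x"]) (rule dyadic_cube_Suc)

lemma dyadic_cube_hcube:
  assumes "0 < l"
  shows "dyadic_cube a l k x = hcube (vec_lambda (\<lambda>i. vec_nth a i + l / 2 ^ k * of_int (dyadic_index a l k x i))) (l / 2 ^ k)"
proof -
  have e: "(dyadic_index a l k y i = z) \<longleftrightarrow>
     (vec_nth a i + l / 2 ^ k * of_int z \<le> vec_nth y i \<and> vec_nth y i < vec_nth a i + l / 2 ^ k * of_int z + l / 2 ^ k)" for y i z
  proof -
    have "(dyadic_index a l k y i = z) \<longleftrightarrow> (of_int z \<le> 2 ^ k * ((vec_nth y i - vec_nth a i) / l) \<and> 2 ^ k * ((vec_nth y i - vec_nth a i) / l) < of_int z + 1)"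
      unfolding dyadic_index_def floor_eq_iff ..
    also have "of_int z \<le> 2 ^ k * ((vec_nth y i - vec_nth a i) / l) \<longleftrightarrow> vec_nth a i + l / 2 ^ k * of_int z \<le> vec_nth y i"
      using assms by (simp add: field_simps)
    also have "2 ^ k * ((vec_nth y i - vec_nth a i) / l) < of_int z + 1 \<longleftrightarrow> vec_nth y i < vec_nth a i + l / 2 ^ k * of_int z + l / 2 ^ k"
      using assms by (simp add: field_simps)
    finally show ?thesis .
  qed
  show ?thesis by (auto simp: dyadic_cube_def hcube_def fun_eq_iff e)
qed

lemma dyadic_cube_sets [measurable, simp]: "0 < l \<Longrightarrow> dyadic_cube a l k x \<in> sets lebesgue"
  by (simp add: dyadic_cube_hcube)

lemma emeasure_dyadic_cube: "0 < l \<Longrightarrow> emeasure lebesgue (dyadic_cube a l k x) = ennreal ((l / 2 ^ k) ^ CARD('d))"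
  for a x :: "real^'d"
  unfolding dyadic_cube_hcube by (rule emeasure_hcube) simp

lemma dyadic_cube_0:
  assumes "0 < l" "x \<in> hcube a l"
  shows "dyadic_cube a l 0 x = hcube a l"
proof -
  have "dyadic_index a l 0 x i = 0" for i
    using assms by (auto simp: dyadic_index_def hcube_def floor_eq_iff field_simps)
  then show ?thesis by (simp add: dyadic_cube_hcube[OF assms(1)])
qed

lemma dyadic_cube_subset: "0 < l \<Longrightarrow> x \<in> hcube a l \<Longrightarrow> dyadic_cube a l k x \<subseteq> hcube a l"
  using dyadic_cube_antimono[of 0 k a l x] dyadic_cube_0[of l x a] by simp

lemma countable_dyadic_cubes: "countable (range (\<lambda>(k, x). dyadic_cube a l k x))" for a :: "real^'d"
proof (rule countable_subset)
  show "range (\<lambda>(k, x). dyadic_cube a l k x) \<subseteq> range (\<lambda>(k, f :: 'd \<Rightarrow> int). {y. dyadic_index a l k y = f})"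
    by (auto simp: dyadic_cube_def)
  show "countable (range (\<lambda>(k, f :: 'd \<Rightarrow> int). {y. dyadic_index a l k y = f}))" by (rule countableI_type[THEN countable_image])
qed

lemma dyadic_cube_small:
  fixes a x :: "real^'d"
  assumes l: "0 < l" and T: "open T" "x \<in> T"
  shows "\<exists>k. dyadic_cube a l k x \<subseteq> T"
proof -
  obtain r where r: "0 < r" "ball x r \<subseteq> T" using T by (auto simp: open_contains_ball)
  define d where "d = real CARD('d) * l"
  have d: "0 < d" using l by (simp add: d_def)
  obtain k where k: "(1 / 2) ^ k < r / d" using real_arch_pow_inv[of "r / d" "1 / 2"] r d by auto
  have "dyadic_cube a l k x \<subseteq> ball x r"
  proof
    fix y assume y: "y \<in> dyadic_cube a l k x"
    let ?c = "\<lambda>i. vec_nth a i + l / 2 ^ k * of_int (dyadic_index a l k x i)"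
    have "\<bar>vec_nth (x - y) i\<bar> \<le> l / 2 ^ k" for i
    proof -
      have "?c i \<le> vec_nth y i" "vec_nth y i < ?c i + l / 2 ^ k" "?c i \<le> vec_nth x i" "vec_nth x i < ?c i + l / 2 ^ k"
        using y dyadic_cube_self[of x a l k] unfolding dyadic_cube_hcube[OF l] hcube_def by auto
      then show ?thesis unfolding vector_minus_component abs_le_iff by linarith
    qed
    then have "norm (x - y) \<le> (\<Sum>i\<in>(UNIV :: 'd set). l / 2 ^ k)"
      by (intro order_trans[OF norm_le_l1_cart] sum_mono)
    also have "\<dots> = d * (1 / 2) ^ k" by (simp add: d_def power_divide)
    also have "\<dots> < r" using k d by (simp add: field_simps)
    finally show "y \<in> ball x r" by (simp add: dist_norm)
  qed
  with r show ?thesis by blast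
qed

text \<open>P depends on the cube only, so taking at each point the least k with P selects maximal
  cubes. If two selected cubes meet, the larger one contains the other and satisfies P, so
  minimality of k makes them equal. The predicate is left abstract because the selection is made
  twice: by inclusion in an open set, and by size of an average.\<close>

lemma dyadic_stopping:
  fixes a :: "real^'d"
  assumes l: "0 < l" and P: "\<And>k x y. y \<in> dyadic_cube a l k x \<Longrightarrow> P k y = P k x"
  obtains \<J> where "countable \<J>" "disjoint \<J>" "\<Union>\<J> = {x \<in> hcube a l. \<exists>k. P k x}"
    "\<And>J. J \<in> \<J> \<Longrightarrow> \<exists>k x. x \<in> hcube a l \<and> J = dyadic_cube a l k x \<and> P k x \<and> (\<forall>j<k. \<not> P j x)"
proof -
  define B where "B = {x \<in> hcube a l. \<exists>k. P k x}"
  define \<kappa> where "\<kappa> = (\<lambda>x. LEAST k. P k x)"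
  have \<kappa>: "P (\<kappa> x) x" "\<And>j. j < \<kappa> x \<Longrightarrow> \<not> P j x" if "x \<in> B" for x
  proof -
    have "\<exists>k. P k x" using that by (simp add: B_def)
    then show "P (\<kappa> x) x" unfolding \<kappa>_def by (rule LeastI_ex)
    show "\<not> P j x" if "j < \<kappa> x" for j using that unfolding \<kappa>_def by (rule not_less_Least)
  qed
  have \<kappa>_le: "P j x \<Longrightarrow> \<kappa> x \<le> j" for j x unfolding \<kappa>_def by (rule Least_le)
  define \<J> where "\<J> = (\<lambda>x. dyadic_cube a l (\<kappa> x) x) ` B"
  have eq: "dyadic_cube a l (\<kappa> x) x = dyadic_cube a l (\<kappa> y) y"
    if xy: "x \<in> B" "y \<in> B" and z: "z \<in> dyadic_cube a l (\<kappa> x) x" "z \<in> dyadic_cube a l (\<kappa> y) y" and le: "\<kappa> x \<le> \<kappa> y" for x y z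
  proof -
    have "dyadic_cube a l (\<kappa> y) y = dyadic_cube a l (\<kappa> y) z" using dyadic_cube_cong[OF z(2)] ..
    also have "\<dots> \<subseteq> dyadic_cube a l (\<kappa> x) z" by (rule dyadic_cube_antimono[OF le])
    also have "\<dots> = dyadic_cube a l (\<kappa> x) x" by (rule dyadic_cube_cong[OF z(1)])
    finally have y: "y \<in> dyadic_cube a l (\<kappa> x) x" using dyadic_cube_self by blast
    then have "P (\<kappa> x) y" using P[OF y] \<kappa>(1)[OF xy(1)] by simp
    then have "\<kappa> y = \<kappa> x" using \<kappa>_le le by (simp add: antisym)
    then show ?thesis using dyadic_cube_cong[OF y] by simp
  qed
  show thesis
  proof
    have "\<J> \<subseteq> range (\<lambda>(k, x). dyadic_cube a l k x)" by (auto simp: \<J>_def)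
    then show "countable \<J>" using countable_dyadic_cubes by (rule countable_subset)
    show "disjoint \<J>"
    proof (rule disjointI)
      fix J J' assume J: "J \<in> \<J>" "J' \<in> \<J>" "J \<noteq> J'"
      then obtain x y where xy: "x \<in> B" "y \<in> B" "J = dyadic_cube a l (\<kappa> x) x" "J' = dyadic_cube a l (\<kappa> y) y"
        by (auto simp: \<J>_def)
      show "J \<inter> J' = {}"
      proof (rule ccontr)
        assume "J \<inter> J' \<noteq> {}"
        then obtain z where "z \<in> dyadic_cube a l (\<kappa> x) x" "z \<in> dyadic_cube a l (\<kappa> y) y" using xy by auto
        then have "J = J'" using eq[of x y z] eq[of y x z] xy by (cases "\<kappa> x \<le> \<kappa> y") auto
        with J show False by simp
      qed
    qed
    show "\<Union>\<J> = {x \<in> hcube a l. \<exists>k. P k x}"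
    proof (intro equalityI subsetI)
      fix z assume "z \<in> \<Union>\<J>"
      then obtain x where x: "x \<in> B" "z \<in> dyadic_cube a l (\<kappa> x) x" by (auto simp: \<J>_def)
      have "P (\<kappa> x) z" using P[OF x(2)] \<kappa>(1)[OF x(1)] by simp
      moreover have "z \<in> hcube a l" using x dyadic_cube_subset[OF l, of x a "\<kappa> x"] by (auto simp: B_def)
      ultimately show "z \<in> {x \<in> hcube a l. \<exists>k. P k x}" by auto
    next
      fix z assume "z \<in> {x \<in> hcube a l. \<exists>k. P k x}"
      then have "z \<in> B" by (simp add: B_def)
      then show "z \<in> \<Union>\<J>" unfolding \<J>_def using dyadic_cube_self[of z a l "\<kappa> z"] by blast
    qed
    fix J assume "J \<in> \<J>"
    then obtain x where "x \<in> B" "J = dyadic_cube a l (\<kappa> x) x" by (auto simp: \<J>_def)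
    then show "\<exists>k x. x \<in> hcube a l \<and> J = dyadic_cube a l k x \<and> P k x \<and> (\<forall>j<k. \<not> P j x)"
      using \<kappa>[of x] unfolding B_def by blast
  qed
qed

text \<open>Countable additivity of the measure with density f.\<close>

lemma nn_integral_disjoint_Union:
  assumes \<J>: "countable \<J>" "disjoint \<J>" "\<And>J. J \<in> \<J> \<Longrightarrow> J \<in> sets M" and f: "f \<in> borel_measurable M"
  shows "(\<integral>\<^sup>+x\<in>\<Union>\<J>. f x \<partial>M) = (\<integral>\<^sup>+J. (\<integral>\<^sup>+x\<in>J. f x \<partial>M) \<partial>count_space \<J>)"
proof -
  have U: "\<Union>\<J> \<in> sets M" using \<J> by (intro sets.countable_Union) auto
  have "(\<integral>\<^sup>+x\<in>\<Union>\<J>. f x \<partial>M) = emeasure (density M f) (\<Union>J\<in>\<J>. J)"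
    using f U by (simp add: emeasure_density)
  also have "\<dots> = (\<integral>\<^sup>+J. emeasure (density M f) J \<partial>count_space \<J>)"
    using \<J> by (intro emeasure_UN_countable) (auto simp: disjoint_family_on_def disjoint_def)
  also have "\<dots> = (\<integral>\<^sup>+J. (\<integral>\<^sup>+x\<in>J. f x \<partial>M) \<partial>count_space \<J>)"
    using \<J> f by (intro nn_integral_cong) (simp add: emeasure_density)
  finally show ?thesis .
qed

lemma emeasure_disjoint_Union:
  assumes \<J>: "countable \<J>" "disjoint \<J>" "\<And>J. J \<in> \<J> \<Longrightarrow> J \<in> sets M"
  shows "emeasure M (\<Union>\<J>) = (\<integral>\<^sup>+J. emeasure M J \<partial>count_space \<J>)"
  using emeasure_UN_countable[of \<J> "\<lambda>J. J" M] \<J> by (auto simp: disjoint_family_on_def disjoint_def)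

text \<open>Dyadic Lebesgue differentiation, by covering with maximal cubes inside an open set.\<close>

lemma dyadic_average_bound_null:
  fixes a :: "real^'d" and h :: "real^'d \<Rightarrow> ennreal"
  assumes l: "0 < l" and h: "h \<in> borel_measurable lebesgue" and S: "S \<in> sets lebesgue" "S \<subseteq> hcube a l"
    and c: "0 \<le> c" and e: "0 < e" and big: "\<And>x. x \<in> S \<Longrightarrow> ennreal (c + e) \<le> h x"
    and small: "\<And>x k. x \<in> S \<Longrightarrow> (\<integral>\<^sup>+y\<in>dyadic_cube a l k x. h y \<partial>lebesgue) \<le> ennreal c * emeasure lebesgue (dyadic_cube a l k x)"
  shows "S \<in> null_sets lebesgue"
proof -
  have fin: "emeasure lebesgue S < \<infinity>"
    using emeasure_mono[OF S(2) hcube_sets] unfolding emeasure_hcube[OF l] by (rule le_less_trans) simp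
  then obtain s where s: "emeasure lebesgue S = ennreal s" "0 \<le> s" by (cases "emeasure lebesgue S") auto
  \<comment> \<open>The integral of h over a cover of S by maximal cubes inside T is at least (c +
    e) * s, and cube by cube at most c times the measure of the cover, hence at most c * (s +
    \<delta>).\<close>
  have *: "e * s \<le> c * \<delta>" if \<delta>: "0 < \<delta>" for \<delta>
  proof -
    obtain T where T: "open T" "S \<subseteq> T" "emeasure lebesgue (T - S) < ennreal \<delta>"
      using sets_lebesgue_outer_open[OF S(1) \<delta>] by blast
    define P where "P = (\<lambda>k x. dyadic_cube a l k x \<subseteq> T \<and> dyadic_cube a l k x \<inter> S \<noteq> {})"
    obtain \<J> where \<J>: "countable \<J>" "disjoint \<J>" "\<Union>\<J> = {x \<in> hcube a l. \<exists>k. P k x}"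
      "\<And>J. J \<in> \<J> \<Longrightarrow> \<exists>k x. x \<in> hcube a l \<and> J = dyadic_cube a l k x \<and> P k x \<and> (\<forall>j<k. \<not> P j x)"
    proof (rule dyadic_stopping[OF l, of a P])
      show "P k y = P k x" if "y \<in> dyadic_cube a l k x" for k x y using dyadic_cube_cong[OF that] by (simp add: P_def)
    qed blast
    have Js: "J \<in> sets lebesgue" if "J \<in> \<J>" for J using \<J>(4)[OF that] l by auto
    have Us: "\<Union>\<J> \<in> sets lebesgue" using \<J>(1) Js by (intro sets.countable_Union) auto
    have "S \<subseteq> \<Union>\<J>"
    proof
      fix x assume x: "x \<in> S"
      obtain k where "dyadic_cube a l k x \<subseteq> T" using dyadic_cube_small[OF l T(1), of x a] x T(2) by auto
      then have "P k x" using x dyadic_cube_self[of x a l k] by (auto simp: P_def)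
      then show "x \<in> \<Union>\<J>" unfolding \<J>(3) using x S(2) by auto
    qed
    have UT: "\<Union>\<J> \<subseteq> T" unfolding \<J>(3) P_def using dyadic_cube_self by blast
    have "ennreal ((c + e) * s) = (\<integral>\<^sup>+x\<in>S. ennreal (c + e) \<partial>lebesgue)"
      using S c e s by (simp add: nn_integral_cmult_indicator ennreal_mult)
    also have "\<dots> \<le> (\<integral>\<^sup>+x\<in>\<Union>\<J>. h x \<partial>lebesgue)"
      using big \<open>S \<subseteq> \<Union>\<J>\<close> by (intro nn_integral_mono) (auto simp: indicator_def)
    also have "\<dots> = (\<integral>\<^sup>+J. (\<integral>\<^sup>+x\<in>J. h x \<partial>lebesgue) \<partial>count_space \<J>)"
      by (rule nn_integral_disjoint_Union[OF \<J>(1,2) Js h])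
    also have "\<dots> \<le> (\<integral>\<^sup>+J. ennreal c * emeasure lebesgue J \<partial>count_space \<J>)"
    proof (rule nn_integral_mono)
      fix J assume "J \<in> space (count_space \<J>)"
      then have "J \<in> \<J>" by simp
      then obtain k x where J: "J = dyadic_cube a l k x" "P k x" using \<J>(4) by blast
      then obtain y where y: "y \<in> dyadic_cube a l k x" "y \<in> S" by (auto simp: P_def)
      show "(\<integral>\<^sup>+x\<in>J. h x \<partial>lebesgue) \<le> ennreal c * emeasure lebesgue J"
        using small[OF y(2), of k] dyadic_cube_cong[OF y(1)] J by simp
    qed
    also have "\<dots> = ennreal c * (\<integral>\<^sup>+J. emeasure lebesgue J \<partial>count_space \<J>)"
      by (rule nn_integral_cmult) simp
    also have "(\<integral>\<^sup>+J. emeasure lebesgue J \<partial>count_space \<J>) = emeasure lebesgue (\<Union>\<J>)"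
      by (rule emeasure_disjoint_Union[OF \<J>(1,2) Js, symmetric])
    also have "emeasure lebesgue (\<Union>\<J>) \<le> emeasure lebesgue (S \<union> (T - S))"
      using UT S T by (intro emeasure_mono) auto
    also have "\<dots> \<le> emeasure lebesgue S + emeasure lebesgue (T - S)"
      using S T by (intro emeasure_subadditive) auto
    also have "\<dots> \<le> ennreal s + ennreal \<delta>" unfolding s using T(3) by (intro add_left_mono) simp
    finally have "ennreal ((c + e) * s) \<le> ennreal (c * (s + \<delta>))"
      using c s \<delta> by (simp add: ennreal_mult ennreal_plus mult_left_mono)
    then have "(c + e) * s \<le> c * (s + \<delta>)" using c s \<delta> by (subst (asm) ennreal_le_iff) auto
    then show ?thesis by (simp add: algebra_simps)
  qed
  have "s = 0"
  proof (rule ccontr)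
    assume "s \<noteq> 0"
    then have sp: "0 < s" using s by simp
    \<comment> \<open>Small enough that c * \<delta> < e * s, in contradiction to the estimate just
      proved; c + 1 instead of c admits c = 0.\<close>
    define \<delta> where "\<delta> = e * s / (2 * (c + 1))"
    have \<delta>: "0 < \<delta>" using e sp c by (simp add: \<delta>_def)
    have "c * \<delta> < (c + 1) * (2 * \<delta>)" using mult_nonneg_nonneg[OF c less_imp_le[OF \<delta>]] \<delta> by (simp add: algebra_simps)
    also have "(c + 1) * (2 * \<delta>) = e * s" using c by (simp add: \<delta>_def field_simps)
    finally show False using *[OF \<delta>] by simp
  qed
  then show ?thesis using s S by (simp add: null_sets_def)
qed

text \<open>Cubes are stopped when their average exceeds 2 * N. As the average over the whole cube
  is at most N, the stopped cubes fill at most half of it. The parent of a stopped cube is not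
  stopped, which costs the factor 2^d and explains 2 ^ Suc d. Off the stopped cubes all dyadic
  averages are at most 2 * N, hence so is h almost everywhere.\<close>

theorem calderon_zygmund_decomposition:
  fixes a :: "real^'d" and h :: "real^'d \<Rightarrow> real"
  assumes l: "0 < l" and h: "h \<in> borel_measurable lebesgue" and N: "0 < N"
    and int: "(\<integral>\<^sup>+x\<in>hcube a l. ennreal (h x) \<partial>lebesgue) \<le> ennreal N * emeasure lebesgue (hcube a l)"
  obtains \<J> where "countable \<J>" "disjoint \<J>"
    "\<And>J. J \<in> \<J> \<Longrightarrow> J \<subseteq> hcube a l \<and> (\<exists>a' l'. 0 < l' \<and> J = hcube a' l')"
    "\<And>J. J \<in> \<J> \<Longrightarrow> (\<integral>\<^sup>+x\<in>J. ennreal (h x) \<partial>lebesgue) \<le> ennreal (2 ^ Suc CARD('d) * N) * emeasure lebesgue J"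
    "emeasure lebesgue (\<Union>\<J>) \<le> emeasure lebesgue (hcube a l) / 2"
    "AE x in lebesgue. x \<in> hcube a l - \<Union>\<J> \<longrightarrow> h x \<le> 2 * N"
proof -
  let ?I = "\<lambda>J. \<integral>\<^sup>+x\<in>J. ennreal (h x) \<partial>lebesgue"
  define P where "P = (\<lambda>k x. ennreal (2 * N) * emeasure lebesgue (dyadic_cube a l k x) < ?I (dyadic_cube a l k x))"
  obtain \<J> where \<J>: "countable \<J>" "disjoint \<J>" "\<Union>\<J> = {x \<in> hcube a l. \<exists>k. P k x}"
    "\<And>J. J \<in> \<J> \<Longrightarrow> \<exists>k x. x \<in> hcube a l \<and> J = dyadic_cube a l k x \<and> P k x \<and> (\<forall>j<k. \<not> P j x)"
  proof (rule dyadic_stopping[OF l, of a P])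
    show "P k y = P k x" if "y \<in> dyadic_cube a l k x" for k x y using dyadic_cube_cong[OF that] by (simp add: P_def)
  qed blast
  have Js: "J \<in> sets lebesgue" if "J \<in> \<J>" for J using \<J>(4)[OF that] l by auto
  have Us: "\<Union>\<J> \<in> sets lebesgue" using \<J>(1) Js by (intro sets.countable_Union) auto
  have h': "(\<lambda>x. ennreal (h x)) \<in> borel_measurable lebesgue" using h by simp
  show thesis
  proof (rule that[OF \<J>(1,2)])
    fix J assume J: "J \<in> \<J>"
    then obtain k x where kx: "x \<in> hcube a l" "J = dyadic_cube a l k x" "P k x" "\<forall>j<k. \<not> P j x" using \<J>(4) by blast
    show "J \<subseteq> hcube a l \<and> (\<exists>a' l'. 0 < l' \<and> J = hcube a' l')"
    proof
      show "J \<subseteq> hcube a l" unfolding kx(2) by (rule dyadic_cube_subset[OF l kx(1)])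
      show "\<exists>a' l'. 0 < l' \<and> J = hcube a' l'"
        unfolding kx(2) dyadic_cube_hcube[OF l] using l by (intro exI conjI) (rule divide_pos_pos, auto)
    qed
    \<comment> \<open>The starting cube itself is not stopped, so every stopped cube has a parent
      inside it.\<close>
    have "\<not> P 0 x"
    proof -
      have "ennreal N * emeasure lebesgue (hcube a l) \<le> ennreal (2 * N) * emeasure lebesgue (hcube a l)"
        using N by (intro mult_right_mono ennreal_leI) auto
      then show ?thesis unfolding P_def dyadic_cube_0[OF l kx(1)] using int by (simp add: not_less)
    qed
    then have "k \<noteq> 0" using kx(3) by (cases k) auto
    then obtain j where j: "k = Suc j" using not0_implies_Suc by blast
    have "?I J \<le> ?I (dyadic_cube a l j x)"
      using dyadic_cube_Suc[of a l j x] unfolding kx(2) j by (intro nn_integral_mono) (auto simp: indicator_def)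
    also have "\<dots> \<le> ennreal (2 * N) * emeasure lebesgue (dyadic_cube a l j x)"
      using kx(4) j by (auto simp: P_def not_less)
    also have "\<dots> = ennreal (2 ^ Suc CARD('d) * N) * emeasure lebesgue J"
    proof -
      have "(l / 2 ^ j) ^ CARD('d) = 2 ^ CARD('d) * (l / 2 ^ k) ^ CARD('d)"
        unfolding j by (simp add: power_mult_distrib[symmetric])
      then show ?thesis unfolding kx(2) emeasure_dyadic_cube[OF l] using N l
        by (simp add: mult_ac flip: ennreal_mult)
    qed
    finally show "?I J \<le> ennreal (2 ^ Suc CARD('d) * N) * emeasure lebesgue J" .
  next
    have "ennreal (2 * N) * emeasure lebesgue (\<Union>\<J>) = (\<integral>\<^sup>+J. ennreal (2 * N) * emeasure lebesgue J \<partial>count_space \<J>)"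
    proof -
      have "emeasure lebesgue (\<Union>\<J>) = (\<integral>\<^sup>+J. emeasure lebesgue J \<partial>count_space \<J>)"
        by (rule emeasure_disjoint_Union[OF \<J>(1,2) Js])
      then show ?thesis using nn_integral_cmult[of "\<lambda>J. emeasure lebesgue J" "count_space \<J>" "ennreal (2 * N)"] by simp
    qed
    also have "\<dots> \<le> (\<integral>\<^sup>+J. ?I J \<partial>count_space \<J>)"
    proof (rule nn_integral_mono)
      fix J assume "J \<in> space (count_space \<J>)"
      then have "J \<in> \<J>" by simp
      then obtain k x where "J = dyadic_cube a l k x" "P k x" using \<J>(4) by blast
      then show "ennreal (2 * N) * emeasure lebesgue J \<le> ?I J" by (simp only: P_def less_imp_le)
    qed
    also have "\<dots> = ?I (\<Union>\<J>)" by (rule nn_integral_disjoint_Union[OF \<J>(1,2) Js h', symmetric])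
    also have "\<dots> \<le> ?I (hcube a l)" unfolding \<J>(3) by (intro nn_integral_mono) (auto simp: indicator_def)
    also note int
    finally have *: "ennreal (2 * N) * emeasure lebesgue (\<Union>\<J>) \<le> ennreal N * emeasure lebesgue (hcube a l)" .
    have "emeasure lebesgue (\<Union>\<J>) = ennreal (1 / (2 * N)) * (ennreal (2 * N) * emeasure lebesgue (\<Union>\<J>))"
      using N by (simp add: mult.assoc[symmetric] flip: ennreal_mult)
    also have "\<dots> \<le> ennreal (1 / (2 * N)) * (ennreal N * emeasure lebesgue (hcube a l))" using * by (rule mult_left_mono) simp
    also have "\<dots> = ennreal (l ^ CARD('d) / 2)"
      unfolding emeasure_hcube[OF l] using N l by (simp flip: ennreal_mult)
    also have "\<dots> = emeasure lebesgue (hcube a l) / 2"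
      unfolding emeasure_hcube[OF l] using l divide_ennreal[of "l ^ CARD('d)" 2] by simp
    finally show "emeasure lebesgue (\<Union>\<J>) \<le> emeasure lebesgue (hcube a l) / 2" .
  next
    define S where "S = (\<lambda>m. {x \<in> hcube a l - \<Union>\<J>. 2 * N + 1 / real (Suc m) \<le> h x})"
    have "S m \<in> null_sets lebesgue" for m
    proof (rule dyadic_average_bound_null[OF l h', where c = "2 * N" and e = "1 / real (Suc m)" and a = a])
      have "S m = (hcube a l - \<Union>\<J>) \<inter> {x \<in> space lebesgue. 2 * N + 1 / real (Suc m) \<le> h x}" by (auto simp: S_def)
      then show "S m \<in> sets lebesgue" using Us h by simp
      show "S m \<subseteq> hcube a l" by (auto simp: S_def)
      fix x assume x: "x \<in> S m"
      then show "ennreal (2 * N + 1 / real (Suc m)) \<le> ennreal (h x)" by (intro ennreal_leI) (simp add: S_def)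
      fix k
      have "\<not> P k x" using x \<J>(3) by (auto simp: S_def)
      then show "?I (dyadic_cube a l k x) \<le> ennreal (2 * N) * emeasure lebesgue (dyadic_cube a l k x)"
        by (simp add: P_def not_less)
    qed (use N in auto)
    then have "(\<Union>m. S m) \<in> null_sets lebesgue" by (intro null_sets_UN) auto
    then have "AE x in lebesgue. x \<notin> (\<Union>m. S m)" by (rule AE_not_in)
    then show "AE x in lebesgue. x \<in> hcube a l - \<Union>\<J> \<longrightarrow> h x \<le> 2 * N"
    proof eventually_elim
      case (elim x)
      show ?case
      proof (intro impI, rule ccontr)
        assume x: "x \<in> hcube a l - \<Union>\<J>" "\<not> h x \<le> 2 * N"
        obtain m where "inverse (real (Suc m)) < h x - 2 * N" using reals_Archimedean[of "h x - 2 * N"] x(2) by auto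
        then have "x \<in> S m" using x by (auto simp: S_def inverse_eq_divide)
        with elim show False by auto
      qed
    qed
  qed
qed

section \<open>John-Nirenberg iteration\<close>

text \<open>The coefficient \<kappa> of the main term may be taken as close to 1 as desired; only
  the coefficient of the error y grows. The iteration requires this, since its contraction factor
  leaves little room. The two cases are y \<le> \<delta> x and x < y / \<delta>, where (1 +
  \<delta>)^s = \<kappa>.\<close>

lemma powr_add_le_weighted:
  fixes x y s \<kappa> :: real
  assumes "0 \<le> x" "0 \<le> y" "0 < s" "1 < \<kappa>"
  shows "(x + y) powr s \<le> \<kappa> * x powr s + (1 / (\<kappa> powr (1 / s) - 1) + 1) powr s * y powr s"
proof -
  define \<delta> where "\<delta> = \<kappa> powr (1 / s) - 1"
  have \<delta>: "0 < \<delta>" "(1 + \<delta>) powr s = \<kappa>" using assms by (simp_all add: \<delta>_def powr_powr)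
  show ?thesis
  proof (cases "y \<le> \<delta> * x")
    case True
    then have "(x + y) powr s \<le> ((1 + \<delta>) * x) powr s" using assms by (intro powr_mono2) (auto simp: algebra_simps)
    also have "\<dots> = \<kappa> * x powr s" using assms \<delta> by (simp add: powr_mult)
    finally show ?thesis by (simp add: add_increasing2)
  next
    case False
    then have "x \<le> y / \<delta>" using \<delta> by (simp add: field_simps)
    then have "(x + y) powr s \<le> ((1 / \<delta> + 1) * y) powr s" using assms by (intro powr_mono2) (auto simp: algebra_simps)
    also have "\<dots> = (1 / \<delta> + 1) powr s * y powr s" using assms \<delta> by (simp add: powr_mult)
    finally show ?thesis using assms unfolding \<delta>_def by (simp add: add_increasing)
  qed
qed

section \<open>The normalised measure on a cube\<close>

abbreviation avg_measure :: "(real^'d) set \<Rightarrow> (real^'d) measure" where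
  "avg_measure Q \<equiv> uniform_measure lebesgue Q"

definition hcubes :: "(real^'d) set set" where
  "hcubes = {hcube a l | a l. 0 < l}"

lemma hcubeI: "0 < l \<Longrightarrow> hcube a l \<in> hcubes"
  by (auto simp: hcubes_def)

lemma hcubesD:
  assumes "Q \<in> hcubes"
  shows "Q \<in> sets lebesgue" "emeasure lebesgue Q \<noteq> 0" "emeasure lebesgue Q \<noteq> \<infinity>" "0 < measure lebesgue Q"
    "emeasure lebesgue Q = ennreal (measure lebesgue Q)"
proof -
  obtain a :: "real^'a" and l where Q: "Q = hcube a l" "0 < l" using assms by (auto simp: hcubes_def)
  show "Q \<in> sets lebesgue" using Q by simp
  have e: "emeasure lebesgue Q = ennreal (l ^ CARD('a))" unfolding Q(1) by (rule emeasure_hcube[OF Q(2)])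
  show "emeasure lebesgue Q \<noteq> 0" "emeasure lebesgue Q \<noteq> \<infinity>" unfolding e using Q(2) by simp_all
  have m: "measure lebesgue Q = l ^ CARD('a)" unfolding measure_def e using Q(2) by simp
  show "0 < measure lebesgue Q" "emeasure lebesgue Q = ennreal (measure lebesgue Q)" unfolding e m using Q(2) by simp_all
qed

lemma prob_space_avg_measure: "Q \<in> hcubes \<Longrightarrow> prob_space (avg_measure Q)"
  using hcubesD by (intro prob_space_uniform_measure) auto

lemma nn_integral_avg_measure:
  assumes "Q \<in> hcubes" "f \<in> borel_measurable lebesgue"
  shows "(\<integral>\<^sup>+x. f x \<partial>avg_measure Q) = avg Q f"
  unfolding avg_def using assms hcubesD(1) by (intro nn_integral_uniform_measure) auto

lemma measurable_avg_measure [simp]: "borel_measurable (avg_measure Q) = borel_measurable lebesgue"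
  by (rule measurable_cong_sets) simp_all

lemma mat_measurable_avg_measure [simp]: "mat_measurable (avg_measure Q) n A = mat_measurable lebesgue n A"
  by (simp add: mat_measurable_def)

lemma avg_measure_density:
  assumes "Q \<in> hcubes"
  shows "avg_measure Q = density lebesgue (\<lambda>x. ennreal (indicator Q x / measure lebesgue Q))"
proof -
  have "indicator Q x / emeasure lebesgue Q = ennreal (indicator Q x / measure lebesgue Q)" for x
    unfolding hcubesD(5)[OF assms] using hcubesD(4)[OF assms]
    by (auto simp: indicator_def divide_ennreal[symmetric] simp flip: ennreal_1)
  then show ?thesis unfolding uniform_measure_def by simp
qed

lemma integral_avg_measure:
  fixes f :: "real^'d \<Rightarrow> complex"
  assumes Q: "Q \<in> hcubes" and f: "f \<in> borel_measurable lebesgue"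
  shows "(LINT x|avg_measure Q. f x) = (LINT x:Q|lebesgue. f x) /\<^sub>R measure lebesgue Q"
proof -
  have "(LINT x|avg_measure Q. f x) = (LINT x|lebesgue. (indicator Q x / measure lebesgue Q) *\<^sub>R f x)"
    unfolding avg_measure_density[OF Q] using f hcubesD[OF Q] by (intro integral_density) auto
  also have "\<dots> = (LINT x|lebesgue. inverse (measure lebesgue Q) *\<^sub>R (indicator Q x *\<^sub>R f x))"
    by (intro Bochner_Integration.integral_cong) (auto simp: divide_inverse mult.commute)
  also have "\<dots> = inverse (measure lebesgue Q) *\<^sub>R (LINT x|lebesgue. indicator Q x *\<^sub>R f x)"
    by (rule integral_scaleR_right)
  finally show ?thesis unfolding set_lebesgue_integral_def .
qed

lemma integrable_avg_measure:
  fixes f :: "real^'d \<Rightarrow> complex"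
  assumes Q: "Q \<in> hcubes" and f: "f \<in> borel_measurable lebesgue" and int: "set_integrable lebesgue Q f"
  shows "integrable (avg_measure Q) f"
proof -
  have "integrable lebesgue (\<lambda>x. inverse (measure lebesgue Q) *\<^sub>R (indicator Q x *\<^sub>R f x))"
    using int unfolding set_integrable_def by (intro integrable_scaleR_right) auto
  then have "integrable lebesgue (\<lambda>x. (indicator Q x / measure lebesgue Q) *\<^sub>R f x)"
    by (rule back_subst[of "integrable lebesgue"]) (auto simp: divide_inverse mult.commute)
  then show ?thesis
    unfolding avg_measure_density[OF Q] using f hcubesD[OF Q] by (subst integrable_density) auto
qed

lemma set_nn_integral_avg:
  assumes "Q \<in> hcubes"
  shows "(\<integral>\<^sup>+x\<in>Q. f x \<partial>lebesgue) = emeasure lebesgue Q * avg Q f"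
proof -
  have "emeasure lebesgue Q * avg Q f = (\<integral>\<^sup>+x\<in>Q. f x \<partial>lebesgue) * emeasure lebesgue Q / emeasure lebesgue Q"
    unfolding avg_def ennreal_times_divide by (simp only: mult.commute)
  also have "\<dots> = (\<integral>\<^sup>+x\<in>Q. f x \<partial>lebesgue)"
    using hcubesD(3,2)[OF assms] by (simp add: ennreal_mult_divide_eq del: emeasure_completion)
  finally show ?thesis ..
qed

lemma mat_avg_mean:
  assumes "Q \<in> hcubes" "mat_measurable lebesgue n A"
  shows "mat_avg n Q A = mat_mean (avg_measure Q) n A"
  using mat_measurableD(2)[OF assms(2)] by (intro eq_matI) (auto simp: mat_avg_def integral_avg_measure[OF assms(1)])

text \<open>Abstract, because it is instantiated twice: with v, u, B and exponent q, and with the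
  inverses of u and v, the adjoint of B and the conjugate exponent of p. P Q and R Q play the role
  of reducing matrices, with inverses P' Q and R' Q. \<open>u_half\<close> is the half-cube property
  proved above by transfer; it produces the contraction.\<close>

locale john_nirenberg_data =
  fixes n :: nat and v u B :: "real^'d \<Rightarrow> cmat" and P P' R R' :: "(real^'d) set \<Rightarrow> cmat"
    and s c2 c3 c4 N :: real
  assumes v: "mat_measurable lebesgue n v" and u: "mat_measurable lebesgue n u"
    and B: "mat_measurable lebesgue n B" and B_int: "\<And>Q. Q \<in> hcubes \<Longrightarrow> mat_integrable (avg_measure Q) n B"
    and P: "\<And>Q. Q \<in> hcubes \<Longrightarrow> P Q \<in> carrier_mat n n" "\<And>Q. Q \<in> hcubes \<Longrightarrow> P' Q \<in> carrier_mat n n"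
      "\<And>Q. Q \<in> hcubes \<Longrightarrow> P' Q * P Q = 1\<^sub>m n"
    and R: "\<And>Q. Q \<in> hcubes \<Longrightarrow> R Q \<in> carrier_mat n n" "\<And>Q. Q \<in> hcubes \<Longrightarrow> R' Q \<in> carrier_mat n n"
      "\<And>Q. Q \<in> hcubes \<Longrightarrow> R' Q * R Q = 1\<^sub>m n"
    and s: "1 < s" and c2: "0 < c2" and c3: "0 < c3" and c4: "2 \<le> c4" and N: "0 < N"
    and osc: "\<And>Q. Q \<in> hcubes \<Longrightarrow>
      avg Q (\<lambda>x. ennreal (fro (P Q * (B x - mat_mean (avg_measure Q) n B) * R' Q))) \<le> ennreal N"
    and v_avg: "\<And>Q. Q \<in> hcubes \<Longrightarrow> avg Q (\<lambda>x. ennreal (fro (v x * P' Q) powr s)) \<le> ennreal c2"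
    and u_avg: "\<And>Q e. Q \<in> hcubes \<Longrightarrow> e \<in> carrier_vec n \<Longrightarrow>
      ennreal (vec_norm2 (R Q *\<^sub>v e) powr s) \<le> ennreal c3 * avg Q (\<lambda>x. ennreal (vec_norm2 (u x *\<^sub>v e) powr s))"
    and u_fin: "\<And>Q e. Q \<in> hcubes \<Longrightarrow> e \<in> carrier_vec n \<Longrightarrow>
      (\<integral>\<^sup>+x\<in>Q. ennreal (vec_norm2 (u x *\<^sub>v e) powr s) \<partial>lebesgue) < \<infinity>"
    and u_half: "\<And>Q e F. Q \<in> hcubes \<Longrightarrow> e \<in> carrier_vec n \<Longrightarrow> F \<in> sets lebesgue \<Longrightarrow> F \<subseteq> Q \<Longrightarrow>
      emeasure lebesgue Q / 2 \<le> emeasure lebesgue F \<Longrightarrow>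
      (\<integral>\<^sup>+x\<in>Q. ennreal (vec_norm2 (u x *\<^sub>v e) powr s) \<partial>lebesgue)
        \<le> ennreal c4 * (\<integral>\<^sup>+x\<in>F. ennreal (vec_norm2 (u x *\<^sub>v e) powr s) \<partial>lebesgue)"
    and u_pos: "\<And>x e. e \<in> carrier_vec n \<Longrightarrow> e \<noteq> 0\<^sub>v n \<Longrightarrow> 0 < vec_norm2 (u x *\<^sub>v e)"
begin

abbreviation "mB Q \<equiv> mat_mean (avg_measure Q) n B"

text \<open>\<Lambda> bounds the averages over stopped cubes. By \<open>u_half\<close> at least the
  share 1 / c4 of the mass of u lies off them, so they carry at most the share \<gamma>. The factor
  \<kappa> > 1 is chosen with \<kappa> * \<gamma> = \<theta>, half way between \<gamma> and 1, and
  \<open>KK\<close> is the error coefficient that \<open>powr_add_le_weighted\<close> charges for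
  this \<kappa>.\<close>

definition "\<Lambda> = 2 ^ Suc CARD('d) * N"
definition "\<gamma> = 1 - 1 / c4"
definition "\<kappa> = (1 + \<gamma>) / (2 * \<gamma>)"
definition "\<theta> = (1 + \<gamma>) / 2"
definition "KK = (1 / (\<kappa> powr (1 / s) - 1) + 1) powr s"

lemma const_pos: "0 < \<gamma>" "\<gamma> < 1" "1 < \<kappa>" "\<theta> < 1" "0 < \<theta>" "1 \<le> KK" "\<kappa> * \<gamma> = \<theta>" "0 < \<Lambda>" "2 * N \<le> \<Lambda>"
proof -
  show g: "0 < \<gamma>" "\<gamma> < 1" using c4 by (auto simp: \<gamma>_def)
  then show k: "1 < \<kappa>" "\<theta> < 1" "0 < \<theta>" "\<kappa> * \<gamma> = \<theta>" by (auto simp: \<kappa>_def \<theta>_def field_simps)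
  have "0 < \<kappa> powr (1 / s) - 1" using k s by simp
  then have "1 powr s \<le> KK" unfolding KK_def using s by (intro powr_mono2) auto
  then show "1 \<le> KK" by simp
  show "0 < \<Lambda>" using N by (simp add: \<Lambda>_def)
  have "1 \<le> (2 :: real) ^ CARD('d)" by simp
  then show "2 * N \<le> \<Lambda>" unfolding \<Lambda>_def using N by simp
qed

lemma B_car: "B x \<in> carrier_mat n n" by (rule mat_measurableD(1)[OF B])
lemma v_car: "v x \<in> carrier_mat n n" by (rule mat_measurableD(1)[OF v])

context
  fixes e :: cvec
  assumes e: "e \<in> carrier_vec n" and e0: "e \<noteq> 0\<^sub>v n"
begin

definition "\<phi> x = vec_norm2 (u x *\<^sub>v e)"
definition "\<omega> F = (\<integral>\<^sup>+x\<in>F. ennreal (\<phi> x powr s) \<partial>lebesgue)"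
definition "f Q x = vec_norm2 ((v x * (B x - mB Q)) *\<^sub>v e)"
text \<open>The truncation gives a bound that is finite from the outset, \<mu>^s times \<omega> Q,
  which the iteration can then improve. It is made at a multiple of \<phi>, not at a constant, so
  that it does not depend on the cube and matches the measure \<omega> on every subcube.\<close>

definition "T \<mu> Q = (\<integral>\<^sup>+x\<in>Q. ennreal (min (f Q x) (\<mu> * \<phi> x) powr s) \<partial>lebesgue)"

lemma \<phi>_meas [measurable]: "\<phi> \<in> borel_measurable lebesgue"
  unfolding \<phi>_def by (rule borel_measurable_mat_vec_norm2[OF u e])

lemma \<phi>_pos: "0 < \<phi> x" unfolding \<phi>_def by (rule u_pos[OF e e0])

lemma f_nonneg [simp]: "0 \<le> f Q x" by (simp add: f_def)

lemma f_meas [measurable]: "f Q \<in> borel_measurable lebesgue"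
  unfolding f_def
  by (intro borel_measurable_mat_vec_norm2[of _ n] mat_measurable_mult v mat_measurable_minus B mat_measurable_const mat_mean_carrier e)

lemma \<omega>_fin: "Q \<in> hcubes \<Longrightarrow> \<omega> Q < \<infinity>"
  unfolding \<omega>_def \<phi>_def by (rule u_fin[OF _ e])

text \<open>The complement of U has at least half the measure of Q, so \<open>u_half\<close> leaves
  it at least the share 1 / c4 of the mass \<omega> Q. Finiteness of \<omega> Q permits the
  subtraction.\<close>

lemma stopping_omega:
  assumes Q: "Q \<in> hcubes" and U: "U \<in> sets lebesgue" "U \<subseteq> Q" "emeasure lebesgue U \<le> emeasure lebesgue Q / 2"
  shows "\<omega> U \<le> ennreal \<gamma> * \<omega> Q"
proof -
  have Qs: "Q \<in> sets lebesgue" by (rule hcubesD(1)[OF Q])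
  let ?q = "measure lebesgue Q"
  have q2: "emeasure lebesgue Q / 2 = ennreal (?q / 2)"
    unfolding hcubesD(5)[OF Q] using divide_ennreal[of ?q 2] hcubesD(4)[OF Q] by simp
  have Ule: "emeasure lebesgue U \<le> ennreal (?q / 2)" using U(3) unfolding q2 .
  then have Ufin: "emeasure lebesgue U \<noteq> \<infinity>" by (rule neq_top_trans[rotated, unfolded infinity_ennreal_def[symmetric]]) simp
  then obtain m where m: "emeasure lebesgue U = ennreal m" "0 \<le> m" by (cases "emeasure lebesgue U") auto
  have mq: "m \<le> ?q / 2" using Ule hcubesD(4)[OF Q] unfolding m by (subst (asm) ennreal_le_iff) auto
  have "emeasure lebesgue (Q - U) = emeasure lebesgue Q - emeasure lebesgue U"
    using emeasure_Diff[OF Ufin Qs U(1,2)] .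
  moreover have "emeasure lebesgue Q / 2 \<le> emeasure lebesgue Q - emeasure lebesgue U"
    unfolding q2 unfolding m hcubesD(5)[OF Q] ennreal_minus[OF m(2)] using mq by (intro ennreal_leI) simp
  ultimately have "\<omega> Q \<le> ennreal c4 * \<omega> (Q - U)"
    unfolding \<omega>_def \<phi>_def using U Qs by (intro u_half[OF Q e]) auto
  moreover have "\<omega> Q = \<omega> U + \<omega> (Q - U)"
  proof -
    have "\<omega> Q = (\<integral>\<^sup>+x. ennreal (\<phi> x powr s) * indicator U x + ennreal (\<phi> x powr s) * indicator (Q - U) x \<partial>lebesgue)"
      unfolding \<omega>_def using U(2) by (intro nn_integral_cong) (auto simp: indicator_def)
    also have "\<dots> = \<omega> U + \<omega> (Q - U)" unfolding \<omega>_def using U Qs by (intro nn_integral_add) auto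
    finally show ?thesis .
  qed
  moreover obtain x where x: "\<omega> U = ennreal x" "0 \<le> x"
    using \<omega>_fin[OF Q] \<open>\<omega> Q = \<omega> U + \<omega> (Q - U)\<close> by (cases "\<omega> U") auto
  moreover obtain y where y: "\<omega> (Q - U) = ennreal y" "0 \<le> y"
    using \<omega>_fin[OF Q] \<open>\<omega> Q = \<omega> U + \<omega> (Q - U)\<close> by (cases "\<omega> (Q - U)") auto
  ultimately have wQ: "\<omega> Q = ennreal (x + y)" and "ennreal (x + y) \<le> ennreal (c4 * y)"
    using c4 by (simp_all add: ennreal_mult)
  then have "x + y \<le> c4 * y" using c4 y by (subst (asm) ennreal_le_iff) auto
  then have "x \<le> \<gamma> * (x + y)" using c4 by (simp add: \<gamma>_def field_simps)
  then show ?thesis unfolding x(1) wQ using const_pos x y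
    by (subst ennreal_mult[symmetric]) (auto intro!: ennreal_leI simp del: ennreal_plus)
qed

lemma error_integral:
  assumes Q: "Q \<in> hcubes"
  shows "(\<integral>\<^sup>+x\<in>Q. ennreal ((fro (v x * P' Q) * \<Lambda> * vec_norm2 (R Q *\<^sub>v e)) powr s) \<partial>lebesgue)
    \<le> ennreal (c2 * c3 * \<Lambda> powr s) * \<omega> Q"
proof -
  let ?r = "vec_norm2 (R Q *\<^sub>v e)"
  have m: "(\<lambda>x. ennreal (fro (v x * P' Q) powr s)) \<in> borel_measurable lebesgue"
    using borel_measurable_fro[OF mat_measurable_mult[OF v mat_measurable_const[OF P(2)[OF Q]]]] by measurable
  have "(\<integral>\<^sup>+x\<in>Q. ennreal ((fro (v x * P' Q) * \<Lambda> * ?r) powr s) \<partial>lebesgue)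
     = (\<integral>\<^sup>+x. ennreal (\<Lambda> powr s * ?r powr s) * (ennreal (fro (v x * P' Q) powr s) * indicator Q x) \<partial>lebesgue)"
    using const_pos by (intro nn_integral_cong) (auto simp: indicator_def powr_mult ennreal_mult[symmetric] mult_ac)
  also have "\<dots> = ennreal (\<Lambda> powr s * ?r powr s) * (\<integral>\<^sup>+x\<in>Q. ennreal (fro (v x * P' Q) powr s) \<partial>lebesgue)"
    using m hcubesD(1)[OF Q] by (intro nn_integral_cmult) auto
  also have "\<dots> \<le> ennreal (\<Lambda> powr s * ?r powr s) * (emeasure lebesgue Q * ennreal c2)"
    unfolding set_nn_integral_avg[OF Q] using v_avg[OF Q] by (intro mult_left_mono) auto
  also have "\<dots> = ennreal (c2 * \<Lambda> powr s) * (emeasure lebesgue Q * ennreal (?r powr s))"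
    using c2 by (simp add: ennreal_mult mult_ac)
  also have "\<dots> \<le> ennreal (c2 * \<Lambda> powr s) * (emeasure lebesgue Q * (ennreal c3 * avg Q (\<lambda>x. ennreal (\<phi> x powr s))))"
    unfolding \<phi>_def using u_avg[OF Q e] by (intro mult_left_mono) auto
  also have "\<dots> = ennreal (c2 * c3 * \<Lambda> powr s) * \<omega> Q"
    unfolding \<omega>_def set_nn_integral_avg[OF Q] using c2 c3 by (simp add: ennreal_mult mult_ac)
  finally show ?thesis .
qed

text \<open>Inserting P' Q * P Q on the left of X and R' Q * R Q on its right isolates the
  normalised matrix in which the oscillation of B is measured.\<close>

lemma sandwich_vec:
  assumes Q: "Q \<in> hcubes" and X: "X \<in> carrier_mat n n"
  shows "vec_norm2 ((v x * X) *\<^sub>v e) \<le> fro (v x * P' Q) * fro (P Q * X * R' Q) * vec_norm2 (R Q *\<^sub>v e)"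
proof -
  note c = P[OF Q] R[OF Q] v_car[of x] X
  have Re: "R Q *\<^sub>v e \<in> carrier_vec n" by (rule mult_mat_vec_carrier[OF c(4) e])
  have "(v x * P' Q) * (P Q * X * R' Q) * R Q = v x * ((P' Q * P Q) * (X * (R' Q * R Q)))"
    using c(1,2,4,5,7,8) by (simp add: assoc_mult_mat[of _ n n _ n _ n])
  also have "\<dots> = v x * X" unfolding c(3,6) using c by simp
  finally have eq: "v x * X = (v x * P' Q) * (P Q * X * R' Q) * R Q" ..
  have "(v x * X) *\<^sub>v e = ((v x * P' Q) * (P Q * X * R' Q)) *\<^sub>v (R Q *\<^sub>v e)"
    unfolding eq by (rule assoc_mult_mat_vec[of _ n n _ n]) (use c e in simp_all)
  also have "vec_norm2 \<dots> \<le> fro ((v x * P' Q) * (P Q * X * R' Q)) * vec_norm2 (R Q *\<^sub>v e)"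
    by (rule vec_norm2_mult_fro[of _ n n]) (use c Re in simp_all)
  also have "fro ((v x * P' Q) * (P Q * X * R' Q)) \<le> fro (v x * P' Q) * fro (P Q * X * R' Q)"
    by (rule fro_mult[of _ n n _ n]) (use c in simp_all)
  finally show ?thesis by (simp add: mult_right_mono)
qed

text \<open>One pass over the stopped cubes of h. Off them f Q is at most the error E. On a stopped
  cube J, f Q differs from f J by at most E, so the bound assumed for all cubes applies to J with
  the factor \<kappa>; the stopped cubes together carry only the share \<gamma> of \<omega> Q, and
  \<kappa> * \<gamma> = \<theta> < 1.\<close>

lemma truncated_step:
  assumes \<mu>: "0 < \<mu>" and Y: "0 \<le> Y" and IH: "\<And>Q. Q \<in> hcubes \<Longrightarrow> T \<mu> Q \<le> ennreal Y * \<omega> Q" and Q: "Q \<in> hcubes"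
  shows "T \<mu> Q \<le> ennreal (\<theta> * Y + KK * c2 * c3 * \<Lambda> powr s) * \<omega> Q"
proof -
  obtain a l where al: "Q = hcube a l" "0 < l" using Q by (auto simp: hcubes_def)
  define h where "h = (\<lambda>x. fro (P Q * (B x - mB Q) * R' Q))"
  have BQ: "mat_measurable lebesgue n (\<lambda>x. P Q * (B x - mB Q) * R' Q)"
    by (intro mat_measurable_mult mat_measurable_minus B mat_measurable_const mat_mean_carrier P(1)[OF Q] R(2)[OF Q])
  have h: "h \<in> borel_measurable lebesgue" unfolding h_def by (rule borel_measurable_fro[OF BQ])
  have hint: "(\<integral>\<^sup>+x\<in>hcube a l. ennreal (h x) \<partial>lebesgue) \<le> ennreal N * emeasure lebesgue (hcube a l)"
    unfolding al(1)[symmetric] set_nn_integral_avg[OF Q] using mult_left_mono[OF osc[OF Q], of "emeasure lebesgue Q"]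
    by (simp add: h_def mult.commute)
  obtain \<J> where \<J>0: "countable \<J>" "disjoint \<J>"
    "\<And>J. J \<in> \<J> \<Longrightarrow> J \<subseteq> hcube a l \<and> (\<exists>a' l'. 0 < l' \<and> J = hcube a' l')"
    "\<And>J. J \<in> \<J> \<Longrightarrow> (\<integral>\<^sup>+x\<in>J. ennreal (h x) \<partial>lebesgue) \<le> ennreal (2 ^ Suc CARD('d) * N) * emeasure lebesgue J"
    "emeasure lebesgue (\<Union>\<J>) \<le> emeasure lebesgue (hcube a l) / 2"
    "AE x in lebesgue. x \<in> hcube a l - \<Union>\<J> \<longrightarrow> h x \<le> 2 * N"
    by (rule calderon_zygmund_decomposition[OF al(2) h N hint]) blast
  have \<J>3: "J \<subseteq> Q \<and> J \<in> hcubes" if "J \<in> \<J>" for J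
    using \<J>0(3)[OF that] unfolding al(1) hcubes_def by blast
  note \<J> = \<J>0(1,2) \<J>3 \<J>0(4)[folded \<Lambda>_def] \<J>0(5,6)[folded al(1)]
  define E where "E = (\<lambda>x. fro (v x * P' Q) * \<Lambda> * vec_norm2 (R Q *\<^sub>v e))"
  have E_nn: "0 \<le> E x" for x using const_pos by (simp add: E_def)
  have E_meas [measurable]: "E \<in> borel_measurable lebesgue"
    unfolding E_def using borel_measurable_fro[OF mat_measurable_mult[OF v mat_measurable_const[OF P(2)[OF Q]]]] by measurable
  have Js: "J \<in> sets lebesgue" if "J \<in> \<J>" for J using \<J>(3)[OF that] hcubesD(1) by blast
  have Us: "\<Union>\<J> \<in> sets lebesgue" using \<J>(1) Js by (intro sets.countable_Union) auto
  have Qs: "Q \<in> sets lebesgue" by (rule hcubesD(1)[OF Q])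
  have UQ: "\<Union>\<J> \<subseteq> Q" using \<J>(3) by blast
  have off: "AE x in lebesgue. x \<in> Q - \<Union>\<J> \<longrightarrow> f Q x \<le> E x"
    using \<J>(6)
  proof eventually_elim
    case (elim x)
    show ?case
    proof
      assume x: "x \<in> Q - \<Union>\<J>"
      have "f Q x \<le> fro (v x * P' Q) * h x * vec_norm2 (R Q *\<^sub>v e)"
        unfolding f_def h_def by (rule sandwich_vec[OF Q]) (rule minus_carrier_mat[OF mat_mean_carrier])
      also have "\<dots> \<le> E x" unfolding E_def using elim x const_pos by (intro mult_right_mono mult_left_mono) auto
      finally show "f Q x \<le> E x" .
    qed
  qed
  \<comment> \<open>B x - mB Q is split at mB J. The increment mB J - mB Q is the mean over J of B -
    mB Q, so its normalised norm is at most the average of h over J, hence at most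
    \<Lambda>.\<close>
  have on: "f Q x \<le> f J x + E x" if J: "J \<in> \<J>" for J x
  proof -
    have Jc: "J \<in> hcubes" using \<J>(3)[OF J] by simp
    interpret J: prob_space "avg_measure J" by (rule prob_space_avg_measure[OF Jc])
    have dc: "mB J - mB Q \<in> carrier_mat n n" "B x - mB J \<in> carrier_mat n n" for x
      by (rule minus_carrier_mat[OF mat_mean_carrier])+
    have i1: "mat_integrable (avg_measure J) n (\<lambda>x. B x - mB Q)" and m1: "mat_mean (avg_measure J) n (\<lambda>x. B x - mB Q) = mB J - mB Q"
      using mat_integrable_minus[OF B_int[OF Jc] J.mat_integrable_const(1)[OF mat_mean_carrier[of "avg_measure Q" n B]]]
        J.mat_integrable_const(2)[OF mat_mean_carrier[of "avg_measure Q" n B]] by simp_all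
    note i2 = mat_integrable_mult_left[OF i1 P(1)[OF Q]]
    note i3 = mat_integrable_mult_right[OF i2(1) R(2)[OF Q]]
    have "ennreal (fro (P Q * (mB J - mB Q) * R' Q)) \<le> ennreal (LINT x|avg_measure J. h x)"
      using fro_mat_mean_le[OF i3(1)] unfolding i3(2) i2(2) m1 h_def by (rule ennreal_leI)
    also have "\<dots> = (\<integral>\<^sup>+x. ennreal (h x) \<partial>avg_measure J)"
      unfolding h_def using fro_integrable[OF i3(1)] by (intro nn_integral_eq_integral[symmetric]) auto
    also have "\<dots> = avg J (\<lambda>x. ennreal (h x))" using h by (intro nn_integral_avg_measure[OF Jc]) auto
    also have "\<dots> \<le> ennreal \<Lambda> * emeasure lebesgue J / emeasure lebesgue J"
      unfolding avg_def using \<J>(4)[OF J] by (rule divide_right_mono_ennreal)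
    also have "\<dots> = ennreal \<Lambda>" using hcubesD[OF Jc] by (simp add: ennreal_mult_divide_eq)
    finally have hJ: "fro (P Q * (mB J - mB Q) * R' Q) \<le> \<Lambda>" using const_pos by simp
    have "B x - mB Q = (B x - mB J) + (mB J - mB Q)" using B_car[of x] by (intro eq_matI) auto
    then have "v x * (B x - mB Q) = v x * (B x - mB J) + v x * (mB J - mB Q)"
      using mult_add_distrib_mat[OF v_car dc(2,1)] by simp
    then have "(v x * (B x - mB Q)) *\<^sub>v e = (v x * (B x - mB J)) *\<^sub>v e + (v x * (mB J - mB Q)) *\<^sub>v e"
      using add_mult_distrib_mat_vec[of "v x * (B x - mB J)" n n "v x * (mB J - mB Q)" e] v_car dc e by simp
    then have "f Q x \<le> f J x + vec_norm2 ((v x * (mB J - mB Q)) *\<^sub>v e)"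
      unfolding f_def using v_car dc e
      by (auto intro!: vec_norm2_triangle[of _ n] mult_mat_vec_carrier[of _ n n] sq_mult_carrier)
    also have "vec_norm2 ((v x * (mB J - mB Q)) *\<^sub>v e) \<le> fro (v x * P' Q) * fro (P Q * (mB J - mB Q) * R' Q) * vec_norm2 (R Q *\<^sub>v e)"
      by (rule sandwich_vec[OF Q dc(1)])
    also have "\<dots> \<le> E x" unfolding E_def using hJ by (intro mult_right_mono mult_left_mono) auto
    finally show ?thesis by simp
  qed
  let ?t = "\<lambda>Q x. min (f Q x) (\<mu> * \<phi> x)"
  have t_nn: "0 \<le> ?t Q x" for Q x using \<mu> \<phi>_pos[of x] by simp
  have tm: "(\<lambda>x. ennreal (?t Q x powr s)) \<in> borel_measurable lebesgue" for Q by measurable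
  have onJ: "(\<integral>\<^sup>+x\<in>J. ennreal (?t Q x powr s) \<partial>lebesgue) \<le> ennreal (\<kappa> * Y) * \<omega> J + ennreal KK * (\<integral>\<^sup>+x\<in>J. ennreal (E x powr s) \<partial>lebesgue)"
    if J: "J \<in> \<J>" for J
  proof -
    have "(\<integral>\<^sup>+x\<in>J. ennreal (?t Q x powr s) \<partial>lebesgue) \<le>
      (\<integral>\<^sup>+x. ennreal \<kappa> * (ennreal (?t J x powr s) * indicator J x) + ennreal KK * (ennreal (E x powr s) * indicator J x) \<partial>lebesgue)"
    proof (rule nn_integral_mono)
      fix x
      \<comment> \<open>The truncation level is the same for Q and J, so truncating preserves the
        inequality f Q \<le> f J + E.\<close>
      have "?t Q x \<le> ?t J x + E x" using on[OF J, of x] E_nn[of x] by (auto simp: min_def)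
      then have "?t Q x powr s \<le> (?t J x + E x) powr s" using s t_nn by (intro powr_mono2) auto
      also have "\<dots> \<le> \<kappa> * ?t J x powr s + KK * E x powr s"
        unfolding KK_def using t_nn E_nn s const_pos by (intro powr_add_le_weighted) auto
      finally have "ennreal (?t Q x powr s) \<le> ennreal \<kappa> * ennreal (?t J x powr s) + ennreal KK * ennreal (E x powr s)"
        using const_pos by (simp add: ennreal_leI flip: ennreal_mult ennreal_plus)
      then show "ennreal (?t Q x powr s) * indicator J x \<le>
        ennreal \<kappa> * (ennreal (?t J x powr s) * indicator J x) + ennreal KK * (ennreal (E x powr s) * indicator J x)"
        by (auto simp: indicator_def)
    qed
    also have "\<dots> = ennreal \<kappa> * T \<mu> J + ennreal KK * (\<integral>\<^sup>+x\<in>J. ennreal (E x powr s) \<partial>lebesgue)"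
      unfolding T_def using Js[OF J] tm by (subst nn_integral_add) (auto simp: nn_integral_cmult)
    also have "ennreal \<kappa> * T \<mu> J \<le> ennreal \<kappa> * (ennreal Y * \<omega> J)"
      using IH \<J>(3)[OF J] by (intro mult_left_mono) auto
    also have "\<dots> = ennreal (\<kappa> * Y) * \<omega> J" using const_pos Y by (simp add: ennreal_mult mult.assoc)
    finally show ?thesis by (simp add: add_right_mono)
  qed
  let ?EI = "\<lambda>F. \<integral>\<^sup>+x\<in>F. ennreal (E x powr s) \<partial>lebesgue"
  have split: "(\<integral>\<^sup>+x\<in>Q. g x \<partial>lebesgue) = (\<integral>\<^sup>+x\<in>\<Union>\<J>. g x \<partial>lebesgue) + (\<integral>\<^sup>+x\<in>Q - \<Union>\<J>. g x \<partial>lebesgue)"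
    if "g \<in> borel_measurable lebesgue" for g :: "real^'d \<Rightarrow> ennreal"
  proof -
    have "(\<integral>\<^sup>+x\<in>Q. g x \<partial>lebesgue) = (\<integral>\<^sup>+x. g x * indicator (\<Union>\<J>) x + g x * indicator (Q - \<Union>\<J>) x \<partial>lebesgue)"
      using UQ by (intro nn_integral_cong) (auto simp: indicator_def)
    also have "\<dots> = (\<integral>\<^sup>+x\<in>\<Union>\<J>. g x \<partial>lebesgue) + (\<integral>\<^sup>+x\<in>Q - \<Union>\<J>. g x \<partial>lebesgue)"
      using Us Qs that by (intro nn_integral_add) auto
    finally show ?thesis .
  qed
  have inU: "(\<integral>\<^sup>+x\<in>\<Union>\<J>. ennreal (?t Q x powr s) \<partial>lebesgue) \<le> ennreal (\<kappa> * Y) * \<omega> (\<Union>\<J>) + ennreal KK * ?EI (\<Union>\<J>)"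
  proof -
    have "(\<integral>\<^sup>+x\<in>\<Union>\<J>. ennreal (?t Q x powr s) \<partial>lebesgue) = (\<integral>\<^sup>+J. (\<integral>\<^sup>+x\<in>J. ennreal (?t Q x powr s) \<partial>lebesgue) \<partial>count_space \<J>)"
      by (rule nn_integral_disjoint_Union[OF \<J>(1,2) Js tm])
    also have "\<dots> \<le> (\<integral>\<^sup>+J. ennreal (\<kappa> * Y) * \<omega> J + ennreal KK * ?EI J \<partial>count_space \<J>)"
      using onJ by (intro nn_integral_mono) simp
    also have "\<dots> = ennreal (\<kappa> * Y) * (\<integral>\<^sup>+J. \<omega> J \<partial>count_space \<J>) + ennreal KK * (\<integral>\<^sup>+J. ?EI J \<partial>count_space \<J>)"
      by (simp add: nn_integral_add nn_integral_cmult)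
    also have "(\<integral>\<^sup>+J. \<omega> J \<partial>count_space \<J>) = \<omega> (\<Union>\<J>)"
      unfolding \<omega>_def by (rule nn_integral_disjoint_Union[OF \<J>(1,2) Js, symmetric]) auto
    also have "(\<integral>\<^sup>+J. ?EI J \<partial>count_space \<J>) = ?EI (\<Union>\<J>)"
      by (rule nn_integral_disjoint_Union[OF \<J>(1,2) Js, symmetric]) auto
    finally show ?thesis .
  qed
  have outU: "(\<integral>\<^sup>+x\<in>Q - \<Union>\<J>. ennreal (?t Q x powr s) \<partial>lebesgue) \<le> ennreal KK * ?EI (Q - \<Union>\<J>)"
  proof -
    have "(\<integral>\<^sup>+x\<in>Q - \<Union>\<J>. ennreal (?t Q x powr s) \<partial>lebesgue) \<le> ?EI (Q - \<Union>\<J>)"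
    proof (rule nn_integral_mono_AE)
      show "AE x in lebesgue. ennreal (?t Q x powr s) * indicator (Q - \<Union>\<J>) x \<le> ennreal (E x powr s) * indicator (Q - \<Union>\<J>) x"
        using off
      proof eventually_elim
        case (elim x)
        have "?t Q x powr s \<le> E x powr s" if "x \<in> Q - \<Union>\<J>"
          using elim that s t_nn by (intro powr_mono2) auto
        then show ?case by (cases "x \<in> Q - \<Union>\<J>") (simp_all add: ennreal_leI)
      qed
    qed
    also have "?EI (Q - \<Union>\<J>) = 1 * ?EI (Q - \<Union>\<J>)" by simp
    also have "\<dots> \<le> ennreal KK * ?EI (Q - \<Union>\<J>)"
      using const_pos ennreal_leI[of 1 KK] by (intro mult_right_mono) simp_all
    finally show ?thesis .
  qed
  have "T \<mu> Q \<le> (ennreal (\<kappa> * Y) * \<omega> (\<Union>\<J>) + ennreal KK * ?EI (\<Union>\<J>)) + ennreal KK * ?EI (Q - \<Union>\<J>)"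
    unfolding T_def split[OF tm] by (rule add_mono[OF inU outU])
  also have "\<dots> = ennreal (\<kappa> * Y) * \<omega> (\<Union>\<J>) + ennreal KK * ?EI Q"
  proof -
    have "?EI Q = ?EI (\<Union>\<J>) + ?EI (Q - \<Union>\<J>)" by (rule split) measurable
    then show ?thesis by (simp add: distrib_left add.assoc)
  qed
  also have "\<dots> \<le> ennreal (\<kappa> * Y) * (ennreal \<gamma> * \<omega> Q) + ennreal KK * (ennreal (c2 * c3 * \<Lambda> powr s) * \<omega> Q)"
    unfolding E_def by (intro add_mono mult_left_mono error_integral[OF Q] stopping_omega[OF Q Us UQ \<J>(5)]) auto
  also have "\<dots> = (ennreal (\<kappa> * Y) * ennreal \<gamma> + ennreal KK * ennreal (c2 * c3 * \<Lambda> powr s)) * \<omega> Q"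
    by (simp add: distrib_right mult.assoc)
  also have "ennreal (\<kappa> * Y) * ennreal \<gamma> + ennreal KK * ennreal (c2 * c3 * \<Lambda> powr s) = ennreal (\<theta> * Y + KK * c2 * c3 * \<Lambda> powr s)"
  proof -
    have "ennreal (\<kappa> * Y) * ennreal \<gamma> = ennreal (\<theta> * Y)"
      unfolding const_pos(7)[symmetric] using const_pos Y by (subst ennreal_mult[symmetric]) (auto simp: mult_ac)
    moreover have "ennreal KK * ennreal (c2 * c3 * \<Lambda> powr s) = ennreal (KK * c2 * c3 * \<Lambda> powr s)"
      using const_pos c2 c3 by (subst ennreal_mult[symmetric]) (auto simp: mult_ac)
    ultimately show ?thesis using const_pos Y c2 c3 by (simp add: ennreal_plus)
  qed
  finally show ?thesis .
qed

text \<open>The fixed point of Y -> \<theta> * Y + KK * c2 * c3 * \<Lambda>^s.\<close>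

definition "Cjn = KK * c2 * c3 * \<Lambda> powr s / (1 - \<theta>)"

lemma Cjn_nonneg: "0 \<le> Cjn"
  unfolding Cjn_def using const_pos c2 c3 by (intro divide_nonneg_nonneg mult_nonneg_nonneg) auto

text \<open>Starting from the trivial bound \<mu>^s, k steps leave \<theta>^k * \<mu>^s + Cjn;
  letting k tend to infinity removes \<mu> from the constant.\<close>

lemma truncated_bound:
  assumes \<mu>: "0 < \<mu>" and Q: "Q \<in> hcubes"
  shows "T \<mu> Q \<le> ennreal Cjn * \<omega> Q"
proof -
  have it: "T \<mu> Q \<le> ennreal (\<theta> ^ k * \<mu> powr s + Cjn) * \<omega> Q" if "Q \<in> hcubes" for k Q
    using that
  proof (induction k arbitrary: Q)
    case 0
    have "T \<mu> Q \<le> (\<integral>\<^sup>+x. ennreal (\<mu> powr s) * (ennreal (\<phi> x powr s) * indicator Q x) \<partial>lebesgue)"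
      unfolding T_def
    proof (rule nn_integral_mono)
      fix x
      have "min (f Q x) (\<mu> * \<phi> x) powr s \<le> (\<mu> * \<phi> x) powr s" using s \<mu> \<phi>_pos[of x] by (intro powr_mono2) auto
      then show "ennreal (min (f Q x) (\<mu> * \<phi> x) powr s) * indicator Q x \<le> ennreal (\<mu> powr s) * (ennreal (\<phi> x powr s) * indicator Q x)"
        using \<mu> \<phi>_pos[of x] by (auto simp: indicator_def powr_mult ennreal_leI simp flip: ennreal_mult)
    qed
    also have "\<dots> = ennreal (\<mu> powr s) * \<omega> Q" unfolding \<omega>_def using hcubesD(1)[OF 0] by (intro nn_integral_cmult) auto
    also have "\<dots> \<le> ennreal (\<theta> ^ 0 * \<mu> powr s + Cjn) * \<omega> Q" using Cjn_nonneg by (intro mult_right_mono ennreal_leI) auto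
    finally show ?case .
  next
    case (Suc k)
    have "0 \<le> \<theta> ^ k * \<mu> powr s + Cjn" using const_pos Cjn_nonneg by simp
    from truncated_step[OF \<mu> this Suc.IH Suc.prems]
    have "T \<mu> Q \<le> ennreal (\<theta> * (\<theta> ^ k * \<mu> powr s + Cjn) + KK * c2 * c3 * \<Lambda> powr s) * \<omega> Q" by simp
    also have "KK * c2 * c3 * \<Lambda> powr s = (1 - \<theta>) * Cjn" using const_pos by (simp add: Cjn_def)
    also have "\<theta> * (\<theta> ^ k * \<mu> powr s + Cjn) + (1 - \<theta>) * Cjn = \<theta> ^ Suc k * \<mu> powr s + Cjn" by (simp add: algebra_simps)
    finally show ?case .
  qed
  obtain w where w: "\<omega> Q = ennreal w" "0 \<le> w" using \<omega>_fin[OF Q] by (cases "\<omega> Q") auto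
  have "T \<mu> Q < \<infinity>" using it[OF Q, of 0] unfolding w by (rule le_less_trans) (simp add: ennreal_mult_less_top)
  then obtain t where t: "T \<mu> Q = ennreal t" "0 \<le> t" by (cases "T \<mu> Q") auto
  have "t \<le> (\<theta> ^ k * \<mu> powr s + Cjn) * w" for k
    using it[OF Q, of k] w const_pos Cjn_nonneg unfolding w t by (subst (asm) ennreal_mult[symmetric]) auto
  moreover have "(\<lambda>k. (\<theta> ^ k * \<mu> powr s + Cjn) * w) \<longlonglongrightarrow> (0 * \<mu> powr s + Cjn) * w"
    using const_pos by (intro tendsto_intros LIMSEQ_realpow_zero) auto
  ultimately have "t \<le> (0 * \<mu> powr s + Cjn) * w" by (intro LIMSEQ_le_const) auto
  then show ?thesis unfolding w t using w Cjn_nonneg by (simp add: ennreal_leI flip: ennreal_mult)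
qed

text \<open>Since \<phi> is positive at every point, the truncation at (k + 1) * \<phi> eventually
  disappears pointwise, and monotone convergence transfers the bound, which is uniform in
  \<mu>.\<close>

lemma john_nirenberg_nonzero:
  assumes Q: "Q \<in> hcubes"
  shows "(\<integral>\<^sup>+x\<in>Q. ennreal (f Q x powr s) \<partial>lebesgue) \<le> ennreal Cjn * \<omega> Q"
proof -
  let ?g = "\<lambda>k x. ennreal (min (f Q x) (real (Suc k) * \<phi> x) powr s) * indicator Q x"
  have "(\<integral>\<^sup>+x\<in>Q. ennreal (f Q x powr s) \<partial>lebesgue) \<le> (\<integral>\<^sup>+x. (SUP k. ?g k x) \<partial>lebesgue)"
  proof (rule nn_integral_mono)
    fix x
    obtain k where k: "f Q x / \<phi> x \<le> real k" using real_arch_simple by blast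
    then have "f Q x \<le> real (Suc k) * \<phi> x" using \<phi>_pos[of x] by (simp add: field_simps add_increasing2)
    then have "ennreal (f Q x powr s) * indicator Q x = ?g k x" by (simp add: min_absorb1)
    also have "\<dots> \<le> (SUP k. ?g k x)" by (rule SUP_upper) simp
    finally show "ennreal (f Q x powr s) * indicator Q x \<le> (SUP k. ?g k x)" .
  qed
  also have "\<dots> = (SUP k. integral\<^sup>N lebesgue (?g k))"
  proof (rule nn_integral_monotone_convergence_SUP)
    show "incseq ?g"
    proof (intro incseq_SucI le_funI mult_right_mono ennreal_leI powr_mono2)
      fix k x show "min (f Q x) (real (Suc k) * \<phi> x) \<le> min (f Q x) (real (Suc (Suc k)) * \<phi> x)"
        using \<phi>_pos[of x] by (intro min.mono mult_right_mono) auto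
      show "0 \<le> min (f Q x) (real (Suc k) * \<phi> x)" using \<phi>_pos[of x] by simp
    qed (use s in auto)
    show "?g k \<in> borel_measurable lebesgue" for k using hcubesD(1)[OF Q] by measurable
  qed
  also have "\<dots> \<le> ennreal Cjn * \<omega> Q"
    using truncated_bound[OF _ Q, of "real (Suc k)" for k] unfolding T_def by (intro SUP_least) simp
  finally show ?thesis .
qed

end

text \<open>\<open>Cjn\<close> with its factor N^s taken out. The remaining constant does not
  involve the oscillation, which is what makes the final estimate homogeneous in B.\<close>

definition "jn_const = KK * c2 * c3 * (2 ^ Suc CARD('d)) powr s / (1 - \<theta>)"

lemma jn_const_nonneg: "0 \<le> jn_const"
  unfolding jn_const_def using const_pos c2 c3 by (intro divide_nonneg_nonneg mult_nonneg_nonneg) auto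

theorem john_nirenberg:
  assumes Q: "Q \<in> hcubes" and e: "e \<in> carrier_vec n"
  shows "avg Q (\<lambda>x. ennreal (vec_norm2 ((v x * (B x - mB Q)) *\<^sub>v e) powr s))
    \<le> ennreal (jn_const * N powr s) * avg Q (\<lambda>x. ennreal (vec_norm2 (u x *\<^sub>v e) powr s))"
proof (cases "e = 0\<^sub>v n")
  case True
  have "vec_norm2 ((v x * (B x - mB Q)) *\<^sub>v e) = 0" for x
  proof -
    have "v x * (B x - mB Q) \<in> carrier_mat n n"
      by (rule sq_mult_carrier[OF v_car minus_carrier_mat[OF mat_mean_carrier]])
    from vec_norm2_mult_fro[OF this e] show ?thesis unfolding True by (simp add: antisym)
  qed
  then show ?thesis by (simp add: avg_def)
next
  case False
  have "avg Q (\<lambda>x. ennreal (f e Q x powr s)) \<le> (ennreal Cjn * \<omega> e Q) / emeasure lebesgue Q"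
    unfolding avg_def using john_nirenberg_nonzero[OF e False Q] by (rule divide_right_mono_ennreal)
  moreover have "Cjn = jn_const * N powr s"
    using N unfolding Cjn_def[OF e False] jn_const_def \<Lambda>_def by (simp add: powr_mult)
  ultimately show ?thesis unfolding avg_def \<omega>_def[OF e False] f_def[OF e False] \<phi>_def[OF e False]
    by (simp add: ennreal_times_divide)
qed

end

text \<open>The hypothesis speaks of positive D only; D = r + e / c with e tending to 0 covers y = 0
  as well.\<close>

lemma ennreal_le_mult_all:
  fixes x y :: ennreal
  assumes c: "0 < c" and le: "\<And>D. 0 < D \<Longrightarrow> y \<le> ennreal D \<Longrightarrow> x \<le> ennreal (c * D)"
  shows "x \<le> ennreal c * y"
proof (cases y)
  case (real r)
  show ?thesis
  proof (rule ennreal_le_epsilon)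
    fix e :: real assume e: "0 < e"
    have "x \<le> ennreal (c * (r + e / c))"
      using c e real by (intro le) (auto intro!: ennreal_leI add_nonneg_pos)
    also have "c * (r + e / c) = c * r + e" using c by (simp add: field_simps)
    also have "ennreal (c * r + e) = ennreal c * y + ennreal e" using real c e by (simp add: ennreal_mult)
    finally show "x \<le> ennreal c * y + ennreal e" .
  qed
qed (use c in \<open>simp add: ennreal_mult_top\<close>)

section \<open>Averages over half-open cubes\<close>

lemma avg_mono: "(\<And>x. f x \<le> g x) \<Longrightarrow> avg Q f \<le> avg Q g"
  unfolding avg_def by (intro divide_right_mono_ennreal nn_integral_mono mult_right_mono) auto

lemma avg_cmult: "f \<in> borel_measurable lebesgue \<Longrightarrow> Q \<in> hcubes \<Longrightarrow> avg Q (\<lambda>x. c * f x) = c * avg Q f"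
  using nn_integral_cmult[of f "avg_measure Q" c] by (simp add: nn_integral_avg_measure[symmetric])

lemma avg_add: "f \<in> borel_measurable lebesgue \<Longrightarrow> g \<in> borel_measurable lebesgue \<Longrightarrow> Q \<in> hcubes \<Longrightarrow>
    avg Q (\<lambda>x. f x + g x) = avg Q f + avg Q g"
  using nn_integral_add[of f "avg_measure Q" g] by (simp add: nn_integral_avg_measure[symmetric])

lemma avg_sum: "(\<And>i. i \<in> I \<Longrightarrow> f i \<in> borel_measurable lebesgue) \<Longrightarrow> Q \<in> hcubes \<Longrightarrow>
    avg Q (\<lambda>x. \<Sum>i\<in>I. f i x) = (\<Sum>i\<in>I. avg Q (f i))"
  using nn_integral_sum[of I f "avg_measure Q"] by (simp add: nn_integral_avg_measure[symmetric])

lemma avg_const: "Q \<in> hcubes \<Longrightarrow> avg Q (\<lambda>_. c) = c"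
  using prob_space.emeasure_space_1[OF prob_space_avg_measure[of Q]] nn_integral_const[of "avg_measure Q" c]
  by (simp add: nn_integral_avg_measure[symmetric])

lemma avg_measure_half:
  assumes Q: "Q \<in> hcubes" and F: "F \<in> sets lebesgue" "F \<subseteq> Q" "emeasure lebesgue Q / 2 \<le> emeasure lebesgue F"
  shows "1 / 2 \<le> measure (avg_measure Q) F"
proof -
  interpret prob_space "avg_measure Q" by (rule prob_space_avg_measure[OF Q])
  let ?q = "measure lebesgue Q"
  have e: "emeasure (avg_measure Q) F = emeasure lebesgue F / emeasure lebesgue Q"
    using emeasure_uniform_measure[OF hcubesD(1)[OF Q] F(1)] F(2) by (simp add: Int_absorb1)
  have "ennreal (1 / 2) = (emeasure lebesgue Q / 2) / emeasure lebesgue Q"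
    unfolding hcubesD(5)[OF Q] using divide_ennreal[of ?q 2] divide_ennreal[of "?q / 2" ?q] hcubesD(4)[OF Q] by simp
  also have "\<dots> \<le> ennreal (measure (avg_measure Q) F)"
    unfolding emeasure_eq_measure[symmetric] e using F(3) by (rule divide_right_mono_ennreal)
  finally have "ennreal (1 / 2) \<le> ennreal (measure (avg_measure Q) F)" .
  then show ?thesis unfolding ennreal_le_iff[OF measure_nonneg] .
qed

lemma avg_indicator:
  assumes "F \<subseteq> Q"
  shows "avg Q (\<lambda>x. g x * indicator F x) = (\<integral>\<^sup>+x\<in>F. g x \<partial>lebesgue) / emeasure lebesgue Q"
proof -
  have "(\<integral>\<^sup>+x\<in>Q. g x * indicator F x \<partial>lebesgue) = (\<integral>\<^sup>+x\<in>F. g x \<partial>lebesgue)"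
    using assms by (intro nn_integral_cong) (auto simp: indicator_def)
  then show ?thesis by (simp add: avg_def)
qed

text \<open>Converts the transfer estimates, stated on the normalised measure with a bound D as
  input, into the comparison of integrals that the iteration uses.\<close>

lemma half_transfer:
  assumes Q: "Q \<in> hcubes" and F: "F \<in> sets lebesgue" "F \<subseteq> Q" and c: "0 < c"
    and g: "g \<in> borel_measurable lebesgue"
    and le: "\<And>D. 0 < D \<Longrightarrow> (\<integral>\<^sup>+x\<in>F. g x \<partial>avg_measure Q) \<le> ennreal D \<Longrightarrow> (\<integral>\<^sup>+x. g x \<partial>avg_measure Q) \<le> ennreal (c * D)"
  shows "(\<integral>\<^sup>+x\<in>Q. g x \<partial>lebesgue) \<le> ennreal c * (\<integral>\<^sup>+x\<in>F. g x \<partial>lebesgue)"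
proof -
  have "(\<integral>\<^sup>+x. g x \<partial>avg_measure Q) \<le> ennreal c * (\<integral>\<^sup>+x\<in>F. g x \<partial>avg_measure Q)"
    by (rule ennreal_le_mult_all[OF c le])
  also have "(\<integral>\<^sup>+x. g x \<partial>avg_measure Q) = avg Q g" by (rule nn_integral_avg_measure[OF Q g])
  also have "(\<integral>\<^sup>+x\<in>F. g x \<partial>avg_measure Q) = (\<integral>\<^sup>+x\<in>F. g x \<partial>lebesgue) / emeasure lebesgue Q"
    using g F by (subst nn_integral_avg_measure[OF Q]) (auto simp: avg_indicator)
  finally have *: "avg Q g \<le> ennreal c * ((\<integral>\<^sup>+x\<in>F. g x \<partial>lebesgue) / emeasure lebesgue Q)" .
  have "(\<integral>\<^sup>+x\<in>Q. g x \<partial>lebesgue) = emeasure lebesgue Q * avg Q g" by (rule set_nn_integral_avg[OF Q])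
  also have "\<dots> \<le> emeasure lebesgue Q * (ennreal c * ((\<integral>\<^sup>+x\<in>F. g x \<partial>lebesgue) / emeasure lebesgue Q))"
    using * by (rule mult_left_mono) simp
  also have "\<dots> = ennreal c * (emeasure lebesgue Q * ((\<integral>\<^sup>+x\<in>F. g x \<partial>lebesgue) / emeasure lebesgue Q))"
    by (simp only: mult.left_commute)
  also have "emeasure lebesgue Q * ((\<integral>\<^sup>+x\<in>F. g x \<partial>lebesgue) / emeasure lebesgue Q) = (\<integral>\<^sup>+x\<in>F. g x \<partial>lebesgue)"
  proof -
    have "avg Q (\<lambda>x. g x * indicator F x) = (\<integral>\<^sup>+x\<in>F. g x \<partial>lebesgue) / emeasure lebesgue Q" by (rule avg_indicator[OF F(2)])
    moreover have "(\<integral>\<^sup>+x\<in>Q. g x * indicator F x \<partial>lebesgue) = (\<integral>\<^sup>+x\<in>F. g x \<partial>lebesgue)"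
      using F(2) by (intro nn_integral_cong) (auto simp: indicator_def)
    ultimately show ?thesis using set_nn_integral_avg[OF Q, of "\<lambda>x. g x * indicator F x"] by simp
  qed
  finally show ?thesis .
qed

lemma set_nn_integral_finite:
  assumes Q: "Q \<in> hcubes" and g: "g \<in> borel_measurable lebesgue" and fin: "(\<integral>\<^sup>+x. g x \<partial>avg_measure Q) < \<infinity>"
  shows "(\<integral>\<^sup>+x\<in>Q. g x \<partial>lebesgue) < \<infinity>"
proof -
  obtain r where r: "avg Q g = ennreal r" "0 \<le> r"
    using fin unfolding nn_integral_avg_measure[OF Q g] by (cases "avg Q g") auto
  show ?thesis
    unfolding set_nn_integral_avg[OF Q] hcubesD(5)[OF Q] r(1)
    using r(2) by (subst ennreal_mult[symmetric]) auto
qed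

text \<open>The weight class in terms of w and its inverse on all half-open cubes, with the
  Frobenius norm and a real bound A0. Every cube yields a \<open>weight_space\<close> with the same
  constant A.\<close>

locale apq_family =
  fixes n :: nat and w wi :: "real^'d \<Rightarrow> cmat" and a b A0 :: real
  assumes w_meas: "mat_measurable lebesgue n w" and wi_meas: "mat_measurable lebesgue n wi"
    and pdw: "\<And>x. positive_definite n (w x)" and pdwi: "\<And>x. positive_definite n (wi x)"
    and wwi: "\<And>x. w x * wi x = 1\<^sub>m n" and wiw: "\<And>x. wi x * w x = 1\<^sub>m n"
    and a1: "1 < a" and b1: "1 < b" and A0: "0 \<le> A0"
    and apq: "\<And>Q. Q \<in> hcubes \<Longrightarrow>
      avg Q (\<lambda>x. ennreal_powr (avg Q (\<lambda>y. ennreal (fro (w x * wi y) powr a))) (b / a)) \<le> ennreal A0"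
begin

text \<open>Adding 1 makes the majorant H at least 1; the factor 2 powr (b / a) in A pays for it.
  \<open>enn2real\<close> gives 0 where the inner average is infinite, which happens only on a null
  set of the cube because the outer average is finite.\<close>

definition "A = 2 powr (b / a) * (A0 + 1)"
definition "H Q x = enn2real (avg Q (\<lambda>y. ennreal (fro (w x * wi y) powr a))) + 1"

lemma w_car: "w x \<in> carrier_mat n n" by (rule mat_measurableD(1)[OF w_meas])
lemma wi_car: "wi x \<in> carrier_mat n n" by (rule mat_measurableD(1)[OF wi_meas])

lemma A_ge: "1 \<le> A"
proof -
  have "1 \<le> 2 powr (b / a)" using a1 b1 by (intro ge_one_powr_ge_zero) auto
  then have "1 * 1 \<le> 2 powr (b / a) * (A0 + 1)" using A0 by (intro mult_mono) auto
  then show ?thesis by (simp add: A_def)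
qed

lemma weight_space:
  assumes Q: "Q \<in> hcubes"
  shows "weight_space (avg_measure Q) n w wi a b A (H Q)"
proof -
  interpret prob_space "avg_measure Q" by (rule prob_space_avg_measure[OF Q])
  define G where "G = (\<lambda>x. avg Q (\<lambda>y. ennreal (fro (w x * wi y) powr a)))"
  have Km: "(\<lambda>y. ennreal (fro (w x * wi y) powr a)) \<in> borel_measurable lebesgue" for x
  proof -
    have [measurable]: "(\<lambda>y. fro (w x * wi y)) \<in> borel_measurable lebesgue"
      by (intro borel_measurable_fro[of _ n] mat_measurable_mult wi_meas mat_measurable_const w_car)
    show ?thesis by measurable
  qed
  have Geq: "G x = (\<integral>\<^sup>+y. ennreal (fro (w x * wi y) powr a) \<partial>avg_measure Q)" for x
    unfolding G_def by (rule nn_integral_avg_measure[OF Q Km, symmetric])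
  have G_meas [measurable]: "G \<in> borel_measurable lebesgue"
  proof -
    have [measurable]: "(\<lambda>z. fro (w (fst z) * wi (snd z))) \<in> borel_measurable (lebesgue \<Otimes>\<^sub>M avg_measure Q)"
      by (intro borel_measurable_fro[of _ n] mat_measurable_mult mat_measurable_compose[OF measurable_fst w_meas]
        mat_measurable_compose[OF measurable_snd, of "avg_measure Q"]) (simp add: wi_meas)
    have "(\<lambda>z. ennreal (fro (w (fst z) * wi (snd z)) powr a)) \<in> borel_measurable (lebesgue \<Otimes>\<^sub>M avg_measure Q)" by measurable
    from borel_measurable_nn_integral_fst[OF this] show ?thesis unfolding Geq by simp
  qed
  have ep: "(\<lambda>x. ennreal_powr (G x) (b / a)) \<in> borel_measurable lebesgue" by measurable
  have int: "(\<integral>\<^sup>+x. ennreal_powr (G x) (b / a) \<partial>avg_measure Q) \<le> ennreal A0"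
    unfolding nn_integral_avg_measure[OF Q ep] unfolding G_def by (rule apq[OF Q])
  have fin: "AE x in avg_measure Q. G x < \<infinity>"
  proof -
    have "AE x in avg_measure Q. ennreal_powr (G x) (b / a) \<noteq> \<infinity>"
      using int ep by (intro nn_integral_PInf_AE) (auto simp: top_unique)
    then have "AE x in avg_measure Q. ennreal_powr (G x) (b / a) < \<infinity>"
      by (rule AE_mp) (simp add: top.not_eq_extremum)
    then show ?thesis unfolding ennreal_powr_less_top_iff .
  qed
  have H_eq: "H Q x = enn2real (G x) + 1" for x by (simp add: H_def G_def)
  show ?thesis
  proof
    show "H Q \<in> borel_measurable (avg_measure Q)" unfolding H_eq[abs_def] by simp
    show "1 \<le> H Q x" for x by (simp add: H_def)
    show "AE x in avg_measure Q. (\<integral>\<^sup>+y. ennreal (fro (w x * wi y) powr a) \<partial>avg_measure Q) \<le> ennreal (H Q x)"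
      using fin
    proof eventually_elim
      case (elim x)
      then have "G x = ennreal (enn2real (G x))" by simp
      also have "\<dots> \<le> ennreal (H Q x)" unfolding H_eq by (intro ennreal_leI) simp
      finally show ?case by (simp add: Geq)
    qed
    have "(\<integral>\<^sup>+x. ennreal (H Q x powr (b / a)) \<partial>avg_measure Q) \<le>
       (\<integral>\<^sup>+x. ennreal (2 powr (b / a)) * (ennreal_powr (G x) (b / a) + 1) \<partial>avg_measure Q)"
    proof (rule nn_integral_mono_AE)
      show "AE x in avg_measure Q. ennreal (H Q x powr (b / a)) \<le> ennreal (2 powr (b / a)) * (ennreal_powr (G x) (b / a) + 1)"
        using fin
      proof eventually_elim
        case (elim x)
        then obtain g where g: "G x = ennreal g" "0 \<le> g" by (cases "G x") auto
        have "H Q x powr (b / a) \<le> 2 powr (b / a) * (g powr (b / a) + 1 powr (b / a))"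
          unfolding H_eq g(1) using g(2) a1 b1 by (simp only: enn2real_ennreal) (intro powr_add_le, auto)
        then show ?case unfolding g(1) using g(2) by (simp add: ennreal_leI flip: ennreal_mult ennreal_plus ennreal_1)
      qed
    qed
    also have "\<dots> = ennreal (2 powr (b / a)) * ((\<integral>\<^sup>+x. ennreal_powr (G x) (b / a) \<partial>avg_measure Q) + 1)"
    proof -
      have "(\<integral>\<^sup>+x. ennreal_powr (G x) (b / a) + 1 \<partial>avg_measure Q) = (\<integral>\<^sup>+x. ennreal_powr (G x) (b / a) \<partial>avg_measure Q) + (\<integral>\<^sup>+x. 1 \<partial>avg_measure Q)"
        using ep by (intro nn_integral_add) auto
      also have "(\<integral>\<^sup>+x. 1 \<partial>avg_measure Q) = 1" unfolding nn_integral_const emeasure_space_1 by simp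
      finally show ?thesis using ep by (subst nn_integral_cmult) auto
    qed
    also have "\<dots> \<le> ennreal (2 powr (b / a)) * (ennreal A0 + 1)" using int by (intro mult_left_mono add_right_mono) auto
    also have "\<dots> = ennreal A" unfolding A_def using A0 by (simp add: ennreal_mult ennreal_plus)
    finally show "(\<integral>\<^sup>+x. ennreal (H Q x powr (b / a)) \<partial>avg_measure Q) \<le> ennreal A" .
  qed (use w_meas wi_meas pdw pdwi wwi wiw a1 b1 A_ge in simp_all)
qed

definition "Nq Q = mat_mean (avg_measure Q) n w"
definition "Nq' Q = mat_powr (Nq Q) (- 1)"

text \<open>All constants are written in n, a, b and A alone, hence do not depend on the cube. The
  maxima ensure positivity, and for \<open>C4\<close> and \<open>C4'\<close> the lower bound 2 that
  \<open>john_nirenberg_data\<close> demands.\<close>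

definition "C2 = max 1 (weight_space.ci n a b A powr b * weight_space.c2a a b A)"
definition "C2' = (16 * A) powr a * weight_space.g0 a b A"
definition "C3' = max 1 ((2 * weight_space.ci n a b A) powr a)"
definition "C4 = max 2 (weight_space.c4 a b A)"
definition "C4' = max 2 (8 * weight_space.g0 a b A)"

lemma C2'_pos: "0 < C2'"
proof -
  have "hcube (0 :: real^'d) 1 \<in> hcubes" by (rule hcubeI) simp
  from weight_space.g0_pos[OF weight_space[OF this]] show ?thesis
    unfolding C2'_def by (rule mult_pos_pos[rotated]) (use A_ge in simp)
qed

context
  fixes Q :: "(real^'d) set"
  assumes Q: "Q \<in> hcubes"
begin

interpretation WS: weight_space "avg_measure Q" n w wi a b A "H Q" by (rule weight_space[OF Q])

lemma w_int: "mat_integrable (avg_measure Q) n w" by (rule WS.w_int)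

lemma Nq_pd: "positive_definite n (Nq Q)" unfolding Nq_def by (rule WS.N_pd)

lemma Nq_car: "Nq Q \<in> carrier_mat n n" "Nq' Q \<in> carrier_mat n n"
  unfolding Nq'_def by (rule positive_definiteD(1)[OF Nq_pd] mat_powr_carrier[OF Nq_pd])+

lemma Nq_adj: "mat_adjoint (Nq Q) = Nq Q" "mat_adjoint (Nq' Q) = Nq' Q"
  unfolding Nq'_def by (rule positive_definiteD(2)[OF Nq_pd] positive_definiteD(2)[OF pd_mat_powr[OF Nq_pd]])+

lemma Nq_inv: "Nq Q * Nq' Q = 1\<^sub>m n" "Nq' Q * Nq Q = 1\<^sub>m n"
  unfolding Nq'_def using mat_powr_inverse[OF Nq_pd, of 1] mat_powr_one[OF Nq_pd] by simp_all

lemma fro_mult_meas: "X \<in> carrier_mat n n \<Longrightarrow> (\<lambda>x. ennreal (fro (w x * X) powr r)) \<in> borel_measurable lebesgue"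
  "X \<in> carrier_mat n n \<Longrightarrow> (\<lambda>x. ennreal (fro (X * wi x) powr r)) \<in> borel_measurable lebesgue"
  using borel_measurable_fro[OF mat_measurable_mult[OF w_meas mat_measurable_const[of X n]]]
    borel_measurable_fro[OF mat_measurable_mult[OF mat_measurable_const[of X n] wi_meas]] by simp_all

lemma vec_meas: "e \<in> carrier_vec n \<Longrightarrow> (\<lambda>x. vec_norm2 (w x *\<^sub>v e)) \<in> borel_measurable lebesgue"
  "e \<in> carrier_vec n \<Longrightarrow> (\<lambda>x. vec_norm2 (wi x *\<^sub>v e)) \<in> borel_measurable lebesgue"
  by (rule borel_measurable_mat_vec_norm2[OF w_meas] borel_measurable_mat_vec_norm2[OF wi_meas], assumption)+

lemma w_Nq': "avg Q (\<lambda>x. ennreal (fro (w x * Nq' Q) powr b)) \<le> ennreal C2"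
proof -
  have "avg Q (\<lambda>x. ennreal (fro (w x * Nq' Q) powr b)) = (\<integral>\<^sup>+x. ennreal (fro (w x * Nq' Q) powr b) \<partial>avg_measure Q)"
    by (rule nn_integral_avg_measure[OF Q fro_mult_meas(1)[OF Nq_car(2)], symmetric])
  also have "\<dots> \<le> ennreal (weight_space.ci n a b A powr b * weight_space.c2a a b A)"
    using WS.w_Ni[OF Nq_car(2)] Nq_inv(2) unfolding Nq_def by simp
  also have "\<dots> \<le> ennreal C2" unfolding C2_def by (intro ennreal_leI) simp
  finally show ?thesis .
qed

lemma Nq_wi: "avg Q (\<lambda>x. ennreal (fro (Nq Q * wi x) powr a)) \<le> ennreal C2'"
  using WS.N_wi nn_integral_avg_measure[OF Q fro_mult_meas(2)[OF Nq_car(1)]] by (simp add: Nq_def C2'_def)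

lemma Nq_vec:
  assumes "e \<in> carrier_vec n"
  shows "ennreal (vec_norm2 (Nq Q *\<^sub>v e) powr b) \<le> ennreal (2 powr b) * avg Q (\<lambda>x. ennreal (vec_norm2 (w x *\<^sub>v e) powr b))"
  using WS.N_vec[OF assms] vec_meas(1)[OF assms] by (subst nn_integral_avg_measure[OF Q, symmetric]) (auto simp: Nq_def)

lemma Nq'_vec:
  assumes "e \<in> carrier_vec n"
  shows "ennreal (vec_norm2 (Nq' Q *\<^sub>v e) powr a) \<le> ennreal C3' * avg Q (\<lambda>x. ennreal (vec_norm2 (wi x *\<^sub>v e) powr a))"
proof -
  have "ennreal (vec_norm2 (Nq' Q *\<^sub>v e) powr a) \<le> ennreal ((2 * weight_space.ci n a b A) powr a) *
      (\<integral>\<^sup>+x. ennreal (vec_norm2 (wi x *\<^sub>v e) powr a) \<partial>avg_measure Q)"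
    using WS.Ni_vec[OF Nq_car(2) _ _ assms] Nq_inv unfolding Nq_def by simp
  also have "\<dots> \<le> ennreal C3' * (\<integral>\<^sup>+x. ennreal (vec_norm2 (wi x *\<^sub>v e) powr a) \<partial>avg_measure Q)"
    unfolding C3'_def by (intro mult_right_mono ennreal_leI) auto
  finally show ?thesis using vec_meas(2)[OF assms] by (subst nn_integral_avg_measure[OF Q, symmetric]) auto
qed

text \<open>The norms of w x e and wi x e satisfy the hypotheses of \<open>transfer\<close> and
  \<open>transfer'\<close>. For the inverse the kernel appears with its factors exchanged, wi y * w
  x, which is the adjoint of w x * wi y and has the same Frobenius norm.\<close>

lemma h_transfer:
  assumes e: "e \<in> carrier_vec n"
  shows "vec_norm2 (w x *\<^sub>v e) \<le> fro (w x * wi y) * vec_norm2 (w y *\<^sub>v e)"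
    and "vec_norm2 (wi y *\<^sub>v e) \<le> fro (w x * wi y) * vec_norm2 (wi x *\<^sub>v e)"
proof -
  have c: "w y *\<^sub>v e \<in> carrier_vec n" "wi x *\<^sub>v e \<in> carrier_vec n"
    using mult_mat_vec_carrier[OF w_car e] mult_mat_vec_carrier[OF wi_car e] .
  have k: "w x * wi y \<in> carrier_mat n n" "wi y * w x \<in> carrier_mat n n"
    using w_car wi_car by simp_all
  have "w x *\<^sub>v e = (w x * wi y * w y) *\<^sub>v e" using WS.w_split[of x y] by simp
  also have "\<dots> = (w x * wi y) *\<^sub>v (w y *\<^sub>v e)" by (rule assoc_mult_mat_vec[OF k(1) w_car e])
  finally show "vec_norm2 (w x *\<^sub>v e) \<le> fro (w x * wi y) * vec_norm2 (w y *\<^sub>v e)"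
    using vec_norm2_mult_fro[OF k(1) c(1)] by simp
  have "(wi y * w x) * wi x = wi y"
    using assoc_mult_mat[OF wi_car w_car wi_car, of y x x] wwi[of x] wi_car by simp
  then have "wi y *\<^sub>v e = (wi y * w x) *\<^sub>v (wi x *\<^sub>v e)"
    using assoc_mult_mat_vec[OF k(2) wi_car e, of x] by simp
  moreover have "fro (wi y * w x) = fro (w x * wi y)"
  proof -
    have "mat_adjoint (w x * wi y) = wi y * w x"
      using mat_adjoint_mult[OF w_car wi_car] positive_definiteD(2)[OF pdw] positive_definiteD(2)[OF pdwi] by simp
    then show ?thesis using fro_adjoint[of "w x * wi y"] by simp
  qed
  ultimately show "vec_norm2 (wi y *\<^sub>v e) \<le> fro (w x * wi y) * vec_norm2 (wi x *\<^sub>v e)"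
    using vec_norm2_mult_fro[OF k(2) c(2)] by simp
qed

lemma w_half:
  assumes e: "e \<in> carrier_vec n" and F: "F \<in> sets lebesgue" "F \<subseteq> Q" "emeasure lebesgue Q / 2 \<le> emeasure lebesgue F"
  shows "(\<integral>\<^sup>+x\<in>Q. ennreal (vec_norm2 (w x *\<^sub>v e) powr b) \<partial>lebesgue) \<le> ennreal C4 * (\<integral>\<^sup>+x\<in>F. ennreal (vec_norm2 (w x *\<^sub>v e) powr b) \<partial>lebesgue)"
proof -
  have "(\<integral>\<^sup>+x\<in>Q. ennreal (vec_norm2 (w x *\<^sub>v e) powr b) \<partial>lebesgue) \<le> ennreal (weight_space.c4 a b A) * (\<integral>\<^sup>+x\<in>F. ennreal (vec_norm2 (w x *\<^sub>v e) powr b) \<partial>lebesgue)"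
    using F avg_measure_half[OF Q F] vec_meas(1)[OF e] h_transfer(1)[OF e]
    by (intro half_transfer[OF Q F(1,2) WS.c4_pos] WS.transfer[where F=F]) auto
  also have "\<dots> \<le> ennreal C4 * (\<integral>\<^sup>+x\<in>F. ennreal (vec_norm2 (w x *\<^sub>v e) powr b) \<partial>lebesgue)"
    unfolding C4_def by (intro mult_right_mono ennreal_leI) auto
  finally show ?thesis .
qed

lemma wi_half:
  assumes e: "e \<in> carrier_vec n" and F: "F \<in> sets lebesgue" "F \<subseteq> Q" "emeasure lebesgue Q / 2 \<le> emeasure lebesgue F"
  shows "(\<integral>\<^sup>+x\<in>Q. ennreal (vec_norm2 (wi x *\<^sub>v e) powr a) \<partial>lebesgue) \<le> ennreal C4' * (\<integral>\<^sup>+x\<in>F. ennreal (vec_norm2 (wi x *\<^sub>v e) powr a) \<partial>lebesgue)"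
proof -
  have "(\<integral>\<^sup>+x\<in>Q. ennreal (vec_norm2 (wi x *\<^sub>v e) powr a) \<partial>lebesgue) \<le> ennreal (8 * weight_space.g0 a b A) * (\<integral>\<^sup>+x\<in>F. ennreal (vec_norm2 (wi x *\<^sub>v e) powr a) \<partial>lebesgue)"
    using F avg_measure_half[OF Q F] vec_meas(2)[OF e] h_transfer(2)[OF e] WS.g0_pos
    by (intro half_transfer[OF Q F(1,2)] WS.transfer'[where F=F]) auto
  also have "\<dots> \<le> ennreal C4' * (\<integral>\<^sup>+x\<in>F. ennreal (vec_norm2 (wi x *\<^sub>v e) powr a) \<partial>lebesgue)"
    unfolding C4'_def by (intro mult_right_mono ennreal_leI) auto
  finally show ?thesis .
qed

lemma w_fin: "e \<in> carrier_vec n \<Longrightarrow> (\<integral>\<^sup>+x\<in>Q. ennreal (vec_norm2 (w x *\<^sub>v e) powr b) \<partial>lebesgue) < \<infinity>"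
  using vec_meas(1) h_transfer(1) by (intro set_nn_integral_finite[OF Q] WS.transfer_finite) auto

lemma wi_fin: "e \<in> carrier_vec n \<Longrightarrow> (\<integral>\<^sup>+x\<in>Q. ennreal (vec_norm2 (wi x *\<^sub>v e) powr a) \<partial>lebesgue) < \<infinity>"
  using vec_meas(2) h_transfer(2) by (intro set_nn_integral_finite[OF Q] WS.transfer_finite') auto

end

lemma w_pos: "e \<in> carrier_vec n \<Longrightarrow> e \<noteq> 0\<^sub>v n \<Longrightarrow> 0 < vec_norm2 (w x *\<^sub>v e)"
  and wi_pos: "e \<in> carrier_vec n \<Longrightarrow> e \<noteq> 0\<^sub>v n \<Longrightarrow> 0 < vec_norm2 (wi x *\<^sub>v e)"
proof -
  have *: "0 < vec_norm2 (X *\<^sub>v e)" if e: "e \<in> carrier_vec n" "e \<noteq> 0\<^sub>v n"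
    and X: "X \<in> carrier_mat n n" "Y \<in> carrier_mat n n" "Y * X = 1\<^sub>m n" for X Y
  proof -
    have Xe: "X *\<^sub>v e \<in> carrier_vec n" by (rule mult_mat_vec_carrier[OF X(1) e(1)])
    have "Y *\<^sub>v (X *\<^sub>v e) = e" using assoc_mult_mat_vec[OF X(2,1) e(1)] X(3) e(1) by simp
    then have "vec_norm2 e \<le> fro Y * vec_norm2 (X *\<^sub>v e)" using vec_norm2_mult_fro[OF X(2) Xe] by simp
    moreover have "0 < vec_norm2 e" using vec_norm2_eq_0_iff[OF e(1)] e(2) vec_norm2_nonneg[of e] by linarith
    ultimately have "vec_norm2 (X *\<^sub>v e) \<noteq> 0" by auto
    then show ?thesis using vec_norm2_nonneg[of "X *\<^sub>v e"] by linarith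
  qed
  show "e \<in> carrier_vec n \<Longrightarrow> e \<noteq> 0\<^sub>v n \<Longrightarrow> 0 < vec_norm2 (w x *\<^sub>v e)"
    by (rule *[OF _ _ w_car wi_car wiw])
  show "e \<in> carrier_vec n \<Longrightarrow> e \<noteq> 0\<^sub>v n \<Longrightarrow> 0 < vec_norm2 (wi x *\<^sub>v e)"
    by (rule *[OF _ _ wi_car w_car wwi])
qed

end

lemma powr_sum_le:
  fixes f :: "nat \<Rightarrow> real"
  assumes "\<And>i. i < n \<Longrightarrow> 0 \<le> f i" "0 < r"
  shows "(\<Sum>i<n. f i) powr r \<le> real n powr r * (\<Sum>i<n. f i powr r)"
proof (cases "n = 0")
  case False
  define m where "m = Max (f ` {..<n})"
  have ne: "f ` {..<n} \<noteq> {}" "finite (f ` {..<n})" using False by auto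
  obtain k where k: "k < n" "m = f k" using Max_in[OF ne(2,1)] by (auto simp: m_def)
  have "(\<Sum>i<n. f i) \<le> (\<Sum>i<n. m)" unfolding m_def using ne by (intro sum_mono Max_ge) auto
  then have "(\<Sum>i<n. f i) powr r \<le> (real n * m) powr r" using assms by (intro powr_mono2) (auto intro: sum_nonneg)
  also have "\<dots> = real n powr r * f k powr r" using assms(1)[OF k(1)] by (simp add: powr_mult k)
  also have "f k powr r \<le> (\<Sum>i<n. f i powr r)" using k by (intro member_le_sum) auto
  finally show ?thesis by (simp add: mult_left_mono)
qed simp

lemma fro_powr_le_cols:
  assumes "X \<in> carrier_mat n n" "0 < r"
  shows "fro X powr r \<le> real n powr r * (\<Sum>j<n. vec_norm2 (X *\<^sub>v unit_vec n j) powr r)"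
proof -
  have "fro X powr r \<le> (\<Sum>j<n. vec_norm2 (X *\<^sub>v unit_vec n j)) powr r"
    using fro_le_cols[OF assms(1)] assms(2) by (intro powr_mono2) auto
  also have "\<dots> \<le> real n powr r * (\<Sum>j<n. vec_norm2 (X *\<^sub>v unit_vec n j) powr r)"
    using assms(2) by (intro powr_sum_le) auto
  finally show ?thesis .
qed

locale apq_pair = V: apq_family n v vi a b Av + U: apq_family n u ui a b Au
  for n :: nat and v vi u ui :: "real^'d \<Rightarrow> cmat" and a b Av Au :: real +
  fixes B :: "real^'d \<Rightarrow> cmat"
  assumes B_meas: "mat_measurable lebesgue n B" and B_int: "\<And>Q. Q \<in> hcubes \<Longrightarrow> mat_integrable (avg_measure Q) n B"
begin

abbreviation "mB Q \<equiv> mat_mean (avg_measure Q) n B"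

text \<open>The constants are spelled out through the global forms of the locale constants, so that
  they are visibly functions of n, a, b, Av, Au and the dimension of the space. D1, E1 belong to the
  direct application of the iteration and D2, E2 to the dual one; \<open>Eup\<close> and
  \<open>Elow\<close> are collected in \<open>upper_bound\<close> and
  \<open>lower_bound\<close>.\<close>

definition "D1 = john_nirenberg_data.jn_const TYPE('d) b (apq_family.C2 n a b Av) (2 powr b) (apq_family.C4 a b Au)"
definition "D2 = john_nirenberg_data.jn_const TYPE('d) a (apq_family.C2' a b Au) (apq_family.C3' n a b Av) (apq_family.C4' a b Av)"
definition "E1 = real n powr b * real n * D1 * apq_family.C2 n a b Au"
definition "E2 = real n powr a * real n * D2 * apq_family.C2' a b Av"
definition "Eup = 2 powr b * 2 powr (b / a) *
   (E1 * apq_family.C2' a b Au powr (b / a) + apq_family.C2 n a b Av * E2 powr (b / a))"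
definition "Elow = (2 + apq_family.C2 n a b Au) * (1 + apq_family.C2' a b Av + 2 * 2 powr (b / a))"

lemma B_car: "B x \<in> carrier_mat n n" by (rule mat_measurableD(1)[OF B_meas])

lemma diff_car: "B x - mB Q \<in> carrier_mat n n" by (rule minus_carrier_mat[OF mat_mean_carrier])

lemma JN1:
  assumes N: "0 < N" and osc: "\<And>Q. Q \<in> hcubes \<Longrightarrow> avg Q (\<lambda>x. ennreal (fro (V.Nq Q * (B x - mB Q) * U.Nq' Q))) \<le> ennreal N"
  shows "john_nirenberg_data n v u B V.Nq V.Nq' U.Nq U.Nq' b (apq_family.C2 n a b Av) (2 powr b) (apq_family.C4 a b Au) N"
proof
  show "0 < V.C2" "2 \<le> U.C4" unfolding V.C2_def U.C4_def by simp_all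
qed (use N osc V.w_meas U.w_meas B_meas B_int V.Nq_car V.Nq_inv U.Nq_car U.Nq_inv V.b1 V.w_Nq' U.Nq_vec U.w_fin U.w_half U.w_pos
   in \<open>simp_all\<close>)

text \<open>Taking adjoints reverses the product V.Nq Q * (B x - mB Q) * U.Nq' Q without changing
  its norm. The same oscillation bound therefore serves the inverse weights, whose reducing matrices
  are the inverses U.Nq' and V.Nq', with the exponent a in place of b.\<close>

lemma JN2:
  assumes N: "0 < N" and osc: "\<And>Q. Q \<in> hcubes \<Longrightarrow> avg Q (\<lambda>x. ennreal (fro (V.Nq Q * (B x - mB Q) * U.Nq' Q))) \<le> ennreal N"
  shows "john_nirenberg_data n ui vi (\<lambda>x. mat_adjoint (B x)) U.Nq' U.Nq V.Nq' V.Nq a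
     (apq_family.C2' a b Au) (apq_family.C3' n a b Av) (apq_family.C4' a b Av) N"
proof
  show "0 < V.C3'" "2 \<le> V.C4'" unfolding V.C3'_def V.C4'_def by simp_all
  show "0 < U.C2'" by (rule U.C2'_pos)
  show "mat_measurable lebesgue n (\<lambda>x. mat_adjoint (B x))" by (rule mat_measurable_adjoint[OF B_meas])
  fix Q :: "(real^'d) set" assume Q: "Q \<in> hcubes"
  show "mat_integrable (avg_measure Q) n (\<lambda>x. mat_adjoint (B x))" by (rule mat_integrable_adjoint(1)[OF B_int[OF Q]])
  have "fro (U.Nq' Q * (mat_adjoint (B x) - mat_mean (avg_measure Q) n (\<lambda>x. mat_adjoint (B x))) * V.Nq Q)
      = fro (V.Nq Q * (B x - mB Q) * U.Nq' Q)" for x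
  proof -
    have c: "V.Nq Q * (B x - mB Q) \<in> carrier_mat n n" using V.Nq_car[OF Q] diff_car by simp
    have "mat_adjoint (V.Nq Q * (B x - mB Q) * U.Nq' Q) = U.Nq' Q * (mat_adjoint (B x - mB Q) * V.Nq Q)"
      unfolding mat_adjoint_mult[OF c U.Nq_car(2)[OF Q]] mat_adjoint_mult[OF V.Nq_car(1)[OF Q] diff_car]
      unfolding V.Nq_adj[OF Q] U.Nq_adj[OF Q] ..
    also have "\<dots> = U.Nq' Q * mat_adjoint (B x - mB Q) * V.Nq Q"
      by (rule assoc_mult_mat[symmetric, OF U.Nq_car(2)[OF Q] mat_adjoint_carrier[OF diff_car] V.Nq_car(1)[OF Q]])
    also have "mat_adjoint (B x - mB Q) = mat_adjoint (B x) - mat_mean (avg_measure Q) n (\<lambda>x. mat_adjoint (B x))"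
      unfolding mat_integrable_adjoint(2)[OF B_int[OF Q]] by (rule mat_adjoint_minus[OF B_car mat_mean_carrier])
    finally show ?thesis using fro_adjoint[of "V.Nq Q * (B x - mB Q) * U.Nq' Q"] by simp
  qed
  then show "avg Q (\<lambda>x. ennreal (fro (U.Nq' Q * (mat_adjoint (B x) - mat_mean (avg_measure Q) n (\<lambda>x. mat_adjoint (B x))) * V.Nq Q))) \<le> ennreal N"
    using osc[OF Q] by simp
  have "fro (ui x * U.Nq Q) = fro (U.Nq Q * ui x)" for x
  proof -
    have "mat_adjoint (U.Nq Q * ui x) = ui x * U.Nq Q"
      unfolding mat_adjoint_mult[OF U.Nq_car(1)[OF Q] U.wi_car] U.Nq_adj[OF Q] positive_definiteD(2)[OF U.pdwi] ..
    then show ?thesis using fro_adjoint[of "U.Nq Q * ui x"] by simp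
  qed
  then show "avg Q (\<lambda>x. ennreal (fro (ui x * U.Nq Q) powr a)) \<le> ennreal U.C2'" using U.Nq_wi[OF Q] by simp
qed (use N U.wi_meas V.wi_meas V.Nq_car V.Nq_inv U.Nq_car U.Nq_inv V.a1 V.Nq'_vec V.wi_fin V.wi_half V.wi_pos
   in \<open>simp_all\<close>)

lemma vec_norm2_mult_unit_le:
  assumes X: "X \<in> carrier_mat n n" and Y: "Y \<in> carrier_mat n n" and j: "j < n"
  shows "vec_norm2 (X *\<^sub>v (Y *\<^sub>v unit_vec n j)) \<le> fro (X * Y)"
proof -
  have "X *\<^sub>v (Y *\<^sub>v unit_vec n j) = (X * Y) *\<^sub>v unit_vec n j" by (rule assoc_mult_mat_vec[symmetric, OF X Y]) simp
  moreover have "X * Y \<in> carrier_mat n n" using X Y by simp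
  ultimately show ?thesis using vec_norm2_mult_fro[of "X * Y" n n "unit_vec n j"] j by simp
qed

text \<open>Column by column: the John-Nirenberg estimate is available for fixed vectors only, here
  for the columns of Y.\<close>

lemma avg_fro_cols:
  assumes Q: "Q \<in> hcubes" and X: "mat_measurable lebesgue n X" and Y: "Y \<in> carrier_mat n n" and r: "0 < r" and C: "0 \<le> C"
    and le: "\<And>j. j < n \<Longrightarrow> avg Q (\<lambda>x. ennreal (vec_norm2 (X x *\<^sub>v (Y *\<^sub>v unit_vec n j)) powr r)) \<le> ennreal C"
  shows "avg Q (\<lambda>x. ennreal (fro (X x * Y) powr r)) \<le> ennreal (real n powr r * real n * C)"
proof -
  have Yj: "Y *\<^sub>v unit_vec n j \<in> carrier_vec n" for j by (rule mult_mat_vec_carrier[OF Y]) simp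
  have m: "(\<lambda>x. ennreal (vec_norm2 (X x *\<^sub>v (Y *\<^sub>v unit_vec n j)) powr r)) \<in> borel_measurable lebesgue" for j
    using borel_measurable_mat_vec_norm2[OF X Yj[of j]] by measurable
  have "avg Q (\<lambda>x. ennreal (fro (X x * Y) powr r)) \<le>
     avg Q (\<lambda>x. ennreal (real n powr r) * (\<Sum>j<n. ennreal (vec_norm2 (X x *\<^sub>v (Y *\<^sub>v unit_vec n j)) powr r)))"
  proof (rule avg_mono)
    fix x
    have c: "X x \<in> carrier_mat n n" by (rule mat_measurableD(1)[OF X])
    have "(X x * Y) *\<^sub>v unit_vec n j = X x *\<^sub>v (Y *\<^sub>v unit_vec n j)" for j by (rule assoc_mult_mat_vec[OF c Y]) simp
    then have "fro (X x * Y) powr r \<le> real n powr r * (\<Sum>j<n. vec_norm2 (X x *\<^sub>v (Y *\<^sub>v unit_vec n j)) powr r)"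
      using fro_powr_le_cols[of "X x * Y" n r] c Y r by simp
    then show "ennreal (fro (X x * Y) powr r) \<le> ennreal (real n powr r) * (\<Sum>j<n. ennreal (vec_norm2 (X x *\<^sub>v (Y *\<^sub>v unit_vec n j)) powr r))"
      by (simp add: sum_ennreal sum_nonneg ennreal_leI flip: ennreal_mult)
  qed
  also have "\<dots> = ennreal (real n powr r) * (\<Sum>j<n. avg Q (\<lambda>x. ennreal (vec_norm2 (X x *\<^sub>v (Y *\<^sub>v unit_vec n j)) powr r)))"
  proof -
    have "avg Q (\<lambda>x. ennreal (real n powr r) * (\<Sum>j<n. ennreal (vec_norm2 (X x *\<^sub>v (Y *\<^sub>v unit_vec n j)) powr r))) =
      ennreal (real n powr r) * avg Q (\<lambda>x. \<Sum>j<n. ennreal (vec_norm2 (X x *\<^sub>v (Y *\<^sub>v unit_vec n j)) powr r))"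
      using m by (intro avg_cmult[OF _ Q] borel_measurable_sum)
    then show ?thesis unfolding avg_sum[OF m Q] .
  qed
  also have "\<dots> \<le> ennreal (real n powr r) * (\<Sum>j<n. ennreal C)" using le by (intro mult_left_mono sum_mono) auto
  also have "\<dots> = ennreal (real n powr r * real n * C)"
    using C by (simp add: ennreal_mult ennreal_of_nat_eq_real_of_nat mult.assoc)
  finally show ?thesis .
qed

text \<open>The John-Nirenberg estimate at the vectors U.Nq' Q e_j; its right-hand side is then an
  average of |u x * U.Nq' Q|^b, which is bounded by \<open>U.w_Nq'\<close>.\<close>

lemma J1:
  assumes N: "0 < N" and osc: "\<And>Q. Q \<in> hcubes \<Longrightarrow> avg Q (\<lambda>x. ennreal (fro (V.Nq Q * (B x - mB Q) * U.Nq' Q))) \<le> ennreal N"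
    and Q: "Q \<in> hcubes"
  shows "avg Q (\<lambda>x. ennreal (fro (v x * (B x - mB Q) * U.Nq' Q) powr b)) \<le> ennreal (E1 * N powr b)" "0 \<le> E1"
proof -
  interpret J: john_nirenberg_data n v u B V.Nq V.Nq' U.Nq U.Nq' b "apq_family.C2 n a b Av" "2 powr b" "apq_family.C4 a b Au" N
    by (rule JN1[OF N osc])
  have D: "0 \<le> D1" unfolding D1_def by (rule J.jn_const_nonneg)
  have C: "1 \<le> U.C2" unfolding U.C2_def by simp
  have "avg Q (\<lambda>x. ennreal (fro (v x * (B x - mB Q) * U.Nq' Q) powr b)) \<le> ennreal (real n powr b * real n * (D1 * N powr b * U.C2))"
  proof (rule avg_fro_cols[OF Q _ U.Nq_car(2)[OF Q]])
    show "mat_measurable lebesgue n (\<lambda>x. v x * (B x - mB Q))"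
      by (intro mat_measurable_mult V.w_meas mat_measurable_minus B_meas mat_measurable_const mat_mean_carrier)
    fix j assume j: "j < n"
    have "avg Q (\<lambda>x. ennreal (vec_norm2 ((v x * (B x - mB Q)) *\<^sub>v (U.Nq' Q *\<^sub>v unit_vec n j)) powr b)) \<le>
       ennreal (D1 * N powr b) * avg Q (\<lambda>x. ennreal (vec_norm2 (u x *\<^sub>v (U.Nq' Q *\<^sub>v unit_vec n j)) powr b))"
      unfolding D1_def by (rule J.john_nirenberg[OF Q mult_mat_vec_carrier[OF U.Nq_car(2)[OF Q] unit_vec_carrier]])
    also have "\<dots> \<le> ennreal (D1 * N powr b) * avg Q (\<lambda>x. ennreal (fro (u x * U.Nq' Q) powr b))"
      using vec_norm2_mult_unit_le[OF U.w_car U.Nq_car(2)[OF Q] j] V.b1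
      by (intro mult_left_mono avg_mono ennreal_leI powr_mono2) auto
    also have "\<dots> \<le> ennreal (D1 * N powr b) * ennreal U.C2" using U.w_Nq'[OF Q] by (intro mult_left_mono) auto
    finally show "avg Q (\<lambda>x. ennreal (vec_norm2 ((v x * (B x - mB Q)) *\<^sub>v (U.Nq' Q *\<^sub>v unit_vec n j)) powr b)) \<le> ennreal (D1 * N powr b * U.C2)"
      using D C by (subst ennreal_mult) auto
  qed (use V.b1 D C in auto)
  then show "avg Q (\<lambda>x. ennreal (fro (v x * (B x - mB Q) * U.Nq' Q) powr b)) \<le> ennreal (E1 * N powr b)"
    unfolding E1_def by (simp only: mult_ac)
  show "0 \<le> E1" unfolding E1_def using D C by (intro mult_nonneg_nonneg) auto
qed

text \<open>The dual counterpart of \<open>J1\<close>, at the vectors V.Nq Q e_j, followed by taking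
  adjoints back.\<close>

lemma J2:
  assumes N: "0 < N" and osc: "\<And>Q. Q \<in> hcubes \<Longrightarrow> avg Q (\<lambda>x. ennreal (fro (V.Nq Q * (B x - mB Q) * U.Nq' Q))) \<le> ennreal N"
    and Q: "Q \<in> hcubes"
  shows "avg Q (\<lambda>x. ennreal (fro (V.Nq Q * (B x - mB Q) * ui x) powr a)) \<le> ennreal (E2 * N powr a)" "0 \<le> E2"
proof -
  interpret J: john_nirenberg_data n ui vi "\<lambda>x. mat_adjoint (B x)" U.Nq' U.Nq V.Nq' V.Nq a
     "apq_family.C2' a b Au" "apq_family.C3' n a b Av" "apq_family.C4' a b Av" N
    by (rule JN2[OF N osc])
  let ?B = "\<lambda>x. mat_adjoint (B x)" let ?m = "mat_mean (avg_measure Q) n (\<lambda>x. mat_adjoint (B x))"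
  have D: "0 \<le> D2" unfolding D2_def by (rule J.jn_const_nonneg)
  have C: "0 < V.C2'" by (rule V.C2'_pos)
  have fe: "fro (vi x * V.Nq Q) = fro (V.Nq Q * vi x)" for x
  proof -
    have "mat_adjoint (V.Nq Q * vi x) = vi x * V.Nq Q"
      unfolding mat_adjoint_mult[OF V.Nq_car(1)[OF Q] V.wi_car] V.Nq_adj[OF Q] positive_definiteD(2)[OF V.pdwi] ..
    then show ?thesis using fro_adjoint[of "V.Nq Q * vi x"] by simp
  qed
  have "avg Q (\<lambda>x. ennreal (fro (ui x * (?B x - ?m) * V.Nq Q) powr a)) \<le> ennreal (real n powr a * real n * (D2 * N powr a * V.C2'))"
  proof (rule avg_fro_cols[OF Q _ V.Nq_car(1)[OF Q]])
    show "mat_measurable lebesgue n (\<lambda>x. ui x * (?B x - ?m))"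
      by (intro mat_measurable_mult U.wi_meas mat_measurable_minus mat_measurable_adjoint B_meas mat_measurable_const mat_mean_carrier)
    fix j assume j: "j < n"
    have "avg Q (\<lambda>x. ennreal (vec_norm2 ((ui x * (?B x - ?m)) *\<^sub>v (V.Nq Q *\<^sub>v unit_vec n j)) powr a)) \<le>
       ennreal (D2 * N powr a) * avg Q (\<lambda>x. ennreal (vec_norm2 (vi x *\<^sub>v (V.Nq Q *\<^sub>v unit_vec n j)) powr a))"
      unfolding D2_def by (rule J.john_nirenberg[OF Q mult_mat_vec_carrier[OF V.Nq_car(1)[OF Q] unit_vec_carrier]])
    also have "\<dots> \<le> ennreal (D2 * N powr a) * avg Q (\<lambda>x. ennreal (fro (V.Nq Q * vi x) powr a))"
      using vec_norm2_mult_unit_le[OF V.wi_car V.Nq_car(1)[OF Q] j] V.a1 unfolding fe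
      by (intro mult_left_mono avg_mono ennreal_leI powr_mono2) auto
    also have "\<dots> \<le> ennreal (D2 * N powr a) * ennreal V.C2'" using V.Nq_wi[OF Q] by (intro mult_left_mono) auto
    finally show "avg Q (\<lambda>x. ennreal (vec_norm2 ((ui x * (?B x - ?m)) *\<^sub>v (V.Nq Q *\<^sub>v unit_vec n j)) powr a)) \<le> ennreal (D2 * N powr a * V.C2')"
      using D C by (subst ennreal_mult) auto
  qed (use V.a1 D C in auto)
  moreover have "fro (V.Nq Q * (B x - mB Q) * ui x) = fro (ui x * (?B x - ?m) * V.Nq Q)" for x
  proof -
    have c: "V.Nq Q * (B x - mB Q) \<in> carrier_mat n n" using V.Nq_car[OF Q] diff_car by simp
    have "mat_adjoint (V.Nq Q * (B x - mB Q) * ui x) = ui x * (mat_adjoint (B x - mB Q) * V.Nq Q)"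
      unfolding mat_adjoint_mult[OF c U.wi_car] mat_adjoint_mult[OF V.Nq_car(1)[OF Q] diff_car]
      unfolding V.Nq_adj[OF Q] positive_definiteD(2)[OF U.pdwi] ..
    also have "\<dots> = ui x * mat_adjoint (B x - mB Q) * V.Nq Q"
      by (rule assoc_mult_mat[symmetric, OF U.wi_car mat_adjoint_carrier[OF diff_car] V.Nq_car(1)[OF Q]])
    also have "mat_adjoint (B x - mB Q) = ?B x - ?m"
      unfolding mat_integrable_adjoint(2)[OF B_int[OF Q]] by (rule mat_adjoint_minus[OF B_car mat_mean_carrier])
    finally show ?thesis using fro_adjoint[of "V.Nq Q * (B x - mB Q) * ui x"] by simp
  qed
  ultimately show "avg Q (\<lambda>x. ennreal (fro (V.Nq Q * (B x - mB Q) * ui x) powr a)) \<le> ennreal (E2 * N powr a)"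
    unfolding E2_def by (simp only: mult_ac)
  show "0 \<le> E2" unfolding E2_def using D C by (intro mult_nonneg_nonneg) auto
qed

end

section \<open>Equivalence of the mixed oscillation and the BMO quantity\<close>

text \<open>Young's inequality with the conjugate exponent of a, which may be raised to b where y >
  1; the summand 1 absorbs y \<le> 1. The condition on a and b amounts to p \<le> q when a is the
  conjugate exponent of p and b = q.\<close>

lemma young_le:
  fixes x y a b :: real
  assumes "0 \<le> x" "0 \<le> y" "1 < a" "a / (a - 1) \<le> b"
  shows "x * y \<le> 1 + x powr a + y powr b"
proof (cases "x = 0 \<or> y = 0")
  case False
  then have xy: "0 < x" "0 < y" using assms by auto
  define p where "p = a / (a - 1)"
  have p: "1 < p" "1 / a + 1 / p = 1" using assms by (auto simp: p_def field_simps)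
  have "x * y \<le> x powr a / a + y powr p / p" using Youngs_inequality[of a p x y] assms p by simp
  also have "x powr a / a \<le> x powr a" using assms by (simp add: divide_le_eq mult_le_cancel_left1)
  also have "y powr p / p \<le> y powr p" using p by (simp add: divide_le_eq mult_le_cancel_left1)
  also have "y powr p \<le> 1 + y powr b"
  proof (cases "y \<le> 1")
    case True
    then have "y powr p \<le> 1 powr p" using xy p by (intro powr_mono2) auto
    then show ?thesis by (simp add: add_increasing2)
  next
    case False
    then have "y powr p \<le> y powr b" using assms by (intro powr_mono) (auto simp: p_def)
    then show ?thesis by simp
  qed
  finally show ?thesis by simp
qed (use assms in \<open>auto simp: add_nonneg_nonneg\<close>)

context apq_pair
begin

text \<open>B x - B y is split at mB Q, then U.Nq' Q * U.Nq Q is inserted in the first part and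
  V.Nq' Q * V.Nq Q in the second. Each part factors into a function of x times a function of y:
  \<alpha> is bounded by \<open>J1\<close>, \<beta>' by \<open>J2\<close>, and \<beta>, \<alpha>' by
  the reducing matrix estimates.\<close>

lemma upper_bound:
  assumes N: "0 < N" and osc: "\<And>Q. Q \<in> hcubes \<Longrightarrow> avg Q (\<lambda>x. ennreal (fro (V.Nq Q * (B x - mB Q) * U.Nq' Q))) \<le> ennreal N"
    and Q: "Q \<in> hcubes"
  shows "avg Q (\<lambda>x. ennreal_powr (avg Q (\<lambda>y. ennreal (fro (v x * (B x - B y) * ui y) powr a))) (b / a)) \<le> ennreal (Eup * N powr b)"
proof -
  define \<alpha> where "\<alpha> = (\<lambda>x. fro (v x * (B x - mB Q) * U.Nq' Q))"
  define \<beta> where "\<beta> = (\<lambda>y. fro (U.Nq Q * ui y))"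
  define \<alpha>' where "\<alpha>' = (\<lambda>x. fro (v x * V.Nq' Q))"
  define \<beta>' where "\<beta>' = (\<lambda>y. fro (V.Nq Q * (B y - mB Q) * ui y))"
  note J1 = J1[OF N osc Q] and J2 = J2[OF N osc Q]
  have nn: "0 \<le> \<alpha> x" "0 \<le> \<beta> x" "0 \<le> \<alpha>' x" "0 \<le> \<beta>' x" for x by (simp_all add: \<alpha>_def \<beta>_def \<alpha>'_def \<beta>'_def)
  have m: "\<alpha> \<in> borel_measurable lebesgue" "\<beta> \<in> borel_measurable lebesgue" "\<alpha>' \<in> borel_measurable lebesgue" "\<beta>' \<in> borel_measurable lebesgue"
    unfolding \<alpha>_def \<beta>_def \<alpha>'_def \<beta>'_def
    by (intro borel_measurable_fro[of _ n] mat_measurable_mult V.w_meas U.wi_meas mat_measurable_minus B_meas mat_measurable_const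
       mat_mean_carrier V.Nq_car[OF Q] U.Nq_car[OF Q])+
  note [measurable] = m
  have k: "fro (v x * (B x - B y) * ui y) \<le> \<alpha> x * \<beta> y + \<alpha>' x * \<beta>' y" for x y
  proof -
    define X where "X = B x - mB Q"
    define Y where "Y = B y - mB Q"
    have c: "X \<in> carrier_mat n n" "Y \<in> carrier_mat n n" "v x \<in> carrier_mat n n" "ui y \<in> carrier_mat n n"
      "V.Nq Q \<in> carrier_mat n n" "V.Nq' Q \<in> carrier_mat n n" "U.Nq Q \<in> carrier_mat n n" "U.Nq' Q \<in> carrier_mat n n"
      unfolding X_def Y_def using diff_car V.w_car U.wi_car V.Nq_car[OF Q] U.Nq_car[OF Q] by simp_all
    have "(v x * X * U.Nq' Q) * (U.Nq Q * ui y) = v x * (X * ((U.Nq' Q * U.Nq Q) * ui y))"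
      using c by (simp add: assoc_mult_mat[of _ n n _ n _ n])
    then have e1: "(v x * X * U.Nq' Q) * (U.Nq Q * ui y) = v x * X * ui y"
      unfolding U.Nq_inv[OF Q] using c by (simp add: assoc_mult_mat[of _ n n _ n _ n])
    have "(v x * V.Nq' Q) * (V.Nq Q * Y * ui y) = v x * ((V.Nq' Q * V.Nq Q) * (Y * ui y))"
      using c by (simp add: assoc_mult_mat[of _ n n _ n _ n])
    then have e2: "(v x * V.Nq' Q) * (V.Nq Q * Y * ui y) = v x * Y * ui y"
      unfolding V.Nq_inv[OF Q] using c by (simp add: assoc_mult_mat[of _ n n _ n _ n])
    have "B x - B y = X - Y" unfolding X_def Y_def using B_car[of x] B_car[of y] by (intro eq_matI) auto
    then have "v x * (B x - B y) * ui y = v x * X * ui y - v x * Y * ui y"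
      using c by (simp add: mult_minus_distrib_mat[of _ n n _ n] minus_mult_distrib_mat[of _ n n _ _ n])
    also have "fro \<dots> \<le> fro (v x * X * ui y) + fro (v x * Y * ui y)" by (rule fro_minus[of _ n n]) (use c in simp_all)
    also have "fro (v x * X * ui y) \<le> \<alpha> x * \<beta> y" unfolding e1[symmetric] \<alpha>_def \<beta>_def X_def[symmetric]
      by (rule fro_mult[of _ n n _ n]) (use c in simp_all)
    also have "fro (v x * Y * ui y) \<le> \<alpha>' x * \<beta>' y" unfolding e2[symmetric] \<alpha>'_def \<beta>'_def Y_def[symmetric]
      by (rule fro_mult[of _ n n _ n]) (use c in simp_all)
    finally show ?thesis by simp
  qed
  let ?C = "U.C2'" let ?D = "E2 * N powr a"
  have pos: "0 < ?C" "0 \<le> ?D" "1 < a" "1 < b" using U.C2'_pos J2(2) V.a1 V.b1 by auto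
  have inner: "avg Q (\<lambda>y. ennreal (fro (v x * (B x - B y) * ui y) powr a)) \<le> ennreal (2 powr a * (\<alpha> x powr a * ?C + \<alpha>' x powr a * ?D))" for x
  proof -
    have "avg Q (\<lambda>y. ennreal (fro (v x * (B x - B y) * ui y) powr a)) \<le>
      avg Q (\<lambda>y. ennreal (2 powr a * \<alpha> x powr a) * ennreal (\<beta> y powr a) + ennreal (2 powr a * \<alpha>' x powr a) * ennreal (\<beta>' y powr a))"
    proof (rule avg_mono)
      fix y
      have "fro (v x * (B x - B y) * ui y) powr a \<le> (\<alpha> x * \<beta> y + \<alpha>' x * \<beta>' y) powr a"
        using k pos by (intro powr_mono2) auto
      also have "\<dots> \<le> 2 powr a * ((\<alpha> x * \<beta> y) powr a + (\<alpha>' x * \<beta>' y) powr a)" using nn pos by (intro powr_add_le) auto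
      also have "\<dots> = 2 powr a * \<alpha> x powr a * \<beta> y powr a + 2 powr a * \<alpha>' x powr a * \<beta>' y powr a"
        using nn by (simp add: powr_mult algebra_simps)
      finally show "ennreal (fro (v x * (B x - B y) * ui y) powr a) \<le>
         ennreal (2 powr a * \<alpha> x powr a) * ennreal (\<beta> y powr a) + ennreal (2 powr a * \<alpha>' x powr a) * ennreal (\<beta>' y powr a)"
        by (simp add: ennreal_leI flip: ennreal_mult ennreal_plus)
    qed
    also have "\<dots> = ennreal (2 powr a * \<alpha> x powr a) * avg Q (\<lambda>y. ennreal (\<beta> y powr a)) + ennreal (2 powr a * \<alpha>' x powr a) * avg Q (\<lambda>y. ennreal (\<beta>' y powr a))"
      using Q by (simp add: avg_add avg_cmult)
    also have "\<dots> \<le> ennreal (2 powr a * \<alpha> x powr a) * ennreal ?C + ennreal (2 powr a * \<alpha>' x powr a) * ennreal ?D"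
      using U.Nq_wi[OF Q] J2(1) unfolding \<beta>_def \<beta>'_def by (intro add_mono mult_left_mono) auto
    also have "\<dots> = ennreal (2 powr a * (\<alpha> x powr a * ?C + \<alpha>' x powr a * ?D))"
    proof -
      have "ennreal (2 powr a * \<alpha> x powr a) * ennreal ?C = ennreal (2 powr a * \<alpha> x powr a * ?C)"
        "ennreal (2 powr a * \<alpha>' x powr a) * ennreal ?D = ennreal (2 powr a * \<alpha>' x powr a * ?D)"
        using pos by (simp_all only: ennreal_mult[symmetric] mult_nonneg_nonneg powr_ge_zero less_imp_le)
      then show ?thesis using pos by (simp add: distrib_left mult.assoc flip: ennreal_plus)
    qed
    finally show ?thesis .
  qed
  have outer: "ennreal_powr (avg Q (\<lambda>y. ennreal (fro (v x * (B x - B y) * ui y) powr a))) (b / a) \<le>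
     ennreal (2 powr b * 2 powr (b / a) * ?C powr (b / a)) * ennreal (\<alpha> x powr b) + ennreal (2 powr b * 2 powr (b / a) * ?D powr (b / a)) * ennreal (\<alpha>' x powr b)" for x
  proof -
    have "ennreal_powr (avg Q (\<lambda>y. ennreal (fro (v x * (B x - B y) * ui y) powr a))) (b / a) \<le>
      ennreal_powr (ennreal (2 powr a * (\<alpha> x powr a * ?C + \<alpha>' x powr a * ?D))) (b / a)"
      using inner pos by (intro ennreal_powr_mono) auto
    also have "\<dots> = ennreal ((2 powr a * (\<alpha> x powr a * ?C + \<alpha>' x powr a * ?D)) powr (b / a))"
      using pos by (intro ennreal_powr_ennreal) auto
    also have "(2 powr a * (\<alpha> x powr a * ?C + \<alpha>' x powr a * ?D)) powr (b / a) = 2 powr b * (\<alpha> x powr a * ?C + \<alpha>' x powr a * ?D) powr (b / a)"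
      using pos by (simp add: powr_mult powr_powr)
    also have "(\<alpha> x powr a * ?C + \<alpha>' x powr a * ?D) powr (b / a) \<le> 2 powr (b / a) * ((\<alpha> x powr a * ?C) powr (b / a) + (\<alpha>' x powr a * ?D) powr (b / a))"
      using pos by (intro powr_add_le) auto
    also have "(\<alpha> x powr a * ?C) powr (b / a) = \<alpha> x powr b * ?C powr (b / a)" using pos by (simp add: powr_mult powr_powr)
    also have "(\<alpha>' x powr a * ?D) powr (b / a) = \<alpha>' x powr b * ?D powr (b / a)" using pos J2(2) by (simp add: powr_mult powr_powr)
    finally have "ennreal_powr (avg Q (\<lambda>y. ennreal (fro (v x * (B x - B y) * ui y) powr a))) (b / a) \<le>
      ennreal (2 powr b * (2 powr (b / a) * (\<alpha> x powr b * ?C powr (b / a) + \<alpha>' x powr b * ?D powr (b / a))))"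
      by (simp add: mult_left_mono ennreal_leI)
    also have "\<dots> = ennreal (2 powr b * 2 powr (b / a) * ?C powr (b / a) * \<alpha> x powr b + 2 powr b * 2 powr (b / a) * ?D powr (b / a) * \<alpha>' x powr b)"
      by (simp add: algebra_simps)
    finally show ?thesis by (simp flip: ennreal_mult ennreal_plus)
  qed
  have "avg Q (\<lambda>x. ennreal_powr (avg Q (\<lambda>y. ennreal (fro (v x * (B x - B y) * ui y) powr a))) (b / a)) \<le>
     avg Q (\<lambda>x. ennreal (2 powr b * 2 powr (b / a) * ?C powr (b / a)) * ennreal (\<alpha> x powr b) + ennreal (2 powr b * 2 powr (b / a) * ?D powr (b / a)) * ennreal (\<alpha>' x powr b))"
    by (rule avg_mono[OF outer])
  also have "\<dots> = ennreal (2 powr b * 2 powr (b / a) * ?C powr (b / a)) * avg Q (\<lambda>x. ennreal (\<alpha> x powr b)) + ennreal (2 powr b * 2 powr (b / a) * ?D powr (b / a)) * avg Q (\<lambda>x. ennreal (\<alpha>' x powr b))"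
    using Q by (simp add: avg_add avg_cmult)
  also have "\<dots> \<le> ennreal (2 powr b * 2 powr (b / a) * ?C powr (b / a)) * ennreal (E1 * N powr b) + ennreal (2 powr b * 2 powr (b / a) * ?D powr (b / a)) * ennreal V.C2"
    using J1(1) V.w_Nq'[OF Q] unfolding \<alpha>_def \<alpha>'_def by (intro add_mono mult_left_mono) auto
  also have "\<dots> = ennreal (2 powr b * 2 powr (b / a) * ?C powr (b / a) * (E1 * N powr b) + 2 powr b * 2 powr (b / a) * ?D powr (b / a) * V.C2)"
  proof -
    have "0 \<le> V.C2" unfolding V.C2_def by simp
    then show ?thesis using J1(2) by (simp flip: ennreal_mult ennreal_plus)
  qed
  also have "?D powr (b / a) = E2 powr (b / a) * N powr b" using J2(2) pos by (simp add: powr_mult powr_powr)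
  also have "2 powr b * 2 powr (b / a) * ?C powr (b / a) * (E1 * N powr b) + 2 powr b * 2 powr (b / a) * (E2 powr (b / a) * N powr b) * V.C2 = Eup * N powr b"
    unfolding Eup_def by (simp add: algebra_simps)
  finally show ?thesis .
qed

text \<open>Averaging B x - B y over y gives B x - mB Q. After vi x * v x and ui y * u y are
  inserted, the integrand is a product of \<alpha> x, the kernel and \<beta> y, which is separated
  by Young's inequality in y and then in x. The first yields the factor 2 + C2 of
  \<open>Elow\<close>, the second the other factor. The bound is linear in M, so that dividing by
  \<tau> is harmless.\<close>

lemma lower_bound:
  assumes ab: "a / (a - 1) \<le> b" and \<tau>: "0 < \<tau>" and M: "0 < M"
    and X: "\<And>Q. Q \<in> hcubes \<Longrightarrow>
      avg Q (\<lambda>x. ennreal_powr (avg Q (\<lambda>y. ennreal ((\<tau> * fro (v x * (B x - B y) * ui y)) powr a))) (b / a)) \<le> ennreal (M powr b)"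
    and Q: "Q \<in> hcubes"
  shows "ennreal \<tau> * avg Q (\<lambda>x. ennreal (fro (V.Nq Q * (B x - mB Q) * U.Nq' Q))) \<le> ennreal (Elow * M)"
proof -
  interpret prob_space "avg_measure Q" by (rule prob_space_avg_measure[OF Q])
  define k where "k = (\<lambda>x y. \<tau> * fro (v x * (B x - B y) * ui y))"
  define G where "G = (\<lambda>x. avg Q (\<lambda>y. ennreal (k x y powr a)))"
  define \<alpha> where "\<alpha> = (\<lambda>x. fro (V.Nq Q * vi x))"
  define \<beta> where "\<beta> = (\<lambda>y. fro (u y * U.Nq' Q))"
  have nn: "0 \<le> \<alpha> x" "0 \<le> \<beta> x" "0 \<le> k x y" for x y using \<tau> by (simp_all add: \<alpha>_def \<beta>_def k_def)
  have m: "\<alpha> \<in> borel_measurable lebesgue" "\<beta> \<in> borel_measurable lebesgue"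
    unfolding \<alpha>_def \<beta>_def
    by (intro borel_measurable_fro[of _ n] mat_measurable_mult V.wi_meas U.w_meas mat_measurable_const V.Nq_car[OF Q] U.Nq_car[OF Q])+
  note [measurable] = m
  have km [measurable]: "(\<lambda>y. k x y) \<in> borel_measurable lebesgue" for x
    unfolding k_def
    by (intro borel_measurable_times borel_measurable_const borel_measurable_fro[of _ n] mat_measurable_mult U.wi_meas mat_measurable_minus B_meas
       mat_measurable_const V.w_car B_car)
  have km2 [measurable]: "(\<lambda>z. k (fst z) (snd z)) \<in> borel_measurable (lebesgue \<Otimes>\<^sub>M avg_measure Q)"
    unfolding k_def
    by (intro borel_measurable_times borel_measurable_const borel_measurable_fro[of _ n] mat_measurable_mult mat_measurable_minus
       mat_measurable_compose[OF measurable_fst] mat_measurable_compose[OF measurable_snd]) (simp_all add: U.wi_meas V.w_meas B_meas)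
  have G_eq: "G x = (\<integral>\<^sup>+y. ennreal (k x y powr a) \<partial>avg_measure Q)" for x
    unfolding G_def by (rule nn_integral_avg_measure[OF Q, symmetric]) measurable
  have G_meas [measurable]: "G \<in> borel_measurable lebesgue"
  proof -
    have "(\<lambda>z. ennreal (k (fst z) (snd z) powr a)) \<in> borel_measurable (lebesgue \<Otimes>\<^sub>M avg_measure Q)" by measurable
    from borel_measurable_nn_integral_fst[OF this] show ?thesis unfolding G_eq by simp
  qed
  have ep: "(\<lambda>x. ennreal_powr (G x) (b / a)) \<in> borel_measurable lebesgue" by measurable
  have int: "(\<integral>\<^sup>+x. ennreal_powr (G x) (b / a) \<partial>avg_measure Q) \<le> ennreal (M powr b)"
    unfolding nn_integral_avg_measure[OF Q ep] using X[OF Q] unfolding G_def k_def .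
  have fin: "AE x in avg_measure Q. G x < \<infinity>"
  proof -
    have "AE x in avg_measure Q. ennreal_powr (G x) (b / a) \<noteq> \<infinity>"
      using int ep by (intro nn_integral_PInf_AE) (auto simp: top_unique)
    then have "AE x in avg_measure Q. ennreal_powr (G x) (b / a) < \<infinity>"
      by (rule AE_mp) (simp add: top.not_eq_extremum)
    then show ?thesis unfolding ennreal_powr_less_top_iff .
  qed
  have pos: "1 < a" "1 < b" "1 \<le> U.C2" "0 < V.C2'" using V.a1 V.b1 V.C2'_pos by (auto simp: U.C2_def)
  have ab': "b / (b - 1) \<le> a" using ab pos by (simp add: field_simps)
  let ?c = "2 + U.C2"
  have point: "ennreal (\<tau> * fro (V.Nq Q * (B x - mB Q) * U.Nq' Q)) \<le>
     ennreal (?c * M) * (ennreal 1 + (ennreal (\<alpha> x powr a) + ennreal (2 powr (b / a)) * (ennreal (1 / M powr b) * ennreal_powr (G x) (b / a) + ennreal 1)))"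
    if Gx: "G x < \<infinity>" for x
  proof -
    obtain g where g: "G x = ennreal g" "0 \<le> g" using Gx by (cases "G x") auto
    \<comment> \<open>The scale for Young's inequality in y: the a-th moment of k x y / t is at most
      1. The summand M^a keeps t positive, and the b-th power of t / M still has a bounded mean in
      x.\<close>
    define t where "t = (g + M powr a) powr (1 / a)"
    have "0 < g + M powr a" using g(2) M by (intro add_nonneg_pos) auto
    then have t: "0 < t" "t powr a = g + M powr a" using pos by (auto simp: t_def powr_powr)
    have i1: "mat_integrable (avg_measure Q) n (\<lambda>y. B x - B y)" and m1: "mat_mean (avg_measure Q) n (\<lambda>y. B x - B y) = B x - mB Q"
      using mat_integrable_minus[OF mat_integrable_const(1)[OF B_car[of x]] B_int[OF Q]] mat_integrable_const(2)[OF B_car[of x]] by simp_all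
    note i2 = mat_integrable_mult_left[OF i1 V.Nq_car(1)[OF Q]]
    note i3 = mat_integrable_mult_right[OF i2(1) U.Nq_car(2)[OF Q]]
    have "ennreal (fro (V.Nq Q * (B x - mB Q) * U.Nq' Q)) \<le> ennreal (LINT y|avg_measure Q. fro (V.Nq Q * (B x - B y) * U.Nq' Q))"
      using fro_mat_mean_le[OF i3(1)] unfolding i3(2) i2(2) m1 by (rule ennreal_leI)
    also have "\<dots> = (\<integral>\<^sup>+y. ennreal (fro (V.Nq Q * (B x - B y) * U.Nq' Q)) \<partial>avg_measure Q)"
      using fro_integrable[OF i3(1)] by (intro nn_integral_eq_integral[symmetric]) auto
    finally have "ennreal (\<tau> * fro (V.Nq Q * (B x - mB Q) * U.Nq' Q)) \<le> ennreal \<tau> * (\<integral>\<^sup>+y. ennreal (fro (V.Nq Q * (B x - B y) * U.Nq' Q)) \<partial>avg_measure Q)"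
      using \<tau> by (subst ennreal_mult) (auto intro: mult_left_mono)
    also have "\<dots> = (\<integral>\<^sup>+y. ennreal \<tau> * ennreal (fro (V.Nq Q * (B x - B y) * U.Nq' Q)) \<partial>avg_measure Q)"
      using borel_measurable_fro[OF mat_integrable_measurable[OF i3(1)]] by (intro nn_integral_cmult[symmetric]) auto
    also have "\<dots> \<le> (\<integral>\<^sup>+y. ennreal (\<alpha> x * t) * (1 + (ennreal (1 / t powr a) * ennreal (k x y powr a) + ennreal (\<beta> y powr b))) \<partial>avg_measure Q)"
    proof (rule nn_integral_mono)
      fix y
      have c: "B x - B y \<in> carrier_mat n n" "v x \<in> carrier_mat n n" "vi x \<in> carrier_mat n n" "ui y \<in> carrier_mat n n" "u y \<in> carrier_mat n n"
        "V.Nq Q \<in> carrier_mat n n" "U.Nq' Q \<in> carrier_mat n n"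
        using minus_carrier_mat[OF B_car] V.w_car V.wi_car U.w_car U.wi_car V.Nq_car[OF Q] U.Nq_car[OF Q] by simp_all
      have "(V.Nq Q * vi x) * ((v x * (B x - B y) * ui y) * (u y * U.Nq' Q)) = V.Nq Q * ((vi x * v x) * ((B x - B y) * ((ui y * u y) * U.Nq' Q)))"
        using c by (simp add: assoc_mult_mat[of _ n n _ n _ n])
      then have e: "V.Nq Q * (B x - B y) * U.Nq' Q = (V.Nq Q * vi x) * ((v x * (B x - B y) * ui y) * (u y * U.Nq' Q))"
        unfolding V.wiw U.wiw using c by (simp add: assoc_mult_mat[of _ n n _ n _ n])
      have "fro (V.Nq Q * (B x - B y) * U.Nq' Q) \<le> \<alpha> x * fro ((v x * (B x - B y) * ui y) * (u y * U.Nq' Q))"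
        unfolding e \<alpha>_def by (rule fro_mult[of _ n n _ n]) (use c in simp_all)
      also have "\<dots> \<le> \<alpha> x * (fro (v x * (B x - B y) * ui y) * \<beta> y)"
        unfolding \<beta>_def using nn(1) by (intro mult_left_mono fro_mult[of _ n n _ n]) (use c in simp_all)
      finally have "\<tau> * fro (V.Nq Q * (B x - B y) * U.Nq' Q) \<le> \<tau> * (\<alpha> x * (fro (v x * (B x - B y) * ui y) * \<beta> y))" using \<tau> by simp
      also have "\<dots> = (\<alpha> x * t) * ((k x y / t) * \<beta> y)" using t(1) by (simp add: k_def)
      also have "\<dots> \<le> (\<alpha> x * t) * (1 + (k x y / t) powr a + \<beta> y powr b)"
        using nn t(1) pos ab by (intro mult_left_mono young_le) auto
      also have "(k x y / t) powr a = 1 / t powr a * k x y powr a" using nn t(1) by (simp add: powr_divide)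
      finally have "ennreal (\<tau> * fro (V.Nq Q * (B x - B y) * U.Nq' Q)) \<le> ennreal ((\<alpha> x * t) * (1 + (1 / t powr a * k x y powr a + \<beta> y powr b)))"
        by (intro ennreal_leI) (simp add: add.assoc)
      also have "\<dots> = ennreal (\<alpha> x * t) * (1 + (ennreal (1 / t powr a) * ennreal (k x y powr a) + ennreal (\<beta> y powr b)))"
      proof -
        have "ennreal (1 / t powr a * k x y powr a) = ennreal (1 / t powr a) * ennreal (k x y powr a)"
          by (rule ennreal_mult) auto
        then have "ennreal (1 + (1 / t powr a * k x y powr a + \<beta> y powr b)) =
            1 + (ennreal (1 / t powr a) * ennreal (k x y powr a) + ennreal (\<beta> y powr b))"
          by (simp add: ennreal_plus)
        moreover have "ennreal ((\<alpha> x * t) * (1 + (1 / t powr a * k x y powr a + \<beta> y powr b))) =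
            ennreal (\<alpha> x * t) * ennreal (1 + (1 / t powr a * k x y powr a + \<beta> y powr b))"
          using nn t(1) by (intro ennreal_mult) auto
        ultimately show ?thesis by simp
      qed
      finally show "ennreal \<tau> * ennreal (fro (V.Nq Q * (B x - B y) * U.Nq' Q)) \<le>
          ennreal (\<alpha> x * t) * (1 + (ennreal (1 / t powr a) * ennreal (k x y powr a) + ennreal (\<beta> y powr b)))"
        using \<tau> by (simp add: ennreal_mult)
    qed
    also have "\<dots> = ennreal (\<alpha> x * t) * (1 + (ennreal (1 / t powr a) * G x + (\<integral>\<^sup>+y. ennreal (\<beta> y powr b) \<partial>avg_measure Q)))"
    proof -
      have "(\<integral>\<^sup>+y. 1 + (ennreal (1 / t powr a) * ennreal (k x y powr a) + ennreal (\<beta> y powr b)) \<partial>avg_measure Q) =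
        (\<integral>\<^sup>+y. 1 \<partial>avg_measure Q) + (\<integral>\<^sup>+y. ennreal (1 / t powr a) * ennreal (k x y powr a) + ennreal (\<beta> y powr b) \<partial>avg_measure Q)"
        by (intro nn_integral_add) auto
      also have "(\<integral>\<^sup>+y. 1 \<partial>avg_measure Q) = 1" unfolding nn_integral_const emeasure_space_1 by simp
      also have "(\<integral>\<^sup>+y. ennreal (1 / t powr a) * ennreal (k x y powr a) + ennreal (\<beta> y powr b) \<partial>avg_measure Q) =
        (\<integral>\<^sup>+y. ennreal (1 / t powr a) * ennreal (k x y powr a) \<partial>avg_measure Q) + (\<integral>\<^sup>+y. ennreal (\<beta> y powr b) \<partial>avg_measure Q)"
        by (intro nn_integral_add) auto
      also have "(\<integral>\<^sup>+y. ennreal (1 / t powr a) * ennreal (k x y powr a) \<partial>avg_measure Q) = ennreal (1 / t powr a) * G x"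
        unfolding G_eq by (intro nn_integral_cmult) auto
      finally show ?thesis by (subst nn_integral_cmult) auto
    qed
    also have "\<dots> \<le> ennreal (\<alpha> x * t) * (1 + (1 + ennreal U.C2))"
    proof -
      have "ennreal (1 / t powr a) * G x = ennreal (g / t powr a)" unfolding g(1) using g(2) by (subst ennreal_mult[symmetric]) auto
      also have "\<dots> \<le> ennreal 1" using g t M by (intro ennreal_leI) (simp add: divide_le_eq_1 add_nonneg_pos)
      finally have "ennreal (1 / t powr a) * G x \<le> 1" by simp
      moreover have "(\<integral>\<^sup>+y. ennreal (\<beta> y powr b) \<partial>avg_measure Q) \<le> ennreal U.C2"
      proof -
        have "(\<integral>\<^sup>+y. ennreal (\<beta> y powr b) \<partial>avg_measure Q) = avg Q (\<lambda>y. ennreal (\<beta> y powr b))"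
          by (rule nn_integral_avg_measure[OF Q]) measurable
        also have "\<dots> \<le> ennreal U.C2" unfolding \<beta>_def by (rule U.w_Nq'[OF Q])
        finally show ?thesis .
      qed
      ultimately show ?thesis by (intro mult_left_mono add_left_mono add_mono) auto
    qed
    also have "\<dots> = ennreal (?c * M * (\<alpha> x * (t / M)))"
    proof -
      have "1 + (1 + ennreal U.C2) = ennreal ?c" using pos by (simp add: ennreal_plus[symmetric] del: ennreal_plus flip: ennreal_1)
      moreover have "?c * M * (\<alpha> x * (t / M)) = (\<alpha> x * t) * ?c" using M by simp
      ultimately show ?thesis using nn t(1) pos by (simp only: ennreal_mult mult_nonneg_nonneg less_imp_le)
    qed
    also have "\<dots> \<le> ennreal (?c * M * (1 + (\<alpha> x powr a + 2 powr (b / a) * (1 / M powr b * g powr (b / a) + 1))))"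
    proof (intro ennreal_leI mult_left_mono)
      have "(t / M) * \<alpha> x \<le> 1 + (t / M) powr b + \<alpha> x powr a"
        using t(1) M nn pos ab' by (intro young_le) auto
      also have "(t / M) powr b = (g + M powr a) powr (b / a) / M powr b"
        using t(1) M by (simp add: powr_divide t_def powr_powr)
      also have "\<dots> \<le> 2 powr (b / a) * (g powr (b / a) + (M powr a) powr (b / a)) / M powr b"
        using g M pos by (intro divide_right_mono powr_add_le) auto
      also have "(M powr a) powr (b / a) = M powr b" using pos by (simp add: powr_powr)
      also have "2 powr (b / a) * (g powr (b / a) + M powr b) / M powr b = 2 powr (b / a) * (1 / M powr b * g powr (b / a) + 1)"
        using M by (simp add: field_simps)
      finally show "\<alpha> x * (t / M) \<le> 1 + (\<alpha> x powr a + 2 powr (b / a) * (1 / M powr b * g powr (b / a) + 1))"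
        by (simp add: mult.commute)
      show "0 \<le> ?c * M" using pos M by simp
    qed
    also have "\<dots> = ennreal (?c * M) * (ennreal 1 + (ennreal (\<alpha> x powr a) + ennreal (2 powr (b / a)) * (ennreal (1 / M powr b) * ennreal_powr (G x) (b / a) + ennreal 1)))"
    proof -
      have "0 \<le> 1 / M powr b * g powr (b / a)" by simp
      then show ?thesis unfolding g(1) ennreal_powr_ennreal[OF g(2)] using pos M
        by (simp only: ennreal_mult ennreal_plus mult_nonneg_nonneg add_nonneg_nonneg powr_ge_zero less_imp_le zero_le_one
            divide_nonneg_nonneg zero_le_numeral order_trans[OF zero_le_one])
    qed
    finally show ?thesis .
  qed
  have hm: "(\<lambda>x. ennreal (fro (V.Nq Q * (B x - mB Q) * U.Nq' Q))) \<in> borel_measurable lebesgue"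
    using borel_measurable_fro[OF mat_measurable_mult[OF mat_measurable_mult[OF mat_measurable_const[OF V.Nq_car(1)[OF Q]]
      mat_measurable_minus[OF B_meas mat_measurable_const[OF mat_mean_carrier]]] mat_measurable_const[OF U.Nq_car(2)[OF Q]]]] by measurable
  have "ennreal \<tau> * avg Q (\<lambda>x. ennreal (fro (V.Nq Q * (B x - mB Q) * U.Nq' Q))) =
     (\<integral>\<^sup>+x. ennreal \<tau> * ennreal (fro (V.Nq Q * (B x - mB Q) * U.Nq' Q)) \<partial>avg_measure Q)"
    using hm by (subst nn_integral_cmult) (auto simp: nn_integral_avg_measure[OF Q])
  also have "\<dots> \<le> (\<integral>\<^sup>+x. ennreal (?c * M) * (ennreal 1 + (ennreal (\<alpha> x powr a) + ennreal (2 powr (b / a)) * (ennreal (1 / M powr b) * ennreal_powr (G x) (b / a) + ennreal 1))) \<partial>avg_measure Q)"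
  proof (rule nn_integral_mono_AE)
    show "AE x in avg_measure Q. ennreal \<tau> * ennreal (fro (V.Nq Q * (B x - mB Q) * U.Nq' Q)) \<le>
       ennreal (?c * M) * (ennreal 1 + (ennreal (\<alpha> x powr a) + ennreal (2 powr (b / a)) * (ennreal (1 / M powr b) * ennreal_powr (G x) (b / a) + ennreal 1)))"
      using fin
    proof eventually_elim
      case (elim x)
      then show ?case using point[OF elim] \<tau> by (subst ennreal_mult[symmetric]) auto
    qed
  qed
  also have "\<dots> = ennreal (?c * M) * (1 + ((\<integral>\<^sup>+x. ennreal (\<alpha> x powr a) \<partial>avg_measure Q) +
      ennreal (2 powr (b / a)) * (ennreal (1 / M powr b) * (\<integral>\<^sup>+x. ennreal_powr (G x) (b / a) \<partial>avg_measure Q) + 1)))"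
  proof -
    have one: "(\<integral>\<^sup>+x. ennreal 1 \<partial>avg_measure Q) = 1" unfolding nn_integral_const emeasure_space_1 by simp
    have ep': "(\<lambda>x. ennreal_powr (G x) (b / a)) \<in> borel_measurable (avg_measure Q)" using ep by simp
    note [measurable] = ep'
    have am: "\<alpha> \<in> borel_measurable (avg_measure Q)" using m(1) by simp
    note [measurable] = am
    show ?thesis
      by (subst nn_integral_cmult, measurable, subst nn_integral_add, measurable, subst nn_integral_add, measurable,
          subst nn_integral_cmult, measurable, subst nn_integral_add, measurable, subst nn_integral_cmult, measurable)
        (simp only: one)
  qed
  also have "\<dots> \<le> ennreal (?c * M) * (1 + (ennreal V.C2' + ennreal (2 powr (b / a)) * (ennreal (1 / M powr b) * ennreal (M powr b) + 1)))"
  proof -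
    have "(\<integral>\<^sup>+x. ennreal (\<alpha> x powr a) \<partial>avg_measure Q) \<le> ennreal V.C2'"
    proof -
      have "(\<integral>\<^sup>+y. ennreal (\<alpha> y powr a) \<partial>avg_measure Q) = avg Q (\<lambda>y. ennreal (\<alpha> y powr a))"
        by (rule nn_integral_avg_measure[OF Q]) measurable
      also have "\<dots> \<le> ennreal V.C2'" unfolding \<alpha>_def by (rule V.Nq_wi[OF Q])
      finally show ?thesis .
    qed
    then show ?thesis using int by (intro mult_left_mono add_left_mono add_mono add_right_mono) auto
  qed
  also have "ennreal (1 / M powr b) * ennreal (M powr b) = 1" using M by (simp flip: ennreal_mult)
  also have "ennreal (?c * M) * (1 + (ennreal V.C2' + ennreal (2 powr (b / a)) * (1 + 1))) = ennreal (Elow * M)"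
  proof -
    have "1 + (ennreal V.C2' + ennreal (2 powr (b / a)) * (1 + 1)) = ennreal (1 + V.C2' + 2 * 2 powr (b / a))"
    proof -
      have "ennreal (2 powr (b / a)) * (1 + 1) = ennreal (2 * 2 powr (b / a))"
        by (simp add: ennreal_mult mult.commute)
      then show ?thesis using pos by (simp add: add.assoc ennreal_plus)
    qed
    moreover have "Elow * M = (?c * M) * (1 + V.C2' + 2 * 2 powr (b / a))" unfolding Elow_def by simp
    ultimately show ?thesis using pos M by (simp only: ennreal_mult mult_nonneg_nonneg add_nonneg_nonneg less_imp_le zero_le_one powr_ge_zero zero_le_numeral order_trans[OF zero_le_one])
  qed
  finally show ?thesis .
qed

end

section \<open>Mixed averages\<close>

lemma nn_integral_cmult_le:
  fixes f :: "'x \<Rightarrow> ennreal"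
  assumes c: "0 < c"
  shows "(\<integral>\<^sup>+x. ennreal c * f x \<partial>M) \<le> ennreal c * (\<integral>\<^sup>+x. f x \<partial>M)"
  unfolding nn_integral_def[of M "\<lambda>x. ennreal c * f x"]
proof (rule SUP_least)
  fix g assume g: "g \<in> {g. simple_function M g \<and> g \<le> (\<lambda>x. ennreal c * f x)}"
  have inv: "ennreal (1 / c) * (ennreal c * y) = y" "ennreal c * (ennreal (1 / c) * y) = y" for y
    using c by (simp_all add: mult.assoc[symmetric] flip: ennreal_mult)
  have gm: "g \<in> borel_measurable M" using g by (auto intro: borel_measurable_simple_function)
  have "ennreal (1 / c) * g x \<le> f x" for x
  proof -
    have "ennreal (1 / c) * g x \<le> ennreal (1 / c) * (ennreal c * f x)" using g by (intro mult_left_mono) (auto simp: le_fun_def)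
    then show ?thesis by (simp only: inv)
  qed
  then have "ennreal c * (\<integral>\<^sup>+x. ennreal (1 / c) * g x \<partial>M) \<le> ennreal c * (\<integral>\<^sup>+x. f x \<partial>M)"
    by (intro mult_left_mono nn_integral_mono) auto
  moreover have "ennreal c * (\<integral>\<^sup>+x. ennreal (1 / c) * g x \<partial>M) = integral\<^sup>S M g"
    using g by (subst nn_integral_cmult[OF gm]) (auto simp: inv nn_integral_eq_simple_integral)
  ultimately show "integral\<^sup>S M g \<le> ennreal c * (\<integral>\<^sup>+x. f x \<partial>M)" by simp
qed

lemma avg_cmult_le:
  assumes "0 < c" shows "avg Q (\<lambda>x. ennreal c * f x) \<le> ennreal c * avg Q f"
proof -
  have "(\<integral>\<^sup>+x\<in>Q. (ennreal c * f x) \<partial>lebesgue) \<le> ennreal c * (\<integral>\<^sup>+x\<in>Q. f x \<partial>lebesgue)"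
    using nn_integral_cmult_le[OF assms, of lebesgue "\<lambda>x. f x * indicator Q x"] by (simp add: mult.assoc)
  then show ?thesis unfolding avg_def ennreal_times_divide by (rule divide_right_mono_ennreal)
qed

lemma avg_cong_AE:
  assumes "AE x in lebesgue. f x = g x"
  shows "avg Q f = avg Q g"
  unfolding avg_def by (rule arg_cong2[where f="(/)"]) (intro nn_integral_cong_AE, use assms in eventually_elim, auto)

text \<open>The b-th power of the mixed norm, L^a in y inside L^b in x, of the kernel on Q. With a
  conjugate to p and b = q, its supremum over cubes is the weight constant when the kernel is the
  operator norm of W^(1/q)(x) W^(-1/q)(y).\<close>

definition mixed_avg :: "(real^'d) set \<Rightarrow> real \<Rightarrow> real \<Rightarrow> (real^'d \<Rightarrow> real^'d \<Rightarrow> real) \<Rightarrow> ennreal" where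
  "mixed_avg Q a b k = avg Q (\<lambda>x. ennreal_powr (avg Q (\<lambda>y. ennreal (k x y powr a))) (b / a))"

lemma mixed_avg_mono:
  assumes "\<And>x y. 0 \<le> k x y" "\<And>x y. k x y \<le> k' x y" "0 < a" "0 < b"
  shows "mixed_avg Q a b k \<le> mixed_avg Q a b k'"
  unfolding mixed_avg_def using assms
  by (intro avg_mono ennreal_powr_mono ennreal_leI powr_mono2) auto

lemma ennreal_powr_cmult:
  assumes c: "0 < c" and r: "0 < r"
  shows "ennreal_powr (ennreal c * x) r = ennreal (c powr r) * ennreal_powr x r"
proof (cases x)
  case (real t)
  then show ?thesis using c by (simp add: powr_mult flip: ennreal_mult)
qed (use c in \<open>simp add: ennreal_mult_top ennreal_powr_def\<close>)

lemma mixed_avg_scale_le: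
  assumes k: "\<And>x y. 0 \<le> k x y" and c: "0 < c" and ab: "0 < a" "0 < b"
  shows "mixed_avg Q a b (\<lambda>x y. c * k x y) \<le> ennreal (c powr b) * mixed_avg Q a b k"
proof -
  have "ennreal_powr (avg Q (\<lambda>y. ennreal ((c * k x y) powr a))) (b / a) \<le>
      ennreal (c powr b) * ennreal_powr (avg Q (\<lambda>y. ennreal (k x y powr a))) (b / a)" for x
  proof -
    have "avg Q (\<lambda>y. ennreal ((c * k x y) powr a)) = avg Q (\<lambda>y. ennreal (c powr a) * ennreal (k x y powr a))"
      using k c by (simp add: powr_mult ennreal_mult)
    also have "\<dots> \<le> ennreal (c powr a) * avg Q (\<lambda>y. ennreal (k x y powr a))" using c by (intro avg_cmult_le) simp
    finally have "ennreal_powr (avg Q (\<lambda>y. ennreal ((c * k x y) powr a))) (b / a) \<le>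
        ennreal_powr (ennreal (c powr a) * avg Q (\<lambda>y. ennreal (k x y powr a))) (b / a)"
      using ab by (intro ennreal_powr_mono) auto
    also have "\<dots> = ennreal (c powr b) * ennreal_powr (avg Q (\<lambda>y. ennreal (k x y powr a))) (b / a)"
      using c ab by (subst ennreal_powr_cmult) (auto simp: powr_powr)
    finally show ?thesis .
  qed
  then have "mixed_avg Q a b (\<lambda>x y. c * k x y) \<le> avg Q (\<lambda>x. ennreal (c powr b) * ennreal_powr (avg Q (\<lambda>y. ennreal (k x y powr a))) (b / a))"
    unfolding mixed_avg_def by (rule avg_mono)
  also have "\<dots> \<le> ennreal (c powr b) * mixed_avg Q a b k" unfolding mixed_avg_def using c by (intro avg_cmult_le) simp
  finally show ?thesis .
qed

lemma mixed_avg_const: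
  assumes Q: "Q \<in> hcubes" and c: "0 \<le> c" and ab: "0 < a" "0 < b"
  shows "mixed_avg Q a b (\<lambda>_ _. c) = ennreal (c powr b)"
  unfolding mixed_avg_def avg_const[OF Q] using c ab by (simp add: powr_powr)

section \<open>Measurable kernels and sums of kernels\<close>

definition kernel_measurable :: "(real^'d \<Rightarrow> real^'d \<Rightarrow> real) \<Rightarrow> bool" where
  "kernel_measurable k \<longleftrightarrow> (\<lambda>z. k (fst z) (snd z)) \<in> borel_measurable (lebesgue \<Otimes>\<^sub>M lebesgue)"

lemma kernel_measurable_slice:
  assumes "kernel_measurable k" shows "(\<lambda>y. k x y) \<in> borel_measurable lebesgue"
proof -
  have "(\<lambda>y. (x, y)) \<in> lebesgue \<rightarrow>\<^sub>M lebesgue \<Otimes>\<^sub>M lebesgue" by simp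
  from measurable_compose[OF this assms[unfolded kernel_measurable_def]] show ?thesis by simp
qed

lemma kernel_inner_measurable:
  assumes k: "kernel_measurable k" and Q: "Q \<in> hcubes"
  shows "(\<lambda>x. avg Q (\<lambda>y. ennreal (k x y powr a))) \<in> borel_measurable lebesgue"
proof -
  interpret prob_space "avg_measure Q" by (rule prob_space_avg_measure[OF Q])
  have "sets (lebesgue \<Otimes>\<^sub>M avg_measure Q) = sets (lebesgue \<Otimes>\<^sub>M lebesgue)" by (rule sets_pair_measure_cong) simp_all
  then have [measurable]: "(\<lambda>z. k (fst z) (snd z)) \<in> borel_measurable (lebesgue \<Otimes>\<^sub>M avg_measure Q)"
    using k unfolding kernel_measurable_def by (simp cong: measurable_cong_sets)
  have "(\<lambda>z. ennreal (k (fst z) (snd z) powr a)) \<in> borel_measurable (lebesgue \<Otimes>\<^sub>M avg_measure Q)" by measurable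
  from borel_measurable_nn_integral_fst[OF this]
  have "(\<lambda>x. \<integral>\<^sup>+y. ennreal (k x y powr a) \<partial>avg_measure Q) \<in> borel_measurable lebesgue" by simp
  moreover have "(\<lambda>y. ennreal (k x y powr a)) \<in> borel_measurable lebesgue" for x
    using kernel_measurable_slice[OF k, of x] by measurable
  ultimately show ?thesis by (simp add: nn_integral_avg_measure[OF Q])
qed

lemma ennreal_powr_add_le:
  assumes "0 < r"
  shows "ennreal_powr (x + y) r \<le> ennreal (2 powr r) * (ennreal_powr x r + ennreal_powr y r)"
proof (cases "x = \<infinity> \<or> y = \<infinity>")
  case False
  then obtain s t where st: "x = ennreal s" "0 \<le> s" "y = ennreal t" "0 \<le> t" by (cases x; cases y) auto
  have "(s + t) powr r \<le> 2 powr r * (s powr r + t powr r)" using st assms by (intro powr_add_le) auto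
  then show ?thesis unfolding st(1,3) using st by (simp add: ennreal_leI flip: ennreal_plus ennreal_mult)
qed (auto simp: ennreal_powr_def ennreal_mult_top)

lemma mixed_avg_add_le:
  assumes k: "kernel_measurable k" "\<And>x y. 0 \<le> k x y" and k': "kernel_measurable k'" "\<And>x y. 0 \<le> k' x y"
    and Q: "Q \<in> hcubes" and ab: "0 < a" "0 < b"
  shows "mixed_avg Q a b (\<lambda>x y. k x y + k' x y) \<le> ennreal (2 powr b * 2 powr (b / a)) * (mixed_avg Q a b k + mixed_avg Q a b k')"
proof -
  let ?G = "\<lambda>k x. avg Q (\<lambda>y. ennreal (k x y powr a))"
  have m: "(\<lambda>y. ennreal (k x y powr a)) \<in> borel_measurable lebesgue" "(\<lambda>y. ennreal (k' x y powr a)) \<in> borel_measurable lebesgue" for x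
    using kernel_measurable_slice[OF k(1), of x] kernel_measurable_slice[OF k'(1), of x] by measurable
  have "ennreal_powr (?G (\<lambda>x y. k x y + k' x y) x) (b / a) \<le> ennreal (2 powr b * 2 powr (b / a)) * (ennreal_powr (?G k x) (b / a) + ennreal_powr (?G k' x) (b / a))" for x
  proof -
    have "?G (\<lambda>x y. k x y + k' x y) x \<le> avg Q (\<lambda>y. ennreal (2 powr a) * (ennreal (k x y powr a) + ennreal (k' x y powr a)))"
    proof (rule avg_mono)
      fix y
      have "(k x y + k' x y) powr a \<le> 2 powr a * (k x y powr a + k' x y powr a)" using k k' ab by (intro powr_add_le) auto
      then show "ennreal ((k x y + k' x y) powr a) \<le> ennreal (2 powr a) * (ennreal (k x y powr a) + ennreal (k' x y powr a))"
        by (simp add: ennreal_leI flip: ennreal_plus ennreal_mult)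
    qed
    also have "\<dots> = ennreal (2 powr a) * (?G k x + ?G k' x)"
      using m by (subst avg_cmult[OF _ Q]) (auto simp: avg_add[OF _ _ Q])
    finally have "ennreal_powr (?G (\<lambda>x y. k x y + k' x y) x) (b / a) \<le> ennreal_powr (ennreal (2 powr a) * (?G k x + ?G k' x)) (b / a)"
      using ab by (intro ennreal_powr_mono) auto
    also have "\<dots> = ennreal (2 powr b) * ennreal_powr (?G k x + ?G k' x) (b / a)"
      using ab by (subst ennreal_powr_cmult) (auto simp: powr_powr)
    also have "\<dots> \<le> ennreal (2 powr b) * (ennreal (2 powr (b / a)) * (ennreal_powr (?G k x) (b / a) + ennreal_powr (?G k' x) (b / a)))"
      using ab by (intro mult_left_mono ennreal_powr_add_le) auto
    finally show ?thesis by (simp add: ennreal_mult mult.assoc)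
  qed
  then have "mixed_avg Q a b (\<lambda>x y. k x y + k' x y) \<le>
     avg Q (\<lambda>x. ennreal (2 powr b * 2 powr (b / a)) * (ennreal_powr (?G k x) (b / a) + ennreal_powr (?G k' x) (b / a)))"
    unfolding mixed_avg_def by (rule avg_mono)
  also have "\<dots> = ennreal (2 powr b * 2 powr (b / a)) * (mixed_avg Q a b k + mixed_avg Q a b k')"
  proof -
    have [measurable]: "(\<lambda>x. ?G k x) \<in> borel_measurable lebesgue" "(\<lambda>x. ?G k' x) \<in> borel_measurable lebesgue"
      by (rule kernel_inner_measurable[OF k(1) Q] kernel_inner_measurable[OF k'(1) Q])+
    have "(\<lambda>x. ennreal_powr (?G k x) (b / a)) \<in> borel_measurable lebesgue" "(\<lambda>x. ennreal_powr (?G k' x) (b / a)) \<in> borel_measurable lebesgue"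
      by measurable
    then show ?thesis unfolding mixed_avg_def by (subst avg_cmult[OF _ Q]) (auto simp: avg_add[OF _ _ Q])
  qed
  finally show ?thesis .
qed

lemma kernel_measurable_fro:
  assumes "mat_measurable (lebesgue \<Otimes>\<^sub>M lebesgue) n (\<lambda>z. X (fst z) (snd z))"
  shows "kernel_measurable (\<lambda>x y. fro (X x y))"
  unfolding kernel_measurable_def by (rule borel_measurable_fro[OF assms])

section \<open>Passage from closed cubes and almost everywhere defined powers to half-open cubes and
  regularised weights\<close>

lemma SUP_cubes:
  assumes "\<And>c l. 0 < l \<Longrightarrow> F (cbox c (c + l *\<^sub>R One)) = G (hcube c l)"
  shows "(SUP Q\<in>cubes. F Q) = (SUP Q\<in>hcubes. G Q)"
proof -
  have "F ` cubes = G ` hcubes"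
  proof (intro equalityI subsetI)
    fix y assume "y \<in> F ` cubes"
    then obtain c l where "0 < l" "y = F (cbox c (c + l *\<^sub>R One))" by (auto simp: cubes_def)
    then show "y \<in> G ` hcubes" using assms[of l c] hcubeI[of l c] by simp
  next
    fix y assume "y \<in> G ` hcubes"
    then obtain c l where cl: "0 < l" "y = G (hcube c l)" by (auto simp: hcubes_def)
    then have "cbox c (c + l *\<^sub>R One) \<in> cubes" by (auto simp: cubes_def)
    then have "F (cbox c (c + l *\<^sub>R One)) \<in> F ` cubes" by (rule imageI)
    then show "y \<in> F ` cubes" unfolding assms[OF cl(1), of c] cl(2) .
  qed
  then show ?thesis by simp
qed

lemma borel_measurable_lebesgue_AE_eq:
  fixes f g :: "real^'d \<Rightarrow> 'b::topological_space"
  assumes f: "f \<in> borel_measurable lebesgue" and eq: "AE x in lebesgue. f x = g x"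
  shows "g \<in> borel_measurable lebesgue"
proof (rule measurableI)
  fix A :: "'b set" assume A: "A \<in> sets borel"
  show "g -` A \<inter> space lebesgue \<in> sets lebesgue"
  proof (rule completion.in_sets_AE)
    show "f -` A \<inter> space lebesgue \<in> sets lebesgue" using f A by (rule measurable_sets)
    show "AE x in lebesgue. (x \<in> f -` A \<inter> space lebesgue) = (x \<in> g -` A \<inter> space lebesgue)"
      using eq by eventually_elim auto
  qed auto
qed simp

lemma mat_avg_eq_mean:
  fixes A A' :: "real^'d \<Rightarrow> cmat"
  assumes l: "0 < l" and A': "mat_measurable lebesgue n A'" and eq: "AE x in lebesgue. A x = A' x"
  shows "mat_avg n (cbox c (c + l *\<^sub>R One)) A = mat_mean (avg_measure (hcube c l)) n A'"
proof -
  have Q: "hcube c l \<in> hcubes" by (rule hcubeI[OF l])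
  have e: "(LINT x:cbox c (c + l *\<^sub>R One)|lebesgue. A x $$ (i, j)) = (LINT x:hcube c l|lebesgue. A' x $$ (i, j))"
    if ij: "i < n" "j < n" for i j
  proof -
    have m: "(\<lambda>x. indicator (hcube c l) x *\<^sub>R (A' x $$ (i, j))) \<in> borel_measurable lebesgue"
      using mat_measurableD(2)[OF A' ij] by (intro borel_measurable_scaleR borel_measurable_indicator) auto
    have ae: "AE x in lebesgue. indicator (hcube c l) x *\<^sub>R (A' x $$ (i, j)) = indicator (cbox c (c + l *\<^sub>R One)) x *\<^sub>R (A x $$ (i, j))"
      using AE_hcube_iff[of c l] eq by eventually_elim (auto simp: indicator_def)
    show ?thesis unfolding set_lebesgue_integral_def
      by (rule integral_cong_AE[OF m borel_measurable_lebesgue_AE_eq[OF m ae] ae, symmetric])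
  qed
  have "measure lebesgue (cbox c (c + l *\<^sub>R One)) = measure lebesgue (hcube c l)"
    unfolding measure_def emeasure_cube[OF l] emeasure_hcube[OF l] ..
  then have "mat_avg n (cbox c (c + l *\<^sub>R One)) A = mat_avg n (hcube c l) A'"
    unfolding mat_avg_def by (intro eq_matI) (auto simp: e)
  then show ?thesis using mat_avg_mean[OF Q A'] by simp
qed

definition reg_powr :: "nat \<Rightarrow> ('x \<Rightarrow> cmat) \<Rightarrow> real \<Rightarrow> 'x \<Rightarrow> cmat" where
  "reg_powr n W s x = mat_powr (regularized n W x) s"

lemma reg_powr_measurable: "matrix_weight n W \<Longrightarrow> mat_measurable lebesgue n (reg_powr n W s)"
  unfolding reg_powr_def[abs_def] by (intro mat_measurable_powr regularized_measurable regularized_pd)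

lemma reg_powr_pd: "positive_definite n (reg_powr n W s x)"
  unfolding reg_powr_def by (intro pd_mat_powr regularized_pd)

lemma reg_powr_carrier: "reg_powr n W s x \<in> carrier_mat n n"
  by (rule positive_definiteD(1)[OF reg_powr_pd])

lemma reg_powr_inverse: "reg_powr n W s x * reg_powr n W (- s) x = 1\<^sub>m n" "reg_powr n W (- s) x * reg_powr n W s x = 1\<^sub>m n"
  unfolding reg_powr_def by (rule mat_powr_inverse[OF regularized_pd])+

lemma reg_powr_AE: "matrix_weight n W \<Longrightarrow> AE x in lebesgue. weight_powr W s x = reg_powr n W s x"
  using regularized_AE[of n W] by (auto simp: weight_powr_def reg_powr_def elim!: eventually_mono)

lemma reg_powr_AE2: "matrix_weight n W \<Longrightarrow> AE x in lebesgue. weight_powr (weight_powr W r) s x = reg_powr n W (r * s) x"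
  using regularized_AE[of n W] mat_powr_powr[OF regularized_pd[of n W]]
  by (auto simp: weight_powr_def reg_powr_def elim!: eventually_mono) metis

lemma Apq_eq_SUP_mixed_avg:
  fixes W X Y :: "real^'d \<Rightarrow> cmat"
  assumes X: "AE x in lebesgue. weight_powr W (1 / q) x = X x" and Y: "AE x in lebesgue. weight_powr W (- (1 / q)) x = Y x"
  shows "Apq p q W = (SUP Q\<in>hcubes. mixed_avg Q (conj_exp p) q (\<lambda>x y. mat_opnorm (X x * Y y)))"
  unfolding Apq_def
proof (rule SUP_cubes)
  fix c :: "real^'d" and l :: real assume l: "0 < l"
  have "AE x in lebesgue. ennreal_powr (avg (hcube c l) (\<lambda>y. ennreal (mat_opnorm (weight_powr W (1 / q) x * weight_powr W (- (1 / q)) y) powr conj_exp p))) (q / conj_exp p)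
     = ennreal_powr (avg (hcube c l) (\<lambda>y. ennreal (mat_opnorm (X x * Y y) powr conj_exp p))) (q / conj_exp p)"
    using X
  proof eventually_elim
    case (elim x)
    show ?case unfolding elim
      by (rule arg_cong[where f="\<lambda>z. ennreal_powr z (q / conj_exp p)"], rule avg_cong_AE) (use Y in eventually_elim, simp)
  qed
  from avg_cong_AE[OF this, of "hcube c l"]
  show "avg (cbox c (c + l *\<^sub>R One)) (\<lambda>x. ennreal_powr (avg (cbox c (c + l *\<^sub>R One)) (\<lambda>y. ennreal (mat_opnorm (weight_powr W (1 / q) x * weight_powr W (- (1 / q)) y) powr conj_exp p))) (q / conj_exp p))
     = mixed_avg (hcube c l) (conj_exp p) q (\<lambda>x y. mat_opnorm (X x * Y y))"
    unfolding mixed_avg_def avg_hcube[OF l] .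
qed

lemma mixed_avg_fro_le:
  assumes X: "\<And>x y. X x y \<in> carrier_mat n n" and n: "0 < n" and ab: "0 < a" "0 < b"
  shows "mixed_avg Q a b (\<lambda>x y. fro (X x y)) \<le> ennreal (real n powr b) * mixed_avg Q a b (\<lambda>x y. mat_opnorm (X x y))"
proof -
  have "mixed_avg Q a b (\<lambda>x y. fro (X x y)) \<le> mixed_avg Q a b (\<lambda>x y. real n * mat_opnorm (X x y))"
    using fro_le_opnorm[OF X] ab by (intro mixed_avg_mono) auto
  also have "\<dots> \<le> ennreal (real n powr b) * mixed_avg Q a b (\<lambda>x y. mat_opnorm (X x y))"
    using n ab by (intro mixed_avg_scale_le) auto
  finally show ?thesis .
qed

lemma conj_exp_gt_1: "1 < p \<Longrightarrow> 1 < conj_exp p"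
  by (simp add: conj_exp_def field_simps)

text \<open>The factor n^q is the price of replacing the operator norm in the kernel by the
  Frobenius norm.\<close>

lemma apq_family_of_weight:
  assumes W: "Apq_weight n p q W" and p: "1 < p" and q: "1 < q" and n: "0 < n"
  shows "apq_family n (reg_powr n W (1 / q)) (reg_powr n W (- (1 / q))) (conj_exp p) q (real n powr q * enn2real (Apq p q W))"
proof
  have mw: "matrix_weight n W" and fin: "Apq p q W < \<infinity>" using W by (auto simp: Apq_weight_def)
  show "mat_measurable lebesgue n (reg_powr n W (1 / q))" "mat_measurable lebesgue n (reg_powr n W (- (1 / q)))"
    by (rule reg_powr_measurable[OF mw])+
  fix Q :: "(real^'a) set" assume Q: "Q \<in> hcubes"
  have "mixed_avg Q (conj_exp p) q (\<lambda>x y. fro (reg_powr n W (1 / q) x * reg_powr n W (- (1 / q)) y)) \<le>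
     ennreal (real n powr q) * mixed_avg Q (conj_exp p) q (\<lambda>x y. mat_opnorm (reg_powr n W (1 / q) x * reg_powr n W (- (1 / q)) y))"
    using n q conj_exp_gt_1[OF p] by (intro mixed_avg_fro_le sq_mult_carrier reg_powr_carrier) auto
  also have "\<dots> \<le> ennreal (real n powr q) * Apq p q W"
    unfolding Apq_eq_SUP_mixed_avg[OF reg_powr_AE[OF mw] reg_powr_AE[OF mw]] using Q by (intro mult_left_mono SUP_upper) auto
  also have "\<dots> = ennreal (real n powr q * enn2real (Apq p q W))" using fin by (simp add: ennreal_mult)
  finally show "avg Q (\<lambda>x. ennreal_powr (avg Q (\<lambda>y. ennreal (fro (reg_powr n W (1 / q) x * reg_powr n W (- (1 / q)) y) powr conj_exp p))) (q / conj_exp p))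
     \<le> ennreal (real n powr q * enn2real (Apq p q W))" unfolding mixed_avg_def .
qed (use p q conj_exp_gt_1 reg_powr_pd reg_powr_inverse in auto)

lemma locally_integrable_cubes:
  assumes B: "locally_integrable_mat n B"
  shows "mat_measurable lebesgue n B" "Q \<in> hcubes \<Longrightarrow> mat_integrable (avg_measure Q) n B"
proof -
  show m: "mat_measurable lebesgue n B" using B by (auto simp: locally_integrable_mat_def mat_measurable_def)
  assume "Q \<in> hcubes"
  then obtain c l where cl: "0 < l" "Q = hcube c l" by (auto simp: hcubes_def)
  show "mat_integrable (avg_measure Q) n B"
    unfolding mat_integrable_def
  proof (intro conjI allI impI)
    show "B x \<in> carrier_mat n n" for x by (rule mat_measurableD(1)[OF m])
    fix i j assume ij: "i < n" "j < n"
    have "set_integrable lebesgue (cbox c (c + l *\<^sub>R One)) (\<lambda>x. B x $$ (i, j))"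
      using B ij compact_cbox by (auto simp: locally_integrable_mat_def)
    then have "set_integrable lebesgue Q (\<lambda>x. B x $$ (i, j))"
      unfolding cl(2) by (rule set_integrable_subset) (use hcube_subset in auto)
    then show "integrable (avg_measure Q) (\<lambda>x. B x $$ (i, j))"
      by (intro integrable_avg_measure mat_measurableD(2)[OF m ij] \<open>Q \<in> hcubes\<close>)
  qed
qed

lemma the_mat_inverse:
  fixes A B :: cmat
  assumes A: "A \<in> carrier_mat n n" and B: "B \<in> carrier_mat n n" and inv: "A * B = 1\<^sub>m n" "B * A = 1\<^sub>m n"
  shows "the (mat_inverse A) = B"
proof (cases "mat_inverse A")
  case None
  then have "A \<notin> Units (ring_mat TYPE(complex) n ())" by (rule mat_inverse(1)[OF A])
  then show ?thesis using A B inv by (auto simp: Units_def ring_mat_simps)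
next
  case (Some C)
  then have C: "A * C = 1\<^sub>m n" "C \<in> carrier_mat n n" using mat_inverse(2)[OF A] by auto
  have "C = (B * A) * C" unfolding inv(2) using C by simp
  also have "\<dots> = B * (A * C)" by (rule assoc_mult_mat[OF B A C(2)])
  also have "\<dots> = B" unfolding C(1) using B by simp
  finally show ?thesis using Some by simp
qed

text \<open>The pair hypothesis supplies integrability of u and v on cubes and positive definiteness
  of their means, so that \<open>mat_inverse\<close> succeeds and is the inverse used in the
  iteration.\<close>

lemma bmo_eq:
  fixes U V B :: "real^'d \<Rightarrow> cmat"
  assumes pair: "apq_pair n (reg_powr n V (1 / q)) vi (reg_powr n U (1 / q)) ui a b Av Au B"
    and U: "matrix_weight n U" and V: "matrix_weight n V"
  shows "bmo n q V U B = (SUP Q\<in>hcubes. avg Q (\<lambda>x. ennreal (mat_opnorm (apq_family.Nq n (reg_powr n V (1 / q)) Q * (B x - mat_mean (avg_measure Q) n B)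
     * apq_family.Nq' n (reg_powr n U (1 / q)) Q))))"
proof -
  interpret apq_pair n "reg_powr n V (1 / q)" vi "reg_powr n U (1 / q)" ui a b Av Au B by (rule pair)
  show ?thesis unfolding bmo_def
  proof (rule SUP_cubes)
    fix c :: "real^'d" and l :: real assume l: "0 < l"
    have Q: "hcube c l \<in> hcubes" by (rule hcubeI[OF l])
    have "mat_avg n (cbox c (c + l *\<^sub>R One)) (weight_powr V (1 / q)) = V.Nq (hcube c l)"
      unfolding V.Nq_def by (rule mat_avg_eq_mean[OF l V.w_meas reg_powr_AE[OF V]])
    moreover have "mat_avg n (cbox c (c + l *\<^sub>R One)) (weight_powr U (1 / q)) = U.Nq (hcube c l)"
      unfolding U.Nq_def by (rule mat_avg_eq_mean[OF l U.w_meas reg_powr_AE[OF U]])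
    moreover have "mat_avg n (cbox c (c + l *\<^sub>R One)) B = mB (hcube c l)"
      by (rule mat_avg_eq_mean[OF l B_meas]) simp
    moreover have "the (mat_inverse (U.Nq (hcube c l))) = U.Nq' (hcube c l)"
      by (rule the_mat_inverse[OF U.Nq_car[OF Q] U.Nq_inv[OF Q]])
    ultimately show "avg (cbox c (c + l *\<^sub>R One)) (\<lambda>x. ennreal (mat_opnorm (mat_avg n (cbox c (c + l *\<^sub>R One)) (weight_powr V (1 / q)) *
        (B x - mat_avg n (cbox c (c + l *\<^sub>R One)) B) * the (mat_inverse (mat_avg n (cbox c (c + l *\<^sub>R One)) (weight_powr U (1 / q))))))) =
       avg (hcube c l) (\<lambda>x. ennreal (mat_opnorm (V.Nq (hcube c l) * (B x - mB (hcube c l)) * U.Nq' (hcube c l))))"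
      unfolding avg_hcube[OF l] by simp
  qed
qed

section \<open>Weights given by invertible matrix functions\<close>

definition lp_norm :: "real \<Rightarrow> (real^'d \<Rightarrow> real) \<Rightarrow> ennreal" where
  "lp_norm r h = ennreal_powr (\<integral>\<^sup>+x. ennreal (h x powr r) \<partial>lebesgue) (1 / r)"

lemma lp_norm_mono_AE:
  assumes "AE x in lebesgue. h x \<le> h' x" "\<And>x. 0 \<le> h x" "0 < r"
  shows "lp_norm r h \<le> lp_norm r h'"
  unfolding lp_norm_def
proof (intro ennreal_powr_mono nn_integral_mono_AE)
  show "AE x in lebesgue. ennreal (h x powr r) \<le> ennreal (h' x powr r)"
    using assms(1)
  proof eventually_elim
    case (elim x)
    then show ?case using assms(2)[of x] assms(3) by (intro ennreal_leI powr_mono2) auto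
  qed
qed (use assms(3) in simp)

lemma lp_norm_cmult_le:
  assumes h: "\<And>x. 0 \<le> h x" and c: "0 < c" and r: "0 < r"
  shows "lp_norm r (\<lambda>x. c * h x) \<le> ennreal c * lp_norm r h"
proof -
  have "(\<integral>\<^sup>+x. ennreal ((c * h x) powr r) \<partial>lebesgue) = (\<integral>\<^sup>+x. ennreal (c powr r) * ennreal (h x powr r) \<partial>lebesgue)"
    using h c by (simp add: powr_mult ennreal_mult)
  also have "\<dots> \<le> ennreal (c powr r) * (\<integral>\<^sup>+x. ennreal (h x powr r) \<partial>lebesgue)"
    using c by (intro nn_integral_cmult_le) simp
  finally have "lp_norm r (\<lambda>x. c * h x) \<le> ennreal_powr (ennreal (c powr r) * (\<integral>\<^sup>+x. ennreal (h x powr r) \<partial>lebesgue)) (1 / r)"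
    unfolding lp_norm_def using r by (intro ennreal_powr_mono) auto
  also have "\<dots> = ennreal c * lp_norm r h" unfolding lp_norm_def
    using c r by (subst ennreal_powr_cmult) (auto simp: powr_powr)
  finally show ?thesis .
qed

text \<open>A quasi-triangle inequality from the pointwise power inequality, with the constant 2 * 2
  powr (1 / r) rounded up to 4; constants are immaterial here.\<close>

lemma lp_norm_add_le:
  assumes [measurable]: "h \<in> borel_measurable lebesgue" "h' \<in> borel_measurable lebesgue"
    and h: "\<And>x. 0 \<le> h x" "\<And>x. 0 \<le> h' x" and r: "1 < r"
  shows "lp_norm r (\<lambda>x. h x + h' x) \<le> 4 * (lp_norm r h + lp_norm r h')"
proof -
  let ?I = "\<lambda>h. \<integral>\<^sup>+x. ennreal (h x powr r) \<partial>lebesgue"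
  have "?I (\<lambda>x. h x + h' x) \<le> (\<integral>\<^sup>+x. (ennreal (2 powr r) * (ennreal (h x powr r) + ennreal (h' x powr r))) \<partial>lebesgue)"
  proof (rule nn_integral_mono)
    fix x
    have "(h x + h' x) powr r \<le> 2 powr r * (h x powr r + h' x powr r)" using h r by (intro powr_add_le) auto
    then show "ennreal ((h x + h' x) powr r) \<le> ennreal (2 powr r) * (ennreal (h x powr r) + ennreal (h' x powr r))"
      by (simp add: ennreal_leI flip: ennreal_plus ennreal_mult)
  qed
  also have "\<dots> = ennreal (2 powr r) * (?I h + ?I h')"
    by (subst nn_integral_cmult) (auto simp: nn_integral_add)
  finally have "lp_norm r (\<lambda>x. h x + h' x) \<le> ennreal_powr (ennreal (2 powr r) * (?I h + ?I h')) (1 / r)"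
    unfolding lp_norm_def using r by (intro ennreal_powr_mono) auto
  also have "\<dots> = ennreal 2 * ennreal_powr (?I h + ?I h') (1 / r)"
    using r by (subst ennreal_powr_cmult) (auto simp: powr_powr)
  also have "\<dots> \<le> ennreal 2 * (ennreal (2 powr (1 / r)) * (lp_norm r h + lp_norm r h'))"
    unfolding lp_norm_def using r by (intro mult_left_mono ennreal_powr_add_le) auto
  also have "\<dots> \<le> ennreal 2 * (ennreal 2 * (lp_norm r h + lp_norm r h'))"
  proof (intro mult_left_mono mult_right_mono ennreal_leI)
    show "2 powr (1 / r) \<le> (2::real)" using powr_mono[of "1 / r" 1 "2::real"] r by simp
  qed auto
  also have "\<dots> = 4 * (lp_norm r h + lp_norm r h')"
    by (simp add: mult.assoc[symmetric] flip: ennreal_numeral ennreal_mult)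
  finally show ?thesis .
qed

definition gauge_norm :: "real \<Rightarrow> (real^'d \<Rightarrow> cmat) \<Rightarrow> (real^'d \<Rightarrow> cvec) \<Rightarrow> ennreal" where
  "gauge_norm r \<Phi> f = lp_norm r (\<lambda>x. vec_norm2 (\<Phi> x *\<^sub>v f x))"

lemma wnorm_eq_gauge_norm: "wnorm r W f = gauge_norm r (weight_powr W (1 / r)) f"
  unfolding wnorm_def gauge_norm_def lp_norm_def ..

lemma gauge_norm_cong_AE:
  assumes "AE x in lebesgue. vec_norm2 (\<Phi> x *\<^sub>v f x) = vec_norm2 (\<Psi> x *\<^sub>v f x)" "0 < r"
  shows "gauge_norm r \<Phi> f = gauge_norm r \<Psi> f"
  unfolding gauge_norm_def by (intro antisym lp_norm_mono_AE) (use assms in auto)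

text \<open>\<open>\<Phi>\<close> represents the weight \<open>W\<close> when \<open>\<bar>W\<^bsup>1/q\<^esup> z\<bar> = \<bar>\<Phi> z\<bar>\<close>; the Gram matrix
  construction below gives every invertible \<open>\<Phi>\<close> such a \<open>W\<close>.\<close>

definition weight_gauge :: "nat \<Rightarrow> real \<Rightarrow> real \<Rightarrow> (real^'d \<Rightarrow> cmat) \<Rightarrow> (real^'d \<Rightarrow> cmat) \<Rightarrow> bool" where
  "weight_gauge n p q W \<Phi> \<longleftrightarrow> (\<forall>f. (\<forall>x. f x \<in> carrier_vec n) \<longrightarrow>
     wnorm p (weight_powr W (p / q)) f = gauge_norm p \<Phi> f \<and> wnorm q W f = gauge_norm q \<Phi> f)"

lemma weight_gaugeI:
  fixes W \<Phi> :: "real^'d \<Rightarrow> cmat"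
  assumes "AE x in lebesgue. \<forall>v\<in>carrier_vec n. vec_norm2 (weight_powr (weight_powr W (p / q)) (1 / p) x *\<^sub>v v) = vec_norm2 (\<Phi> x *\<^sub>v v)"
    and "AE x in lebesgue. \<forall>v\<in>carrier_vec n. vec_norm2 (weight_powr W (1 / q) x *\<^sub>v v) = vec_norm2 (\<Phi> x *\<^sub>v v)" and "0 < p" "0 < q"
  shows "weight_gauge n p q W \<Phi>"
  unfolding weight_gauge_def wnorm_eq_gauge_norm
proof (intro allI impI conjI)
  fix f :: "real^'d \<Rightarrow> cvec" assume f: "\<forall>x. f x \<in> carrier_vec n"
  show "gauge_norm p (weight_powr (weight_powr W (p / q)) (1 / p)) f = gauge_norm p \<Phi> f"
    by (rule gauge_norm_cong_AE[OF _ assms(3)]) (use assms(1) f in \<open>auto elim!: eventually_mono\<close>)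
  show "gauge_norm q (weight_powr W (1 / q)) f = gauge_norm q \<Phi> f"
    by (rule gauge_norm_cong_AE[OF _ assms(4)]) (use assms(2) f in \<open>auto elim!: eventually_mono\<close>)
qed

lemma weight_gauge_reg_powr:
  fixes W :: "real^'d \<Rightarrow> cmat"
  assumes W: "matrix_weight n W" and p: "0 < p" and q: "0 < q"
  shows "weight_gauge n p q W (reg_powr n W (1 / q))"
proof (rule weight_gaugeI[OF _ _ p q])
  show "AE x in lebesgue. \<forall>v\<in>carrier_vec n. vec_norm2 (weight_powr (weight_powr W (p / q)) (1 / p) x *\<^sub>v v) = vec_norm2 (reg_powr n W (1 / q) x *\<^sub>v v)"
    using reg_powr_AE2[OF W, of "p / q" "1 / p"] by eventually_elim (use p in simp)
  show "AE x in lebesgue. \<forall>v\<in>carrier_vec n. vec_norm2 (weight_powr W (1 / q) x *\<^sub>v v) = vec_norm2 (reg_powr n W (1 / q) x *\<^sub>v v)"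
    using reg_powr_AE[OF W, of "1 / q"] by eventually_elim simp
qed

text \<open>The exponent q / 2 is chosen so that the power 1 / q of this weight is the positive
  factor in the polar decomposition of \<Phi> x.\<close>

definition polar_weight :: "real \<Rightarrow> ('x \<Rightarrow> cmat) \<Rightarrow> 'x \<Rightarrow> cmat" where
  "polar_weight q \<Phi> x = mat_powr (mat_adjoint (\<Phi> x) * \<Phi> x) (q / 2)"

locale invertible_gauge =
  fixes n :: nat and \<Phi> \<Psi> :: "real^'d \<Rightarrow> cmat"
  assumes \<Phi>_meas: "mat_measurable lebesgue n \<Phi>" and \<Psi>_meas: "mat_measurable lebesgue n \<Psi>"
    and \<Phi>_inverse: "\<And>x. \<Phi> x * \<Psi> x = 1\<^sub>m n" "\<And>x. \<Psi> x * \<Phi> x = 1\<^sub>m n"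
begin

lemma \<Phi>_carrier: "\<Phi> x \<in> carrier_mat n n" and \<Psi>_carrier: "\<Psi> x \<in> carrier_mat n n"
  by (rule mat_measurableD(1)[OF \<Phi>_meas] mat_measurableD(1)[OF \<Psi>_meas])+

lemma gram_pd: "positive_definite n (mat_adjoint (\<Phi> x) * \<Phi> x)"
  by (rule pd_gram[OF \<Phi>_carrier \<Psi>_carrier \<Phi>_inverse(2)])

lemma polar_weight_powr: "weight_powr (polar_weight q \<Phi>) s x = mat_powr (mat_adjoint (\<Phi> x) * \<Phi> x) (q / 2 * s)"
  unfolding weight_powr_def polar_weight_def by (rule mat_powr_powr[OF gram_pd])

lemma matrix_weight_polar: "matrix_weight n (polar_weight q \<Phi>)"
proof -
  have "mat_measurable lebesgue n (polar_weight q \<Phi>)"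
    unfolding polar_weight_def[abs_def]
    by (intro mat_measurable_powr mat_measurable_mult mat_measurable_adjoint \<Phi>_meas gram_pd)
  then show ?thesis
    using pd_mat_powr[OF gram_pd] unfolding matrix_weight_def mat_measurable_def polar_weight_def by simp
qed

lemma weight_gauge_polar:
  assumes p: "0 < p" and q: "0 < q"
  shows "weight_gauge n p q (polar_weight q \<Phi>) \<Phi>"
proof (rule weight_gaugeI[OF _ _ p q]; intro AE_I2 ballI)
  fix x and v :: cvec assume v: "v \<in> carrier_vec n"
  have "weight_powr (weight_powr (polar_weight q \<Phi>) (p / q)) (1 / p) x = mat_powr (mat_powr (mat_adjoint (\<Phi> x) * \<Phi> x) (q / 2 * (p / q))) (1 / p)"
    unfolding weight_powr_def[of "weight_powr (polar_weight q \<Phi>) (p / q)"] polar_weight_powr ..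
  also have "\<dots> = mat_powr (mat_adjoint (\<Phi> x) * \<Phi> x) (1 / 2)"
    using mat_powr_powr[OF gram_pd, of x] p q by simp
  finally show "vec_norm2 (weight_powr (weight_powr (polar_weight q \<Phi>) (p / q)) (1 / p) x *\<^sub>v v) = vec_norm2 (\<Phi> x *\<^sub>v v)"
    using vec_norm2_polar[OF \<Phi>_carrier \<Psi>_carrier \<Phi>_inverse(2) v] by simp
  have "weight_powr (polar_weight q \<Phi>) (1 / q) x = mat_powr (mat_adjoint (\<Phi> x) * \<Phi> x) (1 / 2)"
    unfolding polar_weight_powr using q by simp
  then show "vec_norm2 (weight_powr (polar_weight q \<Phi>) (1 / q) x *\<^sub>v v) = vec_norm2 (\<Phi> x *\<^sub>v v)"
    using vec_norm2_polar[OF \<Phi>_carrier \<Psi>_carrier \<Phi>_inverse(2) v] by simp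
qed

text \<open>By \<open>opnorm_polar\<close> the kernel of the weight may be computed from \<Phi> and
  \<Psi> directly, so the powers of the block weight never have to be evaluated.\<close>

lemma Apq_polar:
  assumes q: "0 < q"
  shows "Apq p q (polar_weight q \<Phi>) = (SUP Q\<in>hcubes. mixed_avg Q (conj_exp p) q (\<lambda>x y. mat_opnorm (\<Phi> x * \<Psi> y)))"
proof -
  let ?G = "\<lambda>s x. mat_powr (mat_adjoint (\<Phi> x) * \<Phi> x) s"
  have "q / 2 * (1 / q) = 1 / 2" "q / 2 * (- (1 / q)) = - (1 / 2)" using q by simp_all
  then have "Apq p q (polar_weight q \<Phi>) = (SUP Q\<in>hcubes. mixed_avg Q (conj_exp p) q (\<lambda>x y. mat_opnorm (?G (1 / 2) x * ?G (- (1 / 2)) y)))"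
    by (intro Apq_eq_SUP_mixed_avg AE_I2) (simp_all only: polar_weight_powr)
  then show ?thesis
    unfolding opnorm_polar[OF \<Phi>_carrier \<Psi>_carrier \<Phi>_inverse(2) \<Phi>_carrier \<Psi>_carrier \<Phi>_inverse(2) \<Phi>_inverse(1)] .
qed

end

text \<open>An admissible constant in \<open>op_norm\<close>, stated without the weights. Finiteness
  of the norm of S f is not listed because it follows from the inequality.\<close>

definition gauge_bounded :: "(real^'d \<Rightarrow> cvec) set \<Rightarrow> ((real^'d \<Rightarrow> cvec) \<Rightarrow> real^'d \<Rightarrow> cvec) \<Rightarrow> nat \<Rightarrow>
    real \<Rightarrow> (real^'d \<Rightarrow> cmat) \<Rightarrow> real \<Rightarrow> (real^'d \<Rightarrow> cmat) \<Rightarrow> real \<Rightarrow> bool" where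
  "gauge_bounded E S n p \<Phi> q \<Psi> c \<longleftrightarrow> (\<forall>f. (\<forall>x. f x \<in> carrier_vec n) \<and>
     (\<forall>i<n. (\<lambda>x. f x $ i) \<in> borel_measurable lebesgue) \<and> gauge_norm p \<Phi> f < \<infinity> \<longrightarrow>
     f \<in> E \<and> (\<forall>x. S f x \<in> carrier_vec n) \<and> (\<forall>i<n. (\<lambda>x. S f x $ i) \<in> borel_measurable lebesgue) \<and>
     gauge_norm q \<Psi> (S f) \<le> ennreal c * gauge_norm p \<Phi> f)"

lemma gauge_boundedD:
  fixes f :: "real^'d \<Rightarrow> cvec" and S :: "(real^'d \<Rightarrow> cvec) \<Rightarrow> real^'d \<Rightarrow> cvec"
  assumes "gauge_bounded E S n p \<Phi> q \<Psi> c" "\<And>x. f x \<in> carrier_vec n"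
    "\<And>i. i < n \<Longrightarrow> (\<lambda>x. f x $ i) \<in> borel_measurable lebesgue" "gauge_norm p \<Phi> f < \<infinity>"
  shows "f \<in> E" "S f x \<in> carrier_vec n" "i < n \<Longrightarrow> (\<lambda>x. S f x $ i) \<in> borel_measurable lebesgue"
    "gauge_norm q \<Psi> (S f) \<le> ennreal c * gauge_norm p \<Phi> f"
  using assms unfolding gauge_bounded_def by blast+

lemma op_norm_le_iff_gauge_bounded:
  assumes X: "weight_gauge n p q X \<Phi>" and Y: "weight_gauge n p q Y \<Psi>" and c: "0 \<le> c"
  shows "(\<forall>f\<in>wspace n p (weight_powr X (p / q)). f \<in> E \<and> S f \<in> wspace n q Y \<and>
     wnorm q Y (S f) \<le> ennreal c * wnorm p (weight_powr X (p / q)) f) \<longleftrightarrow> gauge_bounded E S n p \<Phi> q \<Psi> c"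
    (is "?L \<longleftrightarrow> ?R")
proof
  assume L: ?L
  show ?R unfolding gauge_bounded_def
  proof (intro allI impI, elim conjE)
    fix f :: "real^'a \<Rightarrow> cvec"
    assume f: "\<forall>x. f x \<in> carrier_vec n" "\<forall>i<n. (\<lambda>x. f x $ i) \<in> borel_measurable lebesgue" "gauge_norm p \<Phi> f < \<infinity>"
    have e: "wnorm p (weight_powr X (p / q)) f = gauge_norm p \<Phi> f" using X f(1) by (auto simp: weight_gauge_def)
    have "f \<in> wspace n p (weight_powr X (p / q))" using f e by (auto simp: wspace_def)
    with L have r: "f \<in> E" "S f \<in> wspace n q Y" "wnorm q Y (S f) \<le> ennreal c * wnorm p (weight_powr X (p / q)) f" by auto
    moreover have "wnorm q Y (S f) = gauge_norm q \<Psi> (S f)" using Y r(2) by (auto simp: weight_gauge_def wspace_def)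
    ultimately show "f \<in> E \<and> (\<forall>x. S f x \<in> carrier_vec n) \<and> (\<forall>i<n. (\<lambda>x. S f x $ i) \<in> borel_measurable lebesgue) \<and>
       gauge_norm q \<Psi> (S f) \<le> ennreal c * gauge_norm p \<Phi> f" using e by (auto simp: wspace_def)
  qed
next
  assume R: ?R
  show ?L
  proof
    fix f :: "real^'a \<Rightarrow> cvec" assume "f \<in> wspace n p (weight_powr X (p / q))"
    then have f: "\<And>x. f x \<in> carrier_vec n" "\<And>i. i < n \<Longrightarrow> (\<lambda>x. f x $ i) \<in> borel_measurable lebesgue"
      "wnorm p (weight_powr X (p / q)) f < \<infinity>" by (auto simp: wspace_def)
    have e: "wnorm p (weight_powr X (p / q)) f = gauge_norm p \<Phi> f" using X f(1) by (auto simp: weight_gauge_def)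
    note r = gauge_boundedD[OF R f(1,2) f(3)[unfolded e]]
    have e': "wnorm q Y (S f) = gauge_norm q \<Psi> (S f)" using Y r(2) by (auto simp: weight_gauge_def)
    have fin: "ennreal c * z < \<infinity>" if "z < \<infinity>" for z
      using that c by (cases z) (auto simp flip: ennreal_mult)
    have "gauge_norm q \<Psi> (S f) < \<infinity>"
      by (rule order.strict_trans1[OF r(4) fin[OF f(3)[unfolded e]]])
    then show "f \<in> E \<and> S f \<in> wspace n q Y \<and> wnorm q Y (S f) \<le> ennreal c * wnorm p (weight_powr X (p / q)) f"
      using r e e' by (auto simp: wspace_def)
  qed
qed

lemma op_norm_le:
  assumes X: "weight_gauge n p q X \<Phi>" and Y: "weight_gauge n p q Y \<Psi>" and c: "0 \<le> c"
    and b: "gauge_bounded E S n p \<Phi> q \<Psi> c"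
  shows "op_norm n p (weight_powr X (p / q)) q Y E S \<le> ennreal c"
  unfolding op_norm_def using c b op_norm_le_iff_gauge_bounded[OF X Y c, of E S] by (intro INF_lower) auto

text \<open>The inequality is strict because \<open>op_norm\<close> is an infimum: some admissible
  c' lies below c, and a larger constant is admissible as well.\<close>

lemma gauge_bounded_of_op_norm:
  assumes X: "weight_gauge n p q X \<Phi>" and Y: "weight_gauge n p q Y \<Psi>"
    and c: "op_norm n p (weight_powr X (p / q)) q Y E S < ennreal c"
  shows "gauge_bounded E S n p \<Phi> q \<Psi> c"
proof -
  obtain c' where c': "0 \<le> c'" "ennreal c' < ennreal c" "\<forall>f\<in>wspace n p (weight_powr X (p / q)). f \<in> E \<and> S f \<in> wspace n q Y \<and>
     wnorm q Y (S f) \<le> ennreal c' * wnorm p (weight_powr X (p / q)) f"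
    using c unfolding op_norm_def INF_less_iff by blast
  have b: "gauge_bounded E S n p \<Phi> q \<Psi> c'" using c'(3) op_norm_le_iff_gauge_bounded[OF X Y c'(1)] by blast
  have "ennreal c' * z \<le> ennreal c * z" for z using c'(2) by (intro mult_right_mono) auto
  then show ?thesis using b order.trans unfolding gauge_bounded_def by blast
qed

section \<open>Block triangular matrices\<close>

lemma mat_measurable_four_block:
  assumes A: "mat_measurable M n A" and D: "mat_measurable M k D"
    and B: "\<And>x. B x \<in> carrier_mat n k" "\<And>i j. i < n \<Longrightarrow> j < k \<Longrightarrow> (\<lambda>x. B x $$ (i, j)) \<in> borel_measurable M"
  shows "mat_measurable M (n + k) (\<lambda>x. four_block_mat (A x) (B x) (0\<^sub>m k n) (D x))"
proof (rule mat_measurableI)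
  show "four_block_mat (A x) (B x) (0\<^sub>m k n) (D x) \<in> carrier_mat (n + k) (n + k)" for x
    using mat_measurableD(1)[OF A] mat_measurableD(1)[OF D] by (rule four_block_carrier_mat)
  fix i j assume ij: "i < n + k" "j < n + k"
  have "four_block_mat (A x) (B x) (0\<^sub>m k n) (D x) $$ (i, j) =
    (if i < n then if j < n then A x $$ (i, j) else B x $$ (i, j - n) else if j < n then 0 else D x $$ (i - n, j - n))" for x
    using ij mat_measurableD(1)[OF A, of x] mat_measurableD(1)[OF D, of x] by (subst index_mat_four_block) auto
  then show "(\<lambda>x. four_block_mat (A x) (B x) (0\<^sub>m k n) (D x) $$ (i, j)) \<in> borel_measurable M"
    using ij mat_measurableD(2)[OF A] mat_measurableD(2)[OF D] B(2) by (cases "i < n"; cases "j < n") auto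
qed

lemma mat_measurable_smult:
  fixes c :: complex
  assumes A: "mat_measurable M n A" shows "mat_measurable M n (\<lambda>x. c \<cdot>\<^sub>m A x)"
proof (rule mat_measurableI)
  fix i j assume ij: "i < n" "j < n"
  have "(c \<cdot>\<^sub>m A x) $$ (i, j) = c * A x $$ (i, j)" for x using ij mat_measurableD(1)[OF A, of x] by auto
  then show "(\<lambda>x. (c \<cdot>\<^sub>m A x) $$ (i, j)) \<in> borel_measurable M" using mat_measurableD(2)[OF A ij] by auto
qed (use mat_measurableD(1)[OF A] in auto)

lemma four_block_triangular_mult:
  fixes v :: cmat
  assumes c: "v \<in> carrier_mat m m" "B \<in> carrier_mat m m" "u \<in> carrier_mat m m"
    "v' \<in> carrier_mat m m" "B' \<in> carrier_mat m m" "u' \<in> carrier_mat m m"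
  shows "four_block_mat v (t \<cdot>\<^sub>m (v * B)) (0\<^sub>m m m) u * four_block_mat v' ((- t) \<cdot>\<^sub>m (B' * u')) (0\<^sub>m m m) u'
    = four_block_mat (v * v') (t \<cdot>\<^sub>m (v * (B - B') * u')) (0\<^sub>m m m) (u * u')"
proof -
  have "v * ((- t) \<cdot>\<^sub>m (B' * u')) = (- t) \<cdot>\<^sub>m (v * B' * u')"
    by (simp only: mult_smult_distrib[OF c(1) sq_mult_carrier[OF c(5,6)]] assoc_mult_mat[OF c(1,5,6)])
  moreover have "t \<cdot>\<^sub>m (v * B) * u' = t \<cdot>\<^sub>m (v * B * u')"
    by (rule mult_smult_assoc_mat[OF sq_mult_carrier[OF c(1,2)] c(6)])
  moreover have "v * (B - B') * u' = v * B * u' - v * B' * u'"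
    unfolding mult_minus_distrib_mat[OF c(1,2,5)] by (rule minus_mult_distrib_mat[OF sq_mult_carrier[OF c(1,2)] sq_mult_carrier[OF c(1,5)] c(6)])
  moreover have "(- t) \<cdot>\<^sub>m X + t \<cdot>\<^sub>m Y = t \<cdot>\<^sub>m (Y - X)" if "X \<in> carrier_mat m m" "Y \<in> carrier_mat m m" for X Y
    using that by (intro eq_matI) (auto simp: right_diff_distrib)
  ultimately have e: "v * ((- t) \<cdot>\<^sub>m (B' * u')) + t \<cdot>\<^sub>m (v * B) * u' = t \<cdot>\<^sub>m (v * (B - B') * u')"
    using c by simp
  have z: "v * v' + t \<cdot>\<^sub>m (v * B) * 0\<^sub>m m m = v * v'" "0\<^sub>m m m * v' + u * 0\<^sub>m m m = 0\<^sub>m m m"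
    "0\<^sub>m m m * ((- t) \<cdot>\<^sub>m (B' * u')) + u * u' = u * u'"
    using c sq_mult_carrier[OF c(1,4)] sq_mult_carrier[OF c(3,6)] sq_mult_carrier[OF c(1,2)] sq_mult_carrier[OF c(5,6)]
    by (simp_all add: left_mult_zero_mat[of _ m m] right_mult_zero_mat[of _ m m])
  show ?thesis
    unfolding e[symmetric]
    by (subst mult_four_block_mat[OF c(1) smult_carrier_mat[OF sq_mult_carrier[OF c(1,2)]] zero_carrier_mat c(3)
        c(4) smult_carrier_mat[OF sq_mult_carrier[OF c(5,6)]] zero_carrier_mat c(6)]) (simp only: z)
qed

lemma sum_lessThan_add: "(\<Sum>i<n + k. g i) = (\<Sum>i<n. g i) + (\<Sum>i<k. g (n + i))"
  for g :: "nat \<Rightarrow> real"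
  by (induction k) (simp_all add: algebra_simps)

lemma smult_mat_mult_vec:
  fixes A :: cmat
  assumes "A \<in> carrier_mat n k" "b \<in> carrier_vec k"
  shows "(c \<cdot>\<^sub>m A) *\<^sub>v b = c \<cdot>\<^sub>v (A *\<^sub>v b)"
  using assms by (intro eq_vecI) (auto simp: scalar_prod_def sum_distrib_left mult.assoc)

lemma vec_norm2_append_sq:
  assumes a: "a \<in> carrier_vec n" and b: "b \<in> carrier_vec k"
  shows "(vec_norm2 (a @\<^sub>v b))\<^sup>2 = (vec_norm2 a)\<^sup>2 + (vec_norm2 b)\<^sup>2"
proof -
  have "(\<Sum>i<n + k. (cmod (vec_index (a @\<^sub>v b) i))\<^sup>2) = (\<Sum>i<n. (cmod (vec_index (a @\<^sub>v b) i))\<^sup>2) + (\<Sum>i<k. (cmod (vec_index (a @\<^sub>v b) (n + i)))\<^sup>2)"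
    by (rule sum_lessThan_add)
  then show ?thesis using a b by (simp add: vec_norm2_sq[of _ "n + k"] vec_norm2_sq[of _ n] vec_norm2_sq[of _ k])
qed

lemma vec_norm2_append:
  assumes a: "a \<in> carrier_vec n" and b: "b \<in> carrier_vec k"
  shows "vec_norm2 a \<le> vec_norm2 (a @\<^sub>v b)" "vec_norm2 b \<le> vec_norm2 (a @\<^sub>v b)" "vec_norm2 (a @\<^sub>v b) \<le> vec_norm2 a + vec_norm2 b"
    "vec_norm2 (0\<^sub>v n @\<^sub>v b) = vec_norm2 b"
proof -
  show "vec_norm2 a \<le> vec_norm2 (a @\<^sub>v b)" "vec_norm2 b \<le> vec_norm2 (a @\<^sub>v b)"
    by (rule power2_le_imp_le; use vec_norm2_append_sq[OF a b] in simp)+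
  show "vec_norm2 (a @\<^sub>v b) \<le> vec_norm2 a + vec_norm2 b"
    by (rule power2_le_imp_le) (use vec_norm2_append_sq[OF a b] in \<open>auto simp: power2_sum\<close>)
  have "(vec_norm2 (0\<^sub>v n @\<^sub>v b))\<^sup>2 = (vec_norm2 b)\<^sup>2" using vec_norm2_append_sq[OF zero_carrier_vec b] by simp
  then show "vec_norm2 (0\<^sub>v n @\<^sub>v b) = vec_norm2 b" by (simp add: power2_eq_iff_nonneg)
qed

lemma fro_four_block_le:
  fixes A :: cmat
  assumes c: "A \<in> carrier_mat n n" "B \<in> carrier_mat n k" "D \<in> carrier_mat k k"
  shows "fro B \<le> fro (four_block_mat A B (0\<^sub>m k n) D)" "fro A \<le> fro (four_block_mat A B (0\<^sub>m k n) D)"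
    "fro (four_block_mat A B (0\<^sub>m k n) D) \<le> fro A + fro B + fro D"
proof -
  let ?F = "four_block_mat A B (0\<^sub>m k n) D"
  have F: "?F \<in> carrier_mat (n + k) (n + k)" using c by auto
  have s: "(fro ?F)\<^sup>2 = (fro A)\<^sup>2 + (fro B)\<^sup>2 + (fro D)\<^sup>2"
    using c unfolding fro_sq[OF F] fro_sq[OF c(1)] fro_sq[OF c(2)] fro_sq[OF c(3)] sum_lessThan_add by (simp add: sum.distrib)
  show "fro B \<le> fro ?F" "fro A \<le> fro ?F" by (rule power2_le_imp_le; use s in auto)+
  have "(fro ?F)\<^sup>2 \<le> (fro A + fro B + fro D)\<^sup>2"
    unfolding s by (simp add: power2_eq_square algebra_simps)
  then show "fro ?F \<le> fro A + fro B + fro D" by (rule power2_le_imp_le) simp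
qed

locale block_gauge = V: invertible_gauge m v vi + U: invertible_gauge m u ui
  for m :: nat and v vi u ui :: "real^'d \<Rightarrow> cmat" +
  fixes B :: "real^'d \<Rightarrow> cmat" and \<tau> :: real
  assumes B_meas: "mat_measurable lebesgue m B" and \<tau>: "0 < \<tau>"
begin

definition block :: "real^'d \<Rightarrow> cmat" where
  "block x = four_block_mat (v x) (complex_of_real \<tau> \<cdot>\<^sub>m (v x * B x)) (0\<^sub>m m m) (u x)"

definition block_inv :: "real^'d \<Rightarrow> cmat" where
  "block_inv x = four_block_mat (vi x) ((- complex_of_real \<tau>) \<cdot>\<^sub>m (B x * ui x)) (0\<^sub>m m m) (ui x)"

lemma B_carrier: "B x \<in> carrier_mat m m" by (rule mat_measurableD(1)[OF B_meas])

lemma block_mult_inv: "block x * block_inv y =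
    four_block_mat (v x * vi y) (complex_of_real \<tau> \<cdot>\<^sub>m (v x * (B x - B y) * ui y)) (0\<^sub>m m m) (u x * ui y)"
  unfolding block_def block_inv_def
  by (rule four_block_triangular_mult[OF V.\<Phi>_carrier B_carrier U.\<Phi>_carrier V.\<Psi>_carrier B_carrier U.\<Psi>_carrier])

sublocale W: invertible_gauge "m + m" block block_inv
proof
  show bm: "mat_measurable lebesgue (m + m) block"
    using mat_measurable_smult[OF mat_measurable_mult[OF V.\<Phi>_meas B_meas]] unfolding block_def[abs_def]
    by (intro mat_measurable_four_block V.\<Phi>_meas U.\<Phi>_meas) (auto dest: mat_measurableD)
  show im: "mat_measurable lebesgue (m + m) block_inv"
    using mat_measurable_smult[OF mat_measurable_mult[OF B_meas U.\<Psi>_meas]] unfolding block_inv_def[abs_def]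
    by (intro mat_measurable_four_block V.\<Psi>_meas U.\<Psi>_meas) (auto dest: mat_measurableD)
  fix x
  have "B x - B x = 0\<^sub>m m m" using B_carrier[of x] by auto
  then have "complex_of_real \<tau> \<cdot>\<^sub>m (v x * (B x - B x) * ui x) = 0\<^sub>m m m"
    using V.\<Phi>_carrier[of x] U.\<Psi>_carrier[of x] by simp
  then show e: "block x * block_inv x = 1\<^sub>m (m + m)"
    unfolding block_mult_inv V.\<Phi>_inverse U.\<Phi>_inverse by simp
  show "block_inv x * block x = 1\<^sub>m (m + m)"
    by (rule mat_mult_left_right_inverse[OF mat_measurableD(1)[OF bm] mat_measurableD(1)[OF im] e])
qed

text \<open>The block matrix is a shear in the first component followed by diag(v, u). In this form
  the commutator appears when T is applied to both components.\<close>

lemma block_mult_vec: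
  assumes a: "a \<in> carrier_vec m" and b: "b \<in> carrier_vec m"
  shows "block x *\<^sub>v (a @\<^sub>v b) = (v x *\<^sub>v (a + complex_of_real \<tau> \<cdot>\<^sub>v (B x *\<^sub>v b))) @\<^sub>v (u x *\<^sub>v b)"
proof -
  note c = V.\<Phi>_carrier[of x] U.\<Phi>_carrier[of x] B_carrier[of x]
  have Bb: "B x *\<^sub>v b \<in> carrier_vec m" using c b by auto
  have "block x *\<^sub>v (a @\<^sub>v b) = (v x *\<^sub>v a + (complex_of_real \<tau> \<cdot>\<^sub>m (v x * B x)) *\<^sub>v b) @\<^sub>v (0\<^sub>m m m *\<^sub>v a + u x *\<^sub>v b)"
    unfolding block_def by (rule four_block_mat_mult_vec) (use c a b in auto)
  also have "0\<^sub>m m m *\<^sub>v a + u x *\<^sub>v b = u x *\<^sub>v b" using c a b by auto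
  also have "v x *\<^sub>v a + (complex_of_real \<tau> \<cdot>\<^sub>m (v x * B x)) *\<^sub>v b = v x *\<^sub>v (a + complex_of_real \<tau> \<cdot>\<^sub>v (B x *\<^sub>v b))"
    using c a b Bb by (simp add: mult_add_distrib_mat_vec[of _ m m] mult_mat_vec[of _ m m] smult_mat_mult_vec[of _ m m])
  finally show ?thesis .
qed

end

section \<open>Extended operators and commutators\<close>

lemma linear_operatorD:
  assumes "linear_operator D T"
  shows "f \<in> D \<Longrightarrow> f \<in> borel_measurable lebesgue" "f \<in> D \<Longrightarrow> T f \<in> borel_measurable lebesgue" "(\<lambda>x. 0) \<in> D"
    "f \<in> D \<Longrightarrow> g \<in> D \<Longrightarrow> (\<lambda>x. f x + g x) \<in> D"
    "f \<in> D \<Longrightarrow> g \<in> D \<Longrightarrow> AE x in lebesgue. T (\<lambda>x. f x + g x) x = T f x + T g x"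
    "f \<in> D \<Longrightarrow> (\<lambda>x. c * f x) \<in> D"
    "f \<in> D \<Longrightarrow> AE x in lebesgue. T (\<lambda>x. c * f x) x = c * T f x"
  using assms unfolding linear_operator_def by auto

lemma ext_op_carrier [simp]: "ext_op n T f x \<in> carrier_vec n"
  by (simp add: ext_op_def)

lemma ext_op_index: "i < n \<Longrightarrow> vec_index (ext_op n T f x) i = T (\<lambda>y. vec_index (f y) i) x"
  by (simp add: ext_op_def)

lemma ext_domD:
  assumes "f \<in> ext_dom n D"
  shows "f x \<in> carrier_vec n" "i < n \<Longrightarrow> (\<lambda>x. vec_index (f x) i) \<in> D"
  using assms by (auto simp: ext_dom_def)

lemma ext_op_measurable:
  assumes lin: "linear_operator D T" and f: "f \<in> ext_dom n D" and i: "i < n"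
  shows "(\<lambda>x. vec_index (ext_op n T f x) i) \<in> borel_measurable lebesgue"
  unfolding ext_op_index[OF i] by (intro linear_operatorD(2)[OF lin] ext_domD(2)[OF f i])

lemma ext_op_smult:
  assumes lin: "linear_operator D T" and f: "f \<in> ext_dom n D"
  shows "(\<lambda>x. c \<cdot>\<^sub>v f x) \<in> ext_dom n D"
    and "AE x in lebesgue. ext_op n T (\<lambda>x. c \<cdot>\<^sub>v f x) x = c \<cdot>\<^sub>v ext_op n T f x"
proof -
  note fc = ext_domD(1)[OF f]
  have e: "(\<lambda>x. vec_index (c \<cdot>\<^sub>v f x) i) = (\<lambda>x. c * vec_index (f x) i)" if "i < n" for i
    using that fc by (intro ext) (simp add: carrier_vecD[OF fc])
  show "(\<lambda>x. c \<cdot>\<^sub>v f x) \<in> ext_dom n D"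
    unfolding ext_dom_def using fc e ext_domD(2)[OF f] linear_operatorD(6)[OF lin] by auto
  have "AE x in lebesgue. \<forall>i\<in>{..<n}. T (\<lambda>x. c * vec_index (f x) i) x = c * T (\<lambda>x. vec_index (f x) i) x"
    by (intro AE_finite_allI) (auto intro!: linear_operatorD(7)[OF lin] ext_domD(2)[OF f])
  then show "AE x in lebesgue. ext_op n T (\<lambda>x. c \<cdot>\<^sub>v f x) x = c \<cdot>\<^sub>v ext_op n T f x"
  proof eventually_elim
    case (elim x)
    then show ?case by (intro eq_vecI) (auto simp: ext_op_def e)
  qed
qed

lemma ext_op_add:
  assumes lin: "linear_operator D T" and f: "f \<in> ext_dom n D" and g: "g \<in> ext_dom n D"
  shows "(\<lambda>x. f x + g x) \<in> ext_dom n D"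
    and "AE x in lebesgue. ext_op n T (\<lambda>x. f x + g x) x = ext_op n T f x + ext_op n T g x"
proof -
  note fc = ext_domD(1)[OF f] and gc = ext_domD(1)[OF g]
  have e: "(\<lambda>x. vec_index (f x + g x) i) = (\<lambda>x. vec_index (f x) i + vec_index (g x) i)" if "i < n" for i
    using that by (intro ext) (simp add: carrier_vecD[OF fc] carrier_vecD[OF gc])
  show "(\<lambda>x. f x + g x) \<in> ext_dom n D"
    unfolding ext_dom_def using fc gc e ext_domD(2)[OF f] ext_domD(2)[OF g] linear_operatorD(4)[OF lin] by auto
  have "AE x in lebesgue. \<forall>i\<in>{..<n}. T (\<lambda>x. vec_index (f x) i + vec_index (g x) i) x = T (\<lambda>x. vec_index (f x) i) x + T (\<lambda>x. vec_index (g x) i) x"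
    by (intro AE_finite_allI) (auto intro!: linear_operatorD(5)[OF lin] ext_domD(2)[OF f] ext_domD(2)[OF g])
  then show "AE x in lebesgue. ext_op n T (\<lambda>x. f x + g x) x = ext_op n T f x + ext_op n T g x"
  proof eventually_elim
    case (elim x)
    then show ?case by (intro eq_vecI) (auto simp: ext_op_def e)
  qed
qed

lemma ext_op_append:
  assumes f: "\<And>x. f x \<in> carrier_vec n" and g: "\<And>x. g x \<in> carrier_vec k"
  shows "(\<lambda>x. f x @\<^sub>v g x) \<in> ext_dom (n + k) D \<longleftrightarrow> f \<in> ext_dom n D \<and> g \<in> ext_dom k D"
    and "ext_op (n + k) T (\<lambda>x. f x @\<^sub>v g x) x = ext_op n T f x @\<^sub>v ext_op k T g x"
proof -
  have e1: "(\<lambda>x. vec_index (f x @\<^sub>v g x) i) = (\<lambda>x. vec_index (f x) i)" if "i < n" for i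
    using that by (intro ext) (simp add: carrier_vecD[OF f] carrier_vecD[OF g])
  have e2: "(\<lambda>x. vec_index (f x @\<^sub>v g x) (n + i)) = (\<lambda>x. vec_index (g x) i)" if "i < k" for i
    using that by (intro ext) (simp add: carrier_vecD[OF f] carrier_vecD[OF g])
  have split: "i < n + k \<longleftrightarrow> i < n \<or> (\<exists>j<k. i = n + j)" for i by presburger
  show "(\<lambda>x. f x @\<^sub>v g x) \<in> ext_dom (n + k) D \<longleftrightarrow> f \<in> ext_dom n D \<and> g \<in> ext_dom k D"
  proof
    assume F: "(\<lambda>x. f x @\<^sub>v g x) \<in> ext_dom (n + k) D"
    have "(\<lambda>x. vec_index (f x) i) \<in> D" if "i < n" for i
      unfolding e1[OF that, symmetric] by (rule ext_domD(2)[OF F]) (use that in simp)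
    moreover have "(\<lambda>x. vec_index (g x) i) \<in> D" if "i < k" for i
      unfolding e2[OF that, symmetric] by (rule ext_domD(2)[OF F]) (use that in simp)
    ultimately show "f \<in> ext_dom n D \<and> g \<in> ext_dom k D" using f g by (simp add: ext_dom_def)
  next
    assume fg: "f \<in> ext_dom n D \<and> g \<in> ext_dom k D"
    show "(\<lambda>x. f x @\<^sub>v g x) \<in> ext_dom (n + k) D"
      unfolding ext_dom_def
    proof (intro CollectI conjI allI impI)
      show "f x @\<^sub>v g x \<in> carrier_vec (n + k)" for x using f g by simp
      fix i assume "i < n + k"
      then consider "i < n" | j where "j < k" "i = n + j" unfolding split by blast
      then show "(\<lambda>x. vec_index (f x @\<^sub>v g x) i) \<in> D"
      proof cases
        case 1 then show ?thesis unfolding e1[OF 1] using fg ext_domD(2) by blast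
      next
        case 2 then show ?thesis unfolding 2(2) e2[OF 2(1)] using fg ext_domD(2) by blast
      qed
    qed
  qed
  show "ext_op (n + k) T (\<lambda>x. f x @\<^sub>v g x) x = ext_op n T f x @\<^sub>v ext_op k T g x"
  proof (rule eq_vecI)
    fix i assume "i < dim_vec (ext_op n T f x @\<^sub>v ext_op k T g x)"
    then have "i < n \<or> (\<exists>j<k. i = n + j)" unfolding split[symmetric] by (simp add: ext_op_def)
    then show "vec_index (ext_op (n + k) T (\<lambda>x. f x @\<^sub>v g x) x) i = vec_index (ext_op n T f x @\<^sub>v ext_op k T g x) i"
      by (auto simp: ext_op_def e1 e2)
  qed (simp add: ext_op_def)
qed

lemma append_vec_measurable:
  assumes f: "\<And>x. f x \<in> carrier_vec n" "\<And>i. i < n \<Longrightarrow> (\<lambda>x. vec_index (f x) i) \<in> borel_measurable M"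
    and g: "\<And>x. g x \<in> carrier_vec k" "\<And>i. i < k \<Longrightarrow> (\<lambda>x. vec_index (g x) i) \<in> borel_measurable M" and i: "i < n + k"
  shows "(\<lambda>x. vec_index (f x @\<^sub>v g x) i) \<in> borel_measurable M"
proof -
  have "(\<lambda>x. vec_index (f x @\<^sub>v g x) i) = (\<lambda>x. if i < n then vec_index (f x) i else vec_index (g x) (i - n))"
    using i by (intro ext) (simp add: carrier_vecD[OF f(1)] carrier_vecD[OF g(1)])
  then show ?thesis using i f(2)[of i] g(2)[of "i - n"] by (cases "i < n") auto
qed

lemma gauge_measurable:
  assumes "mat_measurable lebesgue n \<Phi>" "\<And>x. f x \<in> carrier_vec n" "\<And>i. i < n \<Longrightarrow> (\<lambda>x. vec_index (f x) i) \<in> borel_measurable lebesgue"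
  shows "(\<lambda>x. vec_norm2 (\<Phi> x *\<^sub>v f x)) \<in> borel_measurable lebesgue"
  using mat_measurableD(1)[OF assms(1)] assms(2)
  by (intro borel_measurable_vec_norm2[of _ n] borel_measurable_mult_vec[OF assms]) (auto intro: mult_mat_vec_carrier)

lemma gauge_norm_mono_AE:
  assumes "AE x in lebesgue. vec_norm2 (\<Phi> x *\<^sub>v f x) \<le> vec_norm2 (\<Psi> x *\<^sub>v g x)" "0 < r"
  shows "gauge_norm r \<Phi> f \<le> gauge_norm r \<Psi> g"
  unfolding gauge_norm_def by (rule lp_norm_mono_AE[OF assms(1) _ assms(2)]) simp

lemma comm_op_carrier:
  assumes "mat_measurable lebesgue n B" shows "comm_op n B T f x \<in> carrier_vec n"
  using mat_measurableD(1)[OF assms, of x] unfolding comm_op_def mult_op_def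
  by (intro minus_carrier_vec mult_mat_vec_carrier[of _ n n]) auto

lemma comm_op_measurable:
  assumes B: "mat_measurable lebesgue n B" and lin: "linear_operator D T" and f: "f \<in> comm_dom n B D" and i: "i < n"
  shows "(\<lambda>x. vec_index (comm_op n B T f x) i) \<in> borel_measurable lebesgue"
proof -
  have fd: "f \<in> ext_dom n D" "mult_op B f \<in> ext_dom n D" using f by (auto simp: comm_dom_def)
  have c: "B x *\<^sub>v ext_op n T f x \<in> carrier_vec n" for x
    using mat_measurableD(1)[OF B, of x] by (intro mult_mat_vec_carrier[of _ n n]) auto
  have "(\<lambda>x. vec_index (comm_op n B T f x) i) = (\<lambda>x. vec_index (B x *\<^sub>v ext_op n T f x) i - vec_index (ext_op n T (mult_op B f) x) i)"
    unfolding comm_op_def mult_op_def[of _ "ext_op n T f"] using i c by (intro ext, subst index_minus_vec) (auto simp: ext_op_def)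
  moreover have "(\<lambda>x. vec_index (B x *\<^sub>v ext_op n T f x) i) \<in> borel_measurable lebesgue"
    by (rule borel_measurable_mult_vec[OF B _ _ i]) (simp, rule ext_op_measurable[OF lin fd(1)])
  ultimately show ?thesis using ext_op_measurable[OF lin fd(2) i] by simp
qed

text \<open>The large operator is tested on f with zeros appended. The image of the zero part is
  simply dropped, as a block diagonal matrix only increases the norm by its second
  component.\<close>

lemma gauge_bounded_restrict:
  fixes \<Phi> \<Xi> :: "real^'d \<Rightarrow> cmat"
  assumes \<Phi>: "\<And>x. \<Phi> x \<in> carrier_mat n n" and \<Xi>: "\<And>x. \<Xi> x \<in> carrier_mat k k" and lin: "linear_operator D T" and pq: "0 < p" "0 < q"
    and b: "gauge_bounded (ext_dom (n + k) D) (ext_op (n + k) T) (n + k)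
      p (\<lambda>x. four_block_mat (\<Phi> x) (0\<^sub>m n k) (0\<^sub>m k n) (\<Xi> x)) q (\<lambda>x. four_block_mat (\<Phi> x) (0\<^sub>m n k) (0\<^sub>m k n) (\<Xi> x)) c"
  shows "gauge_bounded (ext_dom n D) (ext_op n T) n p \<Phi> q \<Phi> c"
  unfolding gauge_bounded_def
proof (intro allI impI, elim conjE)
  let ?P = "\<lambda>x. four_block_mat (\<Phi> x) (0\<^sub>m n k) (0\<^sub>m k n) (\<Xi> x)"
  fix f :: "real^'d \<Rightarrow> cvec"
  assume "\<forall>x. f x \<in> carrier_vec n" and "\<forall>i<n. (\<lambda>x. vec_index (f x) i) \<in> borel_measurable lebesgue" and fin: "gauge_norm p \<Phi> f < \<infinity>"
  then have f: "\<And>x. f x \<in> carrier_vec n" "\<And>i. i < n \<Longrightarrow> (\<lambda>x. vec_index (f x) i) \<in> borel_measurable lebesgue" by auto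
  define F where "F = (\<lambda>x. f x @\<^sub>v (0\<^sub>v k :: cvec))"
  have mv: "?P x *\<^sub>v (a @\<^sub>v b) = (\<Phi> x *\<^sub>v a) @\<^sub>v (\<Xi> x *\<^sub>v b)" if "a \<in> carrier_vec n" "b \<in> carrier_vec k" for x a b
    by (subst four_block_mat_mult_vec[OF \<Phi> zero_carrier_mat zero_carrier_mat \<Xi> that]) (use \<Phi>[of x] \<Xi>[of x] that in auto)
  have fc: "\<Phi> x *\<^sub>v f x \<in> carrier_vec n" for x by (rule mult_mat_vec_carrier[OF \<Phi> f(1)])
  have z: "\<Xi> x *\<^sub>v 0\<^sub>v k = 0\<^sub>v k" for x using \<Xi>[of x] by auto
  have "gauge_norm p ?P F \<le> gauge_norm p \<Phi> f"
  proof (intro gauge_norm_mono_AE AE_I2 pq)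
    fix x show "vec_norm2 (?P x *\<^sub>v F x) \<le> vec_norm2 (\<Phi> x *\<^sub>v f x)"
      unfolding F_def mv[OF f(1) zero_carrier_vec] z using vec_norm2_append(3)[OF fc zero_carrier_vec, of x k] by simp
  qed
  with fin have finF: "gauge_norm p ?P F < \<infinity>" and le: "gauge_norm p ?P F \<le> gauge_norm p \<Phi> f" by auto
  have Fc: "F x \<in> carrier_vec (n + k)" for x unfolding F_def using f(1)[of x] by simp
  have Fm: "(\<lambda>x. vec_index (F x) i) \<in> borel_measurable lebesgue" if "i < n + k" for i
    unfolding F_def by (rule append_vec_measurable[OF f _ _ that]) auto
  note r = gauge_boundedD[OF b Fc Fm finF]
  have fd: "f \<in> ext_dom n D" using r(1) ext_op_append(1)[OF f(1), where g="\<lambda>_. 0\<^sub>v k" and k=k and D=D] unfolding F_def by simp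
  have Fo: "ext_op (n + k) T F x = ext_op n T f x @\<^sub>v ext_op k T (\<lambda>_. 0\<^sub>v k) x" for x
    unfolding F_def by (rule ext_op_append(2)[OF f(1)]) simp
  have "gauge_norm q \<Phi> (ext_op n T f) \<le> gauge_norm q ?P (ext_op (n + k) T F)"
  proof (intro gauge_norm_mono_AE AE_I2 pq)
    fix x show "vec_norm2 (\<Phi> x *\<^sub>v ext_op n T f x) \<le> vec_norm2 (?P x *\<^sub>v ext_op (n + k) T F x)"
      unfolding Fo mv[OF ext_op_carrier ext_op_carrier]
      by (rule vec_norm2_append(1)[OF mult_mat_vec_carrier[OF \<Phi> ext_op_carrier] mult_mat_vec_carrier[OF \<Xi> ext_op_carrier]])
  qed
  also have "\<dots> \<le> ennreal c * gauge_norm p ?P F" by (rule r(4))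
  also have "\<dots> \<le> ennreal c * gauge_norm p \<Phi> f" by (rule mult_left_mono[OF le]) simp
  finally have "gauge_norm q \<Phi> (ext_op n T f) \<le> ennreal c * gauge_norm p \<Phi> f" .
  then show "f \<in> ext_dom n D \<and> (\<forall>x. ext_op n T f x \<in> carrier_vec n) \<and>
     (\<forall>i<n. (\<lambda>x. vec_index (ext_op n T f x) i) \<in> borel_measurable lebesgue) \<and> gauge_norm q \<Phi> (ext_op n T f) \<le> ennreal c * gauge_norm p \<Phi> f"
    using fd ext_op_measurable[OF lin fd] by auto
qed

lemma ennreal_bound_trans:
  assumes "y \<le> ennreal c * x" "x \<le> ennreal c' * z" "0 \<le> c" "0 \<le> c'"
  shows "y \<le> ennreal (c * c') * z"
proof -
  have "y \<le> ennreal c * (ennreal c' * z)" using assms(1) mult_left_mono[OF assms(2), of "ennreal c"] by (rule order.trans) simp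
  then show ?thesis using assms(3,4) by (simp add: ennreal_mult mult.assoc)
qed

locale block_operator = block_gauge m v vi u ui B \<tau>
  for m :: nat and v vi u ui :: "real^'d \<Rightarrow> cmat" and B :: "real^'d \<Rightarrow> cmat" and \<tau> :: real +
  fixes D :: "(real^'d \<Rightarrow> complex) set" and T :: "(real^'d \<Rightarrow> complex) \<Rightarrow> real^'d \<Rightarrow> complex" and p q :: real
  assumes lin: "linear_operator D T" and p: "1 < p" and q: "1 < q"
begin

abbreviation T_bounded :: "nat \<Rightarrow> (real^'d \<Rightarrow> cmat) \<Rightarrow> real \<Rightarrow> bool" where
  "T_bounded n \<Phi> c \<equiv> gauge_bounded (ext_dom n D) (ext_op n T) n p \<Phi> q \<Phi> c"

abbreviation comm_bounded :: "real \<Rightarrow> bool" where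
  "comm_bounded c \<equiv> gauge_bounded (comm_dom m B D) (comm_op m B T) m p u q v c"

lemma B_mult_carrier: "z \<in> carrier_vec m \<Longrightarrow> B x *\<^sub>v z \<in> carrier_vec m"
  by (rule mult_mat_vec_carrier[OF B_carrier])

text \<open>Both directions of the comparison meet the same expression: the term -\<tau> T(B f) in
  the first component combines with \<tau> B T f from the shear to \<tau> times the
  commutator.\<close>

lemma commutator_shear:
  assumes "AE x in lebesgue. a x = b x + (- complex_of_real \<tau>) \<cdot>\<^sub>v ext_op m T (mult_op B f) x"
    and b: "\<And>x. b x \<in> carrier_vec m"
  shows "AE x in lebesgue. a x + complex_of_real \<tau> \<cdot>\<^sub>v (B x *\<^sub>v ext_op m T f x) = b x + complex_of_real \<tau> \<cdot>\<^sub>v comm_op m B T f x"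
  using assms(1)
proof eventually_elim
  case (elim x)
  have "y + (- k) \<cdot>\<^sub>v z + k \<cdot>\<^sub>v w = y + k \<cdot>\<^sub>v (w - z)"
    if "y \<in> carrier_vec m" "z \<in> carrier_vec m" "w \<in> carrier_vec m" for y z w :: cvec and k
    using that by (intro eq_vecI) (auto simp: right_diff_distrib)
  then show ?case
    unfolding elim comm_op_def mult_op_def[of B "ext_op m T f"] using b B_mult_carrier[OF ext_op_carrier] ext_op_carrier by blast
qed

text \<open>Tested on F = (-\<tau> B f, f): the shear cancels the first component, so F has the norm
  of f with respect to u, while the first component of the image is \<tau> times the commutator,
  measured with v.\<close>

lemma comm_bounded_of_block:
  assumes b: "T_bounded (m + m) block c" and c: "0 \<le> c"
  shows "comm_bounded (c / \<tau>)"
  unfolding gauge_bounded_def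
proof (intro allI impI, elim conjE)
  fix f :: "real^'d \<Rightarrow> cvec"
  assume "\<forall>x. f x \<in> carrier_vec m" and "\<forall>i<m. (\<lambda>x. vec_index (f x) i) \<in> borel_measurable lebesgue" and fin: "gauge_norm p u f < \<infinity>"
  then have f: "\<And>x. f x \<in> carrier_vec m" "\<And>i. i < m \<Longrightarrow> (\<lambda>x. vec_index (f x) i) \<in> borel_measurable lebesgue" by auto
  let ?t = "complex_of_real \<tau>"
  define g where "g = mult_op B f"
  have gc: "g x \<in> carrier_vec m" for x unfolding g_def mult_op_def by (rule B_mult_carrier[OF f(1)])
  have gm: "(\<lambda>x. vec_index (g x) i) \<in> borel_measurable lebesgue" if "i < m" for i
    unfolding g_def mult_op_def by (rule borel_measurable_mult_vec[OF B_meas f that])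
  define h where "h = (\<lambda>x. (- ?t) \<cdot>\<^sub>v g x)"
  have hc: "h x \<in> carrier_vec m" for x unfolding h_def using gc by simp
  have hm: "(\<lambda>x. vec_index (h x) i) \<in> borel_measurable lebesgue" if "i < m" for i
    unfolding h_def using gm[OF that] that by (simp add: carrier_vecD[OF gc])
  define F where "F = (\<lambda>x. h x @\<^sub>v f x)"
  have Fc: "F x \<in> carrier_vec (m + m)" for x unfolding F_def using hc f by simp
  have Fm: "(\<lambda>x. vec_index (F x) i) \<in> borel_measurable lebesgue" if "i < m + m" for i
    unfolding F_def by (rule append_vec_measurable[OF hc hm f that])
  have "h x + ?t \<cdot>\<^sub>v (B x *\<^sub>v f x) = 0\<^sub>v m" for x
    unfolding h_def g_def mult_op_def by (intro eq_vecI) (simp_all add: carrier_matD[OF B_carrier])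
  moreover have "v x *\<^sub>v 0\<^sub>v m = 0\<^sub>v m" for x using V.\<Phi>_carrier[of x] by auto
  ultimately have "block x *\<^sub>v F x = 0\<^sub>v m @\<^sub>v (u x *\<^sub>v f x)" for x
    unfolding F_def block_mult_vec[OF hc f(1)] by simp
  then have FN: "gauge_norm p block F = gauge_norm p u f"
    unfolding gauge_norm_def by (simp add: vec_norm2_append(4)[OF f(1) mult_mat_vec_carrier[OF U.\<Phi>_carrier f(1)]])
  note r = gauge_boundedD[OF b Fc Fm fin[folded FN]]
  have hf: "h \<in> ext_dom m D" "f \<in> ext_dom m D" using r(1) ext_op_append(1)[OF hc f(1), where D=D] unfolding F_def by auto
  \<comment> \<open>The boundedness of T puts only -\<tau> B f in the domain; since \<tau> is not 0,
    linearity gives B f itself, as \<open>comm_dom\<close> requires.\<close>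
  have "g = (\<lambda>x. (- (1 / ?t)) \<cdot>\<^sub>v h x)"
    unfolding h_def using \<tau> by (simp add: smult_smult_assoc)
  then have gd: "g \<in> ext_dom m D" using ext_op_smult(1)[OF lin hf(1), of "- (1 / ?t)"] by simp
  then have fd: "f \<in> comm_dom m B D" using hf(2) unfolding comm_dom_def g_def by simp
  have "AE x in lebesgue. ext_op m T h x = 0\<^sub>v m + (- ?t) \<cdot>\<^sub>v ext_op m T (mult_op B f) x"
    using ext_op_smult(2)[OF lin gd, of "- ?t"] unfolding h_def[symmetric] g_def[symmetric]
    by eventually_elim simp
  from commutator_shear[OF this]
  have ae: "AE x in lebesgue. ext_op m T h x + ?t \<cdot>\<^sub>v (B x *\<^sub>v ext_op m T f x) = 0\<^sub>v m + ?t \<cdot>\<^sub>v comm_op m B T f x" by simp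
  note cc = comm_op_carrier[OF B_meas, of T f]
  have Fo: "ext_op (m + m) T F x = ext_op m T h x @\<^sub>v ext_op m T f x" for x
    unfolding F_def by (rule ext_op_append(2)[OF hc f(1)])
  have "lp_norm q (\<lambda>x. vec_norm2 (v x *\<^sub>v comm_op m B T f x)) \<le> lp_norm q (\<lambda>x. (1 / \<tau>) * vec_norm2 (block x *\<^sub>v ext_op (m + m) T F x))"
  proof (rule lp_norm_mono_AE)
    show "AE x in lebesgue. vec_norm2 (v x *\<^sub>v comm_op m B T f x) \<le> (1 / \<tau>) * vec_norm2 (block x *\<^sub>v ext_op (m + m) T F x)"
      using ae
    proof eventually_elim
      case (elim x)
      have e: "v x *\<^sub>v (0\<^sub>v m + ?t \<cdot>\<^sub>v comm_op m B T f x) = ?t \<cdot>\<^sub>v (v x *\<^sub>v comm_op m B T f x)"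
        using cc[of x] V.\<Phi>_carrier[of x] by (simp add: mult_mat_vec[of _ m m])
      have "\<tau> * vec_norm2 (v x *\<^sub>v comm_op m B T f x) = vec_norm2 (?t \<cdot>\<^sub>v (v x *\<^sub>v comm_op m B T f x))"
        using \<tau> by (simp add: vec_norm2_smult)
      also have "\<dots> \<le> vec_norm2 (block x *\<^sub>v ext_op (m + m) T F x)"
        unfolding Fo block_mult_vec[OF ext_op_carrier ext_op_carrier] elim e
        by (rule vec_norm2_append(1)[OF smult_carrier_vec[THEN iffD2, OF mult_mat_vec_carrier[OF V.\<Phi>_carrier cc]] mult_mat_vec_carrier[OF U.\<Phi>_carrier ext_op_carrier]])
      finally show ?case using \<tau> by (simp add: field_simps)
    qed
  qed (use q in auto)
  also have "\<dots> \<le> ennreal (1 / \<tau>) * gauge_norm q block (ext_op (m + m) T F)"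
    unfolding gauge_norm_def using \<tau> q by (intro lp_norm_cmult_le) auto
  finally have "gauge_norm q v (comm_op m B T f) \<le> ennreal (1 / \<tau> * c) * gauge_norm p u f"
    unfolding gauge_norm_def[of q v] using r(4)[unfolded FN] by (rule ennreal_bound_trans) (use \<tau> c in auto)
  then show "f \<in> comm_dom m B D \<and> (\<forall>x. comm_op m B T f x \<in> carrier_vec m) \<and>
     (\<forall>i<m. (\<lambda>x. vec_index (comm_op m B T f x) i) \<in> borel_measurable lebesgue) \<and>
     gauge_norm q v (comm_op m B T f) \<le> ennreal (c / \<tau>) * gauge_norm p u f"
    using fd cc comm_op_measurable[OF B_meas lin fd] by simp
qed

text \<open>With G = F1 + \<tau> B F2 the norm of f = (F1, F2) is that of (G, F2) with respect to
  diag(v, u), and T f has the components T G + \<tau> [M_B, T] F2 and T F2 after the shear. The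
  factor 16 comes from two uses of the quasi-triangle inequality.\<close>

lemma block_bounded:
  assumes b1: "T_bounded m v c1" and b2: "T_bounded m u c2" and b3: "comm_bounded c3"
    and c: "0 \<le> c1" "0 \<le> c2" "0 \<le> c3"
  shows "T_bounded (m + m) block (16 * (c1 + c2 + \<tau> * c3))"
  unfolding gauge_bounded_def
proof (intro allI impI, elim conjE)
  fix f :: "real^'d \<Rightarrow> cvec"
  assume "\<forall>x. f x \<in> carrier_vec (m + m)" and "\<forall>i<m + m. (\<lambda>x. vec_index (f x) i) \<in> borel_measurable lebesgue"
    and fin: "gauge_norm p block f < \<infinity>"
  then have f: "\<And>x. f x \<in> carrier_vec (m + m)" "\<And>i. i < m + m \<Longrightarrow> (\<lambda>x. vec_index (f x) i) \<in> borel_measurable lebesgue" by auto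
  let ?t = "complex_of_real \<tau>"
  define F1 where "F1 = (\<lambda>x. vec_first (f x) m)"
  define F2 where "F2 = (\<lambda>x. vec_last (f x) m)"
  have fe: "f = (\<lambda>x. F1 x @\<^sub>v F2 x)" unfolding F1_def F2_def using f(1) by (simp add: vec_first_last_append[where n=m and m=m])
  have Fc: "F1 x \<in> carrier_vec m" "F2 x \<in> carrier_vec m" for x unfolding F1_def F2_def by simp_all
  have Fm: "(\<lambda>x. vec_index (F1 x) i) \<in> borel_measurable lebesgue" "(\<lambda>x. vec_index (F2 x) i) \<in> borel_measurable lebesgue" if "i < m" for i
    using f(2)[of i] f(2)[of "m + i"] that carrier_vecD[OF f(1)] by (simp_all add: F1_def F2_def vec_first_def vec_last_def)
  define g where "g = mult_op B F2"
  have gc: "g x \<in> carrier_vec m" for x unfolding g_def mult_op_def by (rule B_mult_carrier[OF Fc(2)])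
  have gm: "(\<lambda>x. vec_index (g x) i) \<in> borel_measurable lebesgue" if "i < m" for i
    unfolding g_def mult_op_def by (rule borel_measurable_mult_vec[OF B_meas Fc(2) Fm(2) that])
  define G where "G = (\<lambda>x. F1 x + ?t \<cdot>\<^sub>v g x)"
  have Gc: "G x \<in> carrier_vec m" for x unfolding G_def using gc Fc by simp
  have Gm: "(\<lambda>x. vec_index (G x) i) \<in> borel_measurable lebesgue" if "i < m" for i
    unfolding G_def using gm[OF that] Fm(1)[OF that] that by (simp add: carrier_vecD[OF gc])
  have bf: "block x *\<^sub>v f x = (v x *\<^sub>v G x) @\<^sub>v (u x *\<^sub>v F2 x)" for x
    unfolding fe block_mult_vec[OF Fc] G_def g_def mult_op_def ..
  note vc = mult_mat_vec_carrier[OF V.\<Phi>_carrier] and uc = mult_mat_vec_carrier[OF U.\<Phi>_carrier]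
  let ?X = "gauge_norm p block f"
  have le1: "gauge_norm p v G \<le> ?X"
    by (intro gauge_norm_mono_AE AE_I2) (use p bf vec_norm2_append(1)[OF vc[OF Gc] uc[OF Fc(2)]] in auto)
  have le2: "gauge_norm p u F2 \<le> ?X"
    by (intro gauge_norm_mono_AE AE_I2) (use p bf vec_norm2_append(2)[OF vc[OF Gc] uc[OF Fc(2)]] in auto)
  have r1: "G \<in> ext_dom m D" "gauge_norm q v (ext_op m T G) \<le> ennreal c1 * gauge_norm p v G"
    by (rule gauge_boundedD[OF b1 Gc Gm order.strict_trans1[OF le1 fin]]; assumption)+
  have r2: "F2 \<in> ext_dom m D" "gauge_norm q u (ext_op m T F2) \<le> ennreal c2 * gauge_norm p u F2"
    by (rule gauge_boundedD[OF b2 Fc(2) Fm(2) order.strict_trans1[OF le2 fin]]; assumption)+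
  have r3: "F2 \<in> comm_dom m B D" "gauge_norm q v (comm_op m B T F2) \<le> ennreal c3 * gauge_norm p u F2"
    by (rule gauge_boundedD[OF b3 Fc(2) Fm(2) order.strict_trans1[OF le2 fin]]; assumption)+
  have gd: "g \<in> ext_dom m D" using r3(1) by (simp add: comm_dom_def g_def)
  have F1e: "F1 = (\<lambda>x. G x + (- ?t) \<cdot>\<^sub>v g x)"
    using carrier_vecD[OF gc] carrier_vecD[OF Fc(1)] unfolding G_def by (intro ext eq_vecI) auto
  note sm = ext_op_smult[OF lin gd, of "- ?t"]
  note ad = ext_op_add[OF lin r1(1) sm(1), folded F1e]
  have "AE x in lebesgue. ext_op m T F1 x = ext_op m T G x + (- ?t) \<cdot>\<^sub>v ext_op m T (mult_op B F2) x"
    using ad(2) sm(2) unfolding g_def[symmetric] by eventually_elim simp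
  from commutator_shear[OF this ext_op_carrier]
  have ae: "AE x in lebesgue. ext_op m T F1 x + ?t \<cdot>\<^sub>v (B x *\<^sub>v ext_op m T F2 x) = ext_op m T G x + ?t \<cdot>\<^sub>v comm_op m B T F2 x" .
  note cc = comm_op_carrier[OF B_meas, of T F2]
  have fd: "f \<in> ext_dom (m + m) D" unfolding fe using ext_op_append(1)[OF Fc, where D=D] ad(1) r2(1) by simp
  have fo: "ext_op (m + m) T f x = ext_op m T F1 x @\<^sub>v ext_op m T F2 x" for x
    unfolding fe by (rule ext_op_append(2)[OF Fc])
  let ?h1 = "\<lambda>x. vec_norm2 (v x *\<^sub>v ext_op m T G x)" and ?h2 = "\<lambda>x. vec_norm2 (u x *\<^sub>v ext_op m T F2 x)"
    and ?h3 = "\<lambda>x. vec_norm2 (v x *\<^sub>v comm_op m B T F2 x)"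
  have [measurable]: "?h1 \<in> borel_measurable lebesgue" "?h2 \<in> borel_measurable lebesgue" "?h3 \<in> borel_measurable lebesgue"
    using r1(1) r2(1) r3(1) by (auto intro!: gauge_measurable[of m] V.\<Phi>_meas U.\<Phi>_meas comm_op_carrier B_meas ext_op_measurable[OF lin] comm_op_measurable[OF B_meas lin])
  have "gauge_norm q block (ext_op (m + m) T f) \<le> lp_norm q (\<lambda>x. ?h1 x + (\<tau> * ?h3 x + ?h2 x))"
    unfolding gauge_norm_def
  proof (rule lp_norm_mono_AE)
    show "AE x in lebesgue. vec_norm2 (block x *\<^sub>v ext_op (m + m) T f x) \<le> ?h1 x + (\<tau> * ?h3 x + ?h2 x)"
      using ae
    proof eventually_elim
      case (elim x)
      have e: "v x *\<^sub>v (ext_op m T G x + ?t \<cdot>\<^sub>v comm_op m B T F2 x) = v x *\<^sub>v ext_op m T G x + ?t \<cdot>\<^sub>v (v x *\<^sub>v comm_op m B T F2 x)"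
        using cc[of x] V.\<Phi>_carrier[of x] ext_op_carrier[of m T G x] by (simp add: mult_mat_vec[of _ m m] mult_add_distrib_mat_vec[of _ m m])
      have sc: "?t \<cdot>\<^sub>v (v x *\<^sub>v comm_op m B T F2 x) \<in> carrier_vec m" using vc[OF cc] by simp
      have "vec_norm2 (block x *\<^sub>v ext_op (m + m) T f x) \<le>
          vec_norm2 (v x *\<^sub>v ext_op m T G x + ?t \<cdot>\<^sub>v (v x *\<^sub>v comm_op m B T F2 x)) + ?h2 x"
        unfolding fo block_mult_vec[OF ext_op_carrier ext_op_carrier] elim e
        by (rule vec_norm2_append(3)[OF add_carrier_vec[OF vc[OF ext_op_carrier] sc] uc[OF ext_op_carrier]])
      also have "vec_norm2 (v x *\<^sub>v ext_op m T G x + ?t \<cdot>\<^sub>v (v x *\<^sub>v comm_op m B T F2 x)) \<le> ?h1 x + \<tau> * ?h3 x"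
        using vec_norm2_triangle[OF vc[OF ext_op_carrier] sc] \<tau> by (simp add: vec_norm2_smult)
      finally show ?case by simp
    qed
  qed (use q in auto)
  also have "\<dots> \<le> 4 * (lp_norm q ?h1 + lp_norm q (\<lambda>x. \<tau> * ?h3 x + ?h2 x))"
    by (rule lp_norm_add_le) (use q \<tau> in auto)
  also have "\<dots> \<le> 4 * (lp_norm q ?h1 + 4 * (lp_norm q (\<lambda>x. \<tau> * ?h3 x) + lp_norm q ?h2))"
    by (intro mult_left_mono add_left_mono lp_norm_add_le) (use q \<tau> in auto)
  also have "\<dots> \<le> 4 * (ennreal c1 * ?X + 4 * (ennreal (\<tau> * c3) * ?X + ennreal c2 * ?X))"
  proof (intro mult_left_mono add_mono)
    show "lp_norm q ?h1 \<le> ennreal c1 * ?X"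
      using r1(2) mult_left_mono[OF le1, of "ennreal c1"] unfolding gauge_norm_def[of q] by (rule order.trans) simp
    show "lp_norm q ?h2 \<le> ennreal c2 * ?X"
      using r2(2) mult_left_mono[OF le2, of "ennreal c2"] unfolding gauge_norm_def[of q] by (rule order.trans) simp
    have "lp_norm q ?h3 \<le> ennreal c3 * ?X"
      using r3(2) mult_left_mono[OF le2, of "ennreal c3"] unfolding gauge_norm_def[of q] by (rule order.trans) simp
    then show "lp_norm q (\<lambda>x. \<tau> * ?h3 x) \<le> ennreal (\<tau> * c3) * ?X"
      by (rule ennreal_bound_trans[rotated]) (use \<tau> q c in \<open>auto intro!: lp_norm_cmult_le\<close>)
  qed auto
  also have "\<dots> \<le> ennreal (16 * (c1 + c2 + \<tau> * c3)) * ?X"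
  proof (cases ?X)
    case (real X)
    have "4 * (c1 * X + 4 * (\<tau> * c3 * X + c2 * X)) \<le> 16 * (c1 + c2 + \<tau> * c3) * X"
      using real c by (simp add: algebra_simps)
    then show ?thesis unfolding real(1) using real c \<tau>
      by (simp add: ennreal_leI flip: ennreal_mult ennreal_plus ennreal_numeral)
  qed (use fin in simp)
  finally have "gauge_norm q block (ext_op (m + m) T f) \<le> ennreal (16 * (c1 + c2 + \<tau> * c3)) * ?X" .
  then show "f \<in> ext_dom (m + m) D \<and> (\<forall>x. ext_op (m + m) T f x \<in> carrier_vec (m + m)) \<and>
     (\<forall>i<m + m. (\<lambda>x. vec_index (ext_op (m + m) T f x) i) \<in> borel_measurable lebesgue) \<and>
     gauge_norm q block (ext_op (m + m) T f) \<le> ennreal (16 * (c1 + c2 + \<tau> * c3)) * ?X"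
    using fd ext_op_measurable[OF lin fd] by auto
qed

end

section \<open>Padding by a scalar weight\<close>

definition diag_pad :: "nat \<Rightarrow> cmat \<Rightarrow> real \<Rightarrow> cmat" where
  "diag_pad n A r = four_block_mat A (0\<^sub>m n 1) (0\<^sub>m 1 n) (complex_of_real r \<cdot>\<^sub>m 1\<^sub>m 1)"

lemma diag_pad_carrier: "A \<in> carrier_mat n n \<Longrightarrow> diag_pad n A r \<in> carrier_mat (n + 1) (n + 1)"
  unfolding diag_pad_def by (rule four_block_carrier_mat) auto

lemma diag_pad_mult:
  assumes A: "A \<in> carrier_mat n n" and B: "B \<in> carrier_mat n n"
  shows "diag_pad n A r * diag_pad n B s = diag_pad n (A * B) (r * s)"
proof -
  have o: "complex_of_real r \<cdot>\<^sub>m 1\<^sub>m 1 \<in> carrier_mat 1 1" for r by simp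
  have "(complex_of_real r \<cdot>\<^sub>m 1\<^sub>m 1) * (complex_of_real s \<cdot>\<^sub>m 1\<^sub>m 1) = complex_of_real (r * s) \<cdot>\<^sub>m 1\<^sub>m 1"
    by (rule eq_matI) (auto simp: index_mult_mat_sum[OF _ _ o o])
  then show ?thesis unfolding diag_pad_def four_block_diag_mult[OF A o B o] by simp
qed

lemma diag_pad_one: "diag_pad n (1\<^sub>m n) 1 = 1\<^sub>m (n + 1)"
  unfolding diag_pad_def by (rule eq_matI) auto

lemma diag_pad_mult_vec:
  assumes A: "A \<in> carrier_mat n n" and a: "a \<in> carrier_vec n" and b: "b \<in> carrier_vec 1"
  shows "diag_pad n A r *\<^sub>v (a @\<^sub>v b) = (A *\<^sub>v a) @\<^sub>v (complex_of_real r \<cdot>\<^sub>v b)"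
proof -
  have "diag_pad n A r *\<^sub>v (a @\<^sub>v b) = (A *\<^sub>v a + 0\<^sub>m n 1 *\<^sub>v b) @\<^sub>v (0\<^sub>m 1 n *\<^sub>v a + (complex_of_real r \<cdot>\<^sub>m 1\<^sub>m 1) *\<^sub>v b)"
    unfolding diag_pad_def by (rule four_block_mat_mult_vec) (use A a b in auto)
  moreover have "(complex_of_real r \<cdot>\<^sub>m 1\<^sub>m 1) *\<^sub>v b = complex_of_real r \<cdot>\<^sub>v b"
    using b by (simp add: smult_mat_mult_vec[of _ 1 1])
  moreover have "A *\<^sub>v a + 0\<^sub>m n 1 *\<^sub>v b = A *\<^sub>v a" "0\<^sub>m 1 n *\<^sub>v a + complex_of_real r \<cdot>\<^sub>v b = complex_of_real r \<cdot>\<^sub>v b"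
    using A a b by auto
  ultimately show ?thesis by simp
qed

lemma opnorm_diag_pad:
  assumes A: "A \<in> carrier_mat n n" and r: "0 \<le> r"
  shows "mat_opnorm (diag_pad n A r) = max (mat_opnorm A) r"
proof (rule antisym)
  let ?M = "max (mat_opnorm A) r"
  have M: "0 \<le> ?M" using r by simp
  show "mat_opnorm (diag_pad n A r) \<le> ?M"
  proof (rule opnorm_leI[OF diag_pad_carrier[OF A] M])
    fix v :: cvec assume v: "v \<in> carrier_vec (n + 1)"
    define a b where "a = vec_first v n" and "b = vec_last v 1"
    have ab: "a \<in> carrier_vec n" "b \<in> carrier_vec 1" by (simp_all add: a_def b_def)
    have ve: "v = a @\<^sub>v b" using v by (simp add: a_def b_def)
    have "vec_norm2 (A *\<^sub>v a) \<le> ?M * vec_norm2 a"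
      using vec_norm2_mult_opnorm[OF A ab(1)] by (rule order.trans) (intro mult_right_mono, auto)
    then have 1: "(vec_norm2 (A *\<^sub>v a))\<^sup>2 \<le> (?M * vec_norm2 a)\<^sup>2" by (rule power_mono) simp
    have "vec_norm2 (complex_of_real r \<cdot>\<^sub>v b) \<le> ?M * vec_norm2 b"
      unfolding vec_norm2_smult using r by (intro mult_right_mono) auto
    then have 2: "(vec_norm2 (complex_of_real r \<cdot>\<^sub>v b))\<^sup>2 \<le> (?M * vec_norm2 b)\<^sup>2" by (rule power_mono) simp
    have rb: "complex_of_real r \<cdot>\<^sub>v b \<in> carrier_vec 1" using ab by simp
    have "(vec_norm2 (diag_pad n A r *\<^sub>v v))\<^sup>2 \<le> (?M * vec_norm2 v)\<^sup>2"
      unfolding ve diag_pad_mult_vec[OF A ab] vec_norm2_append_sq[OF mult_mat_vec_carrier[OF A ab(1)] rb] power_mult_distrib vec_norm2_append_sq[OF ab]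
      using 1 2 by (simp add: power_mult_distrib distrib_left)
    then show "vec_norm2 (diag_pad n A r *\<^sub>v v) \<le> ?M * vec_norm2 v" by (rule power2_le_imp_le) (use M in simp)
  qed
  show "?M \<le> mat_opnorm (diag_pad n A r)"
  proof (rule max.boundedI)
    show "mat_opnorm A \<le> mat_opnorm (diag_pad n A r)"
    proof (rule opnorm_leI[OF A opnorm_nonneg])
      fix a :: cvec assume a: "a \<in> carrier_vec n"
      have z: "complex_of_real r \<cdot>\<^sub>v 0\<^sub>v 1 = 0\<^sub>v 1" by (rule eq_vecI) auto
      have "vec_norm2 (A *\<^sub>v a) \<le> vec_norm2 (diag_pad n A r *\<^sub>v (a @\<^sub>v 0\<^sub>v 1))"
        unfolding diag_pad_mult_vec[OF A a zero_carrier_vec] z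
        by (rule vec_norm2_append(1)[OF mult_mat_vec_carrier[OF A a] zero_carrier_vec])
      also have "\<dots> \<le> mat_opnorm (diag_pad n A r) * vec_norm2 (a @\<^sub>v 0\<^sub>v 1)"
        by (rule vec_norm2_mult_opnorm[OF diag_pad_carrier[OF A] append_carrier_vec[OF a zero_carrier_vec]])
      also have "\<dots> \<le> mat_opnorm (diag_pad n A r) * vec_norm2 a"
        using vec_norm2_append(3)[OF a zero_carrier_vec, of 1] by (intro mult_left_mono) auto
      finally show "vec_norm2 (A *\<^sub>v a) \<le> mat_opnorm (diag_pad n A r) * vec_norm2 a" .
    qed
    let ?e = "unit_vec 1 0 :: cvec"
    have e: "?e \<in> carrier_vec 1" "vec_norm2 ?e = 1" by simp_all
    have "A *\<^sub>v 0\<^sub>v n = 0\<^sub>v n" using A by auto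
    then have "r = vec_norm2 (diag_pad n A r *\<^sub>v (0\<^sub>v n @\<^sub>v ?e))"
      unfolding diag_pad_mult_vec[OF A zero_carrier_vec e(1)] using vec_norm2_append(4)[OF zero_carrier_vec smult_carrier_vec[THEN iffD2, OF e(1)]] e(2) r
      by (simp add: vec_norm2_smult)
    also have "\<dots> \<le> mat_opnorm (diag_pad n A r) * vec_norm2 (0\<^sub>v n @\<^sub>v ?e)"
      by (rule vec_norm2_mult_opnorm[OF diag_pad_carrier[OF A] append_carrier_vec[OF zero_carrier_vec e(1)]])
    also have "\<dots> = mat_opnorm (diag_pad n A r)" using vec_norm2_append(4)[OF zero_carrier_vec e(1)] e(2) by simp
    finally show "r \<le> mat_opnorm (diag_pad n A r)" .
  qed
qed

text \<open>The hypotheses bound f t / f t0 on both sides by powers of max (t / t0) (t0 / t), which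
  tends to 1; so f is continuous and the intermediate value theorem applies.\<close>

lemma attained_of_scaling:
  fixes f :: "real \<Rightarrow> real"
  assumes sc: "\<And>s t. 1 \<le> t \<Longrightarrow> t \<le> s \<Longrightarrow> f s \<le> (s / t) powr q * f t" "\<And>s t. 1 \<le> t \<Longrightarrow> t \<le> s \<Longrightarrow> f t \<le> (s / t) powr q * f s"
    and q: "0 < q" and b: "1 \<le> b" "f 1 \<le> y" "y \<le> f b"
  shows "\<exists>t\<ge>1. f t = y"
proof -
  have "continuous_on {1..b} f"
    unfolding continuous_on_def
  proof
    fix t0 assume t0: "t0 \<in> {1..b}"
    let ?r = "\<lambda>t. max (t / t0) (t0 / t)"
    have rc: "(?r \<longlongrightarrow> 1) (at t0 within {1..b})"
      by (rule tendsto_eq_intros refl | use t0 in force)+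
    have pw: "((\<lambda>t. ?r t powr z * f t0) \<longlongrightarrow> f t0) (at t0 within {1..b})" for z
      using tendsto_mult[OF tendsto_powr[OF rc tendsto_const[of z]] tendsto_const[of "f t0"]] by simp
    have bnd: "f t \<le> ?r t powr q * f t0 \<and> f t0 \<le> ?r t powr q * f t" if t: "t \<in> {1..b}" for t
    proof (cases "t \<le> t0")
      case True
      then have "?r t = t0 / t" using t by (auto simp: max_def field_simps intro: mult_mono)
      then show ?thesis using sc[of t t0] True t by auto
    next
      case False
      then have "?r t = t / t0" using t t0 by (auto simp: max_def field_simps) (smt (verit) mult_mono)
      then show ?thesis using sc[of t0 t] False t0 by auto
    qed
    have rp: "0 < ?r t" if "t \<in> {1..b}" for t using that t0 by (simp add: less_max_iff_disj)
    have ev: "\<forall>\<^sub>F t in at t0 within {1..b}. t \<in> {1..b}" by (simp add: eventually_at_filter)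
    show "(f \<longlongrightarrow> f t0) (at t0 within {1..b})"
    proof (rule tendsto_sandwich[OF _ _ pw[of "- q"] pw[of q]])
      show "\<forall>\<^sub>F t in at t0 within {1..b}. f t \<le> ?r t powr q * f t0" using ev by eventually_elim (use bnd in blast)
      show "\<forall>\<^sub>F t in at t0 within {1..b}. ?r t powr (- q) * f t0 \<le> f t" using ev
      proof eventually_elim
        case (elim t)
        have "?r t powr (- q) * f t0 \<le> ?r t powr (- q) * (?r t powr q * f t)" using bnd[OF elim] by (intro mult_left_mono) auto
        also have "\<dots> = f t" using rp[OF elim] by (simp add: powr_minus)
        finally show ?case .
      qed
    qed
  qed
  from IVT'[OF b(2,3,1) this] show ?thesis by auto
qed

lemma avg_ge_subcube:
  fixes f :: "real^'d \<Rightarrow> ennreal"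
  assumes "\<And>x. x \<in> hcube c 1 \<Longrightarrow> z \<le> f x" and sub: "hcube c 1 \<subseteq> hcube e 2"
  shows "ennreal (1 / 2 ^ CARD('d)) * z \<le> avg (hcube e 2) f"
proof -
  have Q: "hcube e 2 \<in> hcubes" by (rule hcubeI) simp
  have l1: "0 < (1::real)" and l2: "0 < (2::real)" by simp_all
  have "avg (hcube e 2) (indicator (hcube c 1)) = ennreal (1 / 2 ^ CARD('d))"
    using avg_indicator[OF sub, of "\<lambda>_. 1"]
    unfolding mult_1 nn_integral_indicator[OF hcube_sets] emeasure_hcube[OF l1] emeasure_hcube[OF l2]
    by (simp add: divide_ennreal flip: ennreal_1)
  then have "ennreal (1 / 2 ^ CARD('d)) * z = avg (hcube e 2) (\<lambda>x. z * indicator (hcube c 1) x)"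
    by (subst avg_cmult[OF _ Q]) (auto simp: mult.commute)
  also have "\<dots> \<le> avg (hcube e 2) f" using assms(1) by (intro avg_mono) (auto simp: indicator_def)
  finally show ?thesis .
qed

text \<open>The weight constant of the polar weight of \<Phi>, when \<Psi> is the inverse of \<Phi>
  and a is conjugate to p (\<open>Apq_polar\<close>).\<close>

definition gauge_Apq :: "real \<Rightarrow> real \<Rightarrow> (real^'d \<Rightarrow> cmat) \<Rightarrow> (real^'d \<Rightarrow> cmat) \<Rightarrow> ennreal" where
  "gauge_Apq a q \<Phi> \<Psi> = (SUP Q\<in>hcubes. mixed_avg Q a q (\<lambda>x y. mat_opnorm (\<Phi> x * \<Psi> y)))"

text \<open>The two-valued scalar weight of the padding. Every quotient of its values is t, 1 or 1 /
  t, so its contribution to the kernel grows with t in a controlled way.\<close>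

definition bump :: "real \<Rightarrow> real^'d \<Rightarrow> real" where
  "bump t x = (if x \<in> hcube 0 1 then t else 1)"

lemma bump_pos: "1 \<le> t \<Longrightarrow> 0 < bump t x"
  by (simp add: bump_def)

lemma bump_measurable: "bump t \<in> borel_measurable lebesgue"
  unfolding bump_def[abs_def] by measurable

lemma bump_quotient:
  assumes "1 \<le> t" "t \<le> s"
  shows "bump s x / bump s y \<le> (s / t) * (bump t x / bump t y)" "bump t x / bump t y \<le> (s / t) * (bump s x / bump s y)"
proof -
  have st: "1 \<le> s / t" "1 \<le> s" "1 \<le> s * t" using assms mult_mono[of 1 s 1 t] by auto
  have "1 / s \<le> s / t * (1 / t)" "1 / t \<le> s / t * (1 / s)"
    using assms mult_mono[of t s t s] by (simp_all add: field_simps)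
  moreover have "t \<le> s / t * s" using assms mult_mono[of t s t s] by (simp add: field_simps)
  ultimately show "bump s x / bump s y \<le> (s / t) * (bump t x / bump t y)" "bump t x / bump t y \<le> (s / t) * (bump s x / bump s y)"
    using assms st by (cases "x \<in> hcube 0 1"; cases "y \<in> hcube 0 1"; simp add: bump_def)+
qed

definition pad :: "nat \<Rightarrow> (real^'d \<Rightarrow> cmat) \<Rightarrow> real \<Rightarrow> real^'d \<Rightarrow> cmat" where
  "pad n \<Phi> t x = diag_pad n (\<Phi> x) (bump t x)"

definition pad_inv :: "nat \<Rightarrow> (real^'d \<Rightarrow> cmat) \<Rightarrow> real \<Rightarrow> real^'d \<Rightarrow> cmat" where
  "pad_inv n \<Psi> t x = diag_pad n (\<Psi> x) (1 / bump t x)"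

lemma mat_measurable_diag_pad:
  assumes A: "mat_measurable M n A" and r: "r \<in> borel_measurable M"
  shows "mat_measurable M (n + 1) (\<lambda>x. diag_pad n (A x) (r x))"
  unfolding diag_pad_def
proof (rule mat_measurable_four_block[OF A])
  show "mat_measurable M 1 (\<lambda>x. complex_of_real (r x) \<cdot>\<^sub>m 1\<^sub>m 1)"
    by (rule mat_measurableI) (use r in auto)
qed auto

context invertible_gauge
begin

lemma pad_mult: "pad n \<Phi> t x * pad_inv n \<Psi> t y = diag_pad n (\<Phi> x * \<Psi> y) (bump t x / bump t y)"
  unfolding pad_def pad_inv_def diag_pad_mult[OF \<Phi>_carrier \<Psi>_carrier] by simp

lemma invertible_gauge_pad:
  assumes t: "1 \<le> t" shows "invertible_gauge (n + 1) (pad n \<Phi> t) (pad_inv n \<Psi> t)"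
proof
  show "mat_measurable lebesgue (n + 1) (pad n \<Phi> t)" "mat_measurable lebesgue (n + 1) (pad_inv n \<Psi> t)"
    unfolding pad_def[abs_def] pad_inv_def[abs_def]
    by (intro mat_measurable_diag_pad \<Phi>_meas \<Psi>_meas bump_measurable borel_measurable_divide borel_measurable_const)+
  fix x
  show "pad n \<Phi> t x * pad_inv n \<Psi> t x = 1\<^sub>m (n + 1)"
    unfolding pad_mult \<Phi>_inverse using bump_pos[OF t, of x] diag_pad_one[of n] by simp
  show "pad_inv n \<Psi> t x * pad n \<Phi> t x = 1\<^sub>m (n + 1)"
    unfolding pad_def pad_inv_def diag_pad_mult[OF \<Psi>_carrier \<Phi>_carrier] \<Phi>_inverse using bump_pos[OF t, of x] diag_pad_one[of n] by simp
qed

abbreviation pad_kernel :: "real \<Rightarrow> real^'d \<Rightarrow> real^'d \<Rightarrow> real" where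
  "pad_kernel t x y \<equiv> max (mat_opnorm (\<Phi> x * \<Psi> y)) (bump t x / bump t y)"

lemma gauge_Apq_pad:
  assumes t: "1 \<le> t"
  shows "gauge_Apq a q (pad n \<Phi> t) (pad_inv n \<Psi> t) = (SUP Q\<in>hcubes. mixed_avg Q a q (pad_kernel t))"
proof -
  have "mat_opnorm (pad n \<Phi> t x * pad_inv n \<Psi> t y) = pad_kernel t x y" for x y
    unfolding pad_mult using bump_pos[OF t, of x] bump_pos[OF t, of y]
    by (intro opnorm_diag_pad sq_mult_carrier \<Phi>_carrier \<Psi>_carrier) simp
  then show ?thesis unfolding gauge_Apq_def by (simp only:)
qed

lemma kernel_measurable_gauge: "kernel_measurable (\<lambda>x y. fro (\<Phi> x * \<Psi> y))"
  by (rule kernel_measurable_fro[OF mat_measurable_mult[OF mat_measurable_compose[OF measurable_fst \<Phi>_meas] mat_measurable_compose[OF measurable_snd \<Psi>_meas]]])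

text \<open>Passing between t and s changes each quotient of bump values by at most the factor s /
  t, and s / t \<ge> 1 lets the same factor dominate the unchanged part of the kernel.\<close>

lemma gauge_Apq_pad_scale:
  assumes ts: "1 \<le> t" "t \<le> s" and aq: "0 < a" "0 < q"
  shows "gauge_Apq a q (pad n \<Phi> s) (pad_inv n \<Psi> s) \<le> ennreal ((s / t) powr q) * gauge_Apq a q (pad n \<Phi> t) (pad_inv n \<Psi> t)"
    "gauge_Apq a q (pad n \<Phi> t) (pad_inv n \<Psi> t) \<le> ennreal ((s / t) powr q) * gauge_Apq a q (pad n \<Phi> s) (pad_inv n \<Psi> s)"
proof -
  have s: "1 \<le> s" using ts by simp
  have r: "1 \<le> s / t" using ts by simp
  have main: "(SUP Q\<in>hcubes. mixed_avg Q a q (pad_kernel t')) \<le> ennreal ((s / t) powr q) * (SUP Q\<in>hcubes. mixed_avg Q a q (pad_kernel t''))"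
    if le: "\<And>x y. bump t' (x :: real^'d) / bump t' (y :: real^'d) \<le> (s / t) * (bump t'' x / bump t'' y)" and t: "1 \<le> t'" "1 \<le> t''" for t' t''
  proof (rule SUP_least)
    fix Q :: "(real^'d) set" assume Q: "Q \<in> hcubes"
    have k0: "0 \<le> pad_kernel t x y" for t x y by (rule max.coboundedI1) (rule opnorm_nonneg)
    have "pad_kernel t' x y \<le> (s / t) * pad_kernel t'' x y" for x y
    proof (rule max.boundedI)
      have "mat_opnorm (\<Phi> x * \<Psi> y) \<le> 1 * pad_kernel t'' x y" unfolding mult_1 by (rule max.cobounded1)
      also have "\<dots> \<le> (s / t) * pad_kernel t'' x y" by (rule mult_right_mono[OF r k0])
      finally show "mat_opnorm (\<Phi> x * \<Psi> y) \<le> (s / t) * pad_kernel t'' x y" .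
      have "(s / t) * (bump t'' x / bump t'' y) \<le> (s / t) * pad_kernel t'' x y" by (rule mult_left_mono) (rule max.cobounded2, use r in linarith)
      then show "bump t' x / bump t' y \<le> (s / t) * pad_kernel t'' x y" by (rule order.trans[OF le])
    qed
    then have "mixed_avg Q a q (pad_kernel t') \<le> mixed_avg Q a q (\<lambda>x y. (s / t) * pad_kernel t'' x y)"
      by (rule mixed_avg_mono[OF k0 _ aq])
    also have "\<dots> \<le> ennreal ((s / t) powr q) * mixed_avg Q a q (pad_kernel t'')"
      by (rule mixed_avg_scale_le[OF k0 _ aq]) (use r in linarith)
    also have "\<dots> \<le> ennreal ((s / t) powr q) * (SUP Q\<in>hcubes. mixed_avg Q a q (pad_kernel t''))"
      using Q by (intro mult_left_mono SUP_upper) auto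
    finally show "mixed_avg Q a q (pad_kernel t') \<le> ennreal ((s / t) powr q) * (SUP Q\<in>hcubes. mixed_avg Q a q (pad_kernel t''))" .
  qed
  show "gauge_Apq a q (pad n \<Phi> s) (pad_inv n \<Psi> s) \<le> ennreal ((s / t) powr q) * gauge_Apq a q (pad n \<Phi> t) (pad_inv n \<Psi> t)"
    "gauge_Apq a q (pad n \<Phi> t) (pad_inv n \<Psi> t) \<le> ennreal ((s / t) powr q) * gauge_Apq a q (pad n \<Phi> s) (pad_inv n \<Psi> s)"
    unfolding gauge_Apq_pad[OF s] gauge_Apq_pad[OF ts(1)]
    by (rule main[OF bump_quotient(1)[OF ts] s ts(1)] main[OF bump_quotient(2)[OF ts] ts(1) s])+
qed

lemma gauge_Apq_pad_one:
  assumes aq: "0 < a" "0 < q" and n: "0 < n" and K: "gauge_Apq a q \<Phi> \<Psi> \<le> ennreal K" "0 \<le> K"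
  shows "gauge_Apq a q (pad n \<Phi> 1) (pad_inv n \<Psi> 1) \<le> ennreal (2 powr q * 2 powr (q / a) * (real n powr q * K + 1))"
  unfolding gauge_Apq_pad[OF order.refl]
proof (rule SUP_least)
  fix Q :: "(real^'d) set" assume Q: "Q \<in> hcubes"
  have le: "pad_kernel 1 x y \<le> fro (\<Phi> x * \<Psi> y) + 1" for x y
  proof (rule max.boundedI)
    show "mat_opnorm (\<Phi> x * \<Psi> y) \<le> fro (\<Phi> x * \<Psi> y) + 1"
      by (rule order.trans[OF opnorm_le_fro]) linarith
    have "bump 1 z = 1" for z :: "real^'d" unfolding bump_def by (cases "z \<in> hcube 0 1") (simp_all only: if_True if_False)
    then show "bump 1 x / bump 1 y \<le> fro (\<Phi> x * \<Psi> y) + 1" using fro_nonneg[of "\<Phi> x * \<Psi> y"] by (simp only: div_by_1)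
  qed
  have "0 \<le> pad_kernel 1 x y" for x y by (rule max.coboundedI1) (rule opnorm_nonneg)
  from mixed_avg_mono[OF this le aq]
  have "mixed_avg Q a q (pad_kernel 1) \<le> mixed_avg Q a q (\<lambda>x y. fro (\<Phi> x * \<Psi> y) + 1)" .
  also have "\<dots> \<le> ennreal (2 powr q * 2 powr (q / a)) * (mixed_avg Q a q (\<lambda>x y. fro (\<Phi> x * \<Psi> y)) + mixed_avg Q a q (\<lambda>x y. 1))"
    by (rule mixed_avg_add_le[OF kernel_measurable_gauge _ _ _ Q aq]) (auto simp: kernel_measurable_def)
  also have "\<dots> \<le> ennreal (2 powr q * 2 powr (q / a)) * (ennreal (real n powr q * K) + 1)"
  proof (intro mult_left_mono add_mono)
    have "mixed_avg Q a q (\<lambda>x y. fro (\<Phi> x * \<Psi> y)) \<le> ennreal (real n powr q) * mixed_avg Q a q (\<lambda>x y. mat_opnorm (\<Phi> x * \<Psi> y))"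
      by (intro mixed_avg_fro_le sq_mult_carrier \<Phi>_carrier \<Psi>_carrier n aq)
    also have "mixed_avg Q a q (\<lambda>x y. mat_opnorm (\<Phi> x * \<Psi> y)) \<le> ennreal K"
      using SUP_upper[OF Q, of "\<lambda>Q. mixed_avg Q a q (\<lambda>x y. mat_opnorm (\<Phi> x * \<Psi> y))"] K(1) unfolding gauge_Apq_def by (rule order.trans)
    finally show "mixed_avg Q a q (\<lambda>x y. fro (\<Phi> x * \<Psi> y)) \<le> ennreal (real n powr q * K)"
      using K(2) by (simp add: ennreal_mult mult_left_mono)
    show "mixed_avg Q a q (\<lambda>x y. 1) \<le> 1" using mixed_avg_const[OF Q _ aq, of 1] by simp
  qed auto
  also have "\<dots> = ennreal (2 powr q * 2 powr (q / a) * (real n powr q * K + 1))"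
    using K(2) by (simp add: ennreal_mult ennreal_plus)
  finally show "mixed_avg Q a q (pad_kernel 1) \<le> ennreal (2 powr q * 2 powr (q / a) * (real n powr q * K + 1))" .
qed

text \<open>On the cube [-1, 1)^d, x in [0, 1)^d and y in [-1, 0)^d give a kernel of at least t.
  Each of these subcubes has the share 1 / 2^d, once in the inner and once in the outer average. The
  constant therefore becomes arbitrarily large with t.\<close>

lemma gauge_Apq_pad_ge:
  assumes t: "1 \<le> t" and aq: "0 < a" "0 < q"
  shows "ennreal ((1 / 2 ^ CARD('d)) powr (1 + q / a) * t powr q) \<le> gauge_Apq a q (pad n \<Phi> t) (pad_inv n \<Psi> t)"
proof -
  let ?d = "1 / 2 ^ CARD('d) :: real"
  define Q :: "(real^'d) set" where "Q = hcube (- 1) 2"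
  have Q: "Q \<in> hcubes" unfolding Q_def by (rule hcubeI) simp
  have sub: "hcube 0 1 \<subseteq> Q" "hcube (- 1) 1 \<subseteq> Q" by (auto simp: Q_def hcube_def intro: order.trans[of "-1" "0::real"] order.strict_trans[of _ "0::real"])
  have off: "y \<notin> hcube 0 1" if "y \<in> hcube (- 1) 1" for y :: "real^'d"
    using that by (auto simp: hcube_def not_le)
  have inner_le: "ennreal_powr (ennreal (?d * t powr a)) (q / a) \<le> ennreal_powr (avg Q (\<lambda>y. ennreal (pad_kernel t x y powr a))) (q / a)"
    if x: "x \<in> hcube 0 1" for x
  proof (rule ennreal_powr_mono)
    have "ennreal (t powr a) \<le> ennreal (pad_kernel t x y powr a)" if y: "y \<in> hcube (- 1) 1" for y
      using x off[OF y] t aq by (intro ennreal_leI powr_mono2) (auto simp: bump_def)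
    then have "ennreal ?d * ennreal (t powr a) \<le> avg Q (\<lambda>y. ennreal (pad_kernel t x y powr a))"
      unfolding Q_def by (rule avg_ge_subcube) (use sub(2) in \<open>simp_all add: Q_def\<close>)
    then show "ennreal (?d * t powr a) \<le> avg Q (\<lambda>y. ennreal (pad_kernel t x y powr a))"
      by (subst ennreal_mult) auto
  qed (use aq in simp)
  have "ennreal ?d * ennreal_powr (ennreal (?d * t powr a)) (q / a) \<le> mixed_avg Q a q (pad_kernel t)"
    unfolding mixed_avg_def Q_def by (rule avg_ge_subcube[OF inner_le[unfolded Q_def] sub(1)[unfolded Q_def]])
  moreover have "ennreal ?d * ennreal_powr (ennreal (?d * t powr a)) (q / a) = ennreal (?d powr (1 + q / a) * t powr q)"
  proof -
    have "d powr (1 + q / a) * t powr q = d * (d * t powr a) powr (q / a)" if "0 < d" for d :: real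
      using that t aq by (simp add: powr_add powr_mult powr_powr)
    from this[of ?d] have e: "?d powr (1 + q / a) * t powr q = ?d * (?d * t powr a) powr (q / a)" by simp
    show ?thesis unfolding e by (subst ennreal_mult, simp, simp, subst ennreal_powr_ennreal) auto
  qed
  moreover have "mixed_avg Q a q (pad_kernel t) \<le> gauge_Apq a q (pad n \<Phi> t) (pad_inv n \<Psi> t)"
    unfolding gauge_Apq_pad[OF t] by (rule SUP_upper[OF Q])
  ultimately show ?thesis by simp
qed

text \<open>The prescribed value is the bound of \<open>gauge_Apq_pad_one\<close>. It is not
  exceeded at t = 1, is reached or passed for large t, and the constant varies continuously in
  between. The value depends on K but not on \<Phi>.\<close>

lemma gauge_Apq_pad_attains:
  assumes aq: "0 < a" "0 < q" and n: "0 < n" and K: "gauge_Apq a q \<Phi> \<Psi> \<le> ennreal K" "0 \<le> K"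
  shows "\<exists>t\<ge>1. gauge_Apq a q (pad n \<Phi> t) (pad_inv n \<Psi> t) = ennreal (2 powr q * 2 powr (q / a) * (real n powr q * K + 1))"
proof -
  define K1 where "K1 = 2 powr q * 2 powr (q / a) * (real n powr q * K + 1)"
  have K1: "0 \<le> K1" using K(2) by (simp add: K1_def)
  let ?F = "\<lambda>t. gauge_Apq a q (pad n \<Phi> t) (pad_inv n \<Psi> t)"
  note one = gauge_Apq_pad_one[OF aq n K, folded K1_def]
  have fin: "?F t < \<infinity>" if "1 \<le> t" for t
  proof -
    have "?F t \<le> ennreal ((t / 1) powr q) * ennreal K1"
      using gauge_Apq_pad_scale(1)[OF order.refl that aq] mult_left_mono[OF one] by (rule order.trans) simp
    also have "\<dots> < \<infinity>" using K1 by (simp flip: ennreal_mult)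
    finally show ?thesis .
  qed
  define f where "f t = enn2real (?F t)" for t
  have Ff: "?F t = ennreal (f t)" "0 \<le> f t" if "1 \<le> t" for t using fin[OF that] by (simp_all add: f_def)
  have "\<exists>t\<ge>1. f t = K1"
  proof (rule attained_of_scaling[where q=q])
    fix s t :: real assume ts: "1 \<le> t" "t \<le> s"
    then have s: "1 \<le> s" by simp
    show "f s \<le> (s / t) powr q * f t" "f t \<le> (s / t) powr q * f s"
      using gauge_Apq_pad_scale[OF ts aq] Ff[OF s] Ff[OF ts(1)] by (simp_all flip: ennreal_mult)
  next
    let ?e = "(1 / 2 ^ CARD('d)) powr (1 + q / a) :: real"
    \<comment> \<open>For this b the lower bound of \<open>gauge_Apq_pad_ge\<close> is already at
      least K1.\<close>
    let ?b = "max 1 ((K1 / ?e) powr (1 / q))"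
    show "1 \<le> ?b" by simp
    show "f 1 \<le> K1" using one Ff[of 1] K1 by simp
    have "K1 = ?e * ((K1 / ?e) powr (1 / q)) powr q" using aq K1 by (simp add: powr_powr)
    also have "\<dots> \<le> ?e * ?b powr q" using aq by (intro mult_left_mono powr_mono2) auto
    also have "\<dots> \<le> f ?b"
    proof -
      have b: "1 \<le> ?b" by simp
      show ?thesis using gauge_Apq_pad_ge[OF b aq] unfolding Ff(1)[OF b] using Ff(2)[OF b] by (simp only: ennreal_le_iff)
    qed
    finally show "K1 \<le> f ?b" .
  qed (rule aq)
  then obtain t where "1 \<le> t" "f t = K1" by blast
  then have "1 \<le> t \<and> ?F t = ennreal K1" using Ff by simp
  then show ?thesis unfolding K1_def by blast
qed

end

section \<open>Commutator bounds\<close>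

text \<open>The padding makes the weight constant equal to K1 K, whatever \<Phi> is, so \<phi> is
  evaluated at one point only and no monotonicity of \<phi> enters. The price is that the hypothesis
  on T is used in dimension n + 1.\<close>

lemma T_bounded_of_weight_bound:
  fixes T :: "(real^'d \<Rightarrow> complex) \<Rightarrow> real^'d \<Rightarrow> complex"
  assumes lin: "linear_operator D T" and pq: "1 < p" "1 < q" and n: "0 < n"
    and T: "\<forall>n>0. \<exists>\<phi> :: real \<Rightarrow> real. \<forall>W. Apq_weight n p q W \<longrightarrow> T_norm n p q W D T \<le> ennreal (\<phi> (enn2real (Apq p q W)))"
  shows "\<exists>c. (\<forall>K. 0 < c K) \<and> (\<forall>K \<Phi> \<Psi>. 0 \<le> K \<and> invertible_gauge n \<Phi> \<Psi> \<and> gauge_Apq (conj_exp p) q \<Phi> \<Psi> \<le> ennreal K \<longrightarrow>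
     gauge_bounded (ext_dom n D) (ext_op n T) n p \<Phi> q \<Phi> (c K))"
proof -
  obtain \<phi> :: "real \<Rightarrow> real" where \<phi>: "\<And>W. Apq_weight (n + 1) p q W \<Longrightarrow> T_norm (n + 1) p q W D T \<le> ennreal (\<phi> (enn2real (Apq p q W)))"
    using T[rule_format, of "n + 1"] by auto
  define K1 where "K1 K = 2 powr q * 2 powr (q / conj_exp p) * (real n powr q * K + 1)" for K
  \<comment> \<open>The summand 1 supplies the strict inequality that
    \<open>gauge_bounded_of_op_norm\<close> requires and makes the constant positive.\<close>
  define c where "c K = max 0 (\<phi> (K1 K)) + 1" for K
  have aq: "0 < conj_exp p" "0 < q" "0 < p" using conj_exp_gt_1[OF pq(1)] pq by auto
  have "gauge_bounded (ext_dom n D) (ext_op n T) n p \<Phi> q \<Phi> (c K)"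
    if K: "0 \<le> K" and g: "invertible_gauge n \<Phi> \<Psi>" and le: "gauge_Apq (conj_exp p) q \<Phi> \<Psi> \<le> ennreal K" for K \<Phi> \<Psi>
  proof -
    interpret G: invertible_gauge n \<Phi> \<Psi> by (rule g)
    obtain t where t: "1 \<le> t" "gauge_Apq (conj_exp p) q (pad n \<Phi> t) (pad_inv n \<Psi> t) = ennreal (K1 K)"
      using G.gauge_Apq_pad_attains[OF aq(1,2) n le K] unfolding K1_def by blast
    have K1: "0 \<le> K1 K" using K by (simp add: K1_def)
    interpret P: invertible_gauge "n + 1" "pad n \<Phi> t" "pad_inv n \<Psi> t" by (rule G.invertible_gauge_pad[OF t(1)])
    let ?W = "polar_weight q (pad n \<Phi> t)"
    have A: "Apq p q ?W = ennreal (K1 K)" using P.Apq_polar[OF aq(2), of p] t(2) unfolding gauge_Apq_def by (rule trans)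
    have "Apq_weight (n + 1) p q ?W" unfolding Apq_weight_def A using P.matrix_weight_polar by simp
    from \<phi>[OF this] have "T_norm (n + 1) p q ?W D T \<le> ennreal (\<phi> (K1 K))" unfolding A using K1 by simp
    also have "\<dots> \<le> ennreal (max 0 (\<phi> (K1 K)))" by (rule ennreal_leI) simp
    also have "\<dots> < ennreal (c K)" unfolding c_def by (subst ennreal_less_iff) auto
    finally have "T_norm (n + 1) p q ?W D T < ennreal (c K)" .
    from gauge_bounded_of_op_norm[OF P.weight_gauge_polar[OF aq(3,2)] P.weight_gauge_polar[OF aq(3,2)] this[unfolded T_norm_def]]
    have "gauge_bounded (ext_dom (n + 1) D) (ext_op (n + 1) T) (n + 1) p (pad n \<Phi> t) q (pad n \<Phi> t) (c K)" .
    from gauge_bounded_restrict[OF G.\<Phi>_carrier _ lin aq(3,2) this[unfolded pad_def[abs_def] diag_pad_def]]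
    show ?thesis by simp
  qed
  moreover have "0 < c K" for K by (simp add: c_def)
  ultimately show ?thesis by blast
qed

locale commutator_setting =
  fixes p q :: real and m :: nat and U V B :: "real^'d \<Rightarrow> cmat"
    and D :: "(real^'d \<Rightarrow> complex) set" and T :: "(real^'d \<Rightarrow> complex) \<Rightarrow> real^'d \<Rightarrow> complex"
  assumes p: "1 < p" and q: "1 < q" and m: "0 < m"
    and UA: "Apq_weight m p q U" and VA: "Apq_weight m p q V" and BL: "locally_integrable_mat m B" and lin: "linear_operator D T"
begin

abbreviation "a \<equiv> conj_exp p"
abbreviation "u \<equiv> reg_powr m U (1 / q)"
abbreviation "ui \<equiv> reg_powr m U (- (1 / q))"
abbreviation "v \<equiv> reg_powr m V (1 / q)"
abbreviation "vi \<equiv> reg_powr m V (- (1 / q))"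
abbreviation "Au \<equiv> real m powr q * enn2real (Apq p q U)"
abbreviation "Av \<equiv> real m powr q * enn2real (Apq p q V)"

lemma UW: "matrix_weight m U" and VW: "matrix_weight m V"
  using UA VA by (simp_all add: Apq_weight_def)

lemma aq: "0 < a" "0 < q" "0 < p" using conj_exp_gt_1[OF p] p q by auto

sublocale P: apq_pair m v vi u ui a q Av Au B
  by (rule apq_pair.intro[OF apq_family_of_weight[OF VA p q m] apq_family_of_weight[OF UA p q m] apq_pair_axioms.intro[OF locally_integrable_cubes[OF BL]]])

abbreviation "X \<equiv> \<lambda>Q x. apq_family.Nq m v Q * (B x - mat_mean (avg_measure Q) m B) * apq_family.Nq' m u Q"

lemma bmo_SUP: "bmo m q V U B = (SUP Q\<in>hcubes. avg Q (\<lambda>x. ennreal (mat_opnorm (X Q x))))"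
  by (rule bmo_eq[OF P.apq_pair_axioms UW VW])

lemma X_carrier: "Q \<in> hcubes \<Longrightarrow> X Q x \<in> carrier_mat m m"
  by (intro sq_mult_carrier P.V.Nq_car(1) P.U.Nq_car(2) P.diff_car)

lemma gauge_v: "invertible_gauge m v vi" and gauge_u: "invertible_gauge m u ui"
  by (unfold_locales; intro reg_powr_measurable reg_powr_inverse UW VW)+

lemma block_op: "0 < \<tau> \<Longrightarrow> block_operator m v vi u ui B \<tau> D T p q"
  by (intro block_operator.intro block_gauge.intro gauge_v gauge_u block_gauge_axioms.intro block_operator_axioms.intro P.B_meas lin p q)

text \<open>With \<tau> = 1 / r the powers of r cancel in the mixed oscillation of the off-diagonal
  block, so the number up to which boundedness of T is assumed does not involve B. The bound c for
  the block operator then gives c / \<tau> = c * r for the commutator. Any positive r above the BMO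
  quantity is allowed, which includes the case that this quantity is 0.\<close>

lemma comm_norm_le_of_bmo:
  assumes c: "\<And>\<Phi> \<Psi>. invertible_gauge (m + m) \<Phi> \<Psi> \<Longrightarrow> gauge_Apq a q \<Phi> \<Psi> \<le>
      ennreal (2 powr q * 2 powr (q / a) * (2 powr q * 2 powr (q / a) * (Av + Au) + \<bar>apq_pair.Eup TYPE('d) m a q Av Au\<bar> * real m powr q)) \<Longrightarrow>
      gauge_bounded (ext_dom (m + m) D) (ext_op (m + m) T) (m + m) p \<Phi> q \<Phi> c"
    and c0: "0 < c" and r: "0 < r" "bmo m q V U B \<le> ennreal r"
  shows "comm_norm m p q U V B D T \<le> ennreal (c * r)"
proof -
  let ?E = "\<bar>apq_pair.Eup TYPE('d) m a q Av Au\<bar>" and ?C = "2 powr q * 2 powr (q / a) :: real" and ?\<tau> = "1 / r"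
  have \<tau>: "0 < ?\<tau>" using r by simp
  interpret O: block_operator m v vi u ui B ?\<tau> D T p q by (rule block_op[OF \<tau>])
  have "avg Q (\<lambda>x. ennreal (fro (X Q x))) \<le> ennreal (real m * r)" if Q: "Q \<in> hcubes" for Q
  proof -
    have "avg Q (\<lambda>x. ennreal (fro (X Q x))) \<le> avg Q (\<lambda>x. ennreal (real m) * ennreal (mat_opnorm (X Q x)))"
      using fro_le_opnorm[OF X_carrier[OF Q]] by (intro avg_mono) (simp add: ennreal_leI flip: ennreal_mult)
    also have "\<dots> \<le> ennreal (real m) * avg Q (\<lambda>x. ennreal (mat_opnorm (X Q x)))" using m by (intro avg_cmult_le) simp
    also have "\<dots> \<le> ennreal (real m) * bmo m q V U B" unfolding bmo_SUP
      by (intro mult_left_mono SUP_upper[OF Q, of "\<lambda>Q. avg Q (\<lambda>x. ennreal (mat_opnorm (X Q x)))"]) simp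
    also have "\<dots> \<le> ennreal (real m) * ennreal r" using r by (intro mult_left_mono) auto
    finally show ?thesis using r by (simp add: ennreal_mult)
  qed
  note osc = this
  have mr: "0 < real m * r" using m r by simp
  let ?k1 = "\<lambda>x y. fro (v x * vi y)" and ?k2 = "\<lambda>x y. fro (u x * ui y)" and ?k3 = "\<lambda>x y. fro (v x * (B x - B y) * ui y)"
  have "gauge_Apq a q O.block O.block_inv \<le> ennreal (?C * (?C * (Av + Au) + ?E * real m powr q))"
    unfolding gauge_Apq_def
  proof (rule SUP_least)
    fix Q :: "(real^'d) set" assume Q: "Q \<in> hcubes"
    have k3: "mixed_avg Q a q ?k3 \<le> ennreal (?E * (real m * r) powr q)"
      unfolding mixed_avg_def by (rule order.trans[OF P.upper_bound[OF mr osc Q]]) (auto intro!: ennreal_leI mult_right_mono)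
    have "mixed_avg Q a q (\<lambda>x y. ?\<tau> * ?k3 x y) \<le> ennreal (?\<tau> powr q) * mixed_avg Q a q ?k3"
      by (rule mixed_avg_scale_le[OF fro_nonneg \<tau> aq(1,2)])
    also have "\<dots> \<le> ennreal (?\<tau> powr q) * ennreal (?E * (real m * r) powr q)" by (rule mult_left_mono[OF k3]) simp
    also have "\<dots> = ennreal (?\<tau> powr q * (?E * (real m * r) powr q))" by (rule ennreal_mult[symmetric]) auto
    also have "?\<tau> powr q * (?E * (real m * r) powr q) = ?E * real m powr q"
    proof -
      have "?\<tau> powr q * (real m * r) powr q = (?\<tau> * (real m * r)) powr q" using r by (intro powr_mult[symmetric])
      also have "?\<tau> * (real m * r) = real m" using r by simp
      finally show ?thesis by (simp add: algebra_simps)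
    qed
    finally have b3: "mixed_avg Q a q (\<lambda>x y. ?\<tau> * ?k3 x y) \<le> ennreal (?E * real m powr q)" .
    have b12: "mixed_avg Q a q ?k1 \<le> ennreal Av" "mixed_avg Q a q ?k2 \<le> ennreal Au"
      unfolding mixed_avg_def by (rule P.V.apq[OF Q] P.U.apq[OF Q])+
    have mk: "kernel_measurable ?k1" "kernel_measurable ?k2"
      by (rule invertible_gauge.kernel_measurable_gauge[OF gauge_v] invertible_gauge.kernel_measurable_gauge[OF gauge_u])+
    note mf = mat_measurable_compose[OF measurable_fst] and ms = mat_measurable_compose[OF measurable_snd]
    have "kernel_measurable ?k3"
      by (rule kernel_measurable_fro[OF mat_measurable_mult[OF mat_measurable_mult[OF mf[OF P.V.w_meas] mat_measurable_minus[OF mf[OF P.B_meas] ms[OF P.B_meas]]] ms[OF P.U.wi_meas]]])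
    then have mk3: "kernel_measurable (\<lambda>x y. ?\<tau> * ?k3 x y)" unfolding kernel_measurable_def by (intro borel_measurable_times borel_measurable_const)
    have mk12: "kernel_measurable (\<lambda>x y. ?k1 x y + ?k2 x y)" using mk unfolding kernel_measurable_def by (intro borel_measurable_add)
    have k0: "0 \<le> ?k1 x y + ?k2 x y" "0 \<le> ?\<tau> * ?k3 x y" for x y using \<tau> by simp_all
    have "mat_opnorm (O.block x * O.block_inv y) \<le> (?k1 x y + ?k2 x y) + ?\<tau> * ?k3 x y" for x y
    proof -
      have "mat_opnorm (O.block x * O.block_inv y) \<le> fro (O.block x * O.block_inv y)" by (rule opnorm_le_fro)
      also have "\<dots> \<le> ?k1 x y + fro (complex_of_real ?\<tau> \<cdot>\<^sub>m (v x * (B x - B y) * ui y)) + ?k2 x y"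
        unfolding O.block_mult_inv
        by (intro fro_four_block_le(3)[of _ m _ m] sq_mult_carrier smult_carrier_mat minus_carrier_mat reg_powr_carrier O.B_carrier)
      also have "fro (complex_of_real ?\<tau> \<cdot>\<^sub>m (v x * (B x - B y) * ui y)) = ?\<tau> * ?k3 x y"
        unfolding fro_smult norm_of_real using \<tau> by simp
      finally show ?thesis by linarith
    qed
    from mixed_avg_mono[OF opnorm_nonneg this aq(1,2)]
    have "mixed_avg Q a q (\<lambda>x y. mat_opnorm (O.block x * O.block_inv y)) \<le> mixed_avg Q a q (\<lambda>x y. (?k1 x y + ?k2 x y) + ?\<tau> * ?k3 x y)" .
    also have "\<dots> \<le> ennreal ?C * (mixed_avg Q a q (\<lambda>x y. ?k1 x y + ?k2 x y) + mixed_avg Q a q (\<lambda>x y. ?\<tau> * ?k3 x y))"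
      by (rule mixed_avg_add_le[OF mk12 k0(1) mk3 k0(2) Q aq(1,2)])
    also have "\<dots> \<le> ennreal ?C * (ennreal ?C * (mixed_avg Q a q ?k1 + mixed_avg Q a q ?k2) + ennreal (?E * real m powr q))"
      by (intro mult_left_mono add_mono b3 mixed_avg_add_le[OF mk(1) fro_nonneg mk(2) fro_nonneg Q aq(1,2)]) simp
    also have "\<dots> \<le> ennreal ?C * (ennreal ?C * (ennreal Av + ennreal Au) + ennreal (?E * real m powr q))"
      by (intro mult_left_mono add_mono b12 order.refl) simp_all
    also have "\<dots> = ennreal (?C * (?C * (Av + Au) + ?E * real m powr q))"
      by (simp add: ennreal_mult ennreal_plus)
    finally show "mixed_avg Q a q (\<lambda>x y. mat_opnorm (O.block x * O.block_inv y)) \<le> ennreal (?C * (?C * (Av + Au) + ?E * real m powr q))" .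
  qed
  from c[OF O.W.invertible_gauge_axioms this]
  have "gauge_bounded (comm_dom m B D) (comm_op m B T) m p u q v (c / ?\<tau>)"
    by (rule O.comm_bounded_of_block) (use c0 in simp)
  then have "gauge_bounded (comm_dom m B D) (comm_op m B T) m p u q v (c * r)" by simp
  then show ?thesis unfolding comm_norm_def
    by (intro op_norm_le[OF weight_gauge_reg_powr[OF UW aq(3,2)] weight_gauge_reg_powr[OF VW aq(3,2)]]) (use c0 r in auto)
qed

text \<open>For the block weight the lower bound on T turns its norm, at most M = 16 * (c1 + c2 +
  \<tau> * N'), into a bound for \<tau> times the oscillation. After division by \<tau> the norms
  c1, c2 of T vanish as \<tau> grows and only the commutator norm remains. The summand 1 keeps the
  constant positive, which settles the case of an infinite commutator norm.\<close>

lemma bmo_le_of_lower_bound: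
  assumes pq: "p \<le> q" and c: "0 < c"
    and lb: "\<And>W. matrix_weight (m + m) W \<Longrightarrow> ennreal_powr (Apq p q W) (1 / q) \<le> ennreal c * T_norm (m + m) p q W D T"
    and finU: "T_norm m p q U D T < \<infinity>" and finV: "T_norm m p q V D T < \<infinity>"
  shows "bmo m q V U B \<le> ennreal (\<bar>apq_pair.Elow m a q Av Au\<bar> * (2 * real m * (c * 16)) + 1) * comm_norm m p q U V B D T"
    (is "_ \<le> ennreal (?\<kappa> + 1) * ?N")
proof (cases "?N = \<infinity>")
  case True
  have "0 < ?\<kappa> + 1" using c by (intro add_nonneg_pos mult_nonneg_nonneg) auto
  then have "ennreal (?\<kappa> + 1) * ?N = \<infinity>" unfolding True by (simp add: ennreal_mult_top infinity_ennreal_def)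
  then show ?thesis by (simp add: infinity_ennreal_def)
next
  case False
  let ?E = "apq_pair.Elow m a q Av Au"
  define N where "N = enn2real ?N"
  have N: "?N = ennreal N" "0 \<le> N" using False by (cases ?N; simp add: N_def)+
  have lt: "\<exists>c\<ge>0. x < ennreal c" if "x < \<infinity>" for x
  proof (cases x)
    case (real r)
    then show ?thesis by (intro exI[of _ "r + 1"]) (simp add: ennreal_less_iff)
  qed (use that in simp)
  obtain c1 c2 where c12: "0 \<le> c1" "T_norm m p q V D T < ennreal c1" "0 \<le> c2" "T_norm m p q U D T < ennreal c2"
    using lt[OF finU] lt[OF finV] by blast
  note gU = weight_gauge_reg_powr[OF UW aq(3,2)] and gV = weight_gauge_reg_powr[OF VW aq(3,2)]
  have b1: "gauge_bounded (ext_dom m D) (ext_op m T) m p v q v c1"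
    by (rule gauge_bounded_of_op_norm[OF gV gV c12(2)[unfolded T_norm_def]])
  have b2: "gauge_bounded (ext_dom m D) (ext_op m T) m p u q u c2"
    by (rule gauge_bounded_of_op_norm[OF gU gU c12(4)[unfolded T_norm_def]])
  have main: "avg Q (\<lambda>x. ennreal (mat_opnorm (X Q x))) \<le> ennreal (?\<kappa> * ((c1 + c2) / \<tau> + N'))"
    if \<tau>: "0 < \<tau>" and N': "N < N'" and Q: "Q \<in> hcubes" for \<tau> N' Q
  proof -
    interpret O: block_operator m v vi u ui B \<tau> D T p q by (rule block_op[OF \<tau>])
    have N'0: "0 < N'" using N(2) N' by linarith
    have "?N < ennreal N'" unfolding N(1) using N(2) N' by (simp add: ennreal_less_iff)
    then have b3: "gauge_bounded (comm_dom m B D) (comm_op m B T) m p u q v N'"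
      unfolding comm_norm_def by (rule gauge_bounded_of_op_norm[OF gU gV])
    define M where "M = 16 * (c1 + c2 + \<tau> * N')"
    have M: "0 < M" using c12 N'0 \<tau> unfolding M_def by (intro mult_pos_pos add_nonneg_pos add_nonneg_nonneg) auto
    let ?W = "polar_weight q O.block"
    have "gauge_bounded (ext_dom (m + m) D) (ext_op (m + m) T) (m + m) p O.block q O.block M"
      unfolding M_def by (rule O.block_bounded[OF b1 b2 b3]) (use c12 N'0 in auto)
    then have "T_norm (m + m) p q ?W D T \<le> ennreal M"
      unfolding T_norm_def by (intro op_norm_le[OF O.W.weight_gauge_polar[OF aq(3,2)] O.W.weight_gauge_polar[OF aq(3,2)]]) (use M in auto)
    then have "ennreal_powr (Apq p q ?W) (1 / q) \<le> ennreal c * ennreal M"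
      using lb[OF O.W.matrix_weight_polar] by (meson order.trans mult_left_mono zero_le)
    then have "ennreal_powr (Apq p q ?W) (1 / q) \<le> ennreal (c * M)" using c M by (simp add: ennreal_mult)
    from ennreal_powr_le_imp[OF this] have A: "Apq p q ?W \<le> ennreal ((c * M) powr q)" using c M aq by simp
    have osc: "mixed_avg Q a q (\<lambda>x y. \<tau> * fro (v x * (B x - B y) * ui y)) \<le> ennreal ((2 * real m * (c * M)) powr q)"
      if Q: "Q \<in> hcubes" for Q
    proof -
      have car: "O.block x * O.block_inv y \<in> carrier_mat (m + m) (m + m)" for x y
        by (rule sq_mult_carrier[OF O.W.\<Phi>_carrier O.W.\<Psi>_carrier])
      have le: "\<tau> * fro (v x * (B x - B y) * ui y) \<le> fro (O.block x * O.block_inv y)" for x y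
      proof -
        have "\<tau> * fro (v x * (B x - B y) * ui y) = fro (complex_of_real \<tau> \<cdot>\<^sub>m (v x * (B x - B y) * ui y))"
          unfolding fro_smult norm_of_real using \<tau> by simp
        also have "\<dots> \<le> fro (O.block x * O.block_inv y)" unfolding O.block_mult_inv
          by (intro fro_four_block_le(1)[of _ m _ m] sq_mult_carrier smult_carrier_mat minus_carrier_mat reg_powr_carrier O.B_carrier)
        finally show ?thesis .
      qed
      have k0: "0 \<le> \<tau> * fro (v x * (B x - B y) * ui y)" for x y using \<tau> by simp
      have "mixed_avg Q a q (\<lambda>x y. \<tau> * fro (v x * (B x - B y) * ui y)) \<le> mixed_avg Q a q (\<lambda>x y. fro (O.block x * O.block_inv y))"
        by (rule mixed_avg_mono[OF k0 le aq(1,2)])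
      also have "\<dots> \<le> ennreal (real (m + m) powr q) * mixed_avg Q a q (\<lambda>x y. mat_opnorm (O.block x * O.block_inv y))"
        by (rule mixed_avg_fro_le[OF car _ aq(1,2)]) (use m in simp)
      also have "\<dots> \<le> ennreal (real (m + m) powr q) * Apq p q ?W"
        unfolding O.W.Apq_polar[OF aq(2)]
        by (intro mult_left_mono SUP_upper[OF Q, of "\<lambda>Q. mixed_avg Q a q (\<lambda>x y. mat_opnorm (O.block x * O.block_inv y))"]) simp
      also have "\<dots> \<le> ennreal (real (m + m) powr q) * ennreal ((c * M) powr q)" by (rule mult_left_mono[OF A]) simp
      also have "\<dots> = ennreal (real (m + m) powr q * (c * M) powr q)" by (rule ennreal_mult[symmetric]) auto
      also have "real (m + m) powr q * (c * M) powr q = (2 * real m * (c * M)) powr q"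
        using c M by (subst powr_mult[symmetric]) auto
      finally show ?thesis .
    qed
    have apq: "a / (a - 1) \<le> q"
    proof -
      have "a - 1 = 1 / (p - 1)" using p by (simp add: conj_exp_def field_simps)
      then have "a / (a - 1) = p" using p by (simp add: conj_exp_def)
      then show ?thesis using pq by simp
    qed
    have "ennreal \<tau> * avg Q (\<lambda>x. ennreal (fro (X Q x))) \<le> ennreal (?E * (2 * real m * (c * M)))"
      by (rule P.lower_bound[OF apq \<tau> _ _ Q]) (use m c M osc in \<open>auto simp: mixed_avg_def\<close>)
    also have "\<dots> \<le> ennreal (\<bar>?E\<bar> * (2 * real m * (c * M)))" using c M by (intro ennreal_leI mult_right_mono) auto
    finally have t: "ennreal \<tau> * avg Q (\<lambda>x. ennreal (fro (X Q x))) \<le> ennreal (\<bar>?E\<bar> * (2 * real m * (c * M)))" .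
    have "avg Q (\<lambda>x. ennreal (mat_opnorm (X Q x))) \<le> avg Q (\<lambda>x. ennreal (fro (X Q x)))"
      by (intro avg_mono ennreal_leI opnorm_le_fro)
    also have "\<dots> = ennreal (1 / \<tau>) * (ennreal \<tau> * avg Q (\<lambda>x. ennreal (fro (X Q x))))"
      using \<tau> by (simp add: mult.assoc[symmetric] flip: ennreal_mult)
    also have "\<dots> \<le> ennreal (1 / \<tau>) * ennreal (\<bar>?E\<bar> * (2 * real m * (c * M)))" by (rule mult_left_mono[OF t]) simp
    also have "\<dots> = ennreal (1 / \<tau> * (\<bar>?E\<bar> * (2 * real m * (c * M))))" using \<tau> c M by (intro ennreal_mult[symmetric]) auto
    also have "1 / \<tau> * (\<bar>?E\<bar> * (2 * real m * (c * M))) = ?\<kappa> * ((c1 + c2) / \<tau> + N')"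
      using \<tau> unfolding M_def by (simp add: field_simps)
    finally show ?thesis .
  qed
  have \<kappa>: "0 \<le> ?\<kappa>" using c by (intro mult_nonneg_nonneg) auto
  show ?thesis
  proof (rule ennreal_le_epsilon)
    fix e :: real assume e: "0 < e"
    define k where "k = ?\<kappa> + 1"
    have k: "0 < k" "?\<kappa> \<le> k" unfolding k_def using \<kappa> by linarith+
    \<comment> \<open>Large enough that the contribution of c1 + c2 is at most e / 2; the other half
      of e is spent on N' > N.\<close>
    define \<tau> where "\<tau> = 2 * k * (c1 + c2) / e + 1"
    have \<tau>: "0 < \<tau>" unfolding \<tau>_def using k c12 e by (intro add_nonneg_pos divide_nonneg_pos mult_nonneg_nonneg) auto
    have "k * (c1 + c2) \<le> e / 2 * \<tau>" unfolding \<tau>_def using e by (simp add: field_simps)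
    then have 1: "k * ((c1 + c2) / \<tau>) \<le> e / 2" using \<tau> by (simp add: field_simps)
    define N' where "N' = N + e / (2 * k)"
    have "0 < e / (2 * k)" using k e by simp
    then have N': "N < N'" by (simp add: N'_def)
    have 2: "k * N' = k * N + e / 2" unfolding N'_def using k by (simp add: distrib_left)
    have "?\<kappa> * ((c1 + c2) / \<tau> + N') \<le> k * ((c1 + c2) / \<tau> + N')"
      using c12 \<tau> N' N(2) k by (intro mult_right_mono add_nonneg_nonneg) auto
    also have "\<dots> \<le> k * N + e" unfolding distrib_left[of k] using 1 2 by linarith
    finally have le: "?\<kappa> * ((c1 + c2) / \<tau> + N') \<le> k * N + e" .
    have "bmo m q V U B \<le> ennreal (k * N + e)" unfolding bmo_SUP
      by (rule SUP_least) (rule order.trans[OF main[OF \<tau> N'] ennreal_leI[OF le]])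
    also have "\<dots> = ennreal k * ?N + ennreal e" unfolding N(1) using k N(2) e
      by (subst ennreal_plus) (auto intro!: mult_nonneg_nonneg simp: ennreal_mult)
    finally show "bmo m q V U B \<le> ennreal (?\<kappa> + 1) * ?N + ennreal e" unfolding k_def .
  qed
qed

end

section \<open>Constants as functions of the two weight characteristics\<close>

theorem theorem1p1:
  fixes \<alpha> p q :: real and m :: nat
    and D :: "(real^'d \<Rightarrow> complex) set"
    and T :: "(real^'d \<Rightarrow> complex) \<Rightarrow> real^'d \<Rightarrow> complex"
  assumes "0 < \<alpha>" and "\<alpha> < real CARD('d)" and "1 < p" and "1 < q"
    and "\<alpha> / real CARD('d) + 1 / q = 1 / p"
    and "0 < m"
  shows
    "(linear_operator D T \<and>
      (\<forall>n>0. \<exists>\<phi> :: real \<Rightarrow> real. \<forall>W. Apq_weight n p q W \<longrightarrow>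
         T_norm n p q W D T \<le> ennreal (\<phi> (enn2real (Apq p q W))))
      \<longrightarrow>
      (\<exists>C :: real \<Rightarrow> real \<Rightarrow> real. (\<forall>s t. 0 < C s t) \<and>
         (\<forall>U V B. Apq_weight m p q U \<and> Apq_weight m p q V \<and> locally_integrable_mat m B \<longrightarrow>
            comm_norm m p q U V B D T
              \<le> ennreal (C (enn2real (Apq p q U)) (enn2real (Apq p q V))) * bmo m q V U B)))
     \<and>
     (fractional_lower_bound_operator p q D T
      \<longrightarrow>
      (\<exists>C :: real \<Rightarrow> real \<Rightarrow> real. (\<forall>s t. 0 < C s t) \<and>
         (\<forall>U V B. Apq_weight m p q U \<and> Apq_weight m p q V \<and> locally_integrable_mat m B \<longrightarrow>
            bmo m q V U B
              \<le> ennreal (C (enn2real (Apq p q U)) (enn2real (Apq p q V)))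
                 * comm_norm m p q U V B D T)))"
proof (intro conjI impI)
  assume "linear_operator D T \<and>
      (\<forall>n>0. \<exists>\<phi> :: real \<Rightarrow> real. \<forall>W. Apq_weight n p q W \<longrightarrow>
         T_norm n p q W D T \<le> ennreal (\<phi> (enn2real (Apq p q W))))"
  then have lin: "linear_operator D T" and T: "\<forall>n>0. \<exists>\<phi> :: real \<Rightarrow> real. \<forall>W. Apq_weight n p q W \<longrightarrow>
         T_norm n p q W D T \<le> ennreal (\<phi> (enn2real (Apq p q W)))" by blast+
  have mm: "0 < m + m" using assms(6) by simp
  obtain c where c: "\<forall>K. 0 < c K" "\<forall>K \<Phi> \<Psi>. 0 \<le> K \<and> invertible_gauge (m + m) \<Phi> \<Psi> \<and>
      gauge_Apq (conj_exp p) q \<Phi> \<Psi> \<le> ennreal K \<longrightarrow>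
      gauge_bounded (ext_dom (m + m) D) (ext_op (m + m) T) (m + m) p \<Phi> q \<Phi> (c K)"
    using T_bounded_of_weight_bound[OF lin assms(3,4) mm T] by (elim exE conjE)
  define A where "A s = real m powr q * s" for s
  \<comment> \<open>The bound for the constant of the block weight at \<tau> = 1 / r, as a function
    of the characteristics s of U and t of V only.\<close>
  define K where "K s t = 2 powr q * 2 powr (q / conj_exp p) * (2 powr q * 2 powr (q / conj_exp p) * (A t + A s)
      + \<bar>apq_pair.Eup TYPE('d) m (conj_exp p) q (A t) (A s)\<bar> * real m powr q)" for s t
  show "\<exists>C :: real \<Rightarrow> real \<Rightarrow> real. (\<forall>s t. 0 < C s t) \<and>
         (\<forall>U V B. Apq_weight m p q U \<and> Apq_weight m p q V \<and> locally_integrable_mat m B \<longrightarrow>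
            comm_norm m p q U V B D T
              \<le> ennreal (C (enn2real (Apq p q U)) (enn2real (Apq p q V))) * bmo m q V U B)"
  proof (rule exI[of _ "\<lambda>s t. c (K s t)"], intro conjI allI impI)
    fix U V B :: "real^'d \<Rightarrow> cmat"
    assume "Apq_weight m p q U \<and> Apq_weight m p q V \<and> locally_integrable_mat m B"
    then have UVB: "Apq_weight m p q U" "Apq_weight m p q V" "locally_integrable_mat m B" by blast+
    interpret S: commutator_setting p q m U V B D T
      by (rule commutator_setting.intro[OF assms(3,4,6) UVB lin])
    let ?s = "enn2real (Apq p q U)" and ?t = "enn2real (Apq p q V)"
    have K0: "0 \<le> K ?s ?t" unfolding K_def A_def by (intro mult_nonneg_nonneg add_nonneg_nonneg) auto
    have le: "comm_norm m p q U V B D T \<le> ennreal (c (K ?s ?t) * r)" if r: "0 < r" "bmo m q V U B \<le> ennreal r" for r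
    proof (rule S.comm_norm_le_of_bmo[OF _ _ r])
      fix \<Phi> \<Psi> :: "real^'d \<Rightarrow> cmat"
      assume "invertible_gauge (m + m) \<Phi> \<Psi>" and "gauge_Apq (conj_exp p) q \<Phi> \<Psi> \<le> ennreal (2 powr q * 2 powr (q / conj_exp p) *
          (2 powr q * 2 powr (q / conj_exp p) * (real m powr q * ?t + real m powr q * ?s)
           + \<bar>apq_pair.Eup TYPE('d) m (conj_exp p) q (real m powr q * ?t) (real m powr q * ?s)\<bar> * real m powr q))"
      then have "0 \<le> K ?s ?t \<and> invertible_gauge (m + m) \<Phi> \<Psi> \<and> gauge_Apq (conj_exp p) q \<Phi> \<Psi> \<le> ennreal (K ?s ?t)"
        using K0 unfolding K_def A_def by (intro conjI)
      then show "gauge_bounded (ext_dom (m + m) D) (ext_op (m + m) T) (m + m) p \<Phi> q \<Phi> (c (K ?s ?t))"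
        by (rule c(2)[rule_format])
    qed (rule c(1)[rule_format])
    show "comm_norm m p q U V B D T \<le> ennreal (c (K ?s ?t)) * bmo m q V U B"
    \<comment> \<open>\<open>le\<close> needs a positive radius, so the BMO quantity b is approached
      from above by b + e / c; an infinite BMO quantity makes the right-hand side infinite because c
      is positive.\<close>
    proof (cases "bmo m q V U B")
      case (real b)
      show ?thesis
      proof (rule ennreal_le_epsilon)
        fix e :: real assume e: "0 < e"
        let ?c = "c (K ?s ?t)"
        have cp: "0 < ?c" by (rule c(1)[rule_format])
        have "comm_norm m p q U V B D T \<le> ennreal (?c * (b + e / ?c))"
          by (rule le) (use real cp e in \<open>auto intro!: add_nonneg_pos ennreal_leI\<close>)
        also have "?c * (b + e / ?c) = ?c * b + e" using cp by (simp add: distrib_left)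
        also have "ennreal (?c * b + e) = ennreal ?c * bmo m q V U B + ennreal e"
          using real cp e by (subst ennreal_plus) (auto intro!: mult_nonneg_nonneg simp: ennreal_mult)
        finally show "comm_norm m p q U V B D T \<le> ennreal ?c * bmo m q V U B + ennreal e" .
      qed
    next
      case top
      then show ?thesis using c(1)[rule_format, of "K ?s ?t"] by (simp add: ennreal_mult_top infinity_ennreal_def)
    qed
  qed (rule c(1)[rule_format])
next
  assume F: "fractional_lower_bound_operator p q D T"
  have mm: "0 < m + m" using assms(6) by simp
  note F' = F[unfolded fractional_lower_bound_operator_def]
  have lin: "linear_operator D T" by (rule conjunct1[OF F'])
  obtain c where c: "0 < c" "\<And>W. matrix_weight (m + m) W \<Longrightarrow> ennreal_powr (Apq p q W) (1 / q) \<le> ennreal c * T_norm (m + m) p q W D T"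
    using conjunct1[OF conjunct2[OF F', rule_format, OF mm]] by blast
  have fin: "T_norm m p q W D T < \<infinity>" if "Apq_weight m p q W" for W
    by (rule conjunct2[OF conjunct2[OF F', rule_format, OF assms(6)], rule_format, OF that])
  \<comment> \<open>The relation between the exponents, with \<alpha> > 0, gives p \<le> q, which
    Young's inequality in \<open>lower_bound\<close> requires.\<close>
  have "0 \<le> \<alpha> / real CARD('d)" using assms(1) by simp
  then have "1 / q \<le> 1 / p" using assms(5) by linarith
  then have pq: "p \<le> q" using assms(3,4) by (simp add: field_simps)
  define A where "A s = real m powr q * s" for s
  show "\<exists>C :: real \<Rightarrow> real \<Rightarrow> real. (\<forall>s t. 0 < C s t) \<and>
         (\<forall>U V B. Apq_weight m p q U \<and> Apq_weight m p q V \<and> locally_integrable_mat m B \<longrightarrow>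
            bmo m q V U B
              \<le> ennreal (C (enn2real (Apq p q U)) (enn2real (Apq p q V)))
                 * comm_norm m p q U V B D T)"
  proof (rule exI[of _ "\<lambda>s t. \<bar>apq_pair.Elow m (conj_exp p) q (A t) (A s)\<bar> * (2 * real m * (c * 16)) + 1"], intro conjI allI impI)
    fix s t
    show "0 < \<bar>apq_pair.Elow m (conj_exp p) q (A t) (A s)\<bar> * (2 * real m * (c * 16)) + 1"
      using c(1) by (intro add_nonneg_pos mult_nonneg_nonneg) auto
  next
    fix U V B :: "real^'d \<Rightarrow> cmat"
    assume "Apq_weight m p q U \<and> Apq_weight m p q V \<and> locally_integrable_mat m B"
    then have UVB: "Apq_weight m p q U" "Apq_weight m p q V" "locally_integrable_mat m B" by blast+
    interpret S: commutator_setting p q m U V B D T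
      by (rule commutator_setting.intro[OF assms(3,4,6) UVB lin])
    show "bmo m q V U B \<le> ennreal (\<bar>apq_pair.Elow m (conj_exp p) q (A (enn2real (Apq p q V))) (A (enn2real (Apq p q U)))\<bar> * (2 * real m * (c * 16)) + 1)
        * comm_norm m p q U V B D T"
      unfolding A_def by (rule S.bmo_le_of_lower_bound[OF pq c fin[OF UVB(1)] fin[OF UVB(2)]])
  qed
qed

end
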